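(* Let $k$ be an algebraically closed field and let $C$ be a (finite-dimensional, unital) triangular $k$-algebra of global dimension at most $2$. Let $D=\mathrm{Hom}_k(-,k)$ and assume that the $C$-$C$-bimodule $E=\mathrm{Ext}^2_C(DC,C)$ splits as a direct sum of two $C$-$C$-bimodules $E=E'\oplus E''$. Let $B=C\ltimes E'$ be the corresponding partial relation extension and $\widetilde{C}=C\ltimes E$ the relation extension of $C$. Then there exist short exact sequences of $k$-vector spaces $$0\to \mathrm{H}^0(B,E')\to \mathrm{HH}^0(B)\xrightarrow{\varphi^0}\mathrm{HH}^0(C)\to 0,$$ $$0\to \mathrm{H}^1(B,E')\to \mathrm{HH}^1(B)\xrightarrow{\varphi^1}\mathrm{HH}^1(C)\to 0,$$ $$0\to \mathrm{H}^0(\widetilde{C},E'')\to \mathrm{HH}^0(\widetilde{C})\xrightarrow{\varphi^0}\mathrm{HH}^0(B)\to 0,$$ $$0\to \mathrm{H}^1(\widetilde{C},E'')\oplus\mathcal{E}(E'',B)\to \mathrm{HH}^1(\widetilde{C})\xrightarrow{\varphi^1}\mathrm{HH}^1(B)\to 0,$$ where in each sequence $\varphi^0$, respectively $\varphi^1$, denotes the corresponding Hochschild projection morphism.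
   Context: All algebras are finite-dimensional over $k$ and have an identity. An algebra is triangular if its ordinary quiver has no oriented cycles. For an algebra $A$ and an $A$-$A$-bimodule $M$, the trivial extension $A\ltimes M$ is the $k$-algebra with underlying vector space $A\oplus M$ and product $(a,m)(a',m')=(aa',am'+ma')$. It comes with the algebra projection $p\colon A\ltimes M\to A$, $(a,m)\mapsto a$, and its section $q\colon A\to A\ltimes M$, $a\mapsto (a,0)$. For $C$ triangular of global dimension at most $2$ and $E=\mathrm{Ext}^2_C(DC,C)$, the algebra $\widetilde{C}=C\ltimes E$ is called the relation extension of $C$; if $E=E'\oplus E''$ as $C$-$C$-bimodules, $B=C\ltimes E'$ is called a partial relation extension of $C$. The bimodule $E'$ is viewed as a $B$-$B$-bimodule as the ideal $0\oplus E'$ of $B$. The bimodule $E''$ is viewed as an ideal of $\widetilde{C}$, hence as a $\widetilde{C}$-$\widetilde{C}$-bimodule, and as a $B$-$B$-bimodule (with $E'$ acting by zero); one has $\widetilde{C}=B\ltimes E''$. $\mathrm{H}^i(A,M)$ denotes the $i$-th Hochschild cohomology group of $A$ with coefficients in the bimodule $M$, computed from the Hochschild complex with terms $\mathrm{Hom}_k(A^{\otimes i},M)$, and $\mathrm{HH}^i(A)=\mathrm{H}^i(A,A)$. For a trivial extension $R=A\ltimes M$ with the algebra projection $p\colon R\to A$, $(a,m)\mapsto a$, and its section $q\colon A\to R$, $a\mapsto (a,0)$, the $n$-th Hochschild projection morphism is the $k$-linear map $\varphi^n\colon \mathrm{HH}^n(R)\to\mathrm{HH}^n(A)$, $[f]\mapsto[p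 f q^{\otimes n}]$, for cocycles $f\colon R^{\otimes n}\to R$ (for $n=0$ it is the restriction of $p$ to the center of $R$). In the first two sequences this is applied to $B=C\ltimes E'$, in the last two to $\widetilde{C}=B\ltimes E''$. For an algebra $A$ and an $A$-$A$-bimodule $M$, $\mathcal{E}(M,A)$ denotes the set of all $A$-$A$-bimodule morphisms $f\colon M\to A$ such that $xf(y)+f(x)y=0$ for all $x,y\in M$. *)

theory Defs
  imports "HOL-Algebra.Algebraic_Closure" "HOL-Algebra.Ideal_Product"
begin

section \<open>Vector spaces and linear maps\<close>

text \<open>
  Vector spaces over a field \<open>K\<close> are the records and the locale \<open>module\<close> of HOL-Algebra. That
  record also carries the ring fields \<open>mult\<close> and \<open>one\<close>; they are meaningful for algebras only,
  and are left undefined in the spaces built below that have no product.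
\<close>

definition fin_dim :: "('k, 'r) ring_scheme \<Rightarrow> ('k, 'v, 'x) module_scheme \<Rightarrow> bool" where
  "fin_dim K V \<longleftrightarrow> (\<exists>S. finite S \<and> S \<subseteq> carrier V \<and>
     (\<forall>v\<in>carrier V. \<exists>a \<in> S \<rightarrow> carrier K. v = (\<Oplus>\<^bsub>V\<^esub>s\<in>S. a s \<odot>\<^bsub>V\<^esub> s)))"

definition lin :: "('k, 'r) ring_scheme \<Rightarrow> ('k, 'v, 'x) module_scheme
    \<Rightarrow> ('k, 'w, 'y) module_scheme \<Rightarrow> ('v \<Rightarrow> 'w) set" where
  "lin K V W = {f \<in> carrier V \<rightarrow>\<^sub>E carrier W.
     (\<forall>x\<in>carrier V. \<forall>y\<in>carrier V. f (x \<oplus>\<^bsub>V\<^esub> y) = f x \<oplus>\<^bsub>W\<^esub> f y) \<and>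
     (\<forall>a\<in>carrier K. \<forall>x\<in>carrier V. f (a \<odot>\<^bsub>V\<^esub> x) = a \<odot>\<^bsub>W\<^esub> f x)}"

definition short_exact :: "('k, 'r) ring_scheme \<Rightarrow> ('k, 'u, 'x) module_scheme
    \<Rightarrow> ('k, 'v, 'y) module_scheme \<Rightarrow> ('k, 'w, 'z) module_scheme
    \<Rightarrow> ('u \<Rightarrow> 'v) \<Rightarrow> ('v \<Rightarrow> 'w) \<Rightarrow> bool" where
  "short_exact K U V W f g \<longleftrightarrow> f \<in> lin K U V \<and> g \<in> lin K V W \<and>
     inj_on f (carrier U) \<and> f ` carrier U = a_kernel V W g \<and> g ` carrier V = carrier W"

text \<open>The set \<open>F\<close> of functions on \<open>S\<close> with values in \<open>W\<close>, with pointwise operations.\<close>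

definition fun_space :: "'s set \<Rightarrow> ('k, 'w, 'y) module_scheme \<Rightarrow> ('s \<Rightarrow> 'w) set
    \<Rightarrow> ('k, 's \<Rightarrow> 'w) module" where
  "fun_space S W F = \<lparr>carrier = F, monoid.mult = undefined, one = undefined,
     zero = (\<lambda>x\<in>S. \<zero>\<^bsub>W\<^esub>), add = (\<lambda>f g. \<lambda>x\<in>S. f x \<oplus>\<^bsub>W\<^esub> g x),
     smult = (\<lambda>a f. \<lambda>x\<in>S. a \<odot>\<^bsub>W\<^esub> f x)\<rparr>"

definition quot_space :: "('k, 'v, 'x) module_scheme \<Rightarrow> 'v set \<Rightarrow> ('k, 'v set) module" where
  "quot_space V U = \<lparr>carrier = a_rcosets\<^bsub>V\<^esub> U, monoid.mult = undefined, one = undefined,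
     zero = U, add = set_add V, smult = (\<lambda>a S. \<Union>x\<in>S. U +>\<^bsub>V\<^esub> (a \<odot>\<^bsub>V\<^esub> x))\<rparr>"

definition direct_sum :: "('k, 'v, 'x) module_scheme \<Rightarrow> ('k, 'w, 'y) module_scheme
    \<Rightarrow> ('k, 'v \<times> 'w) module" where
  "direct_sum V W = \<lparr>carrier = carrier V \<times> carrier W, monoid.mult = undefined, one = undefined,
     zero = (\<zero>\<^bsub>V\<^esub>, \<zero>\<^bsub>W\<^esub>),
     add = (\<lambda>(v, w) (v', w'). (v \<oplus>\<^bsub>V\<^esub> v', w \<oplus>\<^bsub>W\<^esub> w')),
     smult = (\<lambda>a (v, w). (a \<odot>\<^bsub>V\<^esub> v, a \<odot>\<^bsub>W\<^esub> w))\<rparr>"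

definition self_space :: "('k, 'r) ring_scheme \<Rightarrow> ('k, 'k) module" where
  "self_space K = \<lparr>carrier = carrier K, monoid.mult = monoid.mult K, one = one K, zero = zero K,
     add = add K, smult = monoid.mult K\<rparr>"


section \<open>Algebras, modules and bimodules\<close>

locale fin_dim_algebra = module K A + A?: ring A for K (structure) and A (structure) +
  assumes smult_mult_left:
      "\<lbrakk>a \<in> carrier K; x \<in> carrier A; y \<in> carrier A\<rbrakk> \<Longrightarrow>
        (a \<odot>\<^bsub>A\<^esub> x) \<otimes>\<^bsub>A\<^esub> y = a \<odot>\<^bsub>A\<^esub> (x \<otimes>\<^bsub>A\<^esub> y)"
    and smult_mult_right:
      "\<lbrakk>a \<in> carrier K; x \<in> carrier A; y \<in> carrier A\<rbrakk> \<Longrightarrow>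
        x \<otimes>\<^bsub>A\<^esub> (a \<odot>\<^bsub>A\<^esub> y) = a \<odot>\<^bsub>A\<^esub> (x \<otimes>\<^bsub>A\<^esub> y)"
    and fin_dim: "fin_dim K A"

text \<open>Right modules, and bimodules as right modules with an additional left action.\<close>

record ('k, 'a, 'm) rmodule = "('k, 'm) module" +
  ract :: "'m \<Rightarrow> 'a \<Rightarrow> 'm"

record ('k, 'a, 'm) bimodule = "('k, 'a, 'm) rmodule" +
  lact :: "'a \<Rightarrow> 'm \<Rightarrow> 'm"

locale fin_dim_rmodule = module K M
  for K :: "('k, 'r) ring_scheme" (structure) and A :: "('k, 'a, 's) module_scheme" (structure)
    and M :: "('k, 'a, 'm, 'x) rmodule_scheme" (structure) +
  assumes ract_closed: "\<lbrakk>x \<in> carrier M; a \<in> carrier A\<rbrakk> \<Longrightarrow> ract M x a \<in> carrier M"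
    and ract_add_left:
      "\<lbrakk>x \<in> carrier M; y \<in> carrier M; a \<in> carrier A\<rbrakk> \<Longrightarrow>
        ract M (x \<oplus>\<^bsub>M\<^esub> y) a = ract M x a \<oplus>\<^bsub>M\<^esub> ract M y a"
    and ract_add_right:
      "\<lbrakk>x \<in> carrier M; a \<in> carrier A; b \<in> carrier A\<rbrakk> \<Longrightarrow>
        ract M x (a \<oplus>\<^bsub>A\<^esub> b) = ract M x a \<oplus>\<^bsub>M\<^esub> ract M x b"
    and ract_mult:
      "\<lbrakk>x \<in> carrier M; a \<in> carrier A; b \<in> carrier A\<rbrakk> \<Longrightarrow>
        ract M x (a \<otimes>\<^bsub>A\<^esub> b) = ract M (ract M x a) b"
    and ract_one: "x \<in> carrier M \<Longrightarrow> ract M x \<one>\<^bsub>A\<^esub> = x"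
    and ract_smult_left:
      "\<lbrakk>k \<in> carrier K; x \<in> carrier M; a \<in> carrier A\<rbrakk> \<Longrightarrow>
        ract M (k \<odot>\<^bsub>M\<^esub> x) a = k \<odot>\<^bsub>M\<^esub> ract M x a"
    and ract_smult_right:
      "\<lbrakk>k \<in> carrier K; x \<in> carrier M; a \<in> carrier A\<rbrakk> \<Longrightarrow>
        ract M x (k \<odot>\<^bsub>A\<^esub> a) = k \<odot>\<^bsub>M\<^esub> ract M x a"
    and fin_dim: "fin_dim K M"

definition rhom :: "('k, 'r) ring_scheme \<Rightarrow> ('k, 'a, 's) module_scheme
    \<Rightarrow> ('k, 'a, 'm, 'x) rmodule_scheme \<Rightarrow> ('k, 'a, 'n, 'y) rmodule_scheme \<Rightarrow> ('m \<Rightarrow> 'n) set" where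
  "rhom K A M N = {f \<in> lin K M N.
     \<forall>x\<in>carrier M. \<forall>a\<in>carrier A. f (ract M x a) = ract N (f x) a}"

definition bimod_hom :: "('k, 'r) ring_scheme \<Rightarrow> ('k, 'a, 's) module_scheme
    \<Rightarrow> ('k, 'a, 'm, 'x) bimodule_scheme \<Rightarrow> ('k, 'a, 'n, 'y) bimodule_scheme \<Rightarrow> ('m \<Rightarrow> 'n) set" where
  "bimod_hom K A M N = {f \<in> rhom K A M N.
     \<forall>x\<in>carrier M. \<forall>a\<in>carrier A. f (lact M a x) = lact N a (f x)}"

definition sub_bimodule :: "('k, 'r) ring_scheme \<Rightarrow> ('k, 'a, 's) module_scheme
    \<Rightarrow> ('k, 'a, 'm, 'x) bimodule_scheme \<Rightarrow> 'm set \<Rightarrow> bool" where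
  "sub_bimodule K A M N \<longleftrightarrow> submodule N K M \<and>
     (\<forall>x\<in>N. \<forall>a\<in>carrier A. ract M x a \<in> N \<and> lact M a x \<in> N)"

text \<open>\<open>M = U \<oplus> W\<close> as bimodules, with \<open>U\<close> and \<open>W\<close> realised as sub-bimodules of \<open>M\<close>.\<close>

definition splits :: "('k, 'r) ring_scheme \<Rightarrow> ('k, 'a, 's) module_scheme
    \<Rightarrow> ('k, 'a, 'm, 'x) bimodule_scheme \<Rightarrow> 'm set \<Rightarrow> 'm set \<Rightarrow> bool" where
  "splits K A M U W \<longleftrightarrow> sub_bimodule K A M U \<and> sub_bimodule K A M W \<and>
     U \<inter> W = {\<zero>\<^bsub>M\<^esub>} \<and> U <+>\<^bsub>M\<^esub> W = carrier M"

text \<open>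
  The projection of \<open>M = U \<oplus> W\<close> onto \<open>U\<close>. The trivial extension \<open>A \<ltimes> M\<close> is identified with
  \<open>(A \<ltimes> U) \<ltimes> W\<close> by \<open>(a, u + w) \<mapsto> ((a, u), w)\<close>, so its projection onto \<open>A \<ltimes> U\<close> is
  \<open>(a, m) \<mapsto> (a, component M U W m)\<close>, with the inclusion as section.
\<close>

definition component :: "('k, 'm, 'x) module_scheme \<Rightarrow> 'm set \<Rightarrow> 'm set \<Rightarrow> 'm \<Rightarrow> 'm" where
  "component M U W m = (THE u. u \<in> U \<and> (\<exists>w\<in>W. m = u \<oplus>\<^bsub>M\<^esub> w))"

text \<open>A two-sided ideal \<open>I\<close> of \<open>A\<close> as a bimodule over \<open>A\<close>.\<close>

definition ideal_bimodule :: "('k, 'a, 'x) module_scheme \<Rightarrow> 'a set \<Rightarrow> ('k, 'a, 'a) bimodule" where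
  "ideal_bimodule A I = \<lparr>carrier = I, monoid.mult = monoid.mult A, one = one A, zero = zero A,
     add = add A, smult = smult A, ract = monoid.mult A, lact = monoid.mult A\<rparr>"

abbreviation regular_bimodule :: "('k, 'a, 'x) module_scheme \<Rightarrow> ('k, 'a, 'a) bimodule" where
  "regular_bimodule A \<equiv> ideal_bimodule A (carrier A)"

definition restrict_scalars :: "('b \<Rightarrow> 'a) \<Rightarrow> ('k, 'a, 'm, 'x) bimodule_scheme
    \<Rightarrow> ('k, 'b, 'm) bimodule" where
  "restrict_scalars h M = \<lparr>carrier = carrier M, monoid.mult = undefined, one = undefined,
     zero = zero M, add = add M, smult = smult M,
     ract = (\<lambda>m b. ract M m (h b)), lact = (\<lambda>b m. lact M (h b) m)\<rparr>"

text \<open>\<open>DA = Hom\<^sub>K(A, K)\<close> with \<open>(a\<phi>)(x) = \<phi>(xa)\<close> and \<open>(\<phi>a)(x) = \<phi>(ax)\<close>.\<close>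

definition dual_bimodule :: "('k, 'r) ring_scheme \<Rightarrow> ('k, 'a, 'x) module_scheme
    \<Rightarrow> ('k, 'a, 'a \<Rightarrow> 'k) bimodule" where
  "dual_bimodule K A =
    (let V = fun_space (carrier A) (self_space K) (lin K A (self_space K))
     in \<lparr>carrier = carrier V, monoid.mult = undefined, one = undefined, zero = zero V, add = add V,
       smult = smult V,
       ract = (\<lambda>\<phi> a. \<lambda>x\<in>carrier A. \<phi> (a \<otimes>\<^bsub>A\<^esub> x)),
       lact = (\<lambda>a \<phi>. \<lambda>x\<in>carrier A. \<phi> (x \<otimes>\<^bsub>A\<^esub> a))\<rparr>)"


section \<open>Triangular algebras\<close>

definition right_ideal :: "'a set \<Rightarrow> ('a, 'x) ring_scheme \<Rightarrow> bool" where
  "right_ideal I A \<longleftrightarrow> additive_subgroup I A \<and> (\<forall>x\<in>I. \<forall>a\<in>carrier A. x \<otimes>\<^bsub>A\<^esub> a \<in> I)"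

definition maximal_right_ideal :: "'a set \<Rightarrow> ('a, 'x) ring_scheme \<Rightarrow> bool" where
  "maximal_right_ideal I A \<longleftrightarrow> right_ideal I A \<and> I \<noteq> carrier A \<and>
     (\<forall>J. right_ideal J A \<longrightarrow> I \<subseteq> J \<longrightarrow> J = I \<or> J = carrier A)"

definition jacobson_radical :: "('a, 'x) ring_scheme \<Rightarrow> 'a set" where
  "jacobson_radical A = carrier A \<inter> \<Inter> {I. maximal_right_ideal I A}"

definition idempotent_elt :: "('a, 'x) ring_scheme \<Rightarrow> 'a \<Rightarrow> bool" where
  "idempotent_elt A e \<longleftrightarrow> e \<in> carrier A \<and> e \<otimes>\<^bsub>A\<^esub> e = e"

definition primitive_idempotent :: "('a, 'x) ring_scheme \<Rightarrow> 'a \<Rightarrow> bool" where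
  "primitive_idempotent A e \<longleftrightarrow> idempotent_elt A e \<and> e \<noteq> \<zero>\<^bsub>A\<^esub> \<and>
     (\<forall>f g. idempotent_elt A f \<longrightarrow> idempotent_elt A g \<longrightarrow> f \<otimes>\<^bsub>A\<^esub> g = \<zero>\<^bsub>A\<^esub> \<longrightarrow>
       g \<otimes>\<^bsub>A\<^esub> f = \<zero>\<^bsub>A\<^esub> \<longrightarrow> e = f \<oplus>\<^bsub>A\<^esub> g \<longrightarrow> f = \<zero>\<^bsub>A\<^esub> \<or> g = \<zero>\<^bsub>A\<^esub>)"

definition complete_primitive_idempotents :: "('a, 'x) ring_scheme \<Rightarrow> 'a set \<Rightarrow> bool" where
  "complete_primitive_idempotents A S \<longleftrightarrow> finite S \<and> (\<forall>e\<in>S. primitive_idempotent A e) \<and>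
     (\<forall>e\<in>S. \<forall>f\<in>S. e \<noteq> f \<longrightarrow> e \<otimes>\<^bsub>A\<^esub> f = \<zero>\<^bsub>A\<^esub>) \<and> (\<Oplus>\<^bsub>A\<^esub>e\<in>S. e) = \<one>\<^bsub>A\<^esub>"

text \<open>
  The relation \<open>eA \<cong> fA\<close> of right modules: \<open>x\<close> and \<open>y\<close> below are the images of \<open>f\<close> and \<open>e\<close> under
  two mutually inverse isomorphisms.
\<close>

definition iso_idempotents :: "('a, 'x) ring_scheme \<Rightarrow> 'a \<Rightarrow> 'a \<Rightarrow> bool" where
  "iso_idempotents A e f \<longleftrightarrow> (\<exists>x\<in>carrier A. \<exists>y\<in>carrier A.
     e \<otimes>\<^bsub>A\<^esub> x \<otimes>\<^bsub>A\<^esub> f = x \<and> f \<otimes>\<^bsub>A\<^esub> y \<otimes>\<^bsub>A\<^esub> e = y \<and> x \<otimes>\<^bsub>A\<^esub> y = e \<and> y \<otimes>\<^bsub>A\<^esub> x = f)"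

text \<open>
  Vertices of the ordinary quiver: one primitive idempotent for each isomorphism class of
  indecomposable projectives. (For a basic algebra this is a complete set of primitive orthogonal
  idempotents; in general it is one for the associated basic algebra.)
\<close>

definition quiver_vertices :: "('a, 'x) ring_scheme \<Rightarrow> 'a set \<Rightarrow> bool" where
  "quiver_vertices A V \<longleftrightarrow> (\<exists>S. complete_primitive_idempotents A S \<and> V \<subseteq> S \<and>
     (\<forall>e\<in>S. \<exists>!f. f \<in> V \<and> iso_idempotents A e f))"

text \<open>
  The number of arrows from \<open>e\<close> to \<open>f\<close> is the dimension of \<open>e (rad A / rad\<^sup>2 A) f\<close>; for oriented
  cycles only the existence of an arrow matters, that is, whether \<open>e (rad A) f\<close> is contained in
  \<open>rad\<^sup>2 A\<close>.
\<close>

definition quiver_arrows :: "('a, 'x) ring_scheme \<Rightarrow> 'a set \<Rightarrow> ('a \<times> 'a) set" where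
  "quiver_arrows A V = (let J = jacobson_radical A in
     {(e, f). e \<in> V \<and> f \<in> V \<and> (\<exists>x\<in>J. e \<otimes>\<^bsub>A\<^esub> x \<otimes>\<^bsub>A\<^esub> f \<notin> ideal_prod A J J)})"

text \<open>Up to isomorphism the quiver does not depend on the choice of the idempotents.\<close>

definition triangular :: "('a, 'x) ring_scheme \<Rightarrow> bool" where
  "triangular A \<longleftrightarrow> (\<exists>V. quiver_vertices A V \<and> acyclic (quiver_arrows A V))"


section \<open>Projective resolutions, global dimension and Ext\<close>

definition free_rmodule :: "('k, 'a, 'x) module_scheme \<Rightarrow> nat \<Rightarrow> ('k, 'a, nat \<Rightarrow> 'a) rmodule" where
  "free_rmodule A n =
    (let V = fun_space {..<n} A ({..<n} \<rightarrow>\<^sub>E carrier A)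
     in \<lparr>carrier = carrier V, monoid.mult = undefined, one = undefined, zero = zero V, add = add V,
       smult = smult V, ract = (\<lambda>x a. \<lambda>i\<in>{..<n}. x i \<otimes>\<^bsub>A\<^esub> a)\<rparr>)"

text \<open>Finitely generated projective modules: direct summands of free modules of finite rank.\<close>

definition projective :: "('k, 'r) ring_scheme \<Rightarrow> ('k, 'a, 's) module_scheme
    \<Rightarrow> ('k, 'a, 'm, 'x) rmodule_scheme \<Rightarrow> bool" where
  "projective K A Q \<longleftrightarrow> (\<exists>n. \<exists>s \<in> rhom K A Q (free_rmodule A n).
     \<exists>r \<in> rhom K A (free_rmodule A n) Q. \<forall>x\<in>carrier Q. r (s x) = x)"

text \<open>\<open>\<dots> \<rightarrow> P 2 \<rightarrow> P 1 \<rightarrow> P 0 \<rightarrow> M \<rightarrow> 0\<close> with differentials \<open>d n : P (n + 1) \<rightarrow> P n\<close> and augmentation \<open>\<epsilon>\<close>.\<close>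

definition projective_resolution :: "('k, 'r) ring_scheme \<Rightarrow> ('k, 'a, 's) module_scheme
    \<Rightarrow> ('k, 'a, 'm, 'x) rmodule_scheme \<Rightarrow> (nat \<Rightarrow> ('k, 'a, 'p) rmodule)
    \<Rightarrow> (nat \<Rightarrow> 'p \<Rightarrow> 'p) \<Rightarrow> ('p \<Rightarrow> 'm) \<Rightarrow> bool" where
  "projective_resolution K A M P d \<epsilon> \<longleftrightarrow>
     (\<forall>n. fin_dim_rmodule K A (P n) \<and> projective K A (P n)) \<and>
     (\<forall>n. d n \<in> rhom K A (P (Suc n)) (P n)) \<and> \<epsilon> \<in> rhom K A (P 0) M \<and>
     \<epsilon> ` carrier (P 0) = carrier M \<and>
     d 0 ` carrier (P 1) = a_kernel (P 0) M \<epsilon> \<and>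
     (\<forall>n. d (Suc n) ` carrier (P (Suc (Suc n))) = a_kernel (P (Suc n)) (P n) (d n))"

text \<open>
  Modules are finite-dimensional, so each is isomorphic to one whose carrier is a set of
  functions \<open>nat \<Rightarrow> 'k\<close>: it suffices to let the modules below range over that type.
\<close>

definition proj_dim_le :: "('k, 'r) ring_scheme \<Rightarrow> ('k, 'a, 's) module_scheme
    \<Rightarrow> ('k, 'a, 'm, 'x) rmodule_scheme \<Rightarrow> nat \<Rightarrow> bool" where
  "proj_dim_le K A M m \<longleftrightarrow>
     (\<exists>(P :: nat \<Rightarrow> ('k, 'a, nat \<Rightarrow> 'k) rmodule) d \<epsilon>. projective_resolution K A M P d \<epsilon> \<and>
       (\<forall>i>m. carrier (P i) = {\<zero>\<^bsub>P i\<^esub>}))"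

definition global_dim_le :: "('k, 'r) ring_scheme \<Rightarrow> ('k, 'a, 's) module_scheme \<Rightarrow> nat \<Rightarrow> bool" where
  "global_dim_le K A m \<longleftrightarrow>
     (\<forall>M :: ('k, 'a, nat \<Rightarrow> 'k) rmodule. fin_dim_rmodule K A M \<longrightarrow> proj_dim_le K A M m)"

text \<open>\<open>Ext\<^sup>n\<^sub>A(M, N)\<close> is the \<open>n\<close>-th cohomology of \<open>Hom\<^sub>A(P, N)\<close>, for a projective resolution \<open>P\<close> of \<open>M\<close>.\<close>

definition ext_cocycles :: "('k, 'r) ring_scheme \<Rightarrow> ('k, 'a, 's) module_scheme
    \<Rightarrow> (nat \<Rightarrow> ('k, 'a, 'p) rmodule) \<Rightarrow> (nat \<Rightarrow> 'p \<Rightarrow> 'p)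
    \<Rightarrow> ('k, 'a, 'n, 'y) rmodule_scheme \<Rightarrow> nat \<Rightarrow> ('p \<Rightarrow> 'n) set" where
  "ext_cocycles K A P d N n = {f \<in> rhom K A (P n) N. \<forall>x\<in>carrier (P (Suc n)). f (d n x) = \<zero>\<^bsub>N\<^esub>}"

definition ext_coboundaries :: "('k, 'r) ring_scheme \<Rightarrow> ('k, 'a, 's) module_scheme
    \<Rightarrow> (nat \<Rightarrow> ('k, 'a, 'p) rmodule) \<Rightarrow> (nat \<Rightarrow> 'p \<Rightarrow> 'p)
    \<Rightarrow> ('k, 'a, 'n, 'y) rmodule_scheme \<Rightarrow> nat \<Rightarrow> ('p \<Rightarrow> 'n) set" where
  "ext_coboundaries K A P d N n = (case n of
       0 \<Rightarrow> {\<lambda>x\<in>carrier (P 0). \<zero>\<^bsub>N\<^esub>}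
     | Suc m \<Rightarrow> (\<lambda>g. \<lambda>x\<in>carrier (P n). g (d m x)) ` rhom K A (P m) N)"

text \<open>The chain maps \<open>P \<rightarrow> P\<close> lifting an endomorphism \<open>h\<close> of \<open>M\<close>; they are homotopic to one another.\<close>

definition chain_lifts :: "('k, 'r) ring_scheme \<Rightarrow> ('k, 'a, 's) module_scheme
    \<Rightarrow> (nat \<Rightarrow> ('k, 'a, 'p) rmodule) \<Rightarrow> (nat \<Rightarrow> 'p \<Rightarrow> 'p) \<Rightarrow> ('p \<Rightarrow> 'm)
    \<Rightarrow> ('m \<Rightarrow> 'm) \<Rightarrow> (nat \<Rightarrow> 'p \<Rightarrow> 'p) set" where
  "chain_lifts K A P d \<epsilon> h = {l. (\<forall>n. l n \<in> rhom K A (P n) (P n)) \<and>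
     (\<forall>x\<in>carrier (P 0). \<epsilon> (l 0 x) = h (\<epsilon> x)) \<and>
     (\<forall>n. \<forall>x\<in>carrier (P (Suc n)). d n (l (Suc n) x) = l n (d n x))}"

text \<open>
  For bimodules \<open>M\<close> and \<open>N\<close>, the bimodule structure of \<open>Ext\<^sup>n\<^sub>A(M, N)\<close> (Ext of right modules) is
  obtained by functoriality: \<open>a\<close> acts on the left by \<open>Ext\<^sup>n\<^sub>A(M, y \<mapsto> ay)\<close> and on the right by
  \<open>Ext\<^sup>n\<^sub>A(x \<mapsto> ax, N)\<close>, so \<open>a[f] = [af]\<close> and \<open>[f]a = [f \<circ> l n]\<close> where \<open>l\<close> lifts \<open>x \<mapsto> ax\<close>. The
  actions on classes are written as unions over all choices of representatives and of lifts; the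
  classes united are all equal.
\<close>

definition ext_bimodule :: "('k, 'r) ring_scheme \<Rightarrow> ('k, 'a, 's) module_scheme
    \<Rightarrow> (nat \<Rightarrow> ('k, 'a, 'p) rmodule) \<Rightarrow> (nat \<Rightarrow> 'p \<Rightarrow> 'p) \<Rightarrow> ('p \<Rightarrow> 'm)
    \<Rightarrow> ('k, 'a, 'm, 'x) bimodule_scheme \<Rightarrow> ('k, 'a, 'n, 'y) bimodule_scheme
    \<Rightarrow> nat \<Rightarrow> ('k, 'a, ('p \<Rightarrow> 'n) set) bimodule" where
  "ext_bimodule K A P d \<epsilon> M N n =
    (let Z = fun_space (carrier (P n)) N (ext_cocycles K A P d N n);
         U = ext_coboundaries K A P d N n;
         V = quot_space Z U
     in \<lparr>carrier = carrier V, monoid.mult = undefined, one = undefined, zero = zero V, add = add V,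
       smult = smult V,
       ract = (\<lambda>S a. \<Union>f\<in>S. \<Union>l\<in>chain_lifts K A P d \<epsilon> (lact M a).
         U +>\<^bsub>Z\<^esub> (\<lambda>x\<in>carrier (P n). f (l n x))),
       lact = (\<lambda>a S. \<Union>f\<in>S. U +>\<^bsub>Z\<^esub> (\<lambda>x\<in>carrier (P n). lact N a (f x)))\<rparr>)"


section \<open>Trivial extensions\<close>

definition trivial_ext :: "('k, 'a, 'x) module_scheme \<Rightarrow> ('k, 'a, 'm, 'y) bimodule_scheme
    \<Rightarrow> ('k, 'a \<times> 'm) module" where
  "trivial_ext A M = \<lparr>carrier = carrier A \<times> carrier M,
     monoid.mult = (\<lambda>(a, m) (a', m'). (a \<otimes>\<^bsub>A\<^esub> a', lact M a m' \<oplus>\<^bsub>M\<^esub> ract M m a')),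
     one = (\<one>\<^bsub>A\<^esub>, \<zero>\<^bsub>M\<^esub>), zero = (\<zero>\<^bsub>A\<^esub>, \<zero>\<^bsub>M\<^esub>),
     add = (\<lambda>(a, m) (a', m'). (a \<oplus>\<^bsub>A\<^esub> a', m \<oplus>\<^bsub>M\<^esub> m')),
     smult = (\<lambda>k (a, m). (k \<odot>\<^bsub>A\<^esub> a, k \<odot>\<^bsub>M\<^esub> m))\<rparr>"


section \<open>Hochschild cohomology\<close>

text \<open>Elements of \<open>Hom\<^sub>K(A\<^sup>\<otimes>\<^sup>n, M)\<close> are multilinear maps on the lists of length \<open>n\<close> over \<open>A\<close>.\<close>

definition hoch_tuples :: "('k, 'a, 's) module_scheme \<Rightarrow> nat \<Rightarrow> 'a list set" where
  "hoch_tuples A n = {xs. length xs = n \<and> set xs \<subseteq> carrier A}"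

definition hoch_cochains :: "('k, 'r) ring_scheme \<Rightarrow> ('k, 'a, 's) module_scheme
    \<Rightarrow> ('k, 'a, 'm, 'x) bimodule_scheme \<Rightarrow> nat \<Rightarrow> ('a list \<Rightarrow> 'm) set" where
  "hoch_cochains K A M n = {f \<in> hoch_tuples A n \<rightarrow>\<^sub>E carrier M.
     \<forall>xs\<in>hoch_tuples A n. \<forall>i<n.
       (\<forall>x\<in>carrier A. \<forall>y\<in>carrier A.
         f (xs[i := x \<oplus>\<^bsub>A\<^esub> y]) = f (xs[i := x]) \<oplus>\<^bsub>M\<^esub> f (xs[i := y])) \<and>
       (\<forall>a\<in>carrier K. \<forall>x\<in>carrier A. f (xs[i := a \<odot>\<^bsub>A\<^esub> x]) = a \<odot>\<^bsub>M\<^esub> f (xs[i := x]))}"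

definition signed :: "('m, 'x) ring_scheme \<Rightarrow> nat \<Rightarrow> 'm \<Rightarrow> 'm" where
  "signed M i m = (if even i then m else \<ominus>\<^bsub>M\<^esub> m)"

definition contract :: "('a, 'x) ring_scheme \<Rightarrow> nat \<Rightarrow> 'a list \<Rightarrow> 'a list" where
  "contract A i xs = take i xs @ [xs ! i \<otimes>\<^bsub>A\<^esub> xs ! Suc i] @ drop (Suc (Suc i)) xs"

text \<open>Entries are numbered from \<open>0\<close>, whence the sign \<open>(-1)\<^sup>i\<^sup>+\<^sup>1\<close> at \<open>contract A i\<close>.\<close>

definition hoch_diff :: "('k, 'a, 's) module_scheme \<Rightarrow> ('k, 'a, 'm, 'x) bimodule_scheme
    \<Rightarrow> nat \<Rightarrow> ('a list \<Rightarrow> 'm) \<Rightarrow> ('a list \<Rightarrow> 'm)" where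
  "hoch_diff A M n f = (\<lambda>xs\<in>hoch_tuples A (Suc n).
     lact M (hd xs) (f (tl xs)) \<oplus>\<^bsub>M\<^esub>
     (\<Oplus>\<^bsub>M\<^esub>i\<in>{..<n}. signed M (Suc i) (f (contract A i xs))) \<oplus>\<^bsub>M\<^esub>
     signed M (Suc n) (ract M (f (butlast xs)) (last xs)))"

definition hoch_cocycles :: "('k, 'r) ring_scheme \<Rightarrow> ('k, 'a, 's) module_scheme
    \<Rightarrow> ('k, 'a, 'm, 'x) bimodule_scheme \<Rightarrow> nat \<Rightarrow> ('a list \<Rightarrow> 'm) set" where
  "hoch_cocycles K A M n = {f \<in> hoch_cochains K A M n.
     \<forall>xs\<in>hoch_tuples A (Suc n). hoch_diff A M n f xs = \<zero>\<^bsub>M\<^esub>}"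

definition hoch_coboundaries :: "('k, 'r) ring_scheme \<Rightarrow> ('k, 'a, 's) module_scheme
    \<Rightarrow> ('k, 'a, 'm, 'x) bimodule_scheme \<Rightarrow> nat \<Rightarrow> ('a list \<Rightarrow> 'm) set" where
  "hoch_coboundaries K A M n = (case n of
       0 \<Rightarrow> {\<lambda>xs\<in>hoch_tuples A 0. \<zero>\<^bsub>M\<^esub>}
     | Suc m \<Rightarrow> hoch_diff A M m ` hoch_cochains K A M m)"

abbreviation hoch_cocycle_space :: "('k, 'r) ring_scheme \<Rightarrow> ('k, 'a, 's) module_scheme
    \<Rightarrow> ('k, 'a, 'm, 'x) bimodule_scheme \<Rightarrow> nat \<Rightarrow> ('k, 'a list \<Rightarrow> 'm) module" where
  "hoch_cocycle_space K A M n \<equiv> fun_space (hoch_tuples A n) M (hoch_cocycles K A M n)"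

definition hoch_cohomology :: "('k, 'r) ring_scheme \<Rightarrow> ('k, 'a, 's) module_scheme
    \<Rightarrow> ('k, 'a, 'm, 'x) bimodule_scheme \<Rightarrow> nat \<Rightarrow> ('k, ('a list \<Rightarrow> 'm) set) module" where
  "hoch_cohomology K A M n = quot_space (hoch_cocycle_space K A M n) (hoch_coboundaries K A M n)"

abbreviation HH :: "('k, 'r) ring_scheme \<Rightarrow> ('k, 'a, 's) module_scheme
    \<Rightarrow> nat \<Rightarrow> ('k, ('a list \<Rightarrow> 'a) set) module" where
  "HH K A n \<equiv> hoch_cohomology K A (regular_bimodule A) n"

text \<open>
  \<open>[f] \<mapsto> [p f q\<^sup>\<otimes>\<^sup>n]\<close> for algebra morphisms \<open>p : R \<rightarrow> A\<close> and \<open>q : A \<rightarrow> R\<close> with \<open>p q = 1\<close>. An element of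
  \<open>HH K R 0\<close> is the singleton class of a map \<open>[] \<mapsto> z\<close> with \<open>z\<close> in the centre of \<open>R\<close>; for \<open>n = 0\<close>
  the map below sends it to the class of \<open>[] \<mapsto> p z\<close>.
\<close>

definition hoch_projection :: "('k, 'r) ring_scheme \<Rightarrow> ('k, 'b, 't) module_scheme
    \<Rightarrow> ('k, 'a, 's) module_scheme \<Rightarrow> ('b \<Rightarrow> 'a) \<Rightarrow> ('a \<Rightarrow> 'b) \<Rightarrow> nat
    \<Rightarrow> ('b list \<Rightarrow> 'b) set \<Rightarrow> ('a list \<Rightarrow> 'a) set" where
  "hoch_projection K R A p q n = (\<lambda>S\<in>carrier (HH K R n).
     \<Union>f\<in>S. hoch_coboundaries K A (regular_bimodule A) n
       +>\<^bsub>hoch_cocycle_space K A (regular_bimodule A) n\<^esub>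
       (\<lambda>xs\<in>hoch_tuples A n. p (f (map q xs))))"

text \<open>The space \<open>\<E>(M, A)\<close> of bimodule morphisms \<open>f : M \<rightarrow> A\<close> with \<open>x f(y) + f(x) y = 0\<close>.\<close>

definition \<E>_space :: "('k, 'r) ring_scheme \<Rightarrow> ('k, 'a, 'm, 'x) bimodule_scheme
    \<Rightarrow> ('k, 'a, 's) module_scheme \<Rightarrow> ('k, 'm \<Rightarrow> 'a) module" where
  "\<E>_space K M A = fun_space (carrier M) A {f \<in> bimod_hom K A M (regular_bimodule A).
     \<forall>x\<in>carrier M. \<forall>y\<in>carrier M. ract M x (f y) \<oplus>\<^bsub>M\<^esub> lact M (f x) y = \<zero>\<^bsub>M\<^esub>}"

end

theory Submission
  imports Defs
begin

text \<open>
  The bimodule \<open>E = Ext\<^sup>2(DC, C)\<close> enters the proof through three properties.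

  \<^item> A central element \<open>z\<close> of \<open>C\<close> acts on \<open>E\<close> in the same way from the left and from the right. On \<open>DC\<close>
    and on \<open>C\<close> this is clear, and right multiplication by \<open>z\<close> on a projective resolution \<open>P\<close> of \<open>DC\<close> is
    linear and lifts the action of \<open>z\<close> on \<open>DC\<close> (\<open>central_acts_symmetrically\<close>).
  \<^item> Every derivation \<open>\<delta>\<close> of \<open>C\<close> extends to \<open>E\<close>: there is a linear \<open>D\<close> with \<open>D(ce) = \<delta>(c)e + cD(e)\<close> and
    \<open>D(ec) = D(e)c + e\<delta>(c)\<close>. Indeed \<open>\<phi> \<mapsto> - \<phi> \<circ> \<delta>\<close> is such a map on \<open>DC\<close>, a form of the comparison theorem
    lifts it to a chain map \<open>L\<close> of \<open>P\<close> with \<open>L(xc) = L(x)c + x\<delta>(c)\<close>, and \<open>D[f] = [\<delta> f - f L]\<close>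
    (\<open>derivation_along_E\<close>).
  \<^item> There is no left \<open>C\<close>-linear map \<open>E \<rightarrow> C\<close> except \<open>0\<close>. For a resolution
    \<open>0 \<rightarrow> P\<^sub>2 \<rightarrow> P\<^sub>1 \<rightarrow> P\<^sub>0 \<rightarrow> DC \<rightarrow> 0\<close> the sequence \<open>P\<^sub>1\<^sup>* \<rightarrow> P\<^sub>2\<^sup>* \<rightarrow> E \<rightarrow> 0\<close> of left modules is exact; dualising
    it once more identifies \<open>Hom(E, C)\<close> with the kernel of \<open>P\<^sub>2 \<rightarrow> P\<^sub>1\<close>, which is \<open>0\<close>
    (\<open>left_hom_Ext_regular_eq_zero\<close>). In a resolution that does not stop at \<open>P\<^sub>2\<close>, the kernel of
    \<open>P\<^sub>2 \<rightarrow> P\<^sub>1\<close> is still a direct summand of \<open>P\<^sub>2\<close>, and the argument applies to a complement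
    (\<open>cycles_retract\<close>).

  The rest concerns an algebra \<open>R = A \<ltimes> M\<close> with projection \<open>p\<close> and section \<open>q\<close>. Suppose that central
  elements of \<open>A\<close> remain central in \<open>R\<close>. Then \<open>HH\<^sup>0(R) \<rightarrow> HH\<^sup>0(A)\<close> is onto, and its kernel is visibly
  \<open>H\<^sup>0(R, M)\<close>. A derivation \<open>D\<close> of \<open>R\<close> for which \<open>p D q\<close> is inner becomes, after subtraction of
  an inner derivation, one with \<open>p D q = 0\<close>, and this is uniquely the sum of a derivation with values
  in \<open>M\<close> and of an element of \<open>\<E>(M, A)\<close> extended by \<open>0\<close> to \<open>A\<close>. Such a sum is inner only if the second
  part vanishes and the first is \<open>ad m\<close> for some \<open>m \<in> M\<close>: when it is \<open>ad (z + m)\<close>, the element \<open>z\<close>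
  is central in \<open>A\<close>, hence in \<open>R\<close>. So \<open>0 \<rightarrow> H\<^sup>1(R, M) \<oplus> \<E>(M, A) \<rightarrow> HH\<^sup>1(R) \<rightarrow> HH\<^sup>1(A)\<close> is exact, and
  the last map is onto if the derivations of \<open>A\<close> lift to \<open>R\<close> (\<open>short_exact_degree_0\<close> and
  \<open>short_exact_degree_1\<close> in \<open>split_square_zero\<close>).

  For \<open>B = C \<ltimes> E'\<close> the first property preserves centrality, the second one, followed by the projection
  \<open>E \<rightarrow> E'\<close>, lifts derivations, and the third one gives \<open>\<E>(E', C) = 0\<close>. For \<open>C \<ltimes> E = B \<ltimes> E''\<close>, the third
  property shows that a derivation of \<open>B\<close> has the form \<open>(c, e) \<mapsto> (\<delta> c, \<psi> c + \<kappa> e)\<close>; using \<open>\<kappa>\<close> on \<open>E'\<close> and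
  \<open>D\<close> on \<open>E''\<close> it lifts to \<open>C \<ltimes> E\<close>.
\<close>

section \<open>Linear maps, quotients and short exact sequences\<close>

text \<open>
  Membership in \<open>lin\<close> includes that the function is undefined outside the carrier. Linearity alone is
  what survives composition and pointwise operations on arbitrary functions.
\<close>

definition linear_map :: "('k, 'r) ring_scheme \<Rightarrow> ('k, 'v, 'x) module_scheme
    \<Rightarrow> ('k, 'w, 'y) module_scheme \<Rightarrow> ('v \<Rightarrow> 'w) \<Rightarrow> bool" where
  "linear_map K V W f \<longleftrightarrow> (\<forall>x\<in>carrier V. f x \<in> carrier W) \<and>
     (\<forall>x\<in>carrier V. \<forall>y\<in>carrier V. f (x \<oplus>\<^bsub>V\<^esub> y) = f x \<oplus>\<^bsub>W\<^esub> f y) \<and>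
     (\<forall>a\<in>carrier K. \<forall>x\<in>carrier V. f (a \<odot>\<^bsub>V\<^esub> x) = a \<odot>\<^bsub>W\<^esub> f x)"

lemma linear_mapD:
  assumes "linear_map K V W f"
  shows "x \<in> carrier V \<Longrightarrow> f x \<in> carrier W"
    and "\<lbrakk>x \<in> carrier V; y \<in> carrier V\<rbrakk> \<Longrightarrow> f (x \<oplus>\<^bsub>V\<^esub> y) = f x \<oplus>\<^bsub>W\<^esub> f y"
    and "\<lbrakk>a \<in> carrier K; x \<in> carrier V\<rbrakk> \<Longrightarrow> f (a \<odot>\<^bsub>V\<^esub> x) = a \<odot>\<^bsub>W\<^esub> f x"
  using assms by (auto simp: linear_map_def)

lemma linear_mapI:
  assumes "\<And>x. x \<in> carrier V \<Longrightarrow> f x \<in> carrier W"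
    and "\<And>x y. \<lbrakk>x \<in> carrier V; y \<in> carrier V\<rbrakk> \<Longrightarrow> f (x \<oplus>\<^bsub>V\<^esub> y) = f x \<oplus>\<^bsub>W\<^esub> f y"
    and "\<And>a x. \<lbrakk>a \<in> carrier K; x \<in> carrier V\<rbrakk> \<Longrightarrow> f (a \<odot>\<^bsub>V\<^esub> x) = a \<odot>\<^bsub>W\<^esub> f x"
  shows "linear_map K V W f"
  using assms by (auto simp: linear_map_def)

lemma lin_iff: "f \<in> lin K V W \<longleftrightarrow> f \<in> extensional (carrier V) \<and> linear_map K V W f"
  by (auto simp: lin_def linear_map_def PiE_def)

lemma linear_map_in_lin: "f \<in> lin K V W \<Longrightarrow> linear_map K V W f"
  by (simp add: lin_iff)

lemma linear_map_cong:
  assumes "module K V" "\<And>x. x \<in> carrier V \<Longrightarrow> f x = g x"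
  shows "linear_map K V W f \<longleftrightarrow> linear_map K V W g"
proof -
  interpret V: module K V by fact
  show ?thesis using assms(2) by (auto simp: linear_map_def)
qed

lemma restrict_in_lin:
  assumes "module K V" "linear_map K V W f"
  shows "restrict f (carrier V) \<in> lin K V W"
  using assms linear_map_cong[OF assms(1), of "restrict f (carrier V)" f] by (auto simp: lin_iff)

lemma linear_map_comp:
  assumes "linear_map K U V f" "linear_map K V W g"
  shows "linear_map K U W (\<lambda>x. g (f x))"
  using assms by (auto simp: linear_map_def)

lemma linear_map_id: "linear_map K V V (\<lambda>x. x)"
  by (auto simp: linear_map_def)

lemma linear_map_abelian_group_hom:
  assumes "abelian_group V" "abelian_group W" "linear_map K V W f"
  shows "abelian_group_hom V W f"
proof -
  interpret V: abelian_group V by fact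
  interpret W: abelian_group W by fact
  show ?thesis
    using assms by (intro abelian_group_homI V.abelian_group_axioms W.abelian_group_axioms
      group_hom.intro group_hom_axioms.intro V.a_group W.a_group) (auto simp: hom_def linear_map_def)
qed

lemma linear_map_zero:
  assumes "abelian_group V" "abelian_group W" "linear_map K V W f"
  shows "f \<zero>\<^bsub>V\<^esub> = \<zero>\<^bsub>W\<^esub>"
  by (rule abelian_group_hom.hom_zero[OF linear_map_abelian_group_hom[OF assms]])

lemma linear_map_uminus:
  assumes "abelian_group V" "abelian_group W" "linear_map K V W f" "x \<in> carrier V"
  shows "f (\<ominus>\<^bsub>V\<^esub> x) = \<ominus>\<^bsub>W\<^esub> f x"
  by (rule abelian_group_hom.hom_a_inv[OF linear_map_abelian_group_hom[OF assms(1-3)] assms(4)])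

lemma linear_map_minus:
  assumes "abelian_group V" "abelian_group W" "linear_map K V W f" "x \<in> carrier V" "y \<in> carrier V"
  shows "f (x \<ominus>\<^bsub>V\<^esub> y) = f x \<ominus>\<^bsub>W\<^esub> f y"
proof -
  interpret V: abelian_group V by fact
  show ?thesis
    using assms by (simp add: a_minus_def linear_mapD(2) linear_map_uminus)
qed

lemma linear_map_finsum:
  assumes "abelian_group V" "abelian_group W" "linear_map K V W f" "g \<in> I \<rightarrow> carrier V" "finite I"
  shows "f (finsum V g I) = finsum W (\<lambda>i. f (g i)) I"
proof -
  interpret V: abelian_group V by fact
  interpret W: abelian_group W by fact
  have *: "x \<in> carrier V \<Longrightarrow> f x \<in> carrier W" for x using assms(3) by (rule linear_mapD)
  from assms(5,4) show ?thesis
  proof (induction I rule: finite_induct)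
    case empty
    then show ?case using linear_map_zero[OF assms(1-3)] by simp
  next
    case (insert i I)
    then have "g \<in> I \<rightarrow> carrier V" "g i \<in> carrier V" by auto
    with insert show ?case
      by (simp add: V.finsum_insert W.finsum_insert linear_mapD[OF assms(3)] Pi_iff * V.finsum_closed)
  qed
qed

lemma diff_eq_zero_iff:
  assumes "abelian_group V" "x \<in> carrier V" "y \<in> carrier V"
  shows "x \<ominus>\<^bsub>V\<^esub> y = \<zero>\<^bsub>V\<^esub> \<longleftrightarrow> x = y"
proof -
  interpret V: abelian_group V by fact
  show ?thesis
    using assms(2,3) V.minus_equality[of x "\<ominus>\<^bsub>V\<^esub> y"] by (auto simp: a_minus_def V.r_neg)
qed

lemma diff_cancel_left:
  assumes "abelian_group V" "x \<in> carrier V" "y \<in> carrier V" "z \<in> carrier V"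
  shows "(x \<oplus>\<^bsub>V\<^esub> y) \<ominus>\<^bsub>V\<^esub> (x \<oplus>\<^bsub>V\<^esub> z) = y \<ominus>\<^bsub>V\<^esub> z"
proof -
  interpret V: abelian_group V by fact
  have "(x \<oplus>\<^bsub>V\<^esub> y) \<ominus>\<^bsub>V\<^esub> (x \<oplus>\<^bsub>V\<^esub> z) = y \<oplus>\<^bsub>V\<^esub> (x \<oplus>\<^bsub>V\<^esub> (\<ominus>\<^bsub>V\<^esub> x \<oplus>\<^bsub>V\<^esub> \<ominus>\<^bsub>V\<^esub> z))"
    using assms(2-4) by (simp add: a_minus_def V.minus_add V.a_assoc V.a_lcomm[of x y])
  also have "x \<oplus>\<^bsub>V\<^esub> (\<ominus>\<^bsub>V\<^esub> x \<oplus>\<^bsub>V\<^esub> \<ominus>\<^bsub>V\<^esub> z) = \<ominus>\<^bsub>V\<^esub> z"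
    using assms(2-4) by (simp add: V.r_neg V.a_assoc[symmetric])
  finally show ?thesis using assms by (simp add: a_minus_def)
qed

lemma diff_add_self:
  assumes "abelian_group V" "x \<in> carrier V" "y \<in> carrier V"
  shows "(x \<ominus>\<^bsub>V\<^esub> y) \<oplus>\<^bsub>V\<^esub> y = x"
proof -
  interpret V: abelian_group V by fact
  show ?thesis using assms(2,3) by (simp add: a_minus_def V.a_assoc V.l_neg)
qed

lemma diff_zero:
  assumes "abelian_group V" "x \<in> carrier V"
  shows "x \<ominus>\<^bsub>V\<^esub> \<zero>\<^bsub>V\<^esub> = x"
proof -
  interpret V: abelian_group V by fact
  show ?thesis using assms(2) V.minus_equality[of "\<zero>\<^bsub>V\<^esub>" "\<zero>\<^bsub>V\<^esub>"] by (simp add: a_minus_def)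
qed

lemma diff_diff_self:
  assumes "abelian_group V" "x \<in> carrier V" "y \<in> carrier V"
  shows "x \<ominus>\<^bsub>V\<^esub> (x \<ominus>\<^bsub>V\<^esub> y) = y"
proof -
  interpret V: abelian_group V by fact
  show ?thesis using assms(2,3) by (simp add: a_minus_def V.minus_add V.r_neg V.a_assoc[symmetric])
qed

lemma diff_add_diff:
  assumes "abelian_group V" "a \<in> carrier V" "b \<in> carrier V" "c \<in> carrier V" "d \<in> carrier V"
  shows "(a \<ominus>\<^bsub>V\<^esub> b) \<oplus>\<^bsub>V\<^esub> (c \<ominus>\<^bsub>V\<^esub> d) = (a \<oplus>\<^bsub>V\<^esub> c) \<ominus>\<^bsub>V\<^esub> (b \<oplus>\<^bsub>V\<^esub> d)"
proof -
  interpret V: abelian_group V by fact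
  show ?thesis using assms(2-) by (simp add: a_minus_def V.minus_add V.a_ac)
qed

lemma diff_diff_diff:
  assumes "abelian_group V" "a \<in> carrier V" "b \<in> carrier V" "c \<in> carrier V" "d \<in> carrier V"
  shows "(a \<ominus>\<^bsub>V\<^esub> b) \<ominus>\<^bsub>V\<^esub> (c \<ominus>\<^bsub>V\<^esub> d) = (a \<ominus>\<^bsub>V\<^esub> c) \<ominus>\<^bsub>V\<^esub> (b \<ominus>\<^bsub>V\<^esub> d)"
proof -
  interpret V: abelian_group V by fact
  show ?thesis using assms(2-) by (simp add: a_minus_def V.minus_add V.a_ac)
qed

lemma diff_add_diff_telescope:
  assumes "abelian_group V" "a \<in> carrier V" "b \<in> carrier V" "c \<in> carrier V"
  shows "(a \<ominus>\<^bsub>V\<^esub> b) \<oplus>\<^bsub>V\<^esub> (b \<ominus>\<^bsub>V\<^esub> c) = a \<ominus>\<^bsub>V\<^esub> c"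
proof -
  interpret V: abelian_group V by fact
  show ?thesis using assms(2-) by (simp add: a_minus_def V.a_assoc[symmetric] V.l_neg)
     (simp add: V.a_assoc V.l_neg)
qed

lemma linear_map_add:
  assumes "module K W" "linear_map K V W f" "linear_map K V W g"
  shows "linear_map K V W (\<lambda>x. f x \<oplus>\<^bsub>W\<^esub> g x)"
proof -
  interpret W: module K W by fact
  show ?thesis
    by (intro linear_mapI; simp add: assms(2,3)[THEN linear_mapD(1)] assms(2,3)[THEN linear_mapD(2)]
         assms(2,3)[THEN linear_mapD(3)] W.smult_r_distr W.a_ac)
qed

lemma linear_map_smult:
  assumes "module K W" "linear_map K V W f" "a \<in> carrier K"
  shows "linear_map K V W (\<lambda>x. a \<odot>\<^bsub>W\<^esub> f x)"
proof -
  interpret W: module K W by fact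
  show ?thesis
    using assms(3) by (intro linear_mapI; simp add: linear_mapD[OF assms(2)] W.smult_r_distr
        W.smult_assoc1[symmetric] W.m_comm)
qed

lemma linear_map_diff:
  assumes "module K W" "linear_map K V W f" "linear_map K V W g"
  shows "linear_map K V W (\<lambda>x. f x \<ominus>\<^bsub>W\<^esub> g x)"
proof -
  interpret W: module K W by fact
  show ?thesis
    by (intro linear_mapI; simp add: assms(2,3)[THEN linear_mapD(1)] assms(2,3)[THEN linear_mapD(2)]
         assms(2,3)[THEN linear_mapD(3)] W.smult_r_distr W.smult_r_minus W.minus_add W.a_ac a_minus_def)
qed

lemma linear_map_zero_fun:
  assumes "module K W"
  shows "linear_map K V W (\<lambda>x. \<zero>\<^bsub>W\<^esub>)"
proof -
  interpret W: module K W by fact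
  show ?thesis by (intro linear_mapI; simp)
qed

text \<open>
  Closure under negatives is automatic, as \<open>- x = (- 1) x\<close>.
\<close>

lemma submodule_of_closed:
  assumes "module K V" "H \<subseteq> carrier V" "\<zero>\<^bsub>V\<^esub> \<in> H"
    and "\<And>x y. \<lbrakk>x \<in> H; y \<in> H\<rbrakk> \<Longrightarrow> x \<oplus>\<^bsub>V\<^esub> y \<in> H"
    and smult: "\<And>a x. \<lbrakk>a \<in> carrier K; x \<in> H\<rbrakk> \<Longrightarrow> a \<odot>\<^bsub>V\<^esub> x \<in> H"
  shows "submodule H K V"
proof -
  interpret V: module K V by fact
  have "\<ominus>\<^bsub>V\<^esub> x \<in> H" if "x \<in> H" for x
    using smult[of "\<ominus>\<^bsub>K\<^esub> \<one>\<^bsub>K\<^esub>" x] that assms(2) by (auto simp: V.smult_l_minus subset_iff)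
  then show ?thesis using assms by (intro V.submoduleI) auto
qed

text \<open>
  Rings, modules, right modules and bimodules are records of different types. The vector space axioms
  only concern four of their fields, so they pass from one type to another.
\<close>

lemma module_same_ops:
  assumes "module K V" "carrier W = carrier V" "add W = add V" "zero W = zero V" "smult W = smult V"
  shows "module K W"
proof -
  interpret V: module K V by fact
  have "abelian_group W"
    using assms(2-) V.a_inv_closed V.l_neg
    by (intro abelian_groupI) (auto simp: V.a_ac)
  then show ?thesis
    using assms(2-) by (intro moduleI V.R.is_cring) (auto simp: V.smult_l_distr V.smult_r_distr V.smult_assoc1)
qed

lemma module_of_submodule:
  assumes "module K V" "submodule H K V" "carrier W = H" "add W = add V" "zero W = zero V" "smult W = smult V"
  shows "module K W"
  by (rule module_same_ops[OF submodule.submodule_is_module[OF assms(2,1)]]) (use assms in auto)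

lemma submodule_zero_in: "submodule U K V \<Longrightarrow> \<zero>\<^bsub>V\<^esub> \<in> U"
  using subgroup.one_closed[OF submodule.axioms(1)] by fastforce

lemma fun_space_simps [simp]:
  "carrier (fun_space S W F) = F"
  "\<zero>\<^bsub>fun_space S W F\<^esub> = (\<lambda>x\<in>S. \<zero>\<^bsub>W\<^esub>)"
  "f \<oplus>\<^bsub>fun_space S W F\<^esub> g = (\<lambda>x\<in>S. f x \<oplus>\<^bsub>W\<^esub> g x)"
  "a \<odot>\<^bsub>fun_space S W F\<^esub> f = (\<lambda>x\<in>S. a \<odot>\<^bsub>W\<^esub> f x)"
  by (simp_all add: fun_space_def)

lemma module_fun_space:
  assumes "module K W" "F \<subseteq> S \<rightarrow>\<^sub>E carrier W" "(\<lambda>x\<in>S. \<zero>\<^bsub>W\<^esub>) \<in> F"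
    and add: "\<And>f g. \<lbrakk>f \<in> F; g \<in> F\<rbrakk> \<Longrightarrow> (\<lambda>x\<in>S. f x \<oplus>\<^bsub>W\<^esub> g x) \<in> F"
    and smult: "\<And>a f. \<lbrakk>a \<in> carrier K; f \<in> F\<rbrakk> \<Longrightarrow> (\<lambda>x\<in>S. a \<odot>\<^bsub>W\<^esub> f x) \<in> F"
  shows "module K (fun_space S W F)"
proof -
  interpret W: module K W by fact
  have mem: "f x \<in> carrier W" if "f \<in> F" "x \<in> S" for f x
    using assms(2) that by (auto simp: PiE_iff)
  have ext: "(\<lambda>x\<in>S. f x) = f" if "f \<in> F" for f
    using assms(2) that by (auto simp: PiE_iff extensional_restrict)
  have "abelian_group (fun_space S W F)"
  proof (rule abelian_groupI)
    show "\<exists>g\<in>carrier (fun_space S W F). g \<oplus>\<^bsub>fun_space S W F\<^esub> f = \<zero>\<^bsub>fun_space S W F\<^esub>"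
      if "f \<in> carrier (fun_space S W F)" for f
    proof (rule bexI)
      show "(\<lambda>x\<in>S. (\<ominus>\<^bsub>K\<^esub> \<one>\<^bsub>K\<^esub>) \<odot>\<^bsub>W\<^esub> f x) \<in> carrier (fun_space S W F)"
        using that smult by simp
      show "(\<lambda>x\<in>S. (\<ominus>\<^bsub>K\<^esub> \<one>\<^bsub>K\<^esub>) \<odot>\<^bsub>W\<^esub> f x) \<oplus>\<^bsub>fun_space S W F\<^esub> f = \<zero>\<^bsub>fun_space S W F\<^esub>"
        using that by (auto simp: mem W.smult_l_minus W.l_neg cong: restrict_cong)
    qed
  qed (auto simp: assms mem ext W.a_ac cong: restrict_cong)
  then show ?thesis
  proof (rule moduleI[OF W.R.is_cring])
  qed (auto simp: assms mem ext W.smult_l_distr W.smult_r_distr W.smult_assoc1 smult cong: restrict_cong)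
qed

lemma fun_space_minus:
  assumes "module K W" "module K (fun_space S W F)" "F \<subseteq> S \<rightarrow>\<^sub>E carrier W" "f \<in> F" "g \<in> F"
  shows "f \<ominus>\<^bsub>fun_space S W F\<^esub> g = (\<lambda>x\<in>S. f x \<ominus>\<^bsub>W\<^esub> g x)"
proof -
  interpret W: module K W by fact
  interpret F: module K "fun_space S W F" by fact
  have mem: "f x \<in> carrier W" if "f \<in> F" "x \<in> S" for f x
    using assms(3) that by (auto simp: PiE_iff)
  have "\<ominus>\<^bsub>fun_space S W F\<^esub> g = (\<ominus>\<^bsub>K\<^esub> \<one>\<^bsub>K\<^esub>) \<odot>\<^bsub>fun_space S W F\<^esub> g"
    using assms(5) by (subst F.smult_l_minus) (simp_all del: fun_space_simps(4))
  also have "\<dots> = (\<lambda>x\<in>S. \<ominus>\<^bsub>W\<^esub> g x)"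
    using assms by (auto simp: mem W.smult_l_minus cong: restrict_cong)
  finally show ?thesis using assms by (auto simp: a_minus_def cong: restrict_cong)
qed

lemma direct_sum_simps [simp]:
  "carrier (direct_sum V W) = carrier V \<times> carrier W"
  "\<zero>\<^bsub>direct_sum V W\<^esub> = (\<zero>\<^bsub>V\<^esub>, \<zero>\<^bsub>W\<^esub>)"
  "(v, w) \<oplus>\<^bsub>direct_sum V W\<^esub> (v', w') = (v \<oplus>\<^bsub>V\<^esub> v', w \<oplus>\<^bsub>W\<^esub> w')"
  "a \<odot>\<^bsub>direct_sum V W\<^esub> (v, w) = (a \<odot>\<^bsub>V\<^esub> v, a \<odot>\<^bsub>W\<^esub> w)"
  by (simp_all add: direct_sum_def)

lemma module_direct_sum:
  assumes "module K V" "module K W"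
  shows "module K (direct_sum V W)"
proof -
  interpret V: module K V by fact
  interpret W: module K W by fact
  have "abelian_group (direct_sum V W)"
  proof (rule abelian_groupI)
    show "\<exists>y\<in>carrier (direct_sum V W). y \<oplus>\<^bsub>direct_sum V W\<^esub> x = \<zero>\<^bsub>direct_sum V W\<^esub>"
      if "x \<in> carrier (direct_sum V W)" for x
      using that by (intro bexI[of _ "(\<ominus>\<^bsub>V\<^esub> fst x, \<ominus>\<^bsub>W\<^esub> snd x)"]) (auto simp: V.l_neg W.l_neg)
  qed (auto simp: V.a_ac W.a_ac)
  then show ?thesis
    by (rule moduleI[OF V.R.is_cring])
       (auto simp: V.smult_l_distr V.smult_r_distr V.smult_assoc1
          W.smult_l_distr W.smult_r_distr W.smult_assoc1)
qed

locale quotient_space = V: module K V + U: submodule U K V for K and V and U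
begin

sublocale A: abelian_subgroup U V
  by (rule abelian_subgroupI3)
     (simp_all add: additive_subgroup.intro U.subgroup_axioms V.abelian_group_axioms)

abbreviation cls where "cls x \<equiv> U +>\<^bsub>V\<^esub> x"
abbreviation Q where "Q \<equiv> quot_space V U"

lemma Q_simps:
  "carrier Q = cls ` carrier V" "\<zero>\<^bsub>Q\<^esub> = U" "add Q = set_add V"
  "smult Q = (\<lambda>a S. \<Union>x\<in>S. U +>\<^bsub>V\<^esub> (a \<odot>\<^bsub>V\<^esub> x))"
  by (auto simp: quot_space_def A_RCOSETS_def')

lemma cls_eq_iff:
  assumes "x \<in> carrier V" "y \<in> carrier V"
  shows "cls x = cls y \<longleftrightarrow> x \<ominus>\<^bsub>V\<^esub> y \<in> U"
proof -
  have "cls x = cls y \<longleftrightarrow> x \<in> cls y"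
    using assms A.a_repr_independence' A.a_repr_independenceD by metis
  also have "\<dots> \<longleftrightarrow> x \<ominus>\<^bsub>V\<^esub> y \<in> U"
    using A.a_rcos_module[OF assms(2,1)] by (simp add: a_minus_def)
  finally show ?thesis .
qed


lemma cls_in: "x \<in> carrier V \<Longrightarrow> cls x \<in> carrier Q"
  by (simp add: Q_simps)

lemma QE:
  assumes "S \<in> carrier Q"
  obtains x where "x \<in> carrier V" "S = cls x"
  using assms by (auto simp: Q_simps)

lemma cls_memD:
  assumes "y \<in> cls x" "x \<in> carrier V"
  shows "y \<in> carrier V" "cls y = cls x"
  using A.a_elemrcos_carrier[OF assms(2,1)] A.a_repr_independence'[OF assms] by auto

lemma cls_mem_iff: "x \<in> carrier V \<Longrightarrow> y \<in> cls x \<longleftrightarrow> y \<in> carrier V \<and> y \<ominus>\<^bsub>V\<^esub> x \<in> U"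
  using cls_memD cls_eq_iff A.a_repr_independenceD by metis

lemma UN_cls_const:
  assumes "x \<in> carrier V" "\<And>y. \<lbrakk>y \<in> carrier V; y \<ominus>\<^bsub>V\<^esub> x \<in> U\<rbrakk> \<Longrightarrow> g y = c"
  shows "(\<Union>y\<in>cls x. g y) = c"
proof -
  have "g y = c" if "y \<in> cls x" for y
    using assms(2)[of y] that cls_mem_iff[OF assms(1)] by blast
  moreover have "x \<in> cls x" using A.a_rcos_self[OF assms(1)] .
  ultimately show ?thesis by blast
qed

lemma cls_add:
  assumes "x \<in> carrier V" "y \<in> carrier V"
  shows "cls x \<oplus>\<^bsub>Q\<^esub> cls y = cls (x \<oplus>\<^bsub>V\<^esub> y)"
  using A.a_rcos_sum[OF assms] by (simp add: Q_simps)

lemma smult_minus: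
  assumes "a \<in> carrier K" "x \<in> carrier V" "y \<in> carrier V"
  shows "a \<odot>\<^bsub>V\<^esub> (x \<ominus>\<^bsub>V\<^esub> y) = (a \<odot>\<^bsub>V\<^esub> x) \<ominus>\<^bsub>V\<^esub> (a \<odot>\<^bsub>V\<^esub> y)"
  using assms by (simp add: a_minus_def V.smult_r_distr V.smult_r_minus)

lemma cls_smult:
  assumes "a \<in> carrier K" "x \<in> carrier V"
  shows "a \<odot>\<^bsub>Q\<^esub> cls x = cls (a \<odot>\<^bsub>V\<^esub> x)"
  unfolding Q_simps using assms
  by (intro UN_cls_const) (simp_all add: cls_eq_iff smult_minus[symmetric])

lemma cls_zero_iff: "x \<in> carrier V \<Longrightarrow> cls x = U \<longleftrightarrow> x \<in> U"
  using A.a_rcos_const A.a_rcos_self by blast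

lemma cls_zero: "cls \<zero>\<^bsub>V\<^esub> = U"
  by (simp add: cls_zero_iff)

lemma module_Q: "module K Q"
proof -
  have "abelian_group Q"
  proof (rule abelian_groupI)
    fix S assume "S \<in> carrier Q"
    then obtain x where x: "x \<in> carrier V" "S = cls x" by (rule QE)
    show "\<exists>T\<in>carrier Q. T \<oplus>\<^bsub>Q\<^esub> S = \<zero>\<^bsub>Q\<^esub>"
      using x by (intro bexI[of _ "cls (\<ominus>\<^bsub>V\<^esub> x)"]) (simp_all add: cls_add cls_in V.l_neg Q_simps(2) cls_zero_iff)
    show "\<zero>\<^bsub>Q\<^esub> \<oplus>\<^bsub>Q\<^esub> S = S"
    proof -
      have "\<zero>\<^bsub>Q\<^esub> = cls \<zero>\<^bsub>V\<^esub>" by (simp add: Q_simps(2) cls_zero)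
      then show ?thesis using x by (simp add: cls_add)
    qed
  next
    show "\<zero>\<^bsub>Q\<^esub> \<in> carrier Q"
      using cls_zero cls_in[of "\<zero>\<^bsub>V\<^esub>"] by (simp add: Q_simps(2))
  qed (auto elim!: QE simp: cls_add cls_in V.a_ac)
  then show ?thesis
    by (rule moduleI[OF V.R.is_cring])
       (auto elim!: QE simp: cls_add cls_in cls_smult V.smult_l_distr V.smult_r_distr V.smult_assoc1)
qed

lemma linear_map_cls: "linear_map K V Q cls"
  by (intro linear_mapI) (simp_all add: cls_add cls_smult cls_in)

end

lemma quotient_spaceI: "\<lbrakk>module K V; submodule U K V\<rbrakk> \<Longrightarrow> quotient_space K V U"
  by (simp add: quotient_space_def)

text \<open>
  Maps between quotients, such as \<open>hoch_projection\<close>, are written as unions over all representatives; for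
  a linear map that respects the subspaces all sets in the union are equal.
\<close>

lemma UN_induced_map:
  assumes "quotient_space K V U" "quotient_space K W U'" "linear_map K V W g"
    and "\<And>x. x \<in> U \<Longrightarrow> g x \<in> U'" "x \<in> carrier V"
  shows "(\<Union>y\<in>U +>\<^bsub>V\<^esub> x. U' +>\<^bsub>W\<^esub> g y) = U' +>\<^bsub>W\<^esub> g x"
proof -
  interpret V: quotient_space K V U by fact
  interpret W: quotient_space K W U' by fact
  show ?thesis
    using assms(5) linear_mapD(1)[OF assms(3)]
    by (intro V.UN_cls_const)
      (auto simp: W.cls_eq_iff assms(4)
         linear_map_minus[OF V.V.abelian_group_axioms W.V.abelian_group_axioms assms(3), symmetric])
qed

text \<open>
  All four sequences are instances: \<open>V\<close> and \<open>W\<close> are spaces of cocycles, \<open>U\<close> and \<open>U'\<close> of coboundaries. The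
  left term \<open>Q\<close> is only given as a quotient \<open>c\<close> of a space \<open>T\<close> of representatives, because in one case it
  is not a cohomology space but the direct sum of one and of a space of bimodule morphisms. The left map
  sends \<open>c t\<close> to the class of \<open>g t\<close>.
\<close>

lemma short_exact_of_representatives:
  assumes V: "quotient_space K V U" and W: "quotient_space K W U'"
    and T: "module K T" and Q: "module K Q" and c: "linear_map K T Q c" "c ` carrier T = carrier Q"
    and g: "linear_map K T V g" and h: "linear_map K V W h"
    and hU: "\<And>x. x \<in> U \<Longrightarrow> h x \<in> U'"
    and inj: "\<And>t. t \<in> carrier T \<Longrightarrow> g t \<in> U \<longleftrightarrow> c t = \<zero>\<^bsub>Q\<^esub>"
    and comp: "\<And>t. t \<in> carrier T \<Longrightarrow> h (g t) \<in> U'"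
    and exact: "\<And>v. \<lbrakk>v \<in> carrier V; h v \<in> U'\<rbrakk> \<Longrightarrow> \<exists>t\<in>carrier T. v \<ominus>\<^bsub>V\<^esub> g t \<in> U"
    and surj: "\<And>w. w \<in> carrier W \<Longrightarrow> \<exists>v\<in>carrier V. h v = w"
  shows "\<exists>\<iota>. short_exact K Q (quot_space V U) (quot_space W U') \<iota>
           (\<lambda>S\<in>carrier (quot_space V U). \<Union>x\<in>S. U' +>\<^bsub>W\<^esub> h x)"
proof -
  interpret V: quotient_space K V U by fact
  interpret W: quotient_space K W U' by fact
  interpret T: module K T by fact
  interpret Q: module K Q by fact
  interpret VQ: module K V.Q by (rule V.module_Q)
  interpret WQ: module K W.Q by (rule W.module_Q)
  define r where "r q = (SOME t. t \<in> carrier T \<and> c t = q)" for q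
  have r: "r q \<in> carrier T" "c (r q) = q" if "q \<in> carrier Q" for q
  proof -
    have "\<exists>t. t \<in> carrier T \<and> c t = q" using that c(2) by (metis imageE)
    from someI_ex[OF this] show "r q \<in> carrier T" "c (r q) = q" by (simp_all add: r_def)
  qed
  have cT: "t \<in> carrier T \<Longrightarrow> c t \<in> carrier Q" for t using c by auto
  have gT: "t \<in> carrier T \<Longrightarrow> g t \<in> carrier V" for t using g by (rule linear_mapD)
  have same: "V.cls (g t) = V.cls (g t') \<longleftrightarrow> c t = c t'" if "t \<in> carrier T" "t' \<in> carrier T" for t t'
  proof -
    have "V.cls (g t) = V.cls (g t') \<longleftrightarrow> g (t \<ominus>\<^bsub>T\<^esub> t') \<in> U"
      using that by (simp add: V.cls_eq_iff gT
          linear_map_minus[OF T.abelian_group_axioms V.V.abelian_group_axioms g])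
    also have "\<dots> \<longleftrightarrow> c t \<ominus>\<^bsub>Q\<^esub> c t' = \<zero>\<^bsub>Q\<^esub>"
      using that by (simp add: inj
          linear_map_minus[OF T.abelian_group_axioms Q.abelian_group_axioms c(1)])
    finally show ?thesis using that cT by (simp add: diff_eq_zero_iff Q.abelian_group_axioms)
  qed
  define \<iota> where "\<iota> q = V.cls (g (r q))" for q
  have \<iota>: "\<iota> (c t) = V.cls (g t)" if "t \<in> carrier T" for t
    using that r cT by (simp add: \<iota>_def same)
  have \<iota>_lin: "linear_map K Q V.Q \<iota>"
  proof (rule linear_mapI)
    fix q assume "q \<in> carrier Q"
    then show "\<iota> q \<in> carrier V.Q" using r by (simp add: \<iota>_def V.cls_in gT)
  next
    fix q q' assume *: "q \<in> carrier Q" "q' \<in> carrier Q"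
    have "\<iota> (q \<oplus>\<^bsub>Q\<^esub> q') = \<iota> (c (r q \<oplus>\<^bsub>T\<^esub> r q'))"
      using * r by (simp add: linear_mapD(2)[OF c(1)])
    then show "\<iota> (q \<oplus>\<^bsub>Q\<^esub> q') = \<iota> q \<oplus>\<^bsub>V.Q\<^esub> \<iota> q'"
      using * r by (simp add: \<iota> linear_mapD(2)[OF g] V.cls_add gT \<iota>_def[of q] \<iota>_def[of q'])
  next
    fix a q assume *: "a \<in> carrier K" "q \<in> carrier Q"
    have "\<iota> (a \<odot>\<^bsub>Q\<^esub> q) = \<iota> (c (a \<odot>\<^bsub>T\<^esub> r q))"
      using * r by (simp add: linear_mapD(3)[OF c(1)])
    then show "\<iota> (a \<odot>\<^bsub>Q\<^esub> q) = a \<odot>\<^bsub>V.Q\<^esub> \<iota> q"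
      using * r by (simp add: \<iota> linear_mapD(3)[OF g] V.cls_smult gT \<iota>_def[of q])
  qed
  let ?\<phi> = "\<lambda>S\<in>carrier V.Q. \<Union>x\<in>S. W.cls (h x)"
  have hV: "x \<in> carrier V \<Longrightarrow> h x \<in> carrier W" for x using h by (rule linear_mapD)
  have \<phi>: "?\<phi> (V.cls x) = W.cls (h x)" if "x \<in> carrier V" for x
    using that by (simp add: V.cls_in UN_induced_map[OF V W h hU])
  have \<phi>_lin: "linear_map K V.Q W.Q ?\<phi>"
  proof (rule linear_mapI)
    fix S assume "S \<in> carrier V.Q"
    then show "?\<phi> S \<in> carrier W.Q" by (auto elim!: V.QE simp only: \<phi> W.cls_in hV)
  next
    fix S S' assume "S \<in> carrier V.Q" "S' \<in> carrier V.Q"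
    then show "?\<phi> (S \<oplus>\<^bsub>V.Q\<^esub> S') = ?\<phi> S \<oplus>\<^bsub>W.Q\<^esub> ?\<phi> S'"
      by (auto elim!: V.QE simp only: \<phi> W.cls_in hV V.cls_add W.cls_add V.V.a_closed linear_mapD(2)[OF h])
  next
    fix a S assume "a \<in> carrier K" "S \<in> carrier V.Q"
    then show "?\<phi> (a \<odot>\<^bsub>V.Q\<^esub> S) = a \<odot>\<^bsub>W.Q\<^esub> ?\<phi> S"
      by (auto elim!: V.QE simp only: \<phi> W.cls_in hV V.cls_smult W.cls_smult V.V.smult_closed linear_mapD(3)[OF h])
  qed
  have "short_exact K Q V.Q W.Q (restrict \<iota> (carrier Q)) ?\<phi>"
    unfolding short_exact_def
  proof (intro conjI)
    show "restrict \<iota> (carrier Q) \<in> lin K Q V.Q" by (rule restrict_in_lin[OF Q \<iota>_lin])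
    show "?\<phi> \<in> lin K V.Q W.Q" using \<phi>_lin by (simp add: lin_iff)
    show "inj_on (restrict \<iota> (carrier Q)) (carrier Q)"
    proof (rule inj_onI)
      fix q q' assume "q \<in> carrier Q" "q' \<in> carrier Q"
        "restrict \<iota> (carrier Q) q = restrict \<iota> (carrier Q) q'"
      then show "q = q'" using same[of "r q" "r q'"] r by (simp add: \<iota>_def)
    qed
    have image: "restrict \<iota> (carrier Q) ` carrier Q = V.cls ` g ` carrier T"
      unfolding c(2)[symmetric] image_image using cT by (intro image_cong) (simp_all add: \<iota>)
    have kernel: "a_kernel V.Q W.Q ?\<phi> = V.cls ` {x \<in> carrier V. h x \<in> U'}"
    proof -
      have "a_kernel V.Q W.Q ?\<phi> = {S \<in> carrier V.Q. ?\<phi> S = U'}"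
        by (simp add: a_kernel_def' W.Q_simps(2))
      also have "\<dots> = V.cls ` {x \<in> carrier V. ?\<phi> (V.cls x) = U'}"
        by (auto simp only: V.Q_simps(1))
      also have "\<dots> = V.cls ` {x \<in> carrier V. h x \<in> U'}"
        by (rule arg_cong[of _ _ "image V.cls"], rule Collect_cong) (metis \<phi> W.cls_zero_iff hV)
      finally show ?thesis .
    qed
    show "restrict \<iota> (carrier Q) ` carrier Q = a_kernel V.Q W.Q ?\<phi>"
      unfolding image kernel
    proof
      show "V.cls ` g ` carrier T \<subseteq> V.cls ` {x \<in> carrier V. h x \<in> U'}"
        using gT comp by auto
      show "V.cls ` {x \<in> carrier V. h x \<in> U'} \<subseteq> V.cls ` g ` carrier T"
        using exact gT by (auto simp: image_iff) (metis V.cls_eq_iff gT)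
    qed
    show "?\<phi> ` carrier V.Q = carrier W.Q"
    proof
      show "?\<phi> ` carrier V.Q \<subseteq> carrier W.Q" using linear_mapD(1)[OF \<phi>_lin] by blast
      show "carrier W.Q \<subseteq> ?\<phi> ` carrier V.Q"
      proof
        fix S assume "S \<in> carrier W.Q"
        then obtain w where "w \<in> carrier W" "S = W.cls w" by (rule W.QE)
        then obtain v where "v \<in> carrier V" "S = W.cls (h v)" using surj by blast
        then show "S \<in> ?\<phi> ` carrier V.Q" using \<phi>[of v] V.cls_in[of v] by blast
      qed
    qed
  qed
  then show ?thesis by blast
qed


section \<open>Algebras, modules and derivations; Hochschild cohomology in degrees 0 and 1\<close>

text \<open>The degree \<open>1\<close> is not rewritten to \<open>Suc 0\<close>, so that facts about degree one apply as they are stated.\<close>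

declare One_nat_def [simp del]

locale k_algebra = A: module K A + A: ring A
  for K :: "('k, 'r) ring_scheme" and A :: "('k, 'a, 's) module_scheme" +
  assumes smult_mult_left:
      "\<lbrakk>k \<in> carrier K; x \<in> carrier A; y \<in> carrier A\<rbrakk> \<Longrightarrow>
        (k \<odot>\<^bsub>A\<^esub> x) \<otimes>\<^bsub>A\<^esub> y = k \<odot>\<^bsub>A\<^esub> (x \<otimes>\<^bsub>A\<^esub> y)"
    and smult_mult_right:
      "\<lbrakk>k \<in> carrier K; x \<in> carrier A; y \<in> carrier A\<rbrakk> \<Longrightarrow>
        x \<otimes>\<^bsub>A\<^esub> (k \<odot>\<^bsub>A\<^esub> y) = k \<odot>\<^bsub>A\<^esub> (x \<otimes>\<^bsub>A\<^esub> y)"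

lemma (in fin_dim_algebra) k_algebra: "k_algebra K A"
  by unfold_locales (simp_all add: smult_mult_left smult_mult_right)

locale k_rmodule = A: k_algebra K A + M: module K M
  for K and A :: "('k, 'a, 's) module_scheme" and M :: "('k, 'a, 'm, 'x) rmodule_scheme" +
  assumes ract_closed [simp]: "\<lbrakk>x \<in> carrier M; a \<in> carrier A\<rbrakk> \<Longrightarrow> ract M x a \<in> carrier M"
    and ract_add_left:
      "\<lbrakk>x \<in> carrier M; y \<in> carrier M; a \<in> carrier A\<rbrakk> \<Longrightarrow>
        ract M (x \<oplus>\<^bsub>M\<^esub> y) a = ract M x a \<oplus>\<^bsub>M\<^esub> ract M y a"
    and ract_add_right:
      "\<lbrakk>x \<in> carrier M; a \<in> carrier A; b \<in> carrier A\<rbrakk> \<Longrightarrow>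
        ract M x (a \<oplus>\<^bsub>A\<^esub> b) = ract M x a \<oplus>\<^bsub>M\<^esub> ract M x b"
    and ract_mult:
      "\<lbrakk>x \<in> carrier M; a \<in> carrier A; b \<in> carrier A\<rbrakk> \<Longrightarrow>
        ract M x (a \<otimes>\<^bsub>A\<^esub> b) = ract M (ract M x a) b"
    and ract_one: "x \<in> carrier M \<Longrightarrow> ract M x \<one>\<^bsub>A\<^esub> = x"
    and ract_smult_left:
      "\<lbrakk>k \<in> carrier K; x \<in> carrier M; a \<in> carrier A\<rbrakk> \<Longrightarrow>
        ract M (k \<odot>\<^bsub>M\<^esub> x) a = k \<odot>\<^bsub>M\<^esub> ract M x a"
    and ract_smult_right:
      "\<lbrakk>k \<in> carrier K; x \<in> carrier M; a \<in> carrier A\<rbrakk> \<Longrightarrow>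
        ract M x (k \<odot>\<^bsub>A\<^esub> a) = k \<odot>\<^bsub>M\<^esub> ract M x a"
begin

lemma linear_map_ract_left: "a \<in> carrier A \<Longrightarrow> linear_map K M M (\<lambda>x. ract M x a)"
  by (intro linear_mapI) (simp_all add: ract_add_left ract_smult_left)

lemma linear_map_ract_right: "x \<in> carrier M \<Longrightarrow> linear_map K A M (\<lambda>a. ract M x a)"
  by (intro linear_mapI) (simp_all add: ract_add_right ract_smult_right)

lemmas ract_minus_left =
  linear_map_minus[OF M.abelian_group_axioms M.abelian_group_axioms linear_map_ract_left]
lemmas ract_zero_left =
  linear_map_zero[OF M.abelian_group_axioms M.abelian_group_axioms linear_map_ract_left]
lemmas ract_zero_right =
  linear_map_zero[OF A.A.abelian_group_axioms M.abelian_group_axioms linear_map_ract_right]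

end

locale k_bimodule = k_rmodule K A M
  for K and A :: "('k, 'a, 's) module_scheme" and M :: "('k, 'a, 'm, 'x) bimodule_scheme" +
  assumes lact_closed [simp]: "\<lbrakk>x \<in> carrier M; a \<in> carrier A\<rbrakk> \<Longrightarrow> lact M a x \<in> carrier M"
    and lact_add_right:
      "\<lbrakk>x \<in> carrier M; y \<in> carrier M; a \<in> carrier A\<rbrakk> \<Longrightarrow>
        lact M a (x \<oplus>\<^bsub>M\<^esub> y) = lact M a x \<oplus>\<^bsub>M\<^esub> lact M a y"
    and lact_add_left:
      "\<lbrakk>x \<in> carrier M; a \<in> carrier A; b \<in> carrier A\<rbrakk> \<Longrightarrow>
        lact M (a \<oplus>\<^bsub>A\<^esub> b) x = lact M a x \<oplus>\<^bsub>M\<^esub> lact M b x"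
    and lact_mult:
      "\<lbrakk>x \<in> carrier M; a \<in> carrier A; b \<in> carrier A\<rbrakk> \<Longrightarrow>
        lact M (a \<otimes>\<^bsub>A\<^esub> b) x = lact M a (lact M b x)"
    and lact_one: "x \<in> carrier M \<Longrightarrow> lact M \<one>\<^bsub>A\<^esub> x = x"
    and lact_smult_right:
      "\<lbrakk>k \<in> carrier K; x \<in> carrier M; a \<in> carrier A\<rbrakk> \<Longrightarrow>
        lact M a (k \<odot>\<^bsub>M\<^esub> x) = k \<odot>\<^bsub>M\<^esub> lact M a x"
    and lact_smult_left:
      "\<lbrakk>k \<in> carrier K; x \<in> carrier M; a \<in> carrier A\<rbrakk> \<Longrightarrow>
        lact M (k \<odot>\<^bsub>A\<^esub> a) x = k \<odot>\<^bsub>M\<^esub> lact M a x"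
    and lact_ract:
      "\<lbrakk>x \<in> carrier M; a \<in> carrier A; b \<in> carrier A\<rbrakk> \<Longrightarrow>
        ract M (lact M a x) b = lact M a (ract M x b)"
begin

lemma linear_map_lact_right: "a \<in> carrier A \<Longrightarrow> linear_map K M M (lact M a)"
  by (intro linear_mapI) (simp_all add: lact_add_right lact_smult_right)

lemma linear_map_lact_left: "x \<in> carrier M \<Longrightarrow> linear_map K A M (\<lambda>a. lact M a x)"
  by (intro linear_mapI) (simp_all add: lact_add_left lact_smult_left)

lemmas lact_minus_right =
  linear_map_minus[OF M.abelian_group_axioms M.abelian_group_axioms linear_map_lact_right]
lemmas lact_zero_right =
  linear_map_zero[OF M.abelian_group_axioms M.abelian_group_axioms linear_map_lact_right]
lemmas lact_zero_left =
  linear_map_zero[OF A.A.abelian_group_axioms M.abelian_group_axioms linear_map_lact_left]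

end

text \<open>
  These are the Hochschild 1-cocycles, as functions on the algebra rather than on lists of length one
  (\<open>hoch_cocycles_1_iff\<close>).
\<close>

definition derivation :: "('k, 'r) ring_scheme \<Rightarrow> ('k, 'a, 's) module_scheme
    \<Rightarrow> ('k, 'a, 'm, 'x) bimodule_scheme \<Rightarrow> ('a \<Rightarrow> 'm) \<Rightarrow> bool" where
  "derivation K A M D \<longleftrightarrow> linear_map K A M D \<and>
     (\<forall>a\<in>carrier A. \<forall>b\<in>carrier A. D (a \<otimes>\<^bsub>A\<^esub> b) = lact M a (D b) \<oplus>\<^bsub>M\<^esub> ract M (D a) b)"

lemma derivationD:
  assumes "derivation K A M D"
  shows "linear_map K A M D"
    and "\<lbrakk>a \<in> carrier A; b \<in> carrier A\<rbrakk> \<Longrightarrow> D (a \<otimes>\<^bsub>A\<^esub> b) = lact M a (D b) \<oplus>\<^bsub>M\<^esub> ract M (D a) b"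
  using assms by (simp_all add: derivation_def)

lemma ideal_bimodule_simps [simp]:
  "carrier (ideal_bimodule A I) = I" "monoid.mult (ideal_bimodule A I) = monoid.mult A"
  "one (ideal_bimodule A I) = one A" "zero (ideal_bimodule A I) = zero A"
  "add (ideal_bimodule A I) = add A" "smult (ideal_bimodule A I) = smult A"
  "ract (ideal_bimodule A I) = monoid.mult A" "lact (ideal_bimodule A I) = monoid.mult A"
  by (simp_all add: ideal_bimodule_def)

lemma (in k_algebra) k_bimodule_ideal:
  assumes "submodule I K A"
    and "\<And>x a. \<lbrakk>x \<in> I; a \<in> carrier A\<rbrakk> \<Longrightarrow> x \<otimes>\<^bsub>A\<^esub> a \<in> I"
    and "\<And>x a. \<lbrakk>x \<in> I; a \<in> carrier A\<rbrakk> \<Longrightarrow> a \<otimes>\<^bsub>A\<^esub> x \<in> I"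
  shows "k_bimodule K A (ideal_bimodule A I)"
proof -
  have I: "x \<in> I \<Longrightarrow> x \<in> carrier A" for x
    using A.submoduleE(1)[OF assms(1)] by blast
  have "module K (ideal_bimodule A I)"
    by (rule module_of_submodule[OF A.module_axioms assms(1)]) simp_all
  then interpret M: module K "ideal_bimodule A I" .
  show ?thesis
    by unfold_locales
       (simp_all add: assms(2,3) I A.l_distr A.r_distr A.m_assoc smult_mult_left smult_mult_right)
qed

lemma (in k_algebra) k_bimodule_regular: "k_bimodule K A (regular_bimodule A)"
  by (rule k_bimodule_ideal[OF A.carrier_is_submodule]) simp_all

lemma (in k_bimodule) derivation_module_ops:
  shows derivation_add: "\<lbrakk>derivation K A M D; derivation K A M D'\<rbrakk> \<Longrightarrow> derivation K A M (\<lambda>a. D a \<oplus>\<^bsub>M\<^esub> D' a)"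
    and derivation_diff: "\<lbrakk>derivation K A M D; derivation K A M D'\<rbrakk> \<Longrightarrow> derivation K A M (\<lambda>a. D a \<ominus>\<^bsub>M\<^esub> D' a)"
    and derivation_smult: "\<lbrakk>derivation K A M D; k \<in> carrier K\<rbrakk> \<Longrightarrow> derivation K A M (\<lambda>a. k \<odot>\<^bsub>M\<^esub> D a)"
    and derivation_zero: "derivation K A M (\<lambda>a. \<zero>\<^bsub>M\<^esub>)"
proof -
  assume D: "derivation K A M D"
  have mem: "a \<in> carrier A \<Longrightarrow> D a \<in> carrier M" for a
    using derivationD(1)[OF D] by (rule linear_mapD)
  show "derivation K A M (\<lambda>a. k \<odot>\<^bsub>M\<^esub> D a)" if "k \<in> carrier K"
    using D that by (auto simp: derivation_def linear_map_smult[OF M.module_axioms] mem lact_smult_right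
        ract_smult_left M.smult_r_distr)
  assume D': "derivation K A M D'"
  have mem': "a \<in> carrier A \<Longrightarrow> D' a \<in> carrier M" for a
    using derivationD(1)[OF D'] by (rule linear_mapD)
  show "derivation K A M (\<lambda>a. D a \<oplus>\<^bsub>M\<^esub> D' a)"
    using D D' by (auto simp: derivation_def linear_map_add[OF M.module_axioms] mem mem' lact_add_right
        ract_add_left M.a_ac)
  show "derivation K A M (\<lambda>a. D a \<ominus>\<^bsub>M\<^esub> D' a)"
    unfolding derivation_def
  proof (intro conjI ballI)
    show "linear_map K A M (\<lambda>a. D a \<ominus>\<^bsub>M\<^esub> D' a)"
      by (intro linear_map_diff M.module_axioms derivationD(1)[OF D] derivationD(1)[OF D'])
    fix a b assume "a \<in> carrier A" "b \<in> carrier A"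
    then show "D (a \<otimes>\<^bsub>A\<^esub> b) \<ominus>\<^bsub>M\<^esub> D' (a \<otimes>\<^bsub>A\<^esub> b)
        = lact M a (D b \<ominus>\<^bsub>M\<^esub> D' b) \<oplus>\<^bsub>M\<^esub> ract M (D a \<ominus>\<^bsub>M\<^esub> D' a) b"
      by (simp only: derivationD(2)[OF D] derivationD(2)[OF D'] lact_minus_right ract_minus_left mem mem')
         (simp add: mem mem' a_minus_def M.minus_add M.a_ac)
  qed
next
  show "derivation K A M (\<lambda>a. \<zero>\<^bsub>M\<^esub>)"
    by (auto simp: derivation_def linear_map_zero_fun[OF M.module_axioms] lact_zero_right ract_zero_left)
qed

lemma (in k_bimodule) derivation_inner:
  assumes "m \<in> carrier M"
  shows "derivation K A M (\<lambda>a. lact M a m \<ominus>\<^bsub>M\<^esub> ract M m a)"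
  unfolding derivation_def
proof (intro conjI ballI)
  show "linear_map K A M (\<lambda>a. lact M a m \<ominus>\<^bsub>M\<^esub> ract M m a)"
    by (intro linear_map_diff M.module_axioms linear_map_lact_left linear_map_ract_right assms)
  fix a b assume ab: "a \<in> carrier A" "b \<in> carrier A"
  let ?l = "lact M (a \<otimes>\<^bsub>A\<^esub> b) m" and ?c = "lact M a (ract M m b)" and ?r = "ract M m (a \<otimes>\<^bsub>A\<^esub> b)"
  have "lact M a (lact M b m \<ominus>\<^bsub>M\<^esub> ract M m b) \<oplus>\<^bsub>M\<^esub> ract M (lact M a m \<ominus>\<^bsub>M\<^esub> ract M m a) b
      = (?l \<ominus>\<^bsub>M\<^esub> ?c) \<oplus>\<^bsub>M\<^esub> (?c \<ominus>\<^bsub>M\<^esub> ?r)"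
    using assms ab by (simp add: lact_minus_right ract_minus_left lact_mult ract_mult lact_ract)
  also have "\<dots> = ?l \<ominus>\<^bsub>M\<^esub> ?r"
    using assms ab by (simp add: a_minus_def M.a_assoc M.r_neg1)
  finally show "?l \<ominus>\<^bsub>M\<^esub> ?r
      = lact M a (lact M b m \<ominus>\<^bsub>M\<^esub> ract M m b) \<oplus>\<^bsub>M\<^esub> ract M (lact M a m \<ominus>\<^bsub>M\<^esub> ract M m a) b" ..
qed

lemma hoch_tuples_0: "hoch_tuples A 0 = {[]}"
  by (auto simp: hoch_tuples_def)

lemma hoch_tuples_1: "hoch_tuples A 1 = (\<lambda>a. [a]) ` carrier A"
  by (auto simp: hoch_tuples_def length_Suc_conv One_nat_def)

lemma hoch_tuples_2: "hoch_tuples A (Suc 1) = {[a, b] | a b. a \<in> carrier A \<and> b \<in> carrier A}"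
  by (auto simp: hoch_tuples_def length_Suc_conv One_nat_def)

lemma singleton_in_hoch_tuples [simp]: "[a] \<in> hoch_tuples A 1 \<longleftrightarrow> a \<in> carrier A"
  "[a] \<in> hoch_tuples A (Suc 0) \<longleftrightarrow> a \<in> carrier A"
  by (auto simp: hoch_tuples_def)

lemma fun_on_tuples_1_eqI:
  assumes "f \<in> extensional (hoch_tuples A 1)" "g \<in> extensional (hoch_tuples A 1)"
    and "\<And>a. a \<in> carrier A \<Longrightarrow> f [a] = g [a]"
  shows "f = g"
  using assms by (intro extensionalityI) (auto simp: hoch_tuples_1)

context k_bimodule
begin

lemma hoch_cocycles_0_iff:
  "f \<in> hoch_cocycles K A M 0 \<longleftrightarrow> f \<in> hoch_tuples A 0 \<rightarrow>\<^sub>E carrier M \<and>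
     (\<forall>a\<in>carrier A. lact M a (f []) = ract M (f []) a)"
proof -
  have "hoch_diff A M 0 f [a] = lact M a (f []) \<ominus>\<^bsub>M\<^esub> ract M (f []) a"
    if "a \<in> carrier A" "f [] \<in> carrier M" for a
    using that by (simp add: hoch_diff_def signed_def a_minus_def)
  moreover have "f [] \<in> carrier M" if "f \<in> hoch_tuples A 0 \<rightarrow>\<^sub>E carrier M"
    using that by (auto simp: hoch_tuples_0)
  ultimately show ?thesis
    using hoch_tuples_1[of A]
    by (auto simp: hoch_cocycles_def hoch_cochains_def One_nat_def diff_eq_zero_iff[OF M.abelian_group_axioms])
qed

lemma hoch_cochains_1_iff:
  "f \<in> hoch_cochains K A M 1 \<longleftrightarrow> f \<in> hoch_tuples A 1 \<rightarrow>\<^sub>E carrier M \<and> linear_map K A M (\<lambda>a. f [a])"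
  using A.A.a_closed by (auto simp: hoch_cochains_def linear_map_def hoch_tuples_1)

lemma hoch_diff_1:
  assumes "f \<in> hoch_tuples A 1 \<rightarrow>\<^sub>E carrier M" "a \<in> carrier A" "b \<in> carrier A"
  shows "hoch_diff A M 1 f [a, b] = (lact M a (f [b]) \<oplus>\<^bsub>M\<^esub> ract M (f [a]) b) \<ominus>\<^bsub>M\<^esub> f [a \<otimes>\<^bsub>A\<^esub> b]"
proof -
  have f: "x \<in> carrier A \<Longrightarrow> f [x] \<in> carrier M" for x
    using assms(1) by (auto simp: hoch_tuples_1)
  have "[a, b] \<in> hoch_tuples A (Suc 1)" using assms(2,3) by (simp add: hoch_tuples_def)
  then have "hoch_diff A M 1 f [a, b]
      = lact M a (f [b]) \<oplus>\<^bsub>M\<^esub> (\<ominus>\<^bsub>M\<^esub> f [a \<otimes>\<^bsub>A\<^esub> b]) \<oplus>\<^bsub>M\<^esub> ract M (f [a]) b"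
    using assms(2,3) f by (simp add: hoch_diff_def signed_def contract_def lessThan_Suc M.finsum_insert One_nat_def)
  then show ?thesis using assms(2,3) f by (simp add: a_minus_def M.a_ac)
qed

lemma hoch_cocycles_1_iff:
  "f \<in> hoch_cocycles K A M 1 \<longleftrightarrow> f \<in> hoch_tuples A 1 \<rightarrow>\<^sub>E carrier M \<and> derivation K A M (\<lambda>a. f [a])"
proof -
  have "hoch_diff A M 1 f [a, b] = \<zero>\<^bsub>M\<^esub> \<longleftrightarrow> f [a \<otimes>\<^bsub>A\<^esub> b] = lact M a (f [b]) \<oplus>\<^bsub>M\<^esub> ract M (f [a]) b"
    if f: "f \<in> hoch_tuples A 1 \<rightarrow>\<^sub>E carrier M" and ab: "a \<in> carrier A" "b \<in> carrier A" for a b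
  proof -
    have "x \<in> carrier A \<Longrightarrow> f [x] \<in> carrier M" for x
      using f by (auto simp: hoch_tuples_1)
    then show ?thesis
      unfolding hoch_diff_1[OF f ab] using ab
      by (auto simp: diff_eq_zero_iff[OF M.abelian_group_axioms])
  qed
  then show ?thesis
    unfolding hoch_cocycles_def mem_Collect_eq hoch_cochains_1_iff hoch_tuples_2 derivation_def
    by blast
qed

lemma hoch_coboundaries_0: "hoch_coboundaries K A M 0 = {\<lambda>xs\<in>hoch_tuples A 0. \<zero>\<^bsub>M\<^esub>}"
  by (simp add: hoch_coboundaries_def)

lemma hoch_coboundaries_1_iff:
  "f \<in> hoch_coboundaries K A M 1 \<longleftrightarrow> f \<in> extensional (hoch_tuples A 1) \<and>
     (\<exists>m\<in>carrier M. \<forall>a\<in>carrier A. f [a] = lact M a m \<ominus>\<^bsub>M\<^esub> ract M m a)"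
proof -
  have diff: "hoch_diff A M 0 g [a] = lact M a (g []) \<ominus>\<^bsub>M\<^esub> ract M (g []) a"
    if "a \<in> carrier A" "g [] \<in> carrier M" for a g
    using that by (simp add: hoch_diff_def signed_def a_minus_def)
  have ext: "hoch_diff A M 0 g \<in> extensional (hoch_tuples A 1)" for g
    by (simp add: hoch_diff_def One_nat_def)
  have cochains: "g \<in> hoch_cochains K A M 0 \<longleftrightarrow> g \<in> hoch_tuples A 0 \<rightarrow>\<^sub>E carrier M" for g
    by (simp add: hoch_cochains_def)
  have eq: "hoch_coboundaries K A M 1 = hoch_diff A M 0 ` hoch_cochains K A M 0"
    by (simp add: hoch_coboundaries_def One_nat_def)
  show ?thesis
  proof
    assume "f \<in> hoch_coboundaries K A M 1"
    then obtain g where g: "g \<in> hoch_tuples A 0 \<rightarrow>\<^sub>E carrier M" "f = hoch_diff A M 0 g"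
      by (auto simp: eq cochains)
    then have "g [] \<in> carrier M" by (auto simp: hoch_tuples_0)
    with g diff ext show "f \<in> extensional (hoch_tuples A 1) \<and>
        (\<exists>m\<in>carrier M. \<forall>a\<in>carrier A. f [a] = lact M a m \<ominus>\<^bsub>M\<^esub> ract M m a)" by blast
  next
    assume f: "f \<in> extensional (hoch_tuples A 1) \<and>
        (\<exists>m\<in>carrier M. \<forall>a\<in>carrier A. f [a] = lact M a m \<ominus>\<^bsub>M\<^esub> ract M m a)"
    then obtain m where m: "m \<in> carrier M" "\<And>a. a \<in> carrier A \<Longrightarrow> f [a] = lact M a m \<ominus>\<^bsub>M\<^esub> ract M m a"
      by blast
    have "f = hoch_diff A M 0 (\<lambda>xs\<in>hoch_tuples A 0. m)"
      using f m by (intro fun_on_tuples_1_eqI[of _ A] ext) (simp_all add: diff hoch_tuples_0)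
    then show "f \<in> hoch_coboundaries K A M 1"
      unfolding eq using m(1) by (intro image_eqI) (auto simp: cochains)
  qed
qed

lemma quotient_space_hoch_0:
  "quotient_space K (hoch_cocycle_space K A M 0) (hoch_coboundaries K A M 0)"
proof (rule quotient_spaceI)
  show M: "module K (hoch_cocycle_space K A M 0)"
    by (rule module_fun_space[OF M.module_axioms])
      (auto simp: hoch_cocycles_0_iff hoch_tuples_0 lact_zero_right ract_zero_left lact_add_right
         ract_add_left lact_smult_right ract_smult_left PiE_iff extensional_def)
  show "submodule (hoch_coboundaries K A M 0) K (hoch_cocycle_space K A M 0)"
    by (rule submodule_of_closed[OF M])
      (auto simp: hoch_coboundaries_0 hoch_cocycles_0_iff hoch_tuples_0 lact_zero_right ract_zero_left)
qed

lemma module_hoch_cocycle_space_1: "module K (hoch_cocycle_space K A M 1)"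
proof (rule module_fun_space[OF M.module_axioms])
  have *: "linear_map K A M f \<Longrightarrow> a \<in> carrier A \<Longrightarrow> f a \<in> carrier M" for f a
    by (rule linear_mapD)
  have deriv_cong: "derivation K A M (\<lambda>a. (\<lambda>xs\<in>hoch_tuples A 1. F xs) [a]) \<longleftrightarrow> derivation K A M (\<lambda>a. F [a])"
    for F by (auto simp: derivation_def linear_map_def)
  show "hoch_cocycles K A M 1 \<subseteq> hoch_tuples A 1 \<rightarrow>\<^sub>E carrier M"
    by (auto simp: hoch_cocycles_1_iff)
  show "(\<lambda>xs\<in>hoch_tuples A 1. \<zero>\<^bsub>M\<^esub>) \<in> hoch_cocycles K A M 1"
    unfolding hoch_cocycles_1_iff deriv_cong by (simp add: derivation_zero)
  show "(\<lambda>xs\<in>hoch_tuples A 1. f xs \<oplus>\<^bsub>M\<^esub> g xs) \<in> hoch_cocycles K A M 1"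
    if "f \<in> hoch_cocycles K A M 1" "g \<in> hoch_cocycles K A M 1" for f g
    using that unfolding hoch_cocycles_1_iff deriv_cong by (auto simp: derivation_add PiE_iff)
  show "(\<lambda>xs\<in>hoch_tuples A 1. k \<odot>\<^bsub>M\<^esub> f xs) \<in> hoch_cocycles K A M 1"
    if "k \<in> carrier K" "f \<in> hoch_cocycles K A M 1" for k f
    using that unfolding hoch_cocycles_1_iff deriv_cong by (auto simp: derivation_smult PiE_iff)
qed

lemma quotient_space_hoch_1:
  "quotient_space K (hoch_cocycle_space K A M 1) (hoch_coboundaries K A M 1)"
proof (rule quotient_spaceI[OF module_hoch_cocycle_space_1])
  show "submodule (hoch_coboundaries K A M 1) K (hoch_cocycle_space K A M 1)"
  proof (rule submodule_of_closed[OF module_hoch_cocycle_space_1])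
    show "hoch_coboundaries K A M 1 \<subseteq> carrier (hoch_cocycle_space K A M 1)"
    proof
      fix f assume "f \<in> hoch_coboundaries K A M 1"
      then obtain m where f: "f \<in> extensional (hoch_tuples A 1)" and m: "m \<in> carrier M"
        "\<And>a. a \<in> carrier A \<Longrightarrow> f [a] = lact M a m \<ominus>\<^bsub>M\<^esub> ract M m a"
        by (auto simp: hoch_coboundaries_1_iff)
      have "derivation K A M (\<lambda>a. f [a])"
        using derivation_inner[OF m(1)] m(2) by (auto simp: derivation_def linear_map_def)
      with f m show "f \<in> carrier (hoch_cocycle_space K A M 1)"
        by (auto simp: hoch_cocycles_1_iff PiE_iff hoch_tuples_1)
    qed
    show "\<zero>\<^bsub>hoch_cocycle_space K A M 1\<^esub> \<in> hoch_coboundaries K A M 1"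
      by (auto simp: hoch_coboundaries_1_iff lact_zero_right ract_zero_left
          diff_eq_zero_iff[OF M.abelian_group_axioms, THEN iffD2]
          intro!: bexI[of _ "\<zero>\<^bsub>M\<^esub>"])
  next
    fix f g assume "f \<in> hoch_coboundaries K A M 1" "g \<in> hoch_coboundaries K A M 1"
    then obtain m n where "m \<in> carrier M" "n \<in> carrier M"
        "\<And>a. a \<in> carrier A \<Longrightarrow> f [a] = lact M a m \<ominus>\<^bsub>M\<^esub> ract M m a"
        "\<And>a. a \<in> carrier A \<Longrightarrow> g [a] = lact M a n \<ominus>\<^bsub>M\<^esub> ract M n a"
      by (auto simp: hoch_coboundaries_1_iff)
    then show "f \<oplus>\<^bsub>hoch_cocycle_space K A M 1\<^esub> g \<in> hoch_coboundaries K A M 1"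
      by (auto simp: hoch_coboundaries_1_iff lact_add_right ract_add_left a_minus_def M.minus_add M.a_ac
          intro!: bexI[of _ "m \<oplus>\<^bsub>M\<^esub> n"])
  next
    fix k f assume "k \<in> carrier K" "f \<in> hoch_coboundaries K A M 1"
    moreover then obtain m where "m \<in> carrier M"
        "\<And>a. a \<in> carrier A \<Longrightarrow> f [a] = lact M a m \<ominus>\<^bsub>M\<^esub> ract M m a"
      by (auto simp: hoch_coboundaries_1_iff)
    ultimately show "k \<odot>\<^bsub>hoch_cocycle_space K A M 1\<^esub> f \<in> hoch_coboundaries K A M 1"
      by (auto simp: hoch_coboundaries_1_iff lact_smult_right ract_smult_left a_minus_def
          M.smult_r_distr M.smult_r_minus intro!: bexI[of _ "k \<odot>\<^bsub>M\<^esub> m"])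
  qed
qed

end


section \<open>Hochschild cohomology of a split extension by a square-zero ideal\<close>

lemma regular_bimodule_minus [simp]: "x \<ominus>\<^bsub>regular_bimodule A\<^esub> y = x \<ominus>\<^bsub>A\<^esub> y"
  by (simp add: a_minus_def a_inv_def m_inv_def)

lemma E_space_iff:
  "\<theta> \<in> carrier (\<E>_space K M A) \<longleftrightarrow> \<theta> \<in> extensional (carrier M) \<and> linear_map K M A \<theta> \<and>
     (\<forall>x\<in>carrier M. \<forall>a\<in>carrier A. \<theta> (ract M x a) = \<theta> x \<otimes>\<^bsub>A\<^esub> a) \<and>
     (\<forall>x\<in>carrier M. \<forall>a\<in>carrier A. \<theta> (lact M a x) = a \<otimes>\<^bsub>A\<^esub> \<theta> x) \<and>
     (\<forall>x\<in>carrier M. \<forall>y\<in>carrier M. ract M x (\<theta> y) \<oplus>\<^bsub>M\<^esub> lact M (\<theta> x) y = \<zero>\<^bsub>M\<^esub>)"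
  by (auto simp: \<E>_space_def bimod_hom_def rhom_def lin_iff linear_map_def)

text \<open>
  \<open>R\<close> is a split extension of \<open>A\<close> by the square-zero ideal \<open>ker p\<close>, which \<open>j\<close> identifies with \<open>M\<close>. Up to
  isomorphism \<open>R\<close> is \<open>A \<ltimes> M\<close>, but the presentation by \<open>p\<close>, \<open>q\<close> and \<open>j\<close> covers at the same time \<open>C \<ltimes> E'\<close> over
  \<open>C\<close> and \<open>C \<ltimes> E\<close> over \<open>C \<ltimes> E'\<close>; the elements of the latter are not of the form \<open>((c, e'), e'')\<close>.
\<close>

locale split_square_zero = A: k_algebra K A + R: k_algebra K R + M: module K M
  for K and A :: "('k, 'a, 's) module_scheme" and R :: "('k, 'b, 't) module_scheme"
    and M :: "('k, 'a, 'm, 'x) bimodule_scheme" +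
  fixes p :: "'b \<Rightarrow> 'a" and q :: "'a \<Rightarrow> 'b" and j :: "'m \<Rightarrow> 'b"
  assumes p_linear: "linear_map K R A p"
    and p_mult: "\<lbrakk>r \<in> carrier R; s \<in> carrier R\<rbrakk> \<Longrightarrow> p (r \<otimes>\<^bsub>R\<^esub> s) = p r \<otimes>\<^bsub>A\<^esub> p s"
    and q_linear: "linear_map K A R q"
    and q_mult: "\<lbrakk>a \<in> carrier A; b \<in> carrier A\<rbrakk> \<Longrightarrow> q (a \<otimes>\<^bsub>A\<^esub> b) = q a \<otimes>\<^bsub>R\<^esub> q b"
    and p_q: "a \<in> carrier A \<Longrightarrow> p (q a) = a"
    and j_linear: "linear_map K M R j"
    and j_inj: "inj_on j (carrier M)"
    and j_image: "j ` carrier M = {r \<in> carrier R. p r = \<zero>\<^bsub>A\<^esub>}"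
    and lact_closed: "\<lbrakk>a \<in> carrier A; x \<in> carrier M\<rbrakk> \<Longrightarrow> lact M a x \<in> carrier M"
    and ract_closed: "\<lbrakk>a \<in> carrier A; x \<in> carrier M\<rbrakk> \<Longrightarrow> ract M x a \<in> carrier M"
    and j_lact: "\<lbrakk>a \<in> carrier A; x \<in> carrier M\<rbrakk> \<Longrightarrow> j (lact M a x) = q a \<otimes>\<^bsub>R\<^esub> j x"
    and j_ract: "\<lbrakk>a \<in> carrier A; x \<in> carrier M\<rbrakk> \<Longrightarrow> j (ract M x a) = j x \<otimes>\<^bsub>R\<^esub> q a"
    and j_square_zero: "\<lbrakk>x \<in> carrier M; y \<in> carrier M\<rbrakk> \<Longrightarrow> j x \<otimes>\<^bsub>R\<^esub> j y = \<zero>\<^bsub>R\<^esub>"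
begin

abbreviation I where "I \<equiv> j ` carrier M"

lemma p_closed [simp]: "r \<in> carrier R \<Longrightarrow> p r \<in> carrier A" using p_linear by (rule linear_mapD)
lemma q_closed [simp]: "a \<in> carrier A \<Longrightarrow> q a \<in> carrier R" using q_linear by (rule linear_mapD)
lemma j_closed [simp]: "x \<in> carrier M \<Longrightarrow> j x \<in> carrier R" using j_linear by (rule linear_mapD)
lemma p_j [simp]: "x \<in> carrier M \<Longrightarrow> p (j x) = \<zero>\<^bsub>A\<^esub>" using j_image by blast

lemmas p_add = linear_mapD(2)[OF p_linear]
lemmas q_add = linear_mapD(2)[OF q_linear]
lemmas p_minus = linear_map_minus[OF R.A.abelian_group_axioms A.A.abelian_group_axioms p_linear]
lemmas q_zero = linear_map_zero[OF A.A.abelian_group_axioms R.A.abelian_group_axioms q_linear]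
lemmas j_zero = linear_map_zero[OF M.abelian_group_axioms R.A.abelian_group_axioms j_linear]

lemma j_eq_iff: "\<lbrakk>x \<in> carrier M; y \<in> carrier M\<rbrakk> \<Longrightarrow> j x = j y \<longleftrightarrow> x = y"
  using j_inj by (auto dest: inj_onD)

text \<open>
  The second coordinate in the decomposition \<open>R = q A \<oplus> j M\<close> (lemma \<open>decomposition\<close> below).
\<close>

definition ideal_part where "ideal_part r = inv_into (carrier M) j (r \<ominus>\<^bsub>R\<^esub> q (p r))"

lemma ideal_part_closed [simp]: "r \<in> carrier R \<Longrightarrow> ideal_part r \<in> carrier M"
  and j_ideal_part: "r \<in> carrier R \<Longrightarrow> j (ideal_part r) = r \<ominus>\<^bsub>R\<^esub> q (p r)"
proof -
  assume r: "r \<in> carrier R"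
  then have "p (r \<ominus>\<^bsub>R\<^esub> q (p r)) = \<zero>\<^bsub>A\<^esub>"
    by (simp add: p_minus p_q diff_eq_zero_iff[OF A.A.abelian_group_axioms])
  with r have *: "r \<ominus>\<^bsub>R\<^esub> q (p r) \<in> I" unfolding j_image by simp
  show "ideal_part r \<in> carrier M" unfolding ideal_part_def by (rule inv_into_into[OF *])
  show "j (ideal_part r) = r \<ominus>\<^bsub>R\<^esub> q (p r)" unfolding ideal_part_def by (rule f_inv_into_f[OF *])
qed

lemma ideal_part_eqI: "\<lbrakk>a \<in> carrier A; x \<in> carrier M; r = q a \<oplus>\<^bsub>R\<^esub> j x\<rbrakk> \<Longrightarrow> ideal_part r = x"
proof -
  assume *: "a \<in> carrier A" "x \<in> carrier M" "r = q a \<oplus>\<^bsub>R\<^esub> j x"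
  then have r: "r \<in> carrier R" by simp
  have "p r = a" using * by (simp add: p_add p_q)
  then have "j (ideal_part r) = (q a \<oplus>\<^bsub>R\<^esub> j x) \<ominus>\<^bsub>R\<^esub> q a" using * r by (simp add: j_ideal_part)
  also have "\<dots> = j x"
    using * by (simp add: a_minus_def R.A.a_comm[of "q a"] R.A.a_assoc R.A.r_neg)
  finally show "ideal_part r = x" using * r by (simp add: j_eq_iff)
qed

lemma decomposition: "r \<in> carrier R \<Longrightarrow> r = q (p r) \<oplus>\<^bsub>R\<^esub> j (ideal_part r)"
  by (simp add: j_ideal_part a_minus_def R.A.a_lcomm R.A.r_neg)

lemma ideal_part_j: "x \<in> carrier M \<Longrightarrow> ideal_part (j x) = x"
  by (rule ideal_part_eqI[of "\<zero>\<^bsub>A\<^esub>"]) (simp_all add: q_zero)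

lemma ideal_part_q: "a \<in> carrier A \<Longrightarrow> ideal_part (q a) = \<zero>\<^bsub>M\<^esub>"
  by (rule ideal_part_eqI[of a]) (simp_all add: j_zero)

lemma ideal_part_linear: "linear_map K R M ideal_part"
proof (rule linear_mapI)
  fix r s assume rs: "r \<in> carrier R" "s \<in> carrier R"
  have "r \<oplus>\<^bsub>R\<^esub> s = (q (p r) \<oplus>\<^bsub>R\<^esub> j (ideal_part r)) \<oplus>\<^bsub>R\<^esub> (q (p s) \<oplus>\<^bsub>R\<^esub> j (ideal_part s))"
    using rs decomposition by simp
  also have "\<dots> = q (p r \<oplus>\<^bsub>A\<^esub> p s) \<oplus>\<^bsub>R\<^esub> j (ideal_part r \<oplus>\<^bsub>M\<^esub> ideal_part s)"
    using rs by (simp add: q_add linear_mapD(2)[OF j_linear] R.A.a_ac)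
  finally show "ideal_part (r \<oplus>\<^bsub>R\<^esub> s) = ideal_part r \<oplus>\<^bsub>M\<^esub> ideal_part s"
    using rs by (intro ideal_part_eqI[of "p r \<oplus>\<^bsub>A\<^esub> p s"]) simp_all
next
  fix k r assume kr: "k \<in> carrier K" "r \<in> carrier R"
  have "k \<odot>\<^bsub>R\<^esub> r = k \<odot>\<^bsub>R\<^esub> (q (p r) \<oplus>\<^bsub>R\<^esub> j (ideal_part r))"
    using kr decomposition by simp
  also have "\<dots> = q (k \<odot>\<^bsub>A\<^esub> p r) \<oplus>\<^bsub>R\<^esub> j (k \<odot>\<^bsub>M\<^esub> ideal_part r)"
    using kr by (simp add: R.A.smult_r_distr linear_mapD(3)[OF q_linear] linear_mapD(3)[OF j_linear])
  finally show "ideal_part (k \<odot>\<^bsub>R\<^esub> r) = k \<odot>\<^bsub>M\<^esub> ideal_part r"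
    using kr by (intro ideal_part_eqI[of "k \<odot>\<^bsub>A\<^esub> p r"]) simp_all
qed simp

lemma product_decomposition:
  assumes "a \<in> carrier A" "b \<in> carrier A" "x \<in> carrier M" "y \<in> carrier M"
  shows "(q a \<oplus>\<^bsub>R\<^esub> j x) \<otimes>\<^bsub>R\<^esub> (q b \<oplus>\<^bsub>R\<^esub> j y) = q (a \<otimes>\<^bsub>A\<^esub> b) \<oplus>\<^bsub>R\<^esub> j (lact M a y \<oplus>\<^bsub>M\<^esub> ract M x b)"
  using assms by (simp add: R.A.l_distr R.A.r_distr j_square_zero q_mult lact_closed ract_closed
      linear_mapD(2)[OF j_linear] j_lact j_ract R.A.a_ac)

lemma submodule_I: "submodule I K R"
proof (rule submodule_of_closed[OF R.A.module_axioms])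
  show "I \<subseteq> carrier R" by auto
  show "\<zero>\<^bsub>R\<^esub> \<in> I" by (rule image_eqI[of _ _ "\<zero>\<^bsub>M\<^esub>"]) (simp_all add: j_zero)
  show "r \<oplus>\<^bsub>R\<^esub> s \<in> I" if "r \<in> I" "s \<in> I" for r s
    using that unfolding j_image by (simp add: p_add)
  show "k \<odot>\<^bsub>R\<^esub> r \<in> I" if "k \<in> carrier K" "r \<in> I" for k r
    using that unfolding j_image by (simp add: linear_mapD(3)[OF p_linear])
qed

sublocale I: k_bimodule K R "ideal_bimodule R I"
  by (rule R.k_bimodule_ideal[OF submodule_I]) (auto simp: j_image p_mult)

sublocale RR: k_bimodule K R "regular_bimodule R"
  by (rule R.k_bimodule_regular)

sublocale AA: k_bimodule K A "regular_bimodule A"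
  by (rule A.k_bimodule_regular)

text \<open>
  Extended by \<open>0\<close> to \<open>q A\<close>, a bimodule morphism \<open>\<theta> : M \<rightarrow> A\<close> satisfies the Leibniz rule on \<open>q A\<close> and on mixed
  products. On a product of two elements of \<open>M\<close>, which is \<open>0\<close>, the rule says \<open>x \<theta>(y) + \<theta>(x) y = 0\<close>.
\<close>

lemma E_space_derivation:
  assumes "\<theta> \<in> carrier (\<E>_space K M A)"
  shows "derivation K R (regular_bimodule R) (\<lambda>r. q (\<theta> (ideal_part r)))"
proof -
  from assms have \<theta>: "linear_map K M A \<theta>"
    and ract: "\<And>x a. \<lbrakk>x \<in> carrier M; a \<in> carrier A\<rbrakk> \<Longrightarrow> \<theta> (ract M x a) = \<theta> x \<otimes>\<^bsub>A\<^esub> a"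
    and lact: "\<And>x a. \<lbrakk>x \<in> carrier M; a \<in> carrier A\<rbrakk> \<Longrightarrow> \<theta> (lact M a x) = a \<otimes>\<^bsub>A\<^esub> \<theta> x"
    and zero: "\<And>x y. \<lbrakk>x \<in> carrier M; y \<in> carrier M\<rbrakk> \<Longrightarrow> ract M x (\<theta> y) \<oplus>\<^bsub>M\<^esub> lact M (\<theta> x) y = \<zero>\<^bsub>M\<^esub>"
    by (auto simp: E_space_iff)
  have \<theta>_mem: "x \<in> carrier M \<Longrightarrow> \<theta> x \<in> carrier A" for x using \<theta> by (rule linear_mapD)
  show ?thesis
    unfolding derivation_def
  proof (intro conjI ballI)
    show "linear_map K R (regular_bimodule R) (\<lambda>r. q (\<theta> (ideal_part r)))"
      using linear_map_comp[OF linear_map_comp[OF ideal_part_linear \<theta>] q_linear] by (simp add: linear_map_def)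
    fix r s assume rs: "r \<in> carrier R" "s \<in> carrier R"
    let ?a = "p r" and ?b = "p s" and ?x = "ideal_part r" and ?y = "ideal_part s"
    have j0: "j ?x \<otimes>\<^bsub>R\<^esub> q (\<theta> ?y) \<oplus>\<^bsub>R\<^esub> q (\<theta> ?x) \<otimes>\<^bsub>R\<^esub> j ?y = \<zero>\<^bsub>R\<^esub>"
      using rs arg_cong[OF zero[of ?x ?y], of j]
      by (simp add: linear_mapD(2)[OF j_linear] j_lact j_ract lact_closed ract_closed \<theta>_mem j_zero)
    have "r \<otimes>\<^bsub>R\<^esub> s = q (?a \<otimes>\<^bsub>A\<^esub> ?b) \<oplus>\<^bsub>R\<^esub> j (lact M ?a ?y \<oplus>\<^bsub>M\<^esub> ract M ?x ?b)"
      using rs product_decomposition[of ?a ?b ?x ?y] decomposition[of r] decomposition[of s] by simp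
    then have "ideal_part (r \<otimes>\<^bsub>R\<^esub> s) = lact M ?a ?y \<oplus>\<^bsub>M\<^esub> ract M ?x ?b"
      using rs by (intro ideal_part_eqI[of "?a \<otimes>\<^bsub>A\<^esub> ?b"]) (simp_all add: lact_closed ract_closed)
    then have "q (\<theta> (ideal_part (r \<otimes>\<^bsub>R\<^esub> s))) = q ?a \<otimes>\<^bsub>R\<^esub> q (\<theta> ?y) \<oplus>\<^bsub>R\<^esub> q (\<theta> ?x) \<otimes>\<^bsub>R\<^esub> q ?b"
      using rs by (simp add: linear_mapD(2)[OF \<theta>] lact_closed ract_closed lact ract q_add q_mult \<theta>_mem)
    also have "\<dots> = (q ?a \<otimes>\<^bsub>R\<^esub> q (\<theta> ?y) \<oplus>\<^bsub>R\<^esub> q (\<theta> ?x) \<otimes>\<^bsub>R\<^esub> q ?b)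
        \<oplus>\<^bsub>R\<^esub> (j ?x \<otimes>\<^bsub>R\<^esub> q (\<theta> ?y) \<oplus>\<^bsub>R\<^esub> q (\<theta> ?x) \<otimes>\<^bsub>R\<^esub> j ?y)"
      using rs by (simp add: j0 \<theta>_mem)
    also have "\<dots> = (q ?a \<oplus>\<^bsub>R\<^esub> j ?x) \<otimes>\<^bsub>R\<^esub> q (\<theta> ?y) \<oplus>\<^bsub>R\<^esub> q (\<theta> ?x) \<otimes>\<^bsub>R\<^esub> (q ?b \<oplus>\<^bsub>R\<^esub> j ?y)"
      using rs by (simp add: \<theta>_mem R.A.l_distr R.A.r_distr R.A.a_ac)
    finally show "q (\<theta> (ideal_part (r \<otimes>\<^bsub>R\<^esub> s))) = lact (regular_bimodule R) r (q (\<theta> (ideal_part s)))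
        \<oplus>\<^bsub>regular_bimodule R\<^esub> ract (regular_bimodule R) (q (\<theta> (ideal_part r))) s"
      using rs decomposition by simp
  qed
qed

text \<open>
  Conversely, the relation \<open>x \<theta>(y) + \<theta>(x) y = 0\<close> is the Leibniz rule for \<open>j x \<cdot> j y = 0\<close>, and linearity
  of \<open>\<theta>\<close> over \<open>A\<close> is the one for the products with elements of \<open>q A\<close>, whose derivatives lie in the
  square-zero ideal.
\<close>

lemma derivation_E_space:
  assumes D: "derivation K R (regular_bimodule R) D" and zero: "\<And>a. a \<in> carrier A \<Longrightarrow> p (D (q a)) = \<zero>\<^bsub>A\<^esub>"
  shows "(\<lambda>x\<in>carrier M. p (D (j x))) \<in> carrier (\<E>_space K M A)"
proof -
  from D have D_linear: "linear_map K R R D" by (simp add: derivation_def linear_map_def)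
  have D_mem [simp]: "r \<in> carrier R \<Longrightarrow> D r \<in> carrier R" for r using D_linear by (rule linear_mapD)
  have D_mult: "D (r \<otimes>\<^bsub>R\<^esub> s) = r \<otimes>\<^bsub>R\<^esub> D s \<oplus>\<^bsub>R\<^esub> D r \<otimes>\<^bsub>R\<^esub> s" if "r \<in> carrier R" "s \<in> carrier R" for r s
    using derivationD(2)[OF D that] by simp
  have lin: "linear_map K M A (\<lambda>x. p (D (j x)))"
    by (rule linear_map_comp[OF linear_map_comp[OF j_linear D_linear] p_linear])
  have "linear_map K M A (\<lambda>x\<in>carrier M. p (D (j x)))"
    using linear_map_cong[OF M.module_axioms, of "\<lambda>x\<in>carrier M. p (D (j x))" "\<lambda>x. p (D (j x))" A] lin by simp
  moreover have "ract M x (p (D (j y))) \<oplus>\<^bsub>M\<^esub> lact M (p (D (j x))) y = \<zero>\<^bsub>M\<^esub>"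
    if xy: "x \<in> carrier M" "y \<in> carrier M" for x y
  proof -
    have *: "j z \<otimes>\<^bsub>R\<^esub> r = j z \<otimes>\<^bsub>R\<^esub> q (p r)" "r \<otimes>\<^bsub>R\<^esub> j z = q (p r) \<otimes>\<^bsub>R\<^esub> j z"
      if "z \<in> carrier M" "r \<in> carrier R" for z r
    proof -
      have "j z \<otimes>\<^bsub>R\<^esub> (q (p r) \<oplus>\<^bsub>R\<^esub> j (ideal_part r)) = j z \<otimes>\<^bsub>R\<^esub> q (p r)"
        using that by (simp add: R.A.r_distr j_square_zero)
      then show "j z \<otimes>\<^bsub>R\<^esub> r = j z \<otimes>\<^bsub>R\<^esub> q (p r)" using that decomposition by simp
      have "(q (p r) \<oplus>\<^bsub>R\<^esub> j (ideal_part r)) \<otimes>\<^bsub>R\<^esub> j z = q (p r) \<otimes>\<^bsub>R\<^esub> j z"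
        using that by (simp add: R.A.l_distr j_square_zero)
      then show "r \<otimes>\<^bsub>R\<^esub> j z = q (p r) \<otimes>\<^bsub>R\<^esub> j z" using that decomposition by simp
    qed
    have "j (ract M x (p (D (j y))) \<oplus>\<^bsub>M\<^esub> lact M (p (D (j x))) y)
        = j x \<otimes>\<^bsub>R\<^esub> q (p (D (j y))) \<oplus>\<^bsub>R\<^esub> q (p (D (j x))) \<otimes>\<^bsub>R\<^esub> j y"
      using xy by (simp add: linear_mapD(2)[OF j_linear] lact_closed ract_closed j_lact j_ract)
    also have "\<dots> = D (j x \<otimes>\<^bsub>R\<^esub> j y)"
      using xy by (simp add: D_mult *[symmetric])
    also have "\<dots> = j \<zero>\<^bsub>M\<^esub>"
      using xy by (simp add: j_square_zero j_zero
          linear_map_zero[OF R.A.abelian_group_axioms R.A.abelian_group_axioms D_linear])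
    finally show ?thesis using xy by (simp add: j_eq_iff lact_closed ract_closed)
  qed
  ultimately show ?thesis
    by (auto simp: E_space_iff lact_closed ract_closed j_lact j_ract D_mult p_add p_mult zero p_q)
qed

text \<open>
  The relation that defines \<open>\<E>(M, A)\<close> is linear in \<open>\<theta>\<close>. This is read off after application of the
  injective map \<open>j\<close>, which turns the actions on \<open>M\<close> into products of \<open>R\<close>.
\<close>

lemma module_E_space: "module K (\<E>_space K M A)"
proof -
  let ?F = "carrier (\<E>_space K M A)"
  have eq: "\<E>_space K M A = fun_space (carrier M) A ?F"
    by (simp add: \<E>_space_def)
  have linear_restrict: "linear_map K M A (\<lambda>x\<in>carrier M. f x) \<longleftrightarrow> linear_map K M A f" for f
    by (rule linear_map_cong[OF M.module_axioms]) simp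
  have lin: "linear_map K M A f" if "f \<in> ?F" for f using that by (simp add: E_space_iff)
  have mem: "f x \<in> carrier A" if "f \<in> ?F" "x \<in> carrier M" for f x
    using linear_mapD(1)[OF lin[OF that(1)] that(2)] .
  have rel: "ract M x (f y) \<oplus>\<^bsub>M\<^esub> lact M (f x) y = \<zero>\<^bsub>M\<^esub> \<longleftrightarrow>
      j x \<otimes>\<^bsub>R\<^esub> q (f y) \<oplus>\<^bsub>R\<^esub> q (f x) \<otimes>\<^bsub>R\<^esub> j y = \<zero>\<^bsub>R\<^esub>"
    if "x \<in> carrier M" "y \<in> carrier M" "f x \<in> carrier A" "f y \<in> carrier A" for f x y
    using that by (simp add: j_eq_iff[symmetric] linear_mapD(2)[OF j_linear] lact_closed ract_closed
        j_lact j_ract j_zero)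
  have relD: "j x \<otimes>\<^bsub>R\<^esub> q (f y) \<oplus>\<^bsub>R\<^esub> q (f x) \<otimes>\<^bsub>R\<^esub> j y = \<zero>\<^bsub>R\<^esub>"
    if "f \<in> ?F" "x \<in> carrier M" "y \<in> carrier M" for f x y
    using that rel[of x y f] mem[of f] by (simp add: E_space_iff)
  have EI: "(\<lambda>x\<in>carrier M. f x) \<in> ?F" if "linear_map K M A f"
      "\<And>x a. \<lbrakk>x \<in> carrier M; a \<in> carrier A\<rbrakk> \<Longrightarrow> f (ract M x a) = f x \<otimes>\<^bsub>A\<^esub> a"
      "\<And>x a. \<lbrakk>x \<in> carrier M; a \<in> carrier A\<rbrakk> \<Longrightarrow> f (lact M a x) = a \<otimes>\<^bsub>A\<^esub> f x"
      "\<And>x y. \<lbrakk>x \<in> carrier M; y \<in> carrier M\<rbrakk> \<Longrightarrow> j x \<otimes>\<^bsub>R\<^esub> q (f y) \<oplus>\<^bsub>R\<^esub> q (f x) \<otimes>\<^bsub>R\<^esub> j y = \<zero>\<^bsub>R\<^esub>" for f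
    using that rel[of _ _ f] linear_mapD(1)[OF that(1)]
    by (simp add: E_space_iff linear_restrict lact_closed ract_closed)
  have "module K (fun_space (carrier M) A ?F)"
  proof (rule module_fun_space[OF A.A.module_axioms])
    show "?F \<subseteq> carrier M \<rightarrow>\<^sub>E carrier A"
    proof
      fix f assume f: "f \<in> ?F"
      then have "f \<in> extensional (carrier M)" by (simp add: E_space_iff)
      with mem[OF f] show "f \<in> carrier M \<rightarrow>\<^sub>E carrier A" by (simp add: PiE_iff)
    qed
    show "(\<lambda>x\<in>carrier M. \<zero>\<^bsub>A\<^esub>) \<in> ?F"
      by (rule EI) (simp_all add: linear_map_zero_fun[OF A.A.module_axioms] q_zero)
  next
    fix f g assume fg: "f \<in> ?F" "g \<in> ?F"
    show "(\<lambda>x\<in>carrier M. f x \<oplus>\<^bsub>A\<^esub> g x) \<in> ?F"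
    proof (rule EI)
      show "linear_map K M A (\<lambda>x. f x \<oplus>\<^bsub>A\<^esub> g x)"
        by (rule linear_map_add[OF A.A.module_axioms lin[OF fg(1)] lin[OF fg(2)]])
      fix x assume x: "x \<in> carrier M"
      show "f (ract M x a) \<oplus>\<^bsub>A\<^esub> g (ract M x a) = (f x \<oplus>\<^bsub>A\<^esub> g x) \<otimes>\<^bsub>A\<^esub> a" if "a \<in> carrier A" for a
        using fg x that mem by (simp add: E_space_iff A.A.l_distr)
      show "f (lact M a x) \<oplus>\<^bsub>A\<^esub> g (lact M a x) = a \<otimes>\<^bsub>A\<^esub> (f x \<oplus>\<^bsub>A\<^esub> g x)" if "a \<in> carrier A" for a
        using fg x that mem by (simp add: E_space_iff A.A.r_distr)
      fix y assume y: "y \<in> carrier M"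
      have "j x \<otimes>\<^bsub>R\<^esub> q (f y \<oplus>\<^bsub>A\<^esub> g y) \<oplus>\<^bsub>R\<^esub> q (f x \<oplus>\<^bsub>A\<^esub> g x) \<otimes>\<^bsub>R\<^esub> j y
        = (j x \<otimes>\<^bsub>R\<^esub> q (f y) \<oplus>\<^bsub>R\<^esub> q (f x) \<otimes>\<^bsub>R\<^esub> j y) \<oplus>\<^bsub>R\<^esub> (j x \<otimes>\<^bsub>R\<^esub> q (g y) \<oplus>\<^bsub>R\<^esub> q (g x) \<otimes>\<^bsub>R\<^esub> j y)"
        using fg x y by (simp add: mem q_add R.A.l_distr R.A.r_distr R.A.a_ac)
      then show "j x \<otimes>\<^bsub>R\<^esub> q (f y \<oplus>\<^bsub>A\<^esub> g y) \<oplus>\<^bsub>R\<^esub> q (f x \<oplus>\<^bsub>A\<^esub> g x) \<otimes>\<^bsub>R\<^esub> j y = \<zero>\<^bsub>R\<^esub>"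
        using fg x y by (simp add: relD)
    qed
  next
    fix k f assume kf: "k \<in> carrier K" "f \<in> ?F"
    show "(\<lambda>x\<in>carrier M. k \<odot>\<^bsub>A\<^esub> f x) \<in> ?F"
    proof (rule EI)
      show "linear_map K M A (\<lambda>x. k \<odot>\<^bsub>A\<^esub> f x)"
        by (rule linear_map_smult[OF A.A.module_axioms lin[OF kf(2)] kf(1)])
      fix x assume x: "x \<in> carrier M"
      show "k \<odot>\<^bsub>A\<^esub> f (ract M x a) = (k \<odot>\<^bsub>A\<^esub> f x) \<otimes>\<^bsub>A\<^esub> a" if "a \<in> carrier A" for a
        using kf x that mem by (simp add: E_space_iff A.smult_mult_left)
      show "k \<odot>\<^bsub>A\<^esub> f (lact M a x) = a \<otimes>\<^bsub>A\<^esub> (k \<odot>\<^bsub>A\<^esub> f x)" if "a \<in> carrier A" for a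
        using kf x that mem by (simp add: E_space_iff A.smult_mult_right)
      fix y assume y: "y \<in> carrier M"
      have "j x \<otimes>\<^bsub>R\<^esub> q (k \<odot>\<^bsub>A\<^esub> f y) \<oplus>\<^bsub>R\<^esub> q (k \<odot>\<^bsub>A\<^esub> f x) \<otimes>\<^bsub>R\<^esub> j y
        = k \<odot>\<^bsub>R\<^esub> (j x \<otimes>\<^bsub>R\<^esub> q (f y) \<oplus>\<^bsub>R\<^esub> q (f x) \<otimes>\<^bsub>R\<^esub> j y)"
        using kf x y by (simp add: mem linear_mapD(3)[OF q_linear] R.smult_mult_left R.smult_mult_right
            R.A.smult_r_distr)
      then show "j x \<otimes>\<^bsub>R\<^esub> q (k \<odot>\<^bsub>A\<^esub> f y) \<oplus>\<^bsub>R\<^esub> q (k \<odot>\<^bsub>A\<^esub> f x) \<otimes>\<^bsub>R\<^esub> j y = \<zero>\<^bsub>R\<^esub>"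
        using kf x y by (simp add: relD)
    qed
  qed
  then show ?thesis using eq by simp
qed


abbreviation coefficients where "coefficients \<equiv> ideal_bimodule R I"

text \<open>
  In degree \<open>0\<close> a cocycle is a central element. The hypothesis \<open>central\<close> provides the preimage \<open>q z\<close> of a
  central \<open>z\<close>.
\<close>

theorem short_exact_degree_0:
  assumes central: "\<And>z r. \<lbrakk>z \<in> carrier A; \<And>a. a \<in> carrier A \<Longrightarrow> a \<otimes>\<^bsub>A\<^esub> z = z \<otimes>\<^bsub>A\<^esub> a; r \<in> carrier R\<rbrakk>
    \<Longrightarrow> r \<otimes>\<^bsub>R\<^esub> q z = q z \<otimes>\<^bsub>R\<^esub> r"
  shows "\<exists>\<iota>. short_exact K (hoch_cohomology K R coefficients 0) (HH K R 0) (HH K A 0) \<iota>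
           (hoch_projection K R A p q 0)"
proof -
  let ?ZI = "hoch_cocycle_space K R coefficients 0"
  let ?ZR = "hoch_cocycle_space K R (regular_bimodule R) 0"
  let ?ZA = "hoch_cocycle_space K A (regular_bimodule A) 0"
  let ?BR = "hoch_coboundaries K R (regular_bimodule R) 0"
  let ?BA = "hoch_coboundaries K A (regular_bimodule A) 0"
  interpret QI: quotient_space K ?ZI "hoch_coboundaries K R coefficients 0"
    by (rule I.quotient_space_hoch_0)
  interpret QR: quotient_space K ?ZR
      ?BR
    by (rule RR.quotient_space_hoch_0)
  have *: "hoch_cocycles K R coefficients 0
      = {f \<in> hoch_cocycles K R (regular_bimodule R) 0. f [] \<in> I}"
    by (auto simp: I.hoch_cocycles_0_iff RR.hoch_cocycles_0_iff hoch_tuples_0 PiE_iff)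
  have zR: "f [] \<in> carrier R \<and> (\<forall>r\<in>carrier R. r \<otimes>\<^bsub>R\<^esub> f [] = f [] \<otimes>\<^bsub>R\<^esub> r)"
    if "f \<in> hoch_cocycles K R (regular_bimodule R) 0" for f
    using that by (auto simp: RR.hoch_cocycles_0_iff hoch_tuples_0 PiE_iff)
  have ext: "f = g \<longleftrightarrow> f [] = g []" if "f \<in> extensional {[]}" "g \<in> extensional {[]}" for f g :: "'c list \<Rightarrow> 'd"
    using that by (auto intro: extensionalityI)
  have ext0: "f \<in> extensional {[]}" if "f \<in> hoch_cocycles K R (regular_bimodule R) 0" for f
    using that by (auto simp: RR.hoch_cocycles_0_iff hoch_tuples_0 PiE_iff)
  have h_linear: "linear_map K ?ZR
      ?ZA (\<lambda>f. \<lambda>xs\<in>hoch_tuples A 0. p (f (map q xs)))"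
  proof (rule linear_mapI)
    fix f assume "f \<in> carrier ?ZR"
    then have f: "f \<in> hoch_cocycles K R (regular_bimodule R) 0" by simp
    have "a \<otimes>\<^bsub>A\<^esub> p (f []) = p (f []) \<otimes>\<^bsub>A\<^esub> a" if a: "a \<in> carrier A" for a
    proof -
      have "a \<otimes>\<^bsub>A\<^esub> p (f []) = p (q a \<otimes>\<^bsub>R\<^esub> f [])" using conjunct1[OF zR[OF f]] a by (simp add: p_mult p_q)
      also have "\<dots> = p (f [] \<otimes>\<^bsub>R\<^esub> q a)" using zR[OF f] a by simp
      also have "\<dots> = p (f []) \<otimes>\<^bsub>A\<^esub> a" using conjunct1[OF zR[OF f]] a by (simp add: p_mult p_q)
      finally show ?thesis .
    qed
    then show "(\<lambda>xs\<in>hoch_tuples A 0. p (f (map q xs))) \<in> carrier ?ZA"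
      using zR[OF f] by (auto simp: AA.hoch_cocycles_0_iff hoch_tuples_0 PiE_iff)
  next
    fix f g assume "f \<in> carrier ?ZR"
      "g \<in> carrier ?ZR"
    then show "(\<lambda>xs\<in>hoch_tuples A 0. p ((f \<oplus>\<^bsub>?ZR\<^esub> g) (map q xs)))
      = (\<lambda>xs\<in>hoch_tuples A 0. p (f (map q xs))) \<oplus>\<^bsub>?ZA\<^esub>
        (\<lambda>xs\<in>hoch_tuples A 0. p (g (map q xs)))"
      using zR by (auto simp: hoch_tuples_0 p_add cong: restrict_cong)
  next
    fix k f assume "k \<in> carrier K" "f \<in> carrier ?ZR"
    then show "(\<lambda>xs\<in>hoch_tuples A 0. p ((k \<odot>\<^bsub>?ZR\<^esub> f) (map q xs)))
      = k \<odot>\<^bsub>?ZA\<^esub> (\<lambda>xs\<in>hoch_tuples A 0. p (f (map q xs)))"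
      using zR by (auto simp: hoch_tuples_0 linear_mapD(3)[OF p_linear] cong: restrict_cong)
  qed
  have g_linear: "linear_map K ?ZI
      ?ZR (\<lambda>f. f)"
    by (rule linear_mapI) (simp_all add: *)
  have "\<exists>\<iota>. short_exact K QI.Q QR.Q (quot_space ?ZA
       ?BA) \<iota>
      (\<lambda>S\<in>carrier QR.Q. \<Union>f\<in>S. ?BA
         +>\<^bsub>?ZA\<^esub> (\<lambda>xs\<in>hoch_tuples A 0. p (f (map q xs))))"
  proof (rule short_exact_of_representatives[OF RR.quotient_space_hoch_0 AA.quotient_space_hoch_0
        QI.V.module_axioms QI.module_Q QI.linear_map_cls _ g_linear h_linear])
    show "QI.cls ` carrier ?ZI = carrier QI.Q"
      by (simp add: QI.Q_simps)
    show "(\<lambda>xs\<in>hoch_tuples A 0. p (f (map q xs))) \<in> ?BA"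
      if "f \<in> ?BR" for f
      using that linear_map_zero[OF R.A.abelian_group_axioms A.A.abelian_group_axioms p_linear]
      by (auto simp: RR.hoch_coboundaries_0 AA.hoch_coboundaries_0 hoch_tuples_0)
  next
    fix f assume f: "f \<in> carrier ?ZI"
    show "f \<in> ?BR \<longleftrightarrow> QI.cls f = \<zero>\<^bsub>QI.Q\<^esub>"
      unfolding QI.Q_simps(2) QI.cls_zero_iff[OF f]
      by (simp add: RR.hoch_coboundaries_0 I.hoch_coboundaries_0)
    have "p (f []) = \<zero>\<^bsub>A\<^esub>" using f by (auto simp: *)
    then show "(\<lambda>xs\<in>hoch_tuples A 0. p (f (map q xs))) \<in> ?BA"
      by (auto simp: AA.hoch_coboundaries_0 hoch_tuples_0)
  next
    fix f assume f: "f \<in> carrier ?ZR"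
      and "(\<lambda>xs\<in>hoch_tuples A 0. p (f (map q xs))) \<in> ?BA"
    then have "p (f []) = \<zero>\<^bsub>A\<^esub>"
      by (auto simp: AA.hoch_coboundaries_0 hoch_tuples_0 dest: fun_cong[of _ _ "[]"])
    then have "f [] \<in> I" unfolding j_image using f conjunct1[OF zR[of f]] by simp
    then have "f \<in> carrier ?ZI"
      using f by (simp add: *)
    moreover have "f \<ominus>\<^bsub>?ZR\<^esub> f
        \<in> ?BR"
      using f QR.cls_eq_iff by blast
    ultimately show "\<exists>g\<in>carrier ?ZI.
        f \<ominus>\<^bsub>?ZR\<^esub> g \<in> ?BR"
      by blast
  next
    fix w assume "w \<in> carrier ?ZA"
    then have w: "w [] \<in> carrier A" "\<And>a. a \<in> carrier A \<Longrightarrow> a \<otimes>\<^bsub>A\<^esub> w [] = w [] \<otimes>\<^bsub>A\<^esub> a" "w \<in> extensional {[]}"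
      by (auto simp: AA.hoch_cocycles_0_iff hoch_tuples_0 PiE_iff)
    let ?v = "\<lambda>xs\<in>hoch_tuples R 0. q (w [])"
    have "?v \<in> carrier ?ZR"
      using w central by (auto simp: RR.hoch_cocycles_0_iff hoch_tuples_0)
    moreover have "(\<lambda>xs\<in>hoch_tuples A 0. p (?v (map q xs))) = w"
      using w by (intro extensionalityI[of _ "{[]}"]) (auto simp: hoch_tuples_0 p_q)
    ultimately show "\<exists>v\<in>carrier ?ZR.
        (\<lambda>xs\<in>hoch_tuples A 0. p (v (map q xs))) = w" by blast
  qed
  then show ?thesis by (simp add: hoch_projection_def hoch_cohomology_def)
qed

lemma derivation_coefficients_iff:
  "derivation K R coefficients D \<longleftrightarrow> derivation K R (regular_bimodule R) D \<and> (\<forall>r\<in>carrier R. D r \<in> I)"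
  by (auto simp: derivation_def linear_map_def)

lemma derivation_compression:
  assumes D: "derivation K R (regular_bimodule R) D"
  shows "derivation K A (regular_bimodule A) (\<lambda>a. p (D (q a)))"
proof -
  from D have D_linear: "linear_map K R R D" by (simp add: derivation_def linear_map_def)
  have D_mem [simp]: "r \<in> carrier R \<Longrightarrow> D r \<in> carrier R" for r using D_linear by (rule linear_mapD)
  show ?thesis
    using linear_map_comp[OF linear_map_comp[OF q_linear D_linear] p_linear] derivationD(2)[OF D]
    by (auto simp: derivation_def linear_map_def p_add p_mult p_q q_mult)
qed

text \<open>
  A pair of a derivation \<open>F : R \<rightarrow> ker p\<close> and of \<open>\<theta> \<in> \<E>(M, A)\<close> is sent to the derivation \<open>F + q \<circ> \<theta>\<close>, where \<open>\<theta>\<close>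
  is extended by \<open>0\<close> to \<open>q A\<close>. These are exactly the derivations \<open>D\<close> with \<open>p D q = 0\<close>. Centrality of
  \<open>q z\<close> for central \<open>z\<close> is what makes the map injective on classes: an inner derivation \<open>ad (q z + j m)\<close>
  of this form has \<open>z\<close> central, and therefore equals \<open>ad (j m)\<close>.
\<close>

theorem short_exact_degree_1:
  assumes central: "\<And>z r. \<lbrakk>z \<in> carrier A; \<And>a. a \<in> carrier A \<Longrightarrow> a \<otimes>\<^bsub>A\<^esub> z = z \<otimes>\<^bsub>A\<^esub> a; r \<in> carrier R\<rbrakk>
    \<Longrightarrow> r \<otimes>\<^bsub>R\<^esub> q z = q z \<otimes>\<^bsub>R\<^esub> r"
    and lift: "\<And>\<delta>. derivation K A (regular_bimodule A) \<delta> \<Longrightarrow>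
      \<exists>D. derivation K R (regular_bimodule R) D \<and> (\<forall>a\<in>carrier A. p (D (q a)) = \<delta> a)"
  shows "\<exists>\<iota>. short_exact K (direct_sum (hoch_cohomology K R coefficients 1) (\<E>_space K M A))
           (HH K R 1) (HH K A 1) \<iota> (hoch_projection K R A p q 1)"
proof -
  let ?ZI = "hoch_cocycle_space K R coefficients 1"
  let ?ZR = "hoch_cocycle_space K R (regular_bimodule R) 1"
  let ?ZA = "hoch_cocycle_space K A (regular_bimodule A) 1"
  let ?BR = "hoch_coboundaries K R (regular_bimodule R) 1"
  let ?BA = "hoch_coboundaries K A (regular_bimodule A) 1"
  let ?E = "\<E>_space K M A"
  interpret QI: quotient_space K ?ZI "hoch_coboundaries K R coefficients 1"
    by (rule I.quotient_space_hoch_1)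
  interpret QR: quotient_space K ?ZR ?BR
    by (rule RR.quotient_space_hoch_1)
  define c where "c = (\<lambda>(F, \<theta>). (QI.cls F, \<theta> :: 'm \<Rightarrow> 'a))"
  define g where "g = (\<lambda>(F, \<theta>). \<lambda>xs\<in>hoch_tuples R 1. F xs \<oplus>\<^bsub>R\<^esub> q (\<theta> (ideal_part (hd xs))))"
  define h where "h f = (\<lambda>xs\<in>hoch_tuples A 1. p (f (map q xs)))" for f
  have ZR: "f \<in> carrier ?ZR \<longleftrightarrow> f \<in> hoch_tuples R 1 \<rightarrow>\<^sub>E carrier R \<and> derivation K R (regular_bimodule R) (\<lambda>r. f [r])" for f
    by (simp add: RR.hoch_cocycles_1_iff)
  have ZR_mem: "f [r] \<in> carrier R" if "f \<in> carrier ?ZR" "r \<in> carrier R" for f r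
  proof -
    have "f \<in> hoch_tuples R 1 \<rightarrow>\<^sub>E carrier R" using that(1) unfolding ZR by blast
    then show ?thesis using that(2) by (auto simp: hoch_tuples_1)
  qed
  have ZI: "F \<in> carrier ?ZI \<longleftrightarrow> F \<in> carrier ?ZR \<and> (\<forall>r\<in>carrier R. F [r] \<in> I)" for F
  proof -
    have "F \<in> hoch_tuples R 1 \<rightarrow>\<^sub>E I \<longleftrightarrow> F \<in> hoch_tuples R 1 \<rightarrow>\<^sub>E carrier R \<and> (\<forall>r\<in>carrier R. F [r] \<in> I)"
      by (auto simp: hoch_tuples_1 PiE_iff)
    then show ?thesis
      unfolding ZR fun_space_simps RR.hoch_cocycles_1_iff I.hoch_cocycles_1_iff derivation_coefficients_iff ideal_bimodule_simps
      by blast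
  qed
  have E_lin: "linear_map K M A \<theta>" if "\<theta> \<in> carrier ?E" for \<theta> using that by (simp add: E_space_iff)
  have E_mem: "\<theta> x \<in> carrier A" if "\<theta> \<in> carrier ?E" "x \<in> carrier M" for \<theta> x
    using linear_mapD(1)[OF E_lin[OF that(1)] that(2)] .
  have deriv_cong: "derivation K R (regular_bimodule R) D \<longleftrightarrow> derivation K R (regular_bimodule R) D'"
    if "\<And>r. r \<in> carrier R \<Longrightarrow> D r = D' r" for D D'
    using that by (auto simp: derivation_def linear_map_def)
  have deriv_cong_A: "derivation K A (regular_bimodule A) D \<longleftrightarrow> derivation K A (regular_bimodule A) D'"
    if "\<And>r. r \<in> carrier A \<Longrightarrow> D r = D' r" for D D'
    using that by (auto simp: derivation_def linear_map_def)
  have g_apply: "g (F, \<theta>) [r] = F [r] \<oplus>\<^bsub>R\<^esub> q (\<theta> (ideal_part r))" if "r \<in> carrier R" for F \<theta> r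
    using that by (simp add: g_def)
  have h_apply: "h f [a] = p (f [q a])" if "a \<in> carrier A" for f a
    using that by (simp add: h_def)
  have g_mem: "g (F, \<theta>) \<in> carrier ?ZR" if "F \<in> carrier ?ZI" "\<theta> \<in> carrier ?E" for F \<theta>
  proof -
    have F: "F \<in> carrier ?ZR" using that by (simp add: ZI del: fun_space_simps)
    then have "derivation K R (regular_bimodule R) (\<lambda>r. F [r] \<oplus>\<^bsub>regular_bimodule R\<^esub> q (\<theta> (ideal_part r)))"
      unfolding ZR by (intro RR.derivation_add E_space_derivation[OF that(2)]) simp
    then have "derivation K R (regular_bimodule R) (\<lambda>r. g (F, \<theta>) [r])"
      using deriv_cong[of "\<lambda>r. g (F, \<theta>) [r]"] g_apply by simp
    moreover have "g (F, \<theta>) \<in> hoch_tuples R 1 \<rightarrow>\<^sub>E carrier R"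
      using ZR_mem[OF F] E_mem[OF that(2)] by (auto simp: g_def hoch_tuples_1)
    ultimately show ?thesis unfolding ZR by blast
  qed
  have ext1: "f = f'" if "f \<in> extensional (hoch_tuples S 1)" "f' \<in> extensional (hoch_tuples S 1)"
    "\<And>a. a \<in> carrier S \<Longrightarrow> f [a] = f' [a]" for S :: "('x1, 'x2, 'x3) module_scheme" and f f' :: "'x2 list \<Rightarrow> 'x4"
    using that by (rule fun_on_tuples_1_eqI)
  have g_linear: "linear_map K (direct_sum ?ZI ?E) ?ZR g"
  proof (rule linear_mapI)
    fix s assume "s \<in> carrier (direct_sum ?ZI ?E)"
    then show "g s \<in> carrier ?ZR" using g_mem by (cases s) (simp del: fun_space_simps)
  next
    fix s s' assume s: "s \<in> carrier (direct_sum ?ZI ?E)" "s' \<in> carrier (direct_sum ?ZI ?E)"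
    obtain F \<theta> F' \<theta>' where [simp]: "s = (F, \<theta>)" "s' = (F', \<theta>')" by fastforce
    have F: "F \<in> carrier ?ZR" "F' \<in> carrier ?ZR" and \<theta>: "\<theta> \<in> carrier ?E" "\<theta>' \<in> carrier ?E"
      using s by (simp_all add: ZI del: fun_space_simps)
    show "g (s \<oplus>\<^bsub>direct_sum ?ZI ?E\<^esub> s') = g s \<oplus>\<^bsub>?ZR\<^esub> g s'"
    proof (rule ext1[of _ R])
      fix r assume r: "r \<in> carrier R"
      have "(\<theta> \<oplus>\<^bsub>?E\<^esub> \<theta>') (ideal_part r) = \<theta> (ideal_part r) \<oplus>\<^bsub>A\<^esub> \<theta>' (ideal_part r)"
        using r by (simp add: \<E>_space_def)
      then show "g (s \<oplus>\<^bsub>direct_sum ?ZI ?E\<^esub> s') [r] = (g s \<oplus>\<^bsub>?ZR\<^esub> g s') [r]"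
        using r ZR_mem[OF F(1)] ZR_mem[OF F(2)] \<theta> by (simp add: g_apply q_add E_mem R.A.a_ac)
    qed (simp_all add: g_def)
  next
    fix k s assume s: "k \<in> carrier K" "s \<in> carrier (direct_sum ?ZI ?E)"
    obtain F \<theta> where [simp]: "s = (F, \<theta>)" by fastforce
    have F: "F \<in> carrier ?ZR" and \<theta>: "\<theta> \<in> carrier ?E"
      using s by (simp_all add: ZI del: fun_space_simps)
    show "g (k \<odot>\<^bsub>direct_sum ?ZI ?E\<^esub> s) = k \<odot>\<^bsub>?ZR\<^esub> g s"
    proof (rule ext1[of _ R])
      fix r assume r: "r \<in> carrier R"
      have "(k \<odot>\<^bsub>?E\<^esub> \<theta>) (ideal_part r) = k \<odot>\<^bsub>A\<^esub> \<theta> (ideal_part r)"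
        using r by (simp add: \<E>_space_def)
      then show "g (k \<odot>\<^bsub>direct_sum ?ZI ?E\<^esub> s) [r] = (k \<odot>\<^bsub>?ZR\<^esub> g s) [r]"
        using r s(1) ZR_mem[OF F] \<theta>
        by (simp add: g_apply linear_mapD(3)[OF q_linear] E_mem R.A.smult_r_distr)
    qed (simp_all add: g_def)
  qed
  have h_linear: "linear_map K ?ZR ?ZA h"
  proof (rule linear_mapI)
    fix f assume f: "f \<in> carrier ?ZR"
    then have "derivation K A (regular_bimodule A) (\<lambda>a. p (f [q a]))"
      unfolding ZR by (intro derivation_compression) simp
    then have "derivation K A (regular_bimodule A) (\<lambda>a. h f [a])"
      using deriv_cong_A[of "\<lambda>a. h f [a]"] h_apply by simp
    moreover have "h f \<in> hoch_tuples A 1 \<rightarrow>\<^sub>E carrier A"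
      using ZR_mem[OF f] by (auto simp: h_def hoch_tuples_1)
    ultimately show "h f \<in> carrier ?ZA" by (simp add: AA.hoch_cocycles_1_iff)
  next
    fix f f' assume f: "f \<in> carrier ?ZR" "f' \<in> carrier ?ZR"
    show "h (f \<oplus>\<^bsub>?ZR\<^esub> f') = h f \<oplus>\<^bsub>?ZA\<^esub> h f'"
    proof (rule ext1[of _ A])
      fix a assume "a \<in> carrier A"
      then show "h (f \<oplus>\<^bsub>?ZR\<^esub> f') [a] = (h f \<oplus>\<^bsub>?ZA\<^esub> h f') [a]"
        using ZR_mem[OF f(1)] ZR_mem[OF f(2)] by (simp add: h_apply p_add)
    qed (simp_all add: h_def)
  next
    fix k f assume f: "k \<in> carrier K" "f \<in> carrier ?ZR"
    show "h (k \<odot>\<^bsub>?ZR\<^esub> f) = k \<odot>\<^bsub>?ZA\<^esub> h f"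
    proof (rule ext1[of _ A])
      fix a assume "a \<in> carrier A"
      then show "h (k \<odot>\<^bsub>?ZR\<^esub> f) [a] = (k \<odot>\<^bsub>?ZA\<^esub> h f) [a]"
        using ZR_mem[OF f(2)] f(1) by (simp add: h_apply linear_mapD(3)[OF p_linear])
    qed (simp_all add: h_def)
  qed
  have c_linear: "linear_map K (direct_sum ?ZI ?E) (direct_sum QI.Q ?E) c"
    by (rule linear_mapI) (auto simp: c_def QI.cls_add QI.cls_smult QI.cls_in simp del: fun_space_simps)
  have BR: "f \<in> ?BR \<longleftrightarrow> f \<in> extensional (hoch_tuples R 1) \<and>
      (\<exists>w\<in>carrier R. \<forall>r\<in>carrier R. f [r] = r \<otimes>\<^bsub>R\<^esub> w \<ominus>\<^bsub>R\<^esub> w \<otimes>\<^bsub>R\<^esub> r)" for f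
    by (simp add: RR.hoch_coboundaries_1_iff)
  have BA: "f \<in> ?BA \<longleftrightarrow> f \<in> extensional (hoch_tuples A 1) \<and>
      (\<exists>w\<in>carrier A. \<forall>r\<in>carrier A. f [r] = r \<otimes>\<^bsub>A\<^esub> w \<ominus>\<^bsub>A\<^esub> w \<otimes>\<^bsub>A\<^esub> r)" for f
    by (simp add: AA.hoch_coboundaries_1_iff)
  have BI: "f \<in> hoch_coboundaries K R coefficients 1 \<longleftrightarrow> f \<in> extensional (hoch_tuples R 1) \<and>
      (\<exists>w\<in>I. \<forall>r\<in>carrier R. f [r] = r \<otimes>\<^bsub>R\<^esub> w \<ominus>\<^bsub>R\<^esub> w \<otimes>\<^bsub>R\<^esub> r)" for f
  proof -
    have "linear_map K coefficients R (\<lambda>x. x)" by (rule linear_mapI) auto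
    from linear_map_minus[OF I.M.abelian_group_axioms R.A.abelian_group_axioms this]
    have minus: "x \<in> I \<Longrightarrow> y \<in> I \<Longrightarrow> x \<ominus>\<^bsub>coefficients\<^esub> y = x \<ominus>\<^bsub>R\<^esub> y" for x y by simp
    have "r \<otimes>\<^bsub>R\<^esub> w \<ominus>\<^bsub>coefficients\<^esub> w \<otimes>\<^bsub>R\<^esub> r = r \<otimes>\<^bsub>R\<^esub> w \<ominus>\<^bsub>R\<^esub> w \<otimes>\<^bsub>R\<^esub> r" if "w \<in> I" "r \<in> carrier R" for w r
      using that I.lact_closed[of w r] I.ract_closed[of w r] by (intro minus) simp_all
    then show ?thesis by (auto simp: I.hoch_coboundaries_1_iff)
  qed
  have minus_ZR: "f \<ominus>\<^bsub>?ZR\<^esub> f' = (\<lambda>xs\<in>hoch_tuples R 1. f xs \<ominus>\<^bsub>R\<^esub> f' xs)"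
    if "f \<in> carrier ?ZR" "f' \<in> carrier ?ZR" for f f'
  proof -
    have "hoch_cocycles K R (regular_bimodule R) 1 \<subseteq> hoch_tuples R 1 \<rightarrow>\<^sub>E carrier (regular_bimodule R)"
      by (auto simp: RR.hoch_cocycles_1_iff)
    from fun_space_minus[OF RR.M.module_axioms QR.V.module_axioms this, of f f'] that show ?thesis by simp
  qed
  have "\<exists>\<iota>. short_exact K (direct_sum QI.Q ?E) QR.Q (quot_space ?ZA ?BA) \<iota>
      (\<lambda>S\<in>carrier QR.Q. \<Union>f\<in>S. ?BA +>\<^bsub>?ZA\<^esub> h f)"
  proof (rule short_exact_of_representatives[OF RR.quotient_space_hoch_1 AA.quotient_space_hoch_1
        module_direct_sum[OF QI.V.module_axioms module_E_space]
        module_direct_sum[OF QI.module_Q module_E_space] c_linear _ g_linear h_linear])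
    show "c ` carrier (direct_sum ?ZI ?E) = carrier (direct_sum QI.Q ?E)"
      by (auto simp: c_def QI.Q_simps image_iff Bex_def)
  next
    fix f assume "f \<in> ?BR"
    then obtain w where w: "w \<in> carrier R" "\<And>r. r \<in> carrier R \<Longrightarrow> f [r] = r \<otimes>\<^bsub>R\<^esub> w \<ominus>\<^bsub>R\<^esub> w \<otimes>\<^bsub>R\<^esub> r"
      by (auto simp: BR)
    have "h f [a] = a \<otimes>\<^bsub>A\<^esub> p w \<ominus>\<^bsub>A\<^esub> p w \<otimes>\<^bsub>A\<^esub> a" if "a \<in> carrier A" for a
      using that w by (simp add: h_apply p_minus p_mult p_q)
    then show "h f \<in> ?BA" unfolding BA using w(1) p_closed by (auto simp: h_def)
  next
    fix s assume s: "s \<in> carrier (direct_sum ?ZI ?E)"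
    obtain F \<theta> where s_eq: "s = (F, \<theta>)" by fastforce
    have F: "F \<in> carrier ?ZI" and F': "F \<in> carrier ?ZR" and \<theta>: "\<theta> \<in> carrier ?E"
      using s by (simp_all add: s_eq ZI del: fun_space_simps)
    have FI: "r \<in> carrier R \<Longrightarrow> F [r] \<in> I" for r using F unfolding ZI by blast
    have pF: "r \<in> carrier R \<Longrightarrow> p (F [r]) = \<zero>\<^bsub>A\<^esub>" for r using FI j_image by blast
    have \<theta>0: "\<theta> \<zero>\<^bsub>M\<^esub> = \<zero>\<^bsub>A\<^esub>"
      by (rule linear_map_zero[OF M.abelian_group_axioms A.A.abelian_group_axioms E_lin[OF \<theta>]])
    have "h (g s) [a] = \<zero>\<^bsub>A\<^esub>" if "a \<in> carrier A" for a
      using that ZR_mem[OF F'] by (simp add: h_apply s_eq g_apply ideal_part_q \<theta>0 q_zero pF)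
    then show "h (g s) \<in> ?BA"
      unfolding BA by (auto simp: h_def diff_eq_zero_iff[OF A.A.abelian_group_axioms, THEN iffD2] intro!: bexI[of _ "\<zero>\<^bsub>A\<^esub>"])
    have zero_iff: "c s = \<zero>\<^bsub>direct_sum QI.Q ?E\<^esub> \<longleftrightarrow>
        F \<in> hoch_coboundaries K R coefficients 1 \<and> \<theta> = (\<lambda>x\<in>carrier M. \<zero>\<^bsub>A\<^esub>)"
      using F by (auto simp: s_eq c_def QI.Q_simps(2) QI.cls_zero_iff \<E>_space_def simp del: fun_space_simps(1))
    show "g s \<in> ?BR \<longleftrightarrow> c s = \<zero>\<^bsub>direct_sum QI.Q ?E\<^esub>"
      unfolding zero_iff
    proof
      assume *: "F \<in> hoch_coboundaries K R coefficients 1 \<and> \<theta> = (\<lambda>x\<in>carrier M. \<zero>\<^bsub>A\<^esub>)"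
      then obtain i where "i \<in> I" and i: "\<And>r. r \<in> carrier R \<Longrightarrow> F [r] = r \<otimes>\<^bsub>R\<^esub> i \<ominus>\<^bsub>R\<^esub> i \<otimes>\<^bsub>R\<^esub> r"
        unfolding BI by blast
      then have iR: "i \<in> carrier R" by auto
      have "g s [r] = r \<otimes>\<^bsub>R\<^esub> i \<ominus>\<^bsub>R\<^esub> i \<otimes>\<^bsub>R\<^esub> r" if "r \<in> carrier R" for r
        using that * i iR by (simp add: s_eq g_apply q_zero)
      then show "g s \<in> ?BR" unfolding BR using iR by (auto simp: s_eq g_def)
    next
      assume "g s \<in> ?BR"
      then obtain w where w: "w \<in> carrier R"
        "\<And>r. r \<in> carrier R \<Longrightarrow> F [r] \<oplus>\<^bsub>R\<^esub> q (\<theta> (ideal_part r)) = r \<otimes>\<^bsub>R\<^esub> w \<ominus>\<^bsub>R\<^esub> w \<otimes>\<^bsub>R\<^esub> r"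
        unfolding BR s_eq by (auto simp: g_apply)
      \<comment> \<open>The components of \<open>w\<close>; it is now shown that \<open>z\<close> commutes with everything, so that \<open>ad w = ad (j m)\<close>.\<close>
      define z where "z = p w"
      define m where "m = ideal_part w"
      have zm: "z \<in> carrier A" "m \<in> carrier M" "w = q z \<oplus>\<^bsub>R\<^esub> j m"
        using w(1) decomposition by (simp_all add: z_def m_def)
      have "a \<otimes>\<^bsub>A\<^esub> z = z \<otimes>\<^bsub>A\<^esub> a" if a: "a \<in> carrier A" for a
      proof -
        have "\<zero>\<^bsub>A\<^esub> = p (F [q a] \<oplus>\<^bsub>R\<^esub> q (\<theta> (ideal_part (q a))))"
          using a ZR_mem[OF F'] by (simp add: ideal_part_q \<theta>0 q_zero pF)
        also have "\<dots> = a \<otimes>\<^bsub>A\<^esub> z \<ominus>\<^bsub>A\<^esub> z \<otimes>\<^bsub>A\<^esub> a"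
          using a w by (simp add: p_minus p_mult p_q z_def)
        finally show ?thesis
          using a zm diff_eq_zero_iff[OF A.A.abelian_group_axioms, of "a \<otimes>\<^bsub>A\<^esub> z" "z \<otimes>\<^bsub>A\<^esub> a"] by simp
      qed
      then have qz: "r \<otimes>\<^bsub>R\<^esub> q z = q z \<otimes>\<^bsub>R\<^esub> r" if "r \<in> carrier R" for r
        using central[of z r] zm(1) that by blast
      have inner: "F [r] \<oplus>\<^bsub>R\<^esub> q (\<theta> (ideal_part r)) = r \<otimes>\<^bsub>R\<^esub> j m \<ominus>\<^bsub>R\<^esub> j m \<otimes>\<^bsub>R\<^esub> r" if r: "r \<in> carrier R" for r
      proof -
        have "r \<otimes>\<^bsub>R\<^esub> w \<ominus>\<^bsub>R\<^esub> w \<otimes>\<^bsub>R\<^esub> r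
            = (q z \<otimes>\<^bsub>R\<^esub> r \<oplus>\<^bsub>R\<^esub> r \<otimes>\<^bsub>R\<^esub> j m) \<ominus>\<^bsub>R\<^esub> (q z \<otimes>\<^bsub>R\<^esub> r \<oplus>\<^bsub>R\<^esub> j m \<otimes>\<^bsub>R\<^esub> r)"
          using r zm by (simp add: R.A.l_distr R.A.r_distr qz)
        also have "\<dots> = r \<otimes>\<^bsub>R\<^esub> j m \<ominus>\<^bsub>R\<^esub> j m \<otimes>\<^bsub>R\<^esub> r"
          using r zm by (simp add: diff_cancel_left[OF R.A.abelian_group_axioms])
        finally show ?thesis using w(2)[OF r] by simp
      qed
      have \<theta>_zero: "\<theta> x = \<zero>\<^bsub>A\<^esub>" if x: "x \<in> carrier M" for x
      proof -
        have "\<theta> x = p (F [j x] \<oplus>\<^bsub>R\<^esub> q (\<theta> (ideal_part (j x))))"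
          using x ZR_mem[OF F'] E_mem[OF \<theta>] by (simp add: ideal_part_j p_add p_q pF)
        also have "\<dots> = \<zero>\<^bsub>A\<^esub>"
          using x zm inner[of "j x"]
          by (simp add: j_square_zero diff_eq_zero_iff[OF R.A.abelian_group_axioms, THEN iffD2]
              linear_map_zero[OF R.A.abelian_group_axioms A.A.abelian_group_axioms p_linear])
        finally show ?thesis .
      qed
      have "F [r] = r \<otimes>\<^bsub>R\<^esub> j m \<ominus>\<^bsub>R\<^esub> j m \<otimes>\<^bsub>R\<^esub> r" if "r \<in> carrier R" for r
        using inner[OF that] that ZR_mem[OF F'] by (simp add: \<theta>_zero q_zero)
      moreover have "F \<in> extensional (hoch_tuples R 1)" using F' unfolding ZR by (simp add: PiE_iff)
      ultimately have "F \<in> hoch_coboundaries K R coefficients 1" unfolding BI using zm(2) by blast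
      moreover have "\<theta> = (\<lambda>x\<in>carrier M. \<zero>\<^bsub>A\<^esub>)"
        using \<theta> \<theta>_zero by (intro extensionalityI[of _ "carrier M"]) (auto simp: E_space_iff)
      ultimately show "F \<in> hoch_coboundaries K R coefficients 1 \<and> \<theta> = (\<lambda>x\<in>carrier M. \<zero>\<^bsub>A\<^esub>)" ..
    qed
  next
    fix f assume f: "f \<in> carrier ?ZR" and "h f \<in> ?BA"
    then obtain z where z: "z \<in> carrier A"
      "\<And>a. a \<in> carrier A \<Longrightarrow> p (f [q a]) = a \<otimes>\<^bsub>A\<^esub> z \<ominus>\<^bsub>A\<^esub> z \<otimes>\<^bsub>A\<^esub> a"
      unfolding BA by (auto simp: h_apply)
    \<comment> \<open>Subtracting an inner derivation makes the compression of \<open>f\<close> to \<open>A\<close> vanish.\<close>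
    define D where "D r = f [r] \<ominus>\<^bsub>R\<^esub> (r \<otimes>\<^bsub>R\<^esub> q z \<ominus>\<^bsub>R\<^esub> q z \<otimes>\<^bsub>R\<^esub> r)" for r
    have D: "derivation K R (regular_bimodule R) D"
    proof -
      have "derivation K R (regular_bimodule R) (\<lambda>r. f [r])" using f unfolding ZR by blast
      moreover have "q z \<in> carrier (regular_bimodule R)" using z(1) by simp
      ultimately have "derivation K R (regular_bimodule R)
          (\<lambda>r. f [r] \<ominus>\<^bsub>regular_bimodule R\<^esub> (lact (regular_bimodule R) r (q z)
            \<ominus>\<^bsub>regular_bimodule R\<^esub> ract (regular_bimodule R) (q z) r))"
        by (intro RR.derivation_diff RR.derivation_inner)
      then show ?thesis unfolding D_def[abs_def] regular_bimodule_minus ideal_bimodule_simps .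
    qed
    then have D_linear: "linear_map K R R D" by (simp add: derivation_def linear_map_def)
    have D_mem [simp]: "r \<in> carrier R \<Longrightarrow> D r \<in> carrier R" for r using D_linear by (rule linear_mapD)
    have pDq: "p (D (q a)) = \<zero>\<^bsub>A\<^esub>" if "a \<in> carrier A" for a
      using that z ZR_mem[OF f]
      by (simp add: D_def p_minus p_mult p_q diff_eq_zero_iff[OF A.A.abelian_group_axioms, THEN iffD2])
    define \<theta> where "\<theta> = (\<lambda>x\<in>carrier M. p (D (j x)))"
    have \<theta>: "\<theta> \<in> carrier ?E" unfolding \<theta>_def by (rule derivation_E_space[OF D pDq])
    \<comment> \<open>What remains after removal of the part \<open>M \<rightarrow> A\<close> of \<open>D\<close> takes values in \<open>ker p\<close>.\<close>
    define F where "F = (\<lambda>xs\<in>hoch_tuples R 1. D (hd xs) \<ominus>\<^bsub>R\<^esub> q (\<theta> (ideal_part (hd xs))))"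
    have F_apply: "F [r] = D r \<ominus>\<^bsub>R\<^esub> q (\<theta> (ideal_part r))" if "r \<in> carrier R" for r
      using that by (simp add: F_def)
    have "derivation K R (regular_bimodule R) (\<lambda>r. F [r])"
      using RR.derivation_diff[OF D E_space_derivation[OF \<theta>]] deriv_cong[of "\<lambda>r. F [r]"] F_apply by simp
    moreover have "F \<in> hoch_tuples R 1 \<rightarrow>\<^sub>E carrier R"
      using E_mem[OF \<theta>] by (auto simp: F_def hoch_tuples_1)
    moreover have "F [r] \<in> I" if r: "r \<in> carrier R" for r
    proof -
      have "p (D r) = p (D (q (p r) \<oplus>\<^bsub>R\<^esub> j (ideal_part r)))" using arg_cong[OF decomposition[OF r], of "\<lambda>r. p (D r)"] .
      also have "\<dots> = \<theta> (ideal_part r)"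
        using r by (simp add: linear_mapD(2)[OF D_linear] p_add pDq \<theta>_def)
      finally have "p (F [r]) = \<zero>\<^bsub>A\<^esub>"
        using r E_mem[OF \<theta>] by (simp add: F_apply p_minus p_q diff_eq_zero_iff[OF A.A.abelian_group_axioms])
      then show ?thesis unfolding j_image using r E_mem[OF \<theta>] by (simp add: F_apply)
    qed
    ultimately have F: "F \<in> carrier ?ZI" unfolding ZI ZR by blast
    have "(f \<ominus>\<^bsub>?ZR\<^esub> g (F, \<theta>)) [r] = r \<otimes>\<^bsub>R\<^esub> q z \<ominus>\<^bsub>R\<^esub> q z \<otimes>\<^bsub>R\<^esub> r" if r: "r \<in> carrier R" for r
    proof -
      let ?i = "r \<otimes>\<^bsub>R\<^esub> q z \<ominus>\<^bsub>R\<^esub> q z \<otimes>\<^bsub>R\<^esub> r"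
      have "(f \<ominus>\<^bsub>?ZR\<^esub> g (F, \<theta>)) [r] = f [r] \<ominus>\<^bsub>R\<^esub> g (F, \<theta>) [r]"
        using r minus_ZR[OF f g_mem[OF F \<theta>]] by simp
      also have "\<dots> = f [r] \<ominus>\<^bsub>R\<^esub> D r"
        using r E_mem[OF \<theta>] by (simp add: g_apply F_apply diff_add_self[OF R.A.abelian_group_axioms])
      also have "\<dots> = ?i"
        unfolding D_def using r z(1) ZR_mem[OF f r]
        by (simp add: diff_diff_self[OF R.A.abelian_group_axioms])
      finally show ?thesis .
    qed
    moreover have "f \<ominus>\<^bsub>?ZR\<^esub> g (F, \<theta>) \<in> extensional (hoch_tuples R 1)"
      using minus_ZR[OF f g_mem[OF F \<theta>]] by simp
    ultimately have "f \<ominus>\<^bsub>?ZR\<^esub> g (F, \<theta>) \<in> ?BR" unfolding BR using z(1) by auto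
    then show "\<exists>s\<in>carrier (direct_sum ?ZI ?E). f \<ominus>\<^bsub>?ZR\<^esub> g s \<in> ?BR"
      using F \<theta> by (intro bexI[of _ "(F, \<theta>)"]) (simp_all del: fun_space_simps)
  next
    fix w assume w: "w \<in> carrier ?ZA"
    then have "derivation K A (regular_bimodule A) (\<lambda>a. w [a])" and w_ext: "w \<in> extensional (hoch_tuples A 1)"
      by (simp_all add: AA.hoch_cocycles_1_iff PiE_iff)
    from lift[OF this(1)] obtain D where D: "derivation K R (regular_bimodule R) D"
      "\<And>a. a \<in> carrier A \<Longrightarrow> p (D (q a)) = w [a]" by blast
    define f where "f = (\<lambda>xs\<in>hoch_tuples R 1. D (hd xs))"
    have f_apply: "f [r] = D r" if "r \<in> carrier R" for r using that by (simp add: f_def)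
    have D_mem: "D r \<in> carrier R" if "r \<in> carrier R" for r
      using linear_mapD(1)[OF derivationD(1)[OF D(1)] that] by simp
    have "derivation K R (regular_bimodule R) (\<lambda>r. f [r])"
      by (rule deriv_cong[THEN iffD2, OF _ D(1)]) (rule f_apply)
    moreover have "f \<in> hoch_tuples R 1 \<rightarrow>\<^sub>E carrier R"
    proof (rule PiE_I)
      fix xs assume "xs \<in> hoch_tuples R 1"
      then obtain r where "r \<in> carrier R" "xs = [r]" unfolding hoch_tuples_1 by (elim imageE)
      then show "f xs \<in> carrier R" by (simp only: f_apply D_mem)
    qed (simp add: f_def)
    ultimately have "f \<in> carrier ?ZR" unfolding ZR by (intro conjI)
    moreover have "h f = w"
    proof (rule ext1[of _ A])
      show "h f \<in> extensional (hoch_tuples A 1)" by (simp add: h_def)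
      show "w \<in> extensional (hoch_tuples A 1)" by (rule w_ext)
      show "h f [a] = w [a]" if "a \<in> carrier A" for a
        using that by (simp only: h_apply f_apply q_closed D(2))
    qed
    ultimately show "\<exists>f\<in>carrier ?ZR. h f = w" by (intro bexI)
  qed
  then show ?thesis by (simp add: hoch_projection_def hoch_cohomology_def h_def)
qed

end


section \<open>Right module homomorphisms and projective modules\<close>

definition right_hom :: "('k, 'r) ring_scheme \<Rightarrow> ('k, 'a, 's) module_scheme
    \<Rightarrow> ('k, 'a, 'm, 'x) rmodule_scheme \<Rightarrow> ('k, 'a, 'n, 'y) rmodule_scheme \<Rightarrow> ('m \<Rightarrow> 'n) \<Rightarrow> bool" where
  "right_hom K A M N f \<longleftrightarrow> linear_map K M N f \<and>
     (\<forall>x\<in>carrier M. \<forall>a\<in>carrier A. f (ract M x a) = ract N (f x) a)"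

lemma right_homD:
  assumes "right_hom K A M N f"
  shows "linear_map K M N f" "x \<in> carrier M \<Longrightarrow> f x \<in> carrier N"
    "\<lbrakk>x \<in> carrier M; a \<in> carrier A\<rbrakk> \<Longrightarrow> f (ract M x a) = ract N (f x) a"
  using assms by (auto simp: right_hom_def linear_map_def)

lemma rhom_iff: "f \<in> rhom K A M N \<longleftrightarrow> f \<in> extensional (carrier M) \<and> right_hom K A M N f"
  by (auto simp: rhom_def right_hom_def lin_iff)

lemma right_hom_cong:
  assumes "k_rmodule K A M" "\<And>x. x \<in> carrier M \<Longrightarrow> f x = g x"
  shows "right_hom K A M N f \<longleftrightarrow> right_hom K A M N g"
proof -
  interpret M: k_rmodule K A M by fact
  have "linear_map K M N f \<longleftrightarrow> linear_map K M N g"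
    by (rule linear_map_cong[OF M.M.module_axioms assms(2)])
  then show ?thesis by (simp add: right_hom_def assms(2))
qed

lemma restrict_in_rhom:
  assumes "k_rmodule K A M" "right_hom K A M N f"
  shows "restrict f (carrier M) \<in> rhom K A M N"
  using assms right_hom_cong[OF assms(1), of "restrict f (carrier M)" f] by (auto simp: rhom_iff)

lemma right_hom_comp:
  assumes "right_hom K A L M f" "right_hom K A M N g"
  shows "right_hom K A L N (\<lambda>x. g (f x))"
  using assms linear_map_comp[of K L M f N g] by (auto simp: right_hom_def linear_map_def)

lemma right_hom_id: "right_hom K A M M (\<lambda>x. x)"
  by (auto simp: right_hom_def linear_map_id)

lemma right_hom_add:
  assumes "k_rmodule K A N" "right_hom K A M N f" "right_hom K A M N g"
  shows "right_hom K A M N (\<lambda>x. f x \<oplus>\<^bsub>N\<^esub> g x)"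
proof -
  interpret N: k_rmodule K A N by fact
  show ?thesis
    using assms(2,3) linear_map_add[OF N.M.module_axioms, of M f g]
    by (auto simp: right_hom_def N.ract_add_left linear_map_def)
qed

lemma right_hom_smult:
  assumes "k_rmodule K A N" "right_hom K A M N f" "k \<in> carrier K"
  shows "right_hom K A M N (\<lambda>x. k \<odot>\<^bsub>N\<^esub> f x)"
proof -
  interpret N: k_rmodule K A N by fact
  show ?thesis
    using assms(2,3) linear_map_smult[OF N.M.module_axioms, of M f]
    by (auto simp: right_hom_def N.ract_smult_left linear_map_def)
qed

lemma right_hom_zero:
  assumes "k_rmodule K A N"
  shows "right_hom K A M N (\<lambda>x. \<zero>\<^bsub>N\<^esub>)"
proof -
  interpret N: k_rmodule K A N by fact
  show ?thesis
    using linear_map_zero_fun[OF N.M.module_axioms, of M] N.ract_zero_left by (auto simp: right_hom_def)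
qed

text \<open>
  Two maps that fail to be linear over \<open>A\<close> by the same defect \<open>c\<close> differ by a linear map. With
  \<open>c x a = h(x) \<delta>(a)\<close> this is how derivation-like maps yield morphisms of modules.
\<close>

lemma right_hom_diff_of_twisted:
  assumes "k_rmodule K A N" "linear_map K M N f" "linear_map K M N g"
    and f: "\<And>x a. \<lbrakk>x \<in> carrier M; a \<in> carrier A\<rbrakk> \<Longrightarrow> f (ract M x a) = ract N (f x) a \<oplus>\<^bsub>N\<^esub> c x a"
    and g: "\<And>x a. \<lbrakk>x \<in> carrier M; a \<in> carrier A\<rbrakk> \<Longrightarrow> g (ract M x a) = ract N (g x) a \<oplus>\<^bsub>N\<^esub> c x a"
    and c: "\<And>x a. \<lbrakk>x \<in> carrier M; a \<in> carrier A\<rbrakk> \<Longrightarrow> c x a \<in> carrier N"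
  shows "right_hom K A M N (\<lambda>x. f x \<ominus>\<^bsub>N\<^esub> g x)"
proof -
  interpret N: k_rmodule K A N by fact
  have "f (ract M x a) \<ominus>\<^bsub>N\<^esub> g (ract M x a) = ract N (f x \<ominus>\<^bsub>N\<^esub> g x) a"
    if "x \<in> carrier M" "a \<in> carrier A" for x a
    using that assms(2,3)[THEN linear_mapD(1)] c diff_cancel_left[OF N.M.abelian_group_axioms, of "c x a" "ract N (f x) a" "ract N (g x) a"]
    by (simp add: f g N.ract_minus_left N.M.a_comm)
  then show ?thesis
    using linear_map_diff[OF N.M.module_axioms assms(2,3)] by (auto simp: right_hom_def)
qed

lemma right_hom_diff:
  assumes "k_rmodule K A N" "right_hom K A M N f" "right_hom K A M N g"
  shows "right_hom K A M N (\<lambda>x. f x \<ominus>\<^bsub>N\<^esub> g x)"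
proof -
  interpret N: k_rmodule K A N by fact
  show ?thesis
    using linear_map_diff[OF N.M.module_axioms right_homD(1)[OF assms(2)] right_homD(1)[OF assms(3)]]
      assms(2,3) by (auto simp: right_hom_def linear_map_def N.ract_minus_left)
qed

lemma (in fin_dim_rmodule) k_rmodule:
  assumes "k_algebra K A"
  shows "k_rmodule K A M"
proof -
  interpret A: k_algebra K A by fact
  show ?thesis
    by unfold_locales (simp_all add: ract_closed ract_add_left ract_add_right ract_mult ract_one
        ract_smult_left ract_smult_right)
qed

lemma free_rmodule_simps [simp]:
  "carrier (free_rmodule A n) = {..<n} \<rightarrow>\<^sub>E carrier A"
  "\<zero>\<^bsub>free_rmodule A n\<^esub> = (\<lambda>i\<in>{..<n}. \<zero>\<^bsub>A\<^esub>)"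
  "f \<oplus>\<^bsub>free_rmodule A n\<^esub> g = (\<lambda>i\<in>{..<n}. f i \<oplus>\<^bsub>A\<^esub> g i)"
  "k \<odot>\<^bsub>free_rmodule A n\<^esub> f = (\<lambda>i\<in>{..<n}. k \<odot>\<^bsub>A\<^esub> f i)"
  "ract (free_rmodule A n) f a = (\<lambda>i\<in>{..<n}. f i \<otimes>\<^bsub>A\<^esub> a)"
  by (simp_all add: free_rmodule_def Let_def)

lemma (in k_algebra) module_free_rmodule: "module K (free_rmodule A n)"
proof -
  have "module K (fun_space {..<n} A ({..<n} \<rightarrow>\<^sub>E carrier A))"
    by (rule module_fun_space[OF A.module_axioms]) (auto simp: PiE_iff)
  then show ?thesis
    by (rule module_same_ops) (simp_all add: free_rmodule_def Let_def)
qed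

text \<open>
  The dual basis lemma: \<open>u i\<close> are the coordinates of the embedding into a free module, \<open>b i\<close> the images of
  its standard basis under the retraction. All uses of projectivity go through it.
\<close>

lemma (in k_rmodule) projective_dual_basis:
  assumes "projective K A M"
  obtains n :: nat and b u where "\<And>i. i < n \<Longrightarrow> b i \<in> carrier M"
    and "\<And>i. i < n \<Longrightarrow> linear_map K M A (u i)"
    and "\<And>i x a. \<lbrakk>i < n; x \<in> carrier M; a \<in> carrier A\<rbrakk> \<Longrightarrow> u i (ract M x a) = u i x \<otimes>\<^bsub>A\<^esub> a"
    and "\<And>x. x \<in> carrier M \<Longrightarrow> x = (\<Oplus>\<^bsub>M\<^esub>i\<in>{..<n}. ract M (b i) (u i x))"
proof -
  from assms obtain n s r where s: "s \<in> rhom K A M (free_rmodule A n)"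
    and r: "r \<in> rhom K A (free_rmodule A n) M" and rs: "\<And>x. x \<in> carrier M \<Longrightarrow> r (s x) = x"
    by (auto simp: projective_def)
  let ?F = "free_rmodule A n"
  interpret F: module K ?F by (rule A.module_free_rmodule)
  have s: "right_hom K A M ?F s" and r: "right_hom K A ?F M r" using s r by (simp_all add: rhom_iff)
  define e where "e i = (\<lambda>j\<in>{..<n}. if i = j then \<one>\<^bsub>A\<^esub> else \<zero>\<^bsub>A\<^esub>)" for i
  have e: "e i \<in> carrier ?F" for i by (auto simp: e_def)
  have ev: "linear_map K ?F A (\<lambda>v. v j)" if "j < n" for j
    using that by (intro linear_mapI) auto
  have ract_e: "ract ?F (e i) a \<in> carrier ?F" if "a \<in> carrier A" for i a
    using that by (auto simp: e_def)
  have expand: "v = (\<Oplus>\<^bsub>?F\<^esub>i\<in>{..<n}. ract ?F (e i) (v i))" if v: "v \<in> carrier ?F" for v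
  proof -
    have vi: "i < n \<Longrightarrow> v i \<in> carrier A" for i using v by auto
    have g: "(\<lambda>i. ract ?F (e i) (v i)) \<in> {..<n} \<rightarrow> carrier ?F" using ract_e vi by blast
    have sum: "(\<Oplus>\<^bsub>?F\<^esub>i\<in>{..<n}. ract ?F (e i) (v i)) \<in> carrier ?F"
      by (rule F.finsum_closed[OF g])
    have "(\<Oplus>\<^bsub>?F\<^esub>i\<in>{..<n}. ract ?F (e i) (v i)) j = v j" if j: "j < n" for j
    proof -
      have "(\<Oplus>\<^bsub>?F\<^esub>i\<in>{..<n}. ract ?F (e i) (v i)) j = (\<Oplus>\<^bsub>A\<^esub>i\<in>{..<n}. ract ?F (e i) (v i) j)"
        by (rule linear_map_finsum[OF F.abelian_group_axioms A.A.abelian_group_axioms ev[OF j] g]) simp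
      also have "\<dots> = (\<Oplus>\<^bsub>A\<^esub>i\<in>{..<n}. if j = i then v i else \<zero>\<^bsub>A\<^esub>)"
        using j vi by (intro A.A.finsum_cong') (auto simp: e_def)
      also have "\<dots> = v j"
        using j vi by (intro A.A.finsum_singleton) auto
      finally show ?thesis .
    qed
    then show ?thesis using v sum by (intro extensionalityI[of _ "{..<n}"]) (auto simp: PiE_iff)
  qed
  show thesis
  proof
    show "r (e i) \<in> carrier M" for i using right_homD(2)[OF r e] .
    show "linear_map K M A (\<lambda>x. s x i)" if "i < n" for i
      by (rule linear_map_comp[OF right_homD(1)[OF s] ev[OF that]])
    show "s (ract M x a) i = s x i \<otimes>\<^bsub>A\<^esub> a" if "i < n" "x \<in> carrier M" "a \<in> carrier A" for i x a
      using that by (simp add: right_homD(3)[OF s])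
    show "x = (\<Oplus>\<^bsub>M\<^esub>i\<in>{..<n}. ract M (r (e i)) (s x i))" if x: "x \<in> carrier M" for x
    proof -
      have sx: "s x \<in> carrier ?F" using right_homD(2)[OF s x] .
      then have sxi: "i < n \<Longrightarrow> s x i \<in> carrier A" for i by auto
      have "x = r (\<Oplus>\<^bsub>?F\<^esub>i\<in>{..<n}. ract ?F (e i) (s x i))"
        using rs[OF x] expand[OF sx] by simp
      also have "\<dots> = (\<Oplus>\<^bsub>M\<^esub>i\<in>{..<n}. r (ract ?F (e i) (s x i)))"
        using ract_e sxi
        by (intro linear_map_finsum[OF F.abelian_group_axioms M.abelian_group_axioms right_homD(1)[OF r]]) blast+
      also have "\<dots> = (\<Oplus>\<^bsub>M\<^esub>i\<in>{..<n}. ract M (r (e i)) (s x i))"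
        using sxi right_homD(2)[OF r e] right_homD(3)[OF r e]
        by (intro M.finsum_cong') auto
      finally show ?thesis .
    qed
  qed
qed

lemma (in k_rmodule) linear_map_finsum_of:
  assumes "module K N" "finite I" "\<And>i. i \<in> I \<Longrightarrow> linear_map K N M (f i)"
  shows "linear_map K N M (\<lambda>x. \<Oplus>\<^bsub>M\<^esub>i\<in>I. f i x)"
  using assms(2,3)
proof (induction I rule: finite_induct)
  case empty
  then show ?case using linear_map_zero_fun[OF M.module_axioms] by simp
next
  case (insert j I)
  have eq: "(\<Oplus>\<^bsub>M\<^esub>i\<in>insert j I. f i x) = f j x \<oplus>\<^bsub>M\<^esub> (\<Oplus>\<^bsub>M\<^esub>i\<in>I. f i x)" if "x \<in> carrier N" for x
    using insert that linear_mapD(1)[OF insert.prems] by (intro M.finsum_insert) auto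
  have "linear_map K N M (\<lambda>x. f j x \<oplus>\<^bsub>M\<^esub> (\<Oplus>\<^bsub>M\<^esub>i\<in>I. f i x))"
    using insert by (intro linear_map_add M.module_axioms) auto
  moreover have "linear_map K N M (\<lambda>x. \<Oplus>\<^bsub>M\<^esub>i\<in>insert j I. f i x)
      \<longleftrightarrow> linear_map K N M (\<lambda>x. f j x \<oplus>\<^bsub>M\<^esub> (\<Oplus>\<^bsub>M\<^esub>i\<in>I. f i x))"
    by (rule linear_map_cong[OF assms(1) eq])
  ultimately show ?case by simp
qed

text \<open>
  A lift is determined on a dual basis by choosing preimages \<open>y i\<close> of \<open>f (b i)\<close>.
\<close>

lemma projective_lifting:
  assumes P: "k_rmodule K A P" "projective K A P" and Y: "k_rmodule K A Y" and Z: "k_rmodule K A Z"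
    and \<pi>: "right_hom K A Y Z \<pi>" and f: "right_hom K A P Z f"
    and im: "\<And>x. x \<in> carrier P \<Longrightarrow> f x \<in> \<pi> ` carrier Y"
  obtains g where "right_hom K A P Y g" "\<And>x. x \<in> carrier P \<Longrightarrow> \<pi> (g x) = f x"
proof -
  interpret P: k_rmodule K A P by fact
  interpret Y: k_rmodule K A Y by fact
  interpret Z: k_rmodule K A Z by fact
  obtain n :: nat and b u where b: "\<And>i. i < n \<Longrightarrow> b i \<in> carrier P"
    and u: "\<And>i. i < n \<Longrightarrow> linear_map K P A (u i)"
      "\<And>i x a. \<lbrakk>i < n; x \<in> carrier P; a \<in> carrier A\<rbrakk> \<Longrightarrow> u i (ract P x a) = u i x \<otimes>\<^bsub>A\<^esub> a"
    and expand: "\<And>x. x \<in> carrier P \<Longrightarrow> x = (\<Oplus>\<^bsub>P\<^esub>i\<in>{..<n}. ract P (b i) (u i x))"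
    using P.projective_dual_basis[OF P(2)] by blast
  have ui: "u i x \<in> carrier A" if "i < n" "x \<in> carrier P" for i x
    using linear_mapD(1)[OF u(1)[OF that(1)] that(2)] .
  have "\<exists>y. \<forall>i<n. y i \<in> carrier Y \<and> \<pi> (y i) = f (b i)"
  proof -
    have "\<forall>i. \<exists>y. i < n \<longrightarrow> y \<in> carrier Y \<and> \<pi> y = f (b i)"
      using im b by (metis imageE)
    then show ?thesis by metis
  qed
  then obtain y where y: "\<And>i. i < n \<Longrightarrow> y i \<in> carrier Y" "\<And>i. i < n \<Longrightarrow> \<pi> (y i) = f (b i)" by blast
  define g where "g x = (\<Oplus>\<^bsub>Y\<^esub>i\<in>{..<n}. ract Y (y i) (u i x))" for x
  have closed: "(\<lambda>i. ract Y (y i) (u i x)) \<in> {..<n} \<rightarrow> carrier Y" if "x \<in> carrier P" for x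
    using that y ui by simp
  have lin: "linear_map K P Y g"
    unfolding g_def using y u
    by (intro Y.linear_map_finsum_of P.M.module_axioms)
       (auto intro!: linear_map_comp[OF _ Y.linear_map_ract_right])
  moreover have "g (ract P x a) = ract Y (g x) a" if xa: "x \<in> carrier P" "a \<in> carrier A" for x a
  proof -
    have "ract Y (g x) a = (\<Oplus>\<^bsub>Y\<^esub>i\<in>{..<n}. ract Y (ract Y (y i) (u i x)) a)"
      unfolding g_def
      by (rule linear_map_finsum[OF Y.M.abelian_group_axioms Y.M.abelian_group_axioms
            Y.linear_map_ract_left[OF xa(2)] closed[OF xa(1)]]) simp
    also have "\<dots> = g (ract P x a)"
      unfolding g_def using xa y ui by (intro Y.M.finsum_cong') (auto simp: u(2) Y.ract_mult)
    finally show ?thesis ..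
  qed
  ultimately have "right_hom K A P Y g" by (simp add: right_hom_def)
  moreover have "\<pi> (g x) = f x" if x: "x \<in> carrier P" for x
  proof -
    have "\<pi> (g x) = (\<Oplus>\<^bsub>Z\<^esub>i\<in>{..<n}. \<pi> (ract Y (y i) (u i x)))"
      unfolding g_def
      by (rule linear_map_finsum[OF Y.M.abelian_group_axioms Z.M.abelian_group_axioms
            right_homD(1)[OF \<pi>] closed[OF x]]) simp
    also have "\<dots> = (\<Oplus>\<^bsub>Z\<^esub>i\<in>{..<n}. f (ract P (b i) (u i x)))"
      using x y ui b right_homD(2)[OF f] by (intro Z.M.finsum_cong') (auto simp: right_homD(3)[OF \<pi>] right_homD(3)[OF f])
    also have "\<dots> = f (\<Oplus>\<^bsub>P\<^esub>i\<in>{..<n}. ract P (b i) (u i x))"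
      using x b ui
      by (intro linear_map_finsum[OF P.M.abelian_group_axioms Z.M.abelian_group_axioms
            right_homD(1)[OF f], symmetric]) auto
    finally show ?thesis using expand[OF x] by simp
  qed
  ultimately show thesis by (rule that)
qed

text \<open>
  On a free module one applies \<open>\<delta>\<close> to every coordinate; on a summand this becomes
  \<open>\<mu> x = \<Sum> b\<^sub>i \<delta>(u\<^sub>i x)\<close>, because \<open>\<delta>(u\<^sub>i(x) a) = u\<^sub>i(x) \<delta>(a) + \<delta>(u\<^sub>i x) a\<close> and \<open>\<Sum> b\<^sub>i u\<^sub>i(x) = x\<close>.
\<close>

lemma (in k_rmodule) derivation_lifts_to_projective:
  assumes "projective K A M" and \<delta>: "derivation K A (regular_bimodule A) \<delta>"
  obtains \<mu> where "linear_map K M M \<mu>"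
    "\<And>x a. \<lbrakk>x \<in> carrier M; a \<in> carrier A\<rbrakk> \<Longrightarrow> \<mu> (ract M x a) = ract M (\<mu> x) a \<oplus>\<^bsub>M\<^esub> ract M x (\<delta> a)"
proof -
  obtain n :: nat and b u where b: "\<And>i. i < n \<Longrightarrow> b i \<in> carrier M"
    and u: "\<And>i. i < n \<Longrightarrow> linear_map K M A (u i)"
      "\<And>i x a. \<lbrakk>i < n; x \<in> carrier M; a \<in> carrier A\<rbrakk> \<Longrightarrow> u i (ract M x a) = u i x \<otimes>\<^bsub>A\<^esub> a"
    and expand: "\<And>x. x \<in> carrier M \<Longrightarrow> x = (\<Oplus>\<^bsub>M\<^esub>i\<in>{..<n}. ract M (b i) (u i x))"
    using projective_dual_basis[OF assms(1)] by blast
  have ui: "u i x \<in> carrier A" if "i < n" "x \<in> carrier M" for i x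
    using linear_mapD(1)[OF u(1)[OF that(1)] that(2)] .
  have \<delta>_lin: "linear_map K A A \<delta>" using \<delta> by (simp add: derivation_def linear_map_def)
  have \<delta>_mem: "a \<in> carrier A \<Longrightarrow> \<delta> a \<in> carrier A" for a using linear_mapD(1)[OF \<delta>_lin] .
  have \<delta>_mult: "\<delta> (a \<otimes>\<^bsub>A\<^esub> c) = a \<otimes>\<^bsub>A\<^esub> \<delta> c \<oplus>\<^bsub>A\<^esub> \<delta> a \<otimes>\<^bsub>A\<^esub> c" if "a \<in> carrier A" "c \<in> carrier A" for a c
    using derivationD(2)[OF \<delta> that] by simp
  define \<mu> where "\<mu> x = (\<Oplus>\<^bsub>M\<^esub>i\<in>{..<n}. ract M (b i) (\<delta> (u i x)))" for x
  have "linear_map K M M \<mu>"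
    unfolding \<mu>_def
  proof (intro linear_map_finsum_of M.module_axioms)
    fix i assume "i \<in> {..<n}"
    then show "linear_map K M M (\<lambda>x. ract M (b i) (\<delta> (u i x)))"
      using linear_map_comp[OF linear_map_comp[OF u(1)[of i] \<delta>_lin] linear_map_ract_right[OF b[of i]]] by simp
  qed simp
  moreover have "\<mu> (ract M x a) = ract M (\<mu> x) a \<oplus>\<^bsub>M\<^esub> ract M x (\<delta> a)"
    if xa: "x \<in> carrier M" "a \<in> carrier A" for x a
  proof -
    have "ract M (\<mu> x) a = (\<Oplus>\<^bsub>M\<^esub>i\<in>{..<n}. ract M (ract M (b i) (\<delta> (u i x))) a)"
      unfolding \<mu>_def using xa b ui \<delta>_mem
      by (intro linear_map_finsum[OF M.abelian_group_axioms M.abelian_group_axioms linear_map_ract_left]) auto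
    moreover have "ract M x (\<delta> a) = (\<Oplus>\<^bsub>M\<^esub>i\<in>{..<n}. ract M (ract M (b i) (u i x)) (\<delta> a))"
      by (subst expand[OF xa(1)]) (use xa b ui \<delta>_mem in \<open>auto intro!:
        linear_map_finsum[OF M.abelian_group_axioms M.abelian_group_axioms linear_map_ract_left]\<close>)
    ultimately have "ract M (\<mu> x) a \<oplus>\<^bsub>M\<^esub> ract M x (\<delta> a)
        = (\<Oplus>\<^bsub>M\<^esub>i\<in>{..<n}. ract M (ract M (b i) (\<delta> (u i x))) a \<oplus>\<^bsub>M\<^esub> ract M (ract M (b i) (u i x)) (\<delta> a))"
      using xa b ui \<delta>_mem by (simp add: M.finsum_addf)
    also have "\<dots> = \<mu> (ract M x a)"
      unfolding \<mu>_def using xa b ui \<delta>_mem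
      by (intro M.finsum_cong') (auto simp: u(2) \<delta>_mult ract_add_right ract_mult M.a_comm)
    finally show ?thesis ..
  qed
  ultimately show thesis by (rule that)
qed


section \<open>Comparison of projective resolutions\<close>

locale resolution = A: k_algebra K A + M: k_rmodule K A M
  for K :: "('k, 'r) ring_scheme" and A :: "('k, 'a, 's) module_scheme"
    and M :: "('k, 'a, 'm, 'x) rmodule_scheme" +
  fixes P :: "nat \<Rightarrow> ('k, 'a, 'p) rmodule" and d :: "nat \<Rightarrow> 'p \<Rightarrow> 'p" and \<epsilon> :: "'p \<Rightarrow> 'm"
  assumes resolution: "projective_resolution K A M P d \<epsilon>"
begin

lemma P_rmodule: "k_rmodule K A (P n)"
  using resolution fin_dim_rmodule.k_rmodule[OF _ A.k_algebra_axioms]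
  by (auto simp: projective_resolution_def)

sublocale P: k_rmodule K A "P n" for n by (rule P_rmodule)

lemma P_projective: "projective K A (P n)"
  and d_hom: "right_hom K A (P (Suc n)) (P n) (d n)"
  and \<epsilon>_hom: "right_hom K A (P 0) M \<epsilon>"
  and \<epsilon>_surj: "\<epsilon> ` carrier (P 0) = carrier M"
  using resolution by (auto simp: projective_resolution_def rhom_iff)

lemma d_closed [simp]: "x \<in> carrier (P (Suc n)) \<Longrightarrow> d n x \<in> carrier (P n)"
  by (rule right_homD(2)[OF d_hom])

lemma \<epsilon>_closed [simp]: "x \<in> carrier (P 0) \<Longrightarrow> \<epsilon> x \<in> carrier M"
  by (rule right_homD(2)[OF \<epsilon>_hom])

text \<open>
  The kernel of the map that leaves degree \<open>n\<close>, which for \<open>n = 0\<close> is the augmentation. Exactness then reads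
  the same in all degrees (\<open>cycle_iff\<close>).
\<close>

definition cycle :: "nat \<Rightarrow> 'p \<Rightarrow> bool" where
  "cycle n x \<longleftrightarrow> x \<in> carrier (P n) \<and> (case n of 0 \<Rightarrow> \<epsilon> x = \<zero>\<^bsub>M\<^esub> | Suc m \<Rightarrow> d m x = \<zero>\<^bsub>P m\<^esub>)"

lemma cycle_iff: "cycle n x \<longleftrightarrow> x \<in> d n ` carrier (P (Suc n))"
proof -
  have "d 0 ` carrier (P (Suc 0)) = a_kernel (P 0) M \<epsilon>"
    "\<And>n. d (Suc n) ` carrier (P (Suc (Suc n))) = a_kernel (P (Suc n)) (P n) (d n)"
    using resolution by (simp_all add: projective_resolution_def One_nat_def)
  then show ?thesis by (cases n) (auto simp: cycle_def a_kernel_def')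
qed

lemma d_d: "x \<in> carrier (P (Suc (Suc n))) \<Longrightarrow> d n (d (Suc n) x) = \<zero>\<^bsub>P n\<^esub>"
  using cycle_iff[of "Suc n" "d (Suc n) x"] by (simp add: cycle_def)

lemma \<epsilon>_d: "x \<in> carrier (P (Suc 0)) \<Longrightarrow> \<epsilon> (d 0 x) = \<zero>\<^bsub>M\<^esub>"
  using cycle_iff[of 0 "d 0 x"] by (simp add: cycle_def)

lemmas d_minus = linear_map_minus[OF P.M.abelian_group_axioms P.M.abelian_group_axioms right_homD(1)[OF d_hom]]
lemmas d_add = linear_mapD(2)[OF right_homD(1)[OF d_hom]]
lemmas d_smult = linear_mapD(3)[OF right_homD(1)[OF d_hom]]
lemmas d_zero = linear_map_zero[OF P.M.abelian_group_axioms P.M.abelian_group_axioms right_homD(1)[OF d_hom]]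
lemmas \<epsilon>_minus = linear_map_minus[OF P.M.abelian_group_axioms M.M.abelian_group_axioms right_homD(1)[OF \<epsilon>_hom]]
lemmas \<epsilon>_add = linear_mapD(2)[OF right_homD(1)[OF \<epsilon>_hom]]
lemmas \<epsilon>_smult = linear_mapD(3)[OF right_homD(1)[OF \<epsilon>_hom]]
lemmas \<epsilon>_zero = linear_map_zero[OF P.M.abelian_group_axioms M.M.abelian_group_axioms right_homD(1)[OF \<epsilon>_hom]]

end

text \<open>
  The comparison theorem for maps that need not be linear over \<open>A\<close>. A family \<open>\<mu>\<close> is prescribed whose failure
  to be a chain map over \<open>h\<close> is linear, and it is corrected by linear maps \<open>\<nu>\<close>: each failure takes values in
  cycles and can be lifted, since its source is projective. For \<open>\<mu> = 0\<close> this is the usual theorem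
  (\<open>comparison_right_hom\<close>); with derivation-like \<open>\<mu>\<close> and \<open>h\<close> it lifts the action of a derivation.
\<close>

theorem comparison:
  assumes "resolution K A M P d \<epsilon>" and "resolution K A M' P' d' \<epsilon>'"
    and h: "linear_map K M M' h" and \<mu>: "\<And>n. linear_map K (P n) (P' n) (\<mu> n)"
    and defect_0: "right_hom K A (P 0) M' (\<lambda>x. h (\<epsilon> x) \<ominus>\<^bsub>M'\<^esub> \<epsilon>' (\<mu> 0 x))"
    and defect_Suc: "\<And>n. right_hom K A (P (Suc n)) (P' n) (\<lambda>x. \<mu> n (d n x) \<ominus>\<^bsub>P' n\<^esub> d' n (\<mu> (Suc n) x))"
  obtains \<nu> where "\<And>n. right_hom K A (P n) (P' n) (\<nu> n)"
    "\<And>x. x \<in> carrier (P 0) \<Longrightarrow> \<epsilon>' (\<mu> 0 x \<oplus>\<^bsub>P' 0\<^esub> \<nu> 0 x) = h (\<epsilon> x)"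
    "\<And>n x. x \<in> carrier (P (Suc n)) \<Longrightarrow>
       d' n (\<mu> (Suc n) x \<oplus>\<^bsub>P' (Suc n)\<^esub> \<nu> (Suc n) x) = \<mu> n (d n x) \<oplus>\<^bsub>P' n\<^esub> \<nu> n (d n x)"
proof -
  interpret R: resolution K A M P d \<epsilon> by fact
  interpret R': resolution K A M' P' d' \<epsilon>' by fact
  have \<mu>_mem [simp]: "x \<in> carrier (P n) \<Longrightarrow> \<mu> n x \<in> carrier (P' n)" for n x
    using linear_mapD(1)[OF \<mu>] .
  have h_mem [simp]: "x \<in> carrier M \<Longrightarrow> h x \<in> carrier M'" for x
    using linear_mapD(1)[OF h] .
  \<comment> \<open>Invariant of the recursion: the next failure consists of cycles of the target resolution.\<close>
  define good where "good n \<nu> \<longleftrightarrow> right_hom K A (P n) (P' n) \<nu> \<and>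
      (n = 0 \<longrightarrow> (\<forall>x\<in>carrier (P 0). \<epsilon>' (\<mu> 0 x \<oplus>\<^bsub>P' 0\<^esub> \<nu> x) = h (\<epsilon> x))) \<and>
      (\<forall>x\<in>carrier (P (Suc n)). R'.cycle n (\<mu> n (d n x) \<oplus>\<^bsub>P' n\<^esub> \<nu> (d n x)))" for n \<nu>
  define next_ok where "next_ok n \<nu> \<nu>' \<longleftrightarrow> (\<forall>x\<in>carrier (P (Suc n)).
      d' n (\<mu> (Suc n) x \<oplus>\<^bsub>P' (Suc n)\<^esub> \<nu>' x) = \<mu> n (d n x) \<oplus>\<^bsub>P' n\<^esub> \<nu> (d n x))" for n \<nu> \<nu>'
  have "\<exists>\<nu>. good 0 \<nu>"
  proof -
    have "h (\<epsilon> x) \<ominus>\<^bsub>M'\<^esub> \<epsilon>' (\<mu> 0 x) \<in> \<epsilon>' ` carrier (P' 0)" if "x \<in> carrier (P 0)" for x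
      using that by (simp add: R'.\<epsilon>_surj)
    then obtain \<nu> where \<nu>: "right_hom K A (P 0) (P' 0) \<nu>"
      "\<And>x. x \<in> carrier (P 0) \<Longrightarrow> \<epsilon>' (\<nu> x) = h (\<epsilon> x) \<ominus>\<^bsub>M'\<^esub> \<epsilon>' (\<mu> 0 x)"
      using projective_lifting[OF R.P_rmodule R.P_projective R'.P_rmodule R'.M.k_rmodule_axioms
          R'.\<epsilon>_hom defect_0] by metis
    have \<nu>_mem: "x \<in> carrier (P 0) \<Longrightarrow> \<nu> x \<in> carrier (P' 0)" for x by (rule right_homD(2)[OF \<nu>(1)])
    have eq: "\<epsilon>' (\<mu> 0 x \<oplus>\<^bsub>P' 0\<^esub> \<nu> x) = h (\<epsilon> x)" if "x \<in> carrier (P 0)" for x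
      using that \<nu>(2)[OF that] \<nu>_mem
      by (simp add: R'.\<epsilon>_add R'.M.M.a_comm[of "\<epsilon>' (\<mu> 0 x)"] diff_add_self[OF R'.M.M.abelian_group_axioms])
    have "R'.cycle 0 (\<mu> 0 (d 0 x) \<oplus>\<^bsub>P' 0\<^esub> \<nu> (d 0 x))" if "x \<in> carrier (P (Suc 0))" for x
      using that eq[of "d 0 x"] \<nu>_mem
      by (simp add: R'.cycle_def R.\<epsilon>_d
          linear_map_zero[OF R.M.M.abelian_group_axioms R'.M.M.abelian_group_axioms h])
    with \<nu>(1) eq have "good 0 \<nu>" by (simp add: good_def)
    then show ?thesis by blast
  qed
  moreover have "\<exists>\<nu>'. good (Suc n) \<nu>' \<and> next_ok n \<nu> \<nu>'" if good: "good n \<nu>" for n \<nu>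
  proof -
    from good have \<nu>: "right_hom K A (P n) (P' n) \<nu>"
      and cyc: "\<And>x. x \<in> carrier (P (Suc n)) \<Longrightarrow> R'.cycle n (\<mu> n (d n x) \<oplus>\<^bsub>P' n\<^esub> \<nu> (d n x))"
      by (simp_all add: good_def)
    have \<nu>_mem: "x \<in> carrier (P n) \<Longrightarrow> \<nu> x \<in> carrier (P' n)" for x by (rule right_homD(2)[OF \<nu>])
    let ?f = "\<lambda>x. (\<mu> n (d n x) \<ominus>\<^bsub>P' n\<^esub> d' n (\<mu> (Suc n) x)) \<oplus>\<^bsub>P' n\<^esub> \<nu> (d n x)"
    have f: "right_hom K A (P (Suc n)) (P' n) ?f"
      by (intro right_hom_add R'.P_rmodule defect_Suc right_hom_comp[OF R.d_hom \<nu>])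
    have f_eq: "?f x = (\<mu> n (d n x) \<oplus>\<^bsub>P' n\<^esub> \<nu> (d n x)) \<ominus>\<^bsub>P' n\<^esub> d' n (\<mu> (Suc n) x)"
      if "x \<in> carrier (P (Suc n))" for x
      using that \<nu>_mem by (simp add: a_minus_def R'.P.M.a_ac)
    have im: "?f x \<in> d' n ` carrier (P' (Suc n))" if x: "x \<in> carrier (P (Suc n))" for x
    proof -
      obtain y where y: "y \<in> carrier (P' (Suc n))" "\<mu> n (d n x) \<oplus>\<^bsub>P' n\<^esub> \<nu> (d n x) = d' n y"
        using cyc[OF x] unfolding R'.cycle_iff by blast
      then have "?f x = d' n (y \<ominus>\<^bsub>P' (Suc n)\<^esub> \<mu> (Suc n) x)"
        using x f_eq[OF x] by (simp add: R'.d_minus)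
      then show ?thesis using x y(1) by (intro image_eqI[of _ _ "y \<ominus>\<^bsub>P' (Suc n)\<^esub> \<mu> (Suc n) x"]) simp_all
    qed
    obtain \<nu>' where \<nu>': "right_hom K A (P (Suc n)) (P' (Suc n)) \<nu>'"
      "\<And>x. x \<in> carrier (P (Suc n)) \<Longrightarrow> d' n (\<nu>' x) = ?f x"
      using projective_lifting[OF R.P_rmodule R.P_projective R'.P_rmodule R'.P_rmodule R'.d_hom f im] by metis
    have \<nu>'_mem: "x \<in> carrier (P (Suc n)) \<Longrightarrow> \<nu>' x \<in> carrier (P' (Suc n))" for x
      by (rule right_homD(2)[OF \<nu>'(1)])
    have eq: "d' n (\<mu> (Suc n) x \<oplus>\<^bsub>P' (Suc n)\<^esub> \<nu>' x) = \<mu> n (d n x) \<oplus>\<^bsub>P' n\<^esub> \<nu> (d n x)"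
      if x: "x \<in> carrier (P (Suc n))" for x
    proof -
      have "d' n (\<mu> (Suc n) x \<oplus>\<^bsub>P' (Suc n)\<^esub> \<nu>' x) = ?f x \<oplus>\<^bsub>P' n\<^esub> d' n (\<mu> (Suc n) x)"
        using x \<nu>'_mem by (simp add: R'.d_add \<nu>'(2) \<nu>_mem R'.P.M.a_comm[where y = "d' n (\<mu> (Suc n) x)"])
      then show ?thesis
        using x \<nu>_mem f_eq[OF x] by (simp add: diff_add_self[OF R'.P.M.abelian_group_axioms])
    qed
    have "R'.cycle (Suc n) (\<mu> (Suc n) (d (Suc n) x) \<oplus>\<^bsub>P' (Suc n)\<^esub> \<nu>' (d (Suc n) x))"
      if x: "x \<in> carrier (P (Suc (Suc n)))" for x
      using x eq[of "d (Suc n) x"] \<nu>'_mem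
      by (simp add: R'.cycle_def R.d_d linear_map_zero[OF R.P.M.abelian_group_axioms R'.P.M.abelian_group_axioms \<mu>]
          linear_map_zero[OF R.P.M.abelian_group_axioms R'.P.M.abelian_group_axioms right_homD(1)[OF \<nu>]])
    with \<nu>'(1) eq have "good (Suc n) \<nu>' \<and> next_ok n \<nu> \<nu>'" by (simp add: good_def next_ok_def)
    then show ?thesis by blast
  qed
  ultimately obtain \<nu> where \<nu>: "\<And>n. good n (\<nu> n)" "\<And>n. next_ok n (\<nu> n) (\<nu> (Suc n))"
    using dependent_nat_choice[of good next_ok] by metis
  show thesis
    by (rule that[of \<nu>]) (use \<nu>(1) \<nu>(2) \<nu>(1)[of 0] in \<open>simp_all add: good_def next_ok_def\<close>)
qed

corollary comparison_right_hom:
  assumes res: "resolution K A M P d \<epsilon>" and res': "resolution K A M' P' d' \<epsilon>'" and h: "right_hom K A M M' h"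
  obtains l where "\<And>n. right_hom K A (P n) (P' n) (l n)"
    "\<And>x. x \<in> carrier (P 0) \<Longrightarrow> \<epsilon>' (l 0 x) = h (\<epsilon> x)"
    "\<And>n x. x \<in> carrier (P (Suc n)) \<Longrightarrow> d' n (l (Suc n) x) = l n (d n x)"
proof -
  interpret R: resolution K A M P d \<epsilon> by fact
  interpret R': resolution K A M' P' d' \<epsilon>' by fact
  have hM: "x \<in> carrier M \<Longrightarrow> h x \<in> carrier M'" for x using right_homD(2)[OF h] .
  obtain l where l: "\<And>n. right_hom K A (P n) (P' n) (l n)"
    and l_0: "\<And>x. x \<in> carrier (P 0) \<Longrightarrow> \<epsilon>' (\<zero>\<^bsub>P' 0\<^esub> \<oplus>\<^bsub>P' 0\<^esub> l 0 x) = h (\<epsilon> x)"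
    and l_Suc: "\<And>n x. x \<in> carrier (P (Suc n)) \<Longrightarrow>
       d' n (\<zero>\<^bsub>P' (Suc n)\<^esub> \<oplus>\<^bsub>P' (Suc n)\<^esub> l (Suc n) x) = \<zero>\<^bsub>P' n\<^esub> \<oplus>\<^bsub>P' n\<^esub> l n (d n x)"
  proof (rule comparison[OF res res' right_homD(1)[OF h], of "\<lambda>n x. \<zero>\<^bsub>P' n\<^esub>"])
    show "linear_map K (P n) (P' n) (\<lambda>x. \<zero>\<^bsub>P' n\<^esub>)" for n by (rule linear_map_zero_fun[OF R'.P.M.module_axioms])
    show "right_hom K A (P 0) M' (\<lambda>x. h (\<epsilon> x) \<ominus>\<^bsub>M'\<^esub> \<epsilon>' \<zero>\<^bsub>P' 0\<^esub>)"
    proof (rule right_hom_cong[OF R.P_rmodule, THEN iffD2])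
      show "right_hom K A (P 0) M' (\<lambda>x. h (\<epsilon> x))" by (rule right_hom_comp[OF R.\<epsilon>_hom h])
      show "h (\<epsilon> x) \<ominus>\<^bsub>M'\<^esub> \<epsilon>' \<zero>\<^bsub>P' 0\<^esub> = h (\<epsilon> x)" if "x \<in> carrier (P 0)" for x
        using that hM by (simp only: R'.\<epsilon>_zero R.\<epsilon>_closed diff_zero[OF R'.M.M.abelian_group_axioms])
    qed
    show "right_hom K A (P (Suc n)) (P' n) (\<lambda>x. \<zero>\<^bsub>P' n\<^esub> \<ominus>\<^bsub>P' n\<^esub> d' n \<zero>\<^bsub>P' (Suc n)\<^esub>)" for n
      unfolding R'.d_zero diff_zero[OF R'.P.M.abelian_group_axioms R'.P.M.zero_closed]
      by (rule right_hom_zero[OF R'.P_rmodule])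
  qed (rule that)
  have mem: "x \<in> carrier (P n) \<Longrightarrow> l n x \<in> carrier (P' n)" for n x by (rule right_homD(2)[OF l])
  show thesis
    by (rule that[of l]) (use l l_0 l_Suc in \<open>simp_all add: mem\<close>)
qed

text \<open>
  Degree by degree, what is left of \<open>l\<close> after subtraction of \<open>\<sigma> d\<close> consists of cycles, hence lifts along \<open>d'\<close>.
\<close>

theorem null_homotopy:
  assumes "resolution K A M P d \<epsilon>" and "resolution K A M' P' d' \<epsilon>'"
    and l: "\<And>n. right_hom K A (P n) (P' n) (l n)"
    and l_0: "\<And>x. x \<in> carrier (P 0) \<Longrightarrow> \<epsilon>' (l 0 x) = \<zero>\<^bsub>M'\<^esub>"
    and l_Suc: "\<And>n x. x \<in> carrier (P (Suc n)) \<Longrightarrow> d' n (l (Suc n) x) = l n (d n x)"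
  obtains \<sigma> where "\<And>n. right_hom K A (P n) (P' (Suc n)) (\<sigma> n)"
    "\<And>n x. x \<in> carrier (P (Suc n)) \<Longrightarrow> l (Suc n) x = d' (Suc n) (\<sigma> (Suc n) x) \<oplus>\<^bsub>P' (Suc n)\<^esub> \<sigma> n (d n x)"
proof -
  interpret R: resolution K A M P d \<epsilon> by fact
  interpret R': resolution K A M' P' d' \<epsilon>' by fact
  have l_mem [simp]: "x \<in> carrier (P n) \<Longrightarrow> l n x \<in> carrier (P' n)" for n x
    by (rule right_homD(2)[OF l])
  define good where "good n \<sigma> \<longleftrightarrow> right_hom K A (P n) (P' (Suc n)) \<sigma> \<and>
      (\<forall>x\<in>carrier (P (Suc n)). d' n (l (Suc n) x \<ominus>\<^bsub>P' (Suc n)\<^esub> \<sigma> (d n x)) = \<zero>\<^bsub>P' n\<^esub>)" for n \<sigma>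
  define next_ok where "next_ok n \<sigma> \<sigma>' \<longleftrightarrow> (\<forall>x\<in>carrier (P (Suc n)).
      l (Suc n) x = d' (Suc n) (\<sigma>' x) \<oplus>\<^bsub>P' (Suc n)\<^esub> \<sigma> (d n x))" for n \<sigma> \<sigma>'
  have "\<exists>\<sigma>. good 0 \<sigma>"
  proof -
    have "l 0 x \<in> d' 0 ` carrier (P' (Suc 0))" if "x \<in> carrier (P 0)" for x
      unfolding R'.cycle_iff[symmetric] using that by (simp add: R'.cycle_def l_0)
    then obtain \<sigma> where \<sigma>: "right_hom K A (P 0) (P' (Suc 0)) \<sigma>"
      "\<And>x. x \<in> carrier (P 0) \<Longrightarrow> d' 0 (\<sigma> x) = l 0 x"
      using projective_lifting[OF R.P_rmodule R.P_projective R'.P_rmodule R'.P_rmodule R'.d_hom l] by metis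
    have \<sigma>_mem: "x \<in> carrier (P 0) \<Longrightarrow> \<sigma> x \<in> carrier (P' (Suc 0))" for x by (rule right_homD(2)[OF \<sigma>(1)])
    have "good 0 \<sigma>"
      using \<sigma>_mem by (simp add: good_def \<sigma> R'.d_minus l_Suc diff_eq_zero_iff[OF R'.P.M.abelian_group_axioms])
    then show ?thesis by blast
  qed
  moreover have "\<exists>\<sigma>'. good (Suc n) \<sigma>' \<and> next_ok n \<sigma> \<sigma>'" if good: "good n \<sigma>" for n \<sigma>
  proof -
    from good have \<sigma>: "right_hom K A (P n) (P' (Suc n)) \<sigma>"
      and zero: "\<And>x. x \<in> carrier (P (Suc n)) \<Longrightarrow> d' n (l (Suc n) x \<ominus>\<^bsub>P' (Suc n)\<^esub> \<sigma> (d n x)) = \<zero>\<^bsub>P' n\<^esub>"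
      by (simp_all add: good_def)
    have \<sigma>_mem: "x \<in> carrier (P n) \<Longrightarrow> \<sigma> x \<in> carrier (P' (Suc n))" for x by (rule right_homD(2)[OF \<sigma>])
    let ?f = "\<lambda>x. l (Suc n) x \<ominus>\<^bsub>P' (Suc n)\<^esub> \<sigma> (d n x)"
    have f: "right_hom K A (P (Suc n)) (P' (Suc n)) ?f"
      by (intro right_hom_diff R'.P_rmodule l right_hom_comp[OF R.d_hom \<sigma>])
    have im: "?f x \<in> d' (Suc n) ` carrier (P' (Suc (Suc n)))" if x: "x \<in> carrier (P (Suc n))" for x
      unfolding R'.cycle_iff[symmetric] using x zero[OF x] \<sigma>_mem by (simp add: R'.cycle_def)
    obtain \<sigma>' where \<sigma>': "right_hom K A (P (Suc n)) (P' (Suc (Suc n))) \<sigma>'"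
      "\<And>x. x \<in> carrier (P (Suc n)) \<Longrightarrow> d' (Suc n) (\<sigma>' x) = ?f x"
      using projective_lifting[OF R.P_rmodule R.P_projective R'.P_rmodule R'.P_rmodule R'.d_hom f im] by metis
    have \<sigma>'_mem: "x \<in> carrier (P (Suc n)) \<Longrightarrow> \<sigma>' x \<in> carrier (P' (Suc (Suc n)))" for x
      by (rule right_homD(2)[OF \<sigma>'(1)])
    have eq: "l (Suc n) x = d' (Suc n) (\<sigma>' x) \<oplus>\<^bsub>P' (Suc n)\<^esub> \<sigma> (d n x)" if "x \<in> carrier (P (Suc n))" for x
      using that \<sigma>_mem by (simp add: \<sigma>'(2) diff_add_self[OF R'.P.M.abelian_group_axioms])
    have "d' (Suc n) (l (Suc (Suc n)) x \<ominus>\<^bsub>P' (Suc (Suc n))\<^esub> \<sigma>' (d (Suc n) x)) = \<zero>\<^bsub>P' (Suc n)\<^esub>"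
      if x: "x \<in> carrier (P (Suc (Suc n)))" for x
    proof -
      have "d' (Suc n) (\<sigma>' (d (Suc n) x)) = l (Suc n) (d (Suc n) x)"
        using x eq[of "d (Suc n) x"] \<sigma>'_mem
        by (simp add: R.d_d linear_map_zero[OF R.P.M.abelian_group_axioms R'.P.M.abelian_group_axioms right_homD(1)[OF \<sigma>]])
      then show ?thesis
        using x \<sigma>'_mem by (simp add: R'.d_minus l_Suc diff_eq_zero_iff[OF R'.P.M.abelian_group_axioms])
    qed
    with \<sigma>'(1) eq have "good (Suc n) \<sigma>' \<and> next_ok n \<sigma> \<sigma>'" by (simp add: good_def next_ok_def)
    then show ?thesis by blast
  qed
  ultimately obtain \<sigma> where \<sigma>: "\<And>n. good n (\<sigma> n)" "\<And>n. next_ok n (\<sigma> n) (\<sigma> (Suc n))"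
    using dependent_nat_choice[of good next_ok] by metis
  show thesis
    by (rule that[of \<sigma>]) (use \<sigma> in \<open>simp_all add: good_def next_ok_def\<close>)
qed

text \<open>
  The \<open>(m+1)\<close>-cycles of any resolution of \<open>M\<close> form a direct summand as soon as \<open>M\<close> is a retract of a module \<open>M'\<close>
  with a resolution that vanishes in degree \<open>m + 2\<close>. The two comparison maps compose to an endomorphism of
  \<open>P\<close> that vanishes in degree \<open>m + 2\<close> and is homotopic to the identity by some \<open>\<sigma>\<close>. In that degree
  \<open>x = d \<sigma> x + \<sigma> d x\<close>, so \<open>d x = d \<sigma> (d x)\<close>, and \<open>\<rho> = d \<sigma>\<close> fixes the boundaries, which are the cycles.
\<close>

theorem cycles_retract:
  assumes res: "resolution K A M P d \<epsilon>" and res': "resolution K A M' P' d' \<epsilon>'"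
    and h: "right_hom K A M M' h" "right_hom K A M' M h'" "\<And>x. x \<in> carrier M \<Longrightarrow> h' (h x) = x"
    and zero: "carrier (P' (Suc (Suc m))) = {\<zero>\<^bsub>P' (Suc (Suc m))\<^esub>}"
  obtains \<rho> where "right_hom K A (P (Suc m)) (P (Suc m)) \<rho>"
    "\<And>x. x \<in> carrier (P (Suc m)) \<Longrightarrow> d m (\<rho> x) = \<zero>\<^bsub>P m\<^esub>"
    "\<And>x. \<lbrakk>x \<in> carrier (P (Suc m)); d m x = \<zero>\<^bsub>P m\<^esub>\<rbrakk> \<Longrightarrow> \<rho> x = x"
proof -
  interpret R: resolution K A M P d \<epsilon> by fact
  interpret R': resolution K A M' P' d' \<epsilon>' by fact
  obtain l where l: "\<And>n. right_hom K A (P n) (P' n) (l n)"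
    and l_0: "\<And>x. x \<in> carrier (P 0) \<Longrightarrow> \<epsilon>' (l 0 x) = h (\<epsilon> x)"
    and l_Suc: "\<And>n x. x \<in> carrier (P (Suc n)) \<Longrightarrow> d' n (l (Suc n) x) = l n (d n x)"
  proof (rule comparison_right_hom[OF res res' h(1)])
  qed (rule that)
  obtain l' where l': "\<And>n. right_hom K A (P' n) (P n) (l' n)"
    and l'_0: "\<And>x. x \<in> carrier (P' 0) \<Longrightarrow> \<epsilon> (l' 0 x) = h' (\<epsilon>' x)"
    and l'_Suc: "\<And>n x. x \<in> carrier (P' (Suc n)) \<Longrightarrow> d n (l' (Suc n) x) = l' n (d' n x)"
  proof (rule comparison_right_hom[OF res' res h(2)])
  qed (rule that)
  have mem: "x \<in> carrier (P n) \<Longrightarrow> l n x \<in> carrier (P' n)" "y \<in> carrier (P' n) \<Longrightarrow> l' n y \<in> carrier (P n)" for n x y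
    by (rule right_homD(2)[OF l], assumption) (rule right_homD(2)[OF l'], assumption)
  obtain \<sigma> where \<sigma>: "\<And>n. right_hom K A (P n) (P (Suc n)) (\<sigma> n)"
    and homotopy: "\<And>n x. x \<in> carrier (P (Suc n)) \<Longrightarrow>
      x \<ominus>\<^bsub>P (Suc n)\<^esub> l' (Suc n) (l (Suc n) x) = d (Suc n) (\<sigma> (Suc n) x) \<oplus>\<^bsub>P (Suc n)\<^esub> \<sigma> n (d n x)"
  proof (rule null_homotopy[OF res res, of "\<lambda>n x. x \<ominus>\<^bsub>P n\<^esub> l' n (l n x)"])
    show "right_hom K A (P n) (P n) (\<lambda>x. x \<ominus>\<^bsub>P n\<^esub> l' n (l n x))" for n
      by (rule right_hom_diff[OF R.P_rmodule right_hom_id right_hom_comp[OF l l']])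
    show "\<epsilon> (x \<ominus>\<^bsub>P 0\<^esub> l' 0 (l 0 x)) = \<zero>\<^bsub>M\<^esub>" if "x \<in> carrier (P 0)" for x
      using that by (simp add: R.\<epsilon>_minus mem l_0 l'_0 h(3) diff_eq_zero_iff[OF R.M.M.abelian_group_axioms])
    show "d n (x \<ominus>\<^bsub>P (Suc n)\<^esub> l' (Suc n) (l (Suc n) x)) = d n x \<ominus>\<^bsub>P n\<^esub> l' n (l n (d n x))"
      if "x \<in> carrier (P (Suc n))" for n x
      using that by (simp add: R.d_minus mem l_Suc l'_Suc)
  qed (rule that)
  have \<sigma>_mem: "x \<in> carrier (P n) \<Longrightarrow> \<sigma> n x \<in> carrier (P (Suc n))" for n x by (rule right_homD(2)[OF \<sigma>])
  define \<rho> where "\<rho> x = d (Suc m) (\<sigma> (Suc m) x)" for x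
  have "\<rho> x = x" if x: "x \<in> carrier (P (Suc m))" "d m x = \<zero>\<^bsub>P m\<^esub>" for x
  proof -
    have "R.cycle (Suc m) x" using x by (simp add: R.cycle_def)
    then obtain y where y: "y \<in> carrier (P (Suc (Suc m)))" "x = d (Suc m) y" unfolding R.cycle_iff by blast
    let ?n = "Suc (Suc m)"
    have "l ?n y = \<zero>\<^bsub>P' ?n\<^esub>" using mem(1)[OF y(1)] zero by blast
    then have "l' ?n (l ?n y) = \<zero>\<^bsub>P ?n\<^esub>"
      by (simp add: linear_map_zero[OF R'.P.M.abelian_group_axioms R.P.M.abelian_group_axioms right_homD(1)[OF l']])
    then have "y = d ?n (\<sigma> ?n y) \<oplus>\<^bsub>P ?n\<^esub> \<sigma> (Suc m) x"
      using homotopy[OF y(1)] y by (simp add: diff_zero[OF R.P.M.abelian_group_axioms])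
    then have "d (Suc m) y = d (Suc m) (d ?n (\<sigma> ?n y) \<oplus>\<^bsub>P ?n\<^esub> \<sigma> (Suc m) x)" by simp
    also have "\<dots> = \<rho> x"
      using y x(1) \<sigma>_mem by (simp add: R.d_add R.d_d \<rho>_def del: y(2))
    finally show ?thesis using y(2) by simp
  qed
  moreover have "right_hom K A (P (Suc m)) (P (Suc m)) \<rho>"
    unfolding \<rho>_def[abs_def] by (rule right_hom_comp[OF \<sigma> R.d_hom])
  moreover have "d m (\<rho> x) = \<zero>\<^bsub>P m\<^esub>" if "x \<in> carrier (P (Suc m))" for x
    using that \<sigma>_mem by (simp add: \<rho>_def R.d_d)
  ultimately show thesis by (intro that)
qed


section \<open>The bimodule structure of Ext\<close>

text \<open>
  The degree of the Ext group is written \<open>Suc m\<close>: in degree \<open>0\<close> the coboundaries have another form.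
\<close>

locale bimodule_resolution = resolution K A M P d \<epsilon> + M: k_bimodule K A M + N: k_bimodule K A N
  for K :: "('k, 'r) ring_scheme" and A :: "('k, 'a, 's) module_scheme"
    and M :: "('k, 'a, 'm, 'x) bimodule_scheme"
    and P :: "nat \<Rightarrow> ('k, 'a, 'p) rmodule" and d :: "nat \<Rightarrow> 'p \<Rightarrow> 'p" and \<epsilon> :: "'p \<Rightarrow> 'm"
    and N :: "('k, 'a, 'n, 'y) bimodule_scheme" +
  fixes m :: nat
begin

abbreviation Z where "Z \<equiv> fun_space (carrier (P (Suc m))) N (ext_cocycles K A P d N (Suc m))"
abbreviation U where "U \<equiv> ext_coboundaries K A P d N (Suc m)"
abbreviation E where "E \<equiv> ext_bimodule K A P d \<epsilon> M N (Suc m)"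

definition cocycle :: "('p \<Rightarrow> 'n) \<Rightarrow> bool" where
  "cocycle f \<longleftrightarrow> right_hom K A (P (Suc m)) N f \<and> (\<forall>x\<in>carrier (P (Suc (Suc m))). f (d (Suc m) x) = \<zero>\<^bsub>N\<^esub>)"

lemma cocycleD:
  assumes "cocycle f"
  shows "right_hom K A (P (Suc m)) N f" "x \<in> carrier (P (Suc m)) \<Longrightarrow> f x \<in> carrier N"
    "x \<in> carrier (P (Suc (Suc m))) \<Longrightarrow> f (d (Suc m) x) = \<zero>\<^bsub>N\<^esub>"
  using assms right_homD(2) by (auto simp: cocycle_def)

lemma cocycle_cong: "(\<And>x. x \<in> carrier (P (Suc m)) \<Longrightarrow> f x = g x) \<Longrightarrow> cocycle f \<longleftrightarrow> cocycle g"
  using right_hom_cong[OF P_rmodule, of "Suc m" f g] by (auto simp: cocycle_def)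

lemma ext_cocycles_iff:
  "f \<in> ext_cocycles K A P d N (Suc m) \<longleftrightarrow> f \<in> extensional (carrier (P (Suc m))) \<and> cocycle f"
  by (auto simp: ext_cocycles_def rhom_iff cocycle_def)

lemma ext_cocycles_subset: "ext_cocycles K A P d N (Suc m) \<subseteq> carrier (P (Suc m)) \<rightarrow>\<^sub>E carrier N"
  by (rule subsetI) (simp add: ext_cocycles_iff PiE_iff cocycleD(2))

lemma cocycle_add: "\<lbrakk>cocycle f; cocycle g\<rbrakk> \<Longrightarrow> cocycle (\<lambda>x. f x \<oplus>\<^bsub>N\<^esub> g x)"
  using right_hom_add[OF N.k_rmodule_axioms, of "P (Suc m)" f g] by (auto simp: cocycle_def)

lemma cocycle_smult: "\<lbrakk>k \<in> carrier K; cocycle f\<rbrakk> \<Longrightarrow> cocycle (\<lambda>x. k \<odot>\<^bsub>N\<^esub> f x)"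
  using right_hom_smult[OF N.k_rmodule_axioms, of "P (Suc m)" f k] by (auto simp: cocycle_def)

lemma cocycle_zero: "cocycle (\<lambda>x. \<zero>\<^bsub>N\<^esub>)"
  using right_hom_zero[OF N.k_rmodule_axioms] by (auto simp: cocycle_def)

lemma cocycle_lact:
  assumes a: "a \<in> carrier A" and f: "cocycle f"
  shows "cocycle (\<lambda>x. lact N a (f x))"
proof -
  have "linear_map K (P (Suc m)) N (\<lambda>x. lact N a (f x))"
    by (rule linear_map_comp[OF right_homD(1)[OF cocycleD(1)[OF f]] N.linear_map_lact_right[OF a]])
  then show ?thesis
    using a cocycleD(2)[OF f] right_homD(3)[OF cocycleD(1)[OF f]] cocycleD(3)[OF f]
    by (simp add: cocycle_def right_hom_def N.lact_ract N.lact_zero_right)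
qed

lemma cocycle_coboundary:
  assumes "right_hom K A (P m) N g"
  shows "cocycle (\<lambda>x. g (d m x))"
  using right_hom_comp[OF d_hom assms]
    linear_map_zero[OF P.M.abelian_group_axioms N.M.abelian_group_axioms right_homD(1)[OF assms]]
  by (auto simp: cocycle_def d_d)

lemma restrict_cocycle: "cocycle f \<Longrightarrow> restrict f (carrier (P (Suc m))) \<in> carrier Z"
  using cocycle_cong[of "restrict f (carrier (P (Suc m)))" f] by (simp add: ext_cocycles_iff)

lemma module_Z: "module K Z"
proof (rule module_fun_space[OF N.M.module_axioms])
  show "ext_cocycles K A P d N (Suc m) \<subseteq> carrier (P (Suc m)) \<rightarrow>\<^sub>E carrier N"
    by (rule ext_cocycles_subset)
  show "(\<lambda>x\<in>carrier (P (Suc m)). \<zero>\<^bsub>N\<^esub>) \<in> ext_cocycles K A P d N (Suc m)"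
    using restrict_cocycle[OF cocycle_zero] by simp
  show "(\<lambda>x\<in>carrier (P (Suc m)). f x \<oplus>\<^bsub>N\<^esub> g x) \<in> ext_cocycles K A P d N (Suc m)"
    if "f \<in> ext_cocycles K A P d N (Suc m)" "g \<in> ext_cocycles K A P d N (Suc m)" for f g
    using restrict_cocycle[OF cocycle_add, of f g] that by (simp add: ext_cocycles_iff)
  show "(\<lambda>x\<in>carrier (P (Suc m)). k \<odot>\<^bsub>N\<^esub> f x) \<in> ext_cocycles K A P d N (Suc m)"
    if "k \<in> carrier K" "f \<in> ext_cocycles K A P d N (Suc m)" for k f
    using restrict_cocycle[OF cocycle_smult, of k f] that by (simp add: ext_cocycles_iff)
qed

lemma U_iff:
  "f \<in> U \<longleftrightarrow> f \<in> extensional (carrier (P (Suc m))) \<and>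
     (\<exists>g. right_hom K A (P m) N g \<and> (\<forall>x\<in>carrier (P (Suc m)). f x = g (d m x)))"
proof
  assume "f \<in> U"
  then show "f \<in> extensional (carrier (P (Suc m))) \<and>
     (\<exists>g. right_hom K A (P m) N g \<and> (\<forall>x\<in>carrier (P (Suc m)). f x = g (d m x)))"
    by (auto simp: ext_coboundaries_def rhom_iff)
next
  assume f: "f \<in> extensional (carrier (P (Suc m))) \<and>
     (\<exists>g. right_hom K A (P m) N g \<and> (\<forall>x\<in>carrier (P (Suc m)). f x = g (d m x)))"
  then obtain g where g: "right_hom K A (P m) N g" "\<And>x. x \<in> carrier (P (Suc m)) \<Longrightarrow> f x = g (d m x)" by blast
  have "restrict g (carrier (P m)) \<in> rhom K A (P m) N"
    by (rule restrict_in_rhom[OF P_rmodule g(1)])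
  moreover have "f = (\<lambda>x\<in>carrier (P (Suc m)). restrict g (carrier (P m)) (d m x))"
    using f g(2) by (intro extensionalityI[of f "carrier (P (Suc m))"]) auto
  ultimately show "f \<in> U" unfolding ext_coboundaries_def nat.case
    by (intro image_eqI[where x = "restrict g (carrier (P m))"])
qed

lemma submodule_U: "submodule U K Z"
proof (rule submodule_of_closed[OF module_Z])
  show "U \<subseteq> carrier Z"
  proof
    fix f assume "f \<in> U"
    then obtain g where f: "f \<in> extensional (carrier (P (Suc m)))"
      and g: "right_hom K A (P m) N g" "\<And>x. x \<in> carrier (P (Suc m)) \<Longrightarrow> f x = g (d m x)"
      unfolding U_iff by blast
    have "cocycle f"
      using cocycle_coboundary[OF g(1)] cocycle_cong[of f "\<lambda>x. g (d m x)", OF g(2)] by simp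
    with f show "f \<in> carrier Z" by (simp add: ext_cocycles_iff)
  qed
  show "\<zero>\<^bsub>Z\<^esub> \<in> U"
    unfolding U_iff using right_hom_zero[OF N.k_rmodule_axioms] by auto
  show "f \<oplus>\<^bsub>Z\<^esub> g \<in> U" if "f \<in> U" "g \<in> U" for f g
    using that right_hom_add[OF N.k_rmodule_axioms] unfolding U_iff by fastforce
  show "k \<odot>\<^bsub>Z\<^esub> f \<in> U" if "k \<in> carrier K" "f \<in> U" for k f
    using that right_hom_smult[OF N.k_rmodule_axioms] unfolding U_iff by fastforce
qed

sublocale Q: quotient_space K Z U by (rule quotient_spaceI[OF module_Z submodule_U])

text \<open>
  The class of a cocycle that may be defined anywhere. Cocycles in \<open>ext_cocycles\<close> are undefined outside the
  carrier, which formulas such as \<open>\<lambda>x. lact N a (f x)\<close> do not respect.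
\<close>

definition cl :: "('p \<Rightarrow> 'n) \<Rightarrow> ('p \<Rightarrow> 'n) set" where
  "cl f = Q.cls (restrict f (carrier (P (Suc m))))"

lemma E_simps:
  "carrier E = carrier Q.Q" "add E = add Q.Q" "zero E = zero Q.Q" "smult E = smult Q.Q"
  by (simp_all add: ext_bimodule_def Let_def)

lemma cl_cong: "(\<And>x. x \<in> carrier (P (Suc m)) \<Longrightarrow> f x = g x) \<Longrightarrow> cl f = cl g"
  unfolding cl_def by (metis restrict_ext)

lemma cl_cong_simp: "(\<And>x. x \<in> carrier (P (Suc m)) =simp=> f x = g x) \<Longrightarrow> cl f = cl g"
  unfolding simp_implies_def by (rule cl_cong)

lemma cl_closed [simp]: "cocycle f \<Longrightarrow> cl f \<in> carrier E"
  using Q.cls_in[OF restrict_cocycle] by (simp add: E_simps cl_def)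

lemma E_cases:
  assumes "S \<in> carrier E"
  obtains f where "cocycle f" "S = cl f"
proof -
  from assms obtain f where f: "f \<in> carrier Z" "S = Q.cls f" unfolding E_simps by (rule Q.QE)
  then have "cl f = Q.cls f" by (simp add: cl_def ext_cocycles_iff extensional_restrict)
  with f show thesis by (intro that[of f]) (simp_all add: ext_cocycles_iff)
qed

lemma cl_eq_iff:
  assumes "cocycle f" "cocycle g"
  shows "cl f = cl g \<longleftrightarrow>
    (\<exists>h. right_hom K A (P m) N h \<and> (\<forall>x\<in>carrier (P (Suc m)). f x \<ominus>\<^bsub>N\<^esub> g x = h (d m x)))"
proof -
  have "restrict f (carrier (P (Suc m))) \<ominus>\<^bsub>Z\<^esub> restrict g (carrier (P (Suc m)))
      = (\<lambda>x\<in>carrier (P (Suc m)). f x \<ominus>\<^bsub>N\<^esub> g x)"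
  proof -
    from fun_space_minus[OF N.M.module_axioms module_Z ext_cocycles_subset] restrict_cocycle[OF assms(1)] restrict_cocycle[OF assms(2)]
    show ?thesis by (auto cong: restrict_cong)
  qed
  then show ?thesis
    unfolding cl_def Q.cls_eq_iff[OF restrict_cocycle[OF assms(1)] restrict_cocycle[OF assms(2)]] U_iff
    by auto
qed

lemma cl_add: "\<lbrakk>cocycle f; cocycle g\<rbrakk> \<Longrightarrow> cl f \<oplus>\<^bsub>E\<^esub> cl g = cl (\<lambda>x. f x \<oplus>\<^bsub>N\<^esub> g x)"
  using Q.cls_add[OF restrict_cocycle restrict_cocycle, of f g]
  by (simp add: E_simps cl_def cong: restrict_cong)

lemma cl_smult: "\<lbrakk>k \<in> carrier K; cocycle f\<rbrakk> \<Longrightarrow> k \<odot>\<^bsub>E\<^esub> cl f = cl (\<lambda>x. k \<odot>\<^bsub>N\<^esub> f x)"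
  using Q.cls_smult[OF _ restrict_cocycle, of k f]
  by (simp add: E_simps cl_def cong: restrict_cong)

lemma module_E: "module K E"
  by (rule module_same_ops[OF Q.module_Q]) (simp_all add: E_simps)

lemma cl_zero: "\<zero>\<^bsub>E\<^esub> = cl (\<lambda>x. \<zero>\<^bsub>N\<^esub>)"
  using Q.cls_zero by (simp add: E_simps Q.Q_simps(2) cl_def)

lemma lact_cl:
  assumes "a \<in> carrier A" "cocycle f"
  shows "lact E a (cl f) = cl (\<lambda>x. lact N a (f x))"
proof -
  have "lact E a (cl f) = (\<Union>g\<in>cl f. cl (\<lambda>x. lact N a (g x)))"
    by (simp add: ext_bimodule_def Let_def cl_def)
  also have "\<dots> = cl (\<lambda>x. lact N a (f x))"
    unfolding cl_def[of f]
  proof (rule Q.UN_cls_const[OF restrict_cocycle[OF assms(2)]])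
    fix g assume g: "g \<in> carrier Z" "g \<ominus>\<^bsub>Z\<^esub> restrict f (carrier (P (Suc m))) \<in> U"
    then have coc: "cocycle g" by (simp add: ext_cocycles_iff)
    have "cl g = cl f"
      using g Q.cls_eq_iff[OF g(1) restrict_cocycle[OF assms(2)]]
      by (simp add: cl_def ext_cocycles_iff extensional_restrict)
    then obtain h where h: "right_hom K A (P m) N h" "\<And>x. x \<in> carrier (P (Suc m)) \<Longrightarrow> g x \<ominus>\<^bsub>N\<^esub> f x = h (d m x)"
      using cl_eq_iff[OF coc assms(2)] by blast
    have "right_hom K A (P m) N (\<lambda>x. lact N a (h x))"
      using h(1) linear_map_comp[OF right_homD(1)[OF h(1)] N.linear_map_lact_right[OF assms(1)]] assms(1)
      by (auto simp: right_hom_def linear_map_def N.lact_ract)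
    moreover have "lact N a (g x) \<ominus>\<^bsub>N\<^esub> lact N a (f x) = lact N a (h (d m x))"
      if "x \<in> carrier (P (Suc m))" for x
      using that assms(1) cocycleD(2)[OF coc] cocycleD(2)[OF assms(2)]
      by (simp add: h(2)[symmetric] N.lact_minus_right)
    ultimately show "cl (\<lambda>x. lact N a (g x)) = cl (\<lambda>x. lact N a (f x))"
      using cl_eq_iff[OF cocycle_lact[OF assms(1) coc] cocycle_lact[OF assms]] by blast
  qed
  finally show ?thesis .
qed

definition lifts :: "('m \<Rightarrow> 'm) \<Rightarrow> (nat \<Rightarrow> 'p \<Rightarrow> 'p) \<Rightarrow> bool" where
  "lifts h l \<longleftrightarrow> (\<forall>n. right_hom K A (P n) (P n) (l n)) \<and>
     (\<forall>x\<in>carrier (P 0). \<epsilon> (l 0 x) = h (\<epsilon> x)) \<and>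
     (\<forall>n. \<forall>x\<in>carrier (P (Suc n)). d n (l (Suc n) x) = l n (d n x))"

lemma liftsD:
  assumes "lifts h l"
  shows "right_hom K A (P n) (P n) (l n)" "x \<in> carrier (P n) \<Longrightarrow> l n x \<in> carrier (P n)"
    "x \<in> carrier (P 0) \<Longrightarrow> \<epsilon> (l 0 x) = h (\<epsilon> x)"
    "x \<in> carrier (P (Suc n)) \<Longrightarrow> d n (l (Suc n) x) = l n (d n x)"
proof -
  show "right_hom K A (P n) (P n) (l n)" for n using assms by (simp add: lifts_def)
  then show "l n x \<in> carrier (P n)" if "x \<in> carrier (P n)" by (rule right_homD(2)[OF _ that])
qed (use assms in \<open>simp_all add: lifts_def\<close>)

lemma chain_lifts_lifts: "l \<in> chain_lifts K A P d \<epsilon> h \<Longrightarrow> lifts h l"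
  by (simp add: chain_lifts_def lifts_def rhom_iff)

lemma lifts_chain_lifts:
  assumes "lifts h l"
  shows "(\<lambda>n. restrict (l n) (carrier (P n))) \<in> chain_lifts K A P d \<epsilon> h"
  using assms liftsD(2)[OF assms] restrict_in_rhom[OF P_rmodule liftsD(1)[OF assms]]
  by (auto simp: chain_lifts_def lifts_def)

lemma lift_exists:
  assumes "right_hom K A M M h"
  obtains l where "lifts h l"
proof -
  have res: "resolution K A M P d \<epsilon>" by unfold_locales
  obtain l where "\<And>n. right_hom K A (P n) (P n) (l n)"
    "\<And>x. x \<in> carrier (P 0) \<Longrightarrow> \<epsilon> (l 0 x) = h (\<epsilon> x)"
    "\<And>n x. x \<in> carrier (P (Suc n)) \<Longrightarrow> d n (l (Suc n) x) = l n (d n x)"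
  proof (rule comparison_right_hom[OF res res assms])
  qed (rule that)
  then have "lifts h l" by (simp add: lifts_def)
  then show thesis by (rule that)
qed

lemma right_hom_lact: "a \<in> carrier A \<Longrightarrow> right_hom K A M M (lact M a)"
  using M.linear_map_lact_right by (simp add: right_hom_def M.lact_ract)

lemma cocycle_lift:
  assumes "lifts h l" "cocycle f"
  shows "cocycle (\<lambda>x. f (l (Suc m) x))"
  using right_hom_comp[OF liftsD(1)[OF assms(1)] cocycleD(1)[OF assms(2)]]
    liftsD(4)[OF assms(1), symmetric] liftsD(2)[OF assms(1)] cocycleD(3)[OF assms(2)]
  by (simp add: cocycle_def)

text \<open>
  Two lifts differ by \<open>d \<sigma> + \<sigma> d\<close>. The cocycle \<open>f\<close> vanishes on boundaries, so \<open>f (d \<sigma> + \<sigma> d) = (f \<sigma>) d\<close> is a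
  coboundary.
\<close>

lemma cl_lift_unique:
  assumes l: "lifts h l" and l': "lifts h l'" and hM: "\<And>x. x \<in> carrier M \<Longrightarrow> h x \<in> carrier M"
    and f: "cocycle f"
  shows "cl (\<lambda>x. f (l (Suc m) x)) = cl (\<lambda>x. f (l' (Suc m) x))"
proof -
  note mem = liftsD(2)[OF l] liftsD(2)[OF l']
  have res: "resolution K A M P d \<epsilon>" by unfold_locales
  obtain \<sigma> where \<sigma>: "\<And>n. right_hom K A (P n) (P (Suc n)) (\<sigma> n)"
    "\<And>n x. x \<in> carrier (P (Suc n)) \<Longrightarrow>
       l (Suc n) x \<ominus>\<^bsub>P (Suc n)\<^esub> l' (Suc n) x = d (Suc n) (\<sigma> (Suc n) x) \<oplus>\<^bsub>P (Suc n)\<^esub> \<sigma> n (d n x)"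
  proof (rule null_homotopy[OF res res, of "\<lambda>n x. l n x \<ominus>\<^bsub>P n\<^esub> l' n x"])
    show "right_hom K A (P n) (P n) (\<lambda>x. l n x \<ominus>\<^bsub>P n\<^esub> l' n x)" for n
      by (intro right_hom_diff P_rmodule liftsD(1)[OF l] liftsD(1)[OF l'])
    show "\<epsilon> (l 0 x \<ominus>\<^bsub>P 0\<^esub> l' 0 x) = \<zero>\<^bsub>M\<^esub>" if "x \<in> carrier (P 0)" for x
      using that mem by (simp add: \<epsilon>_minus liftsD(3)[OF l] liftsD(3)[OF l'] hM
          diff_eq_zero_iff[OF M.M.abelian_group_axioms])
    show "d n (l (Suc n) x \<ominus>\<^bsub>P (Suc n)\<^esub> l' (Suc n) x) = l n (d n x) \<ominus>\<^bsub>P n\<^esub> l' n (d n x)"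
      if "x \<in> carrier (P (Suc n))" for n x
      using that mem by (simp add: d_minus liftsD(4)[OF l] liftsD(4)[OF l'])
  qed (rule that)
  have \<sigma>_mem: "x \<in> carrier (P n) \<Longrightarrow> \<sigma> n x \<in> carrier (P (Suc n))" for n x
    by (rule right_homD(2)[OF \<sigma>(1)])
  have "f (l (Suc m) x) \<ominus>\<^bsub>N\<^esub> f (l' (Suc m) x) = f (\<sigma> m (d m x))" if x: "x \<in> carrier (P (Suc m))" for x
  proof -
    have "f (l (Suc m) x) \<ominus>\<^bsub>N\<^esub> f (l' (Suc m) x) = f (l (Suc m) x \<ominus>\<^bsub>P (Suc m)\<^esub> l' (Suc m) x)"
      using x mem by (simp add: linear_map_minus[OF P.M.abelian_group_axioms N.M.abelian_group_axioms
          right_homD(1)[OF cocycleD(1)[OF f]]])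
    also have "\<dots> = f (\<sigma> m (d m x))"
      using x \<sigma>_mem cocycleD(2)[OF f]
      by (simp add: \<sigma>(2) linear_mapD(2)[OF right_homD(1)[OF cocycleD(1)[OF f]]] cocycleD(3)[OF f])
    finally show ?thesis .
  qed
  then show ?thesis
    using cl_eq_iff[OF cocycle_lift[OF l f] cocycle_lift[OF l' f]] right_hom_comp[OF \<sigma>(1) cocycleD(1)[OF f]]
    by blast
qed

text \<open>
  The right action is a union over representatives and over lifts. Neither choice matters: a coboundary
  composed with a chain map is a coboundary, and lifts are unique up to homotopy.
\<close>

lemma ract_cl:
  assumes a: "a \<in> carrier A" and f: "cocycle f" and l: "lifts (lact M a) l"
  shows "ract E (cl f) a = cl (\<lambda>x. f (l (Suc m) x))"
proof -
  have "ract E (cl f) a = (\<Union>g\<in>cl f. \<Union>l\<in>chain_lifts K A P d \<epsilon> (lact M a). cl (\<lambda>x. g (l (Suc m) x)))"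
    by (simp add: ext_bimodule_def Let_def cl_def)
  also have "\<dots> = cl (\<lambda>x. f (l (Suc m) x))"
    unfolding cl_def[of f]
  proof (rule Q.UN_cls_const[OF restrict_cocycle[OF f]])
    fix g assume g: "g \<in> carrier Z" "g \<ominus>\<^bsub>Z\<^esub> restrict f (carrier (P (Suc m))) \<in> U"
    then have coc: "cocycle g" by (simp add: ext_cocycles_iff)
    have "cl g = cl f"
      using g Q.cls_eq_iff[OF g(1) restrict_cocycle[OF f]]
      by (simp add: cl_def ext_cocycles_iff extensional_restrict)
    then obtain h where h: "right_hom K A (P m) N h" "\<And>x. x \<in> carrier (P (Suc m)) \<Longrightarrow> g x \<ominus>\<^bsub>N\<^esub> f x = h (d m x)"
      using cl_eq_iff[OF coc f] by blast
    have "g (l (Suc m) x) \<ominus>\<^bsub>N\<^esub> f (l (Suc m) x) = h (l m (d m x))" if "x \<in> carrier (P (Suc m))" for x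
      using that liftsD(2)[OF l] by (simp add: h(2) liftsD(4)[OF l])
    then have eq: "cl (\<lambda>x. g (l (Suc m) x)) = cl (\<lambda>x. f (l (Suc m) x))"
      using cl_eq_iff[OF cocycle_lift[OF l coc] cocycle_lift[OF l f]]
        right_hom_comp[OF liftsD(1)[OF l] h(1)] by blast
    have "cl (\<lambda>x. g (l' (Suc m) x)) = cl (\<lambda>x. f (l (Suc m) x))"
      if l': "l' \<in> chain_lifts K A P d \<epsilon> (lact M a)" for l'
    proof -
      have "cl (\<lambda>x. g (l' (Suc m) x)) = cl (\<lambda>x. g (l (Suc m) x))"
        by (rule cl_lift_unique[OF chain_lifts_lifts[OF l'] l _ coc]) (rule M.lact_closed[OF _ a])
      then show ?thesis using eq by (rule trans)
    qed
    then show "(\<Union>l\<in>chain_lifts K A P d \<epsilon> (lact M a). cl (\<lambda>x. g (l (Suc m) x))) = cl (\<lambda>x. f (l (Suc m) x))"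
      using lifts_chain_lifts[OF l] by blast
  qed
  finally show ?thesis .
qed

definition lift where "lift a = (SOME l. lifts (lact M a) l)"

lemma lift: "a \<in> carrier A \<Longrightarrow> lifts (lact M a) (lift a)"
proof -
  assume "a \<in> carrier A"
  then obtain l where "lifts (lact M a) l" by (rule lift_exists[OF right_hom_lact])
  then show ?thesis unfolding lift_def by (rule someI[where P = "lifts (lact M a)"])
qed

lemma ract_cl_lift: "\<lbrakk>a \<in> carrier A; cocycle f\<rbrakk> \<Longrightarrow> ract E (cl f) a = cl (\<lambda>x. f (lift a (Suc m) x))"
  by (rule ract_cl[OF _ _ lift])

lemma lifts_add:
  assumes l: "lifts h l" and l': "lifts h' l'"
  shows "lifts (\<lambda>x. h x \<oplus>\<^bsub>M\<^esub> h' x) (\<lambda>n x. l n x \<oplus>\<^bsub>P n\<^esub> l' n x)"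
  unfolding lifts_def
proof (intro conjI allI ballI)
  show "right_hom K A (P n) (P n) (\<lambda>x. l n x \<oplus>\<^bsub>P n\<^esub> l' n x)" for n
    by (intro right_hom_add P_rmodule liftsD(1)[OF l] liftsD(1)[OF l'])
  show "\<epsilon> (l 0 x \<oplus>\<^bsub>P 0\<^esub> l' 0 x) = h (\<epsilon> x) \<oplus>\<^bsub>M\<^esub> h' (\<epsilon> x)" if "x \<in> carrier (P 0)" for x
    using that liftsD(2)[OF l that] liftsD(2)[OF l' that] liftsD(3)[OF l that] liftsD(3)[OF l' that]
    by (simp add: \<epsilon>_add)
  show "d n (l (Suc n) x \<oplus>\<^bsub>P (Suc n)\<^esub> l' (Suc n) x) = l n (d n x) \<oplus>\<^bsub>P n\<^esub> l' n (d n x)"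
    if "x \<in> carrier (P (Suc n))" for n x
    using that liftsD(2)[OF l that] liftsD(2)[OF l' that] liftsD(4)[OF l that] liftsD(4)[OF l' that]
    by (simp add: d_add)
qed

lemma lifts_smult:
  assumes k: "k \<in> carrier K" and l: "lifts h l"
  shows "lifts (\<lambda>x. k \<odot>\<^bsub>M\<^esub> h x) (\<lambda>n x. k \<odot>\<^bsub>P n\<^esub> l n x)"
  unfolding lifts_def
proof (intro conjI allI ballI)
  show "right_hom K A (P n) (P n) (\<lambda>x. k \<odot>\<^bsub>P n\<^esub> l n x)" for n
    by (intro right_hom_smult P_rmodule liftsD(1)[OF l] k)
  show "\<epsilon> (k \<odot>\<^bsub>P 0\<^esub> l 0 x) = k \<odot>\<^bsub>M\<^esub> h (\<epsilon> x)" if "x \<in> carrier (P 0)" for x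
    using that k liftsD(2)[OF l that] liftsD(3)[OF l that] by (simp add: \<epsilon>_smult)
  show "d n (k \<odot>\<^bsub>P (Suc n)\<^esub> l (Suc n) x) = k \<odot>\<^bsub>P n\<^esub> l n (d n x)" if "x \<in> carrier (P (Suc n))" for n x
    using that k liftsD(2)[OF l that] liftsD(4)[OF l that] by (simp add: d_smult)
qed

lemma lifts_comp:
  assumes l: "lifts h l" and l': "lifts h' l'"
  shows "lifts (\<lambda>x. h (h' x)) (\<lambda>n x. l n (l' n x))"
  unfolding lifts_def
proof (intro conjI allI ballI)
  show "right_hom K A (P n) (P n) (\<lambda>x. l n (l' n x))" for n
    by (rule right_hom_comp[OF liftsD(1)[OF l'] liftsD(1)[OF l]])
  show "\<epsilon> (l 0 (l' 0 x)) = h (h' (\<epsilon> x))" if "x \<in> carrier (P 0)" for x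
    using liftsD(3)[OF l liftsD(2)[OF l' that]] liftsD(3)[OF l' that] by simp
  show "d n (l (Suc n) (l' (Suc n) x)) = l n (l' n (d n x))" if "x \<in> carrier (P (Suc n))" for n x
    using liftsD(4)[OF l liftsD(2)[OF l' that]] liftsD(4)[OF l' that] by simp
qed

lemma lifts_cong: "(\<And>x. x \<in> carrier M \<Longrightarrow> h x = h' x) \<Longrightarrow> lifts h l \<Longrightarrow> lifts h' l"
  by (simp add: lifts_def)

text \<open>
  The laws for the right action hold because sums, multiples and composites of lifts are lifts of the
  sums, multiples and composites; since lifts may be chosen freely, no homotopies have to be tracked.
\<close>

lemma k_bimodule_E: "k_bimodule K A E"
proof -
  interpret E: module K E by (rule module_E)
  note coc = cocycle_lift[OF lift] cocycle_add cocycle_smult cocycle_lact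
  have mem: "\<lbrakk>a \<in> carrier A; x \<in> carrier (P n)\<rbrakk> \<Longrightarrow> lift a n x \<in> carrier (P n)" for a n x
    by (rule liftsD(2)[OF lift])
  show ?thesis
  proof (unfold_locales, goal_cases)
    case (1 S a)
    then obtain f where "cocycle f" "S = cl f" by (elim E_cases)
    then show ?case using 1 by (simp add: ract_cl_lift coc)
  next
    case (2 S T a)
    then obtain f g where "cocycle f" "S = cl f" "cocycle g" "T = cl g" by (elim E_cases)
    then show ?case using 2 by (simp add: ract_cl_lift coc cl_add)
  next
    case (3 S a b)
    then obtain f where f: "cocycle f" "S = cl f" by (elim E_cases)
    have "lifts (lact M (a \<oplus>\<^bsub>A\<^esub> b)) (\<lambda>n x. lift a n x \<oplus>\<^bsub>P n\<^esub> lift b n x)"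
      by (rule lifts_cong[OF _ lifts_add[OF lift[OF 3(2)] lift[OF 3(3)]]])
         (simp only: M.lact_add_left[OF _ 3(2,3)])
    from ract_cl[OF _ f(1) this] have "ract E S (a \<oplus>\<^bsub>A\<^esub> b) = cl (\<lambda>x. f (lift a (Suc m) x \<oplus>\<^bsub>P (Suc m)\<^esub> lift b (Suc m) x))"
      using 3 f by simp
    also have "\<dots> = cl (\<lambda>x. f (lift a (Suc m) x) \<oplus>\<^bsub>N\<^esub> f (lift b (Suc m) x))"
      using 3 mem by (intro cl_cong) (simp add: linear_mapD(2)[OF right_homD(1)[OF cocycleD(1)[OF f(1)]]])
    finally show ?case using 3 f by (simp add: ract_cl_lift cl_add coc)
  next
    case (4 S a b)
    then obtain f where f: "cocycle f" "S = cl f" by (elim E_cases)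
    have "lifts (lact M (a \<otimes>\<^bsub>A\<^esub> b)) (\<lambda>n x. lift a n (lift b n x))"
      by (rule lifts_cong[OF _ lifts_comp[OF lift[OF 4(2)] lift[OF 4(3)]]])
         (simp only: M.lact_mult[OF _ 4(2,3)])
    from ract_cl[OF _ f(1) this] show ?case using 4 f by (simp add: ract_cl_lift coc)
  next
    case (5 S)
    then obtain f where f: "cocycle f" "S = cl f" by (elim E_cases)
    have "lifts (lact M \<one>\<^bsub>A\<^esub>) (\<lambda>n x. x)"
      by (simp add: lifts_def M.lact_one right_hom_id)
    from ract_cl[OF _ f(1) this] show ?case using f by simp
  next
    case (6 k S a)
    then obtain f where "cocycle f" "S = cl f" by (elim E_cases)
    then show ?case using 6 by (simp add: ract_cl_lift coc cl_smult)
  next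
    case (7 k S a)
    then obtain f where f: "cocycle f" "S = cl f" by (elim E_cases)
    have "lifts (lact M (k \<odot>\<^bsub>A\<^esub> a)) (\<lambda>n x. k \<odot>\<^bsub>P n\<^esub> lift a n x)"
      by (rule lifts_cong[OF _ lifts_smult[OF 7(1) lift[OF 7(3)]]])
         (simp only: M.lact_smult_left[OF _ _ 7(3)] 7(1))
    from ract_cl[OF _ f(1) this] have "ract E S (k \<odot>\<^bsub>A\<^esub> a) = cl (\<lambda>x. f (k \<odot>\<^bsub>P (Suc m)\<^esub> lift a (Suc m) x))"
      using 7 f by simp
    also have "\<dots> = cl (\<lambda>x. k \<odot>\<^bsub>N\<^esub> f (lift a (Suc m) x))"
      using 7 mem by (intro cl_cong) (simp add: linear_mapD(3)[OF right_homD(1)[OF cocycleD(1)[OF f(1)]]])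
    finally show ?case using 7 f by (simp add: ract_cl_lift cl_smult coc)
  next
    case (8 S a)
    then obtain f where "cocycle f" "S = cl f" by (elim E_cases)
    then show ?case using 8 by (simp add: lact_cl coc cong: cl_cong_simp)
  next
    case (9 S T a)
    then obtain f g where "cocycle f" "S = cl f" "cocycle g" "T = cl g" by (elim E_cases)
    then show ?case using 9 by (simp add: lact_cl coc cl_add N.lact_add_right cocycleD(2) cong: cl_cong_simp)
  next
    case (10 S a b)
    then obtain f where "cocycle f" "S = cl f" by (elim E_cases)
    then show ?case using 10 by (simp add: lact_cl coc cl_add N.lact_add_left cocycleD(2) cong: cl_cong_simp)
  next
    case (11 S a b)
    then obtain f where "cocycle f" "S = cl f" by (elim E_cases)
    then show ?case using 11 by (simp add: lact_cl coc N.lact_mult cocycleD(2) cong: cl_cong_simp)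
  next
    case (12 S)
    then obtain f where "cocycle f" "S = cl f" by (elim E_cases)
    then show ?case using 12 by (simp add: lact_cl coc N.lact_one cocycleD(2) cong: cl_cong_simp)
  next
    case (13 k S a)
    then obtain f where "cocycle f" "S = cl f" by (elim E_cases)
    then show ?case using 13 by (simp add: lact_cl coc cl_smult N.lact_smult_right cocycleD(2) cong: cl_cong_simp)
  next
    case (14 k S a)
    then obtain f where "cocycle f" "S = cl f" by (elim E_cases)
    then show ?case using 14 by (simp add: lact_cl coc cl_smult N.lact_smult_left cocycleD(2) cong: cl_cong_simp)
  next
    case (15 S a b)
    then obtain f where "cocycle f" "S = cl f" by (elim E_cases)
    then show ?case using 15 by (simp add: lact_cl ract_cl_lift coc cong: cl_cong_simp)
  qed
qed

end


section \<open>Central elements, derivations and left linear forms on Ext\<close>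

text \<open>
  For a derivation \<open>\<delta>\<close> of \<open>A\<close> this says that \<open>(a, x) \<mapsto> (\<delta> a, D x)\<close> is a derivation of \<open>A \<ltimes> M\<close>.
\<close>

definition derivation_along :: "('k, 'r) ring_scheme \<Rightarrow> ('k, 'a, 's) module_scheme
    \<Rightarrow> ('k, 'a, 'm, 'x) bimodule_scheme \<Rightarrow> ('a \<Rightarrow> 'a) \<Rightarrow> ('m \<Rightarrow> 'm) \<Rightarrow> bool" where
  "derivation_along K A M \<delta> D \<longleftrightarrow> linear_map K M M D \<and>
     (\<forall>x\<in>carrier M. \<forall>a\<in>carrier A. D (ract M x a) = ract M (D x) a \<oplus>\<^bsub>M\<^esub> ract M x (\<delta> a)) \<and>
     (\<forall>x\<in>carrier M. \<forall>a\<in>carrier A. D (lact M a x) = lact M (\<delta> a) x \<oplus>\<^bsub>M\<^esub> lact M a (D x))"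

lemma derivation_alongD:
  assumes "derivation_along K A M \<delta> D"
  shows "linear_map K M M D" "x \<in> carrier M \<Longrightarrow> D x \<in> carrier M"
    and "\<lbrakk>x \<in> carrier M; a \<in> carrier A\<rbrakk> \<Longrightarrow> D (ract M x a) = ract M (D x) a \<oplus>\<^bsub>M\<^esub> ract M x (\<delta> a)"
    and "\<lbrakk>x \<in> carrier M; a \<in> carrier A\<rbrakk> \<Longrightarrow> D (lact M a x) = lact M (\<delta> a) x \<oplus>\<^bsub>M\<^esub> lact M a (D x)"
  using assms by (simp_all add: derivation_along_def linear_map_def)

lemma derivation_along_regular:
  assumes "k_algebra K A" "derivation K A (regular_bimodule A) \<delta>"
  shows "derivation_along K A (regular_bimodule A) \<delta> \<delta>"
proof -
  interpret A: k_algebra K A by fact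
  have lin: "linear_map K A A \<delta>" using assms(2) by (simp add: derivation_def linear_map_def)
  have mem: "a \<in> carrier A \<Longrightarrow> \<delta> a \<in> carrier A" for a by (rule linear_mapD(1)[OF lin])
  show ?thesis
    using assms(2) mem by (simp add: derivation_along_def derivation_def linear_map_def A.A.a_comm)
qed

context bimodule_resolution
begin

text \<open>
  Right multiplication by a central \<open>z\<close> on the resolution is linear over \<open>A\<close>, and it lifts the left action of \<open>z\<close> on \<open>M\<close>.
\<close>

lemma central_acts_symmetrically:
  assumes z: "z \<in> carrier A" "\<And>a. a \<in> carrier A \<Longrightarrow> a \<otimes>\<^bsub>A\<^esub> z = z \<otimes>\<^bsub>A\<^esub> a"
    and zM: "\<And>x. x \<in> carrier M \<Longrightarrow> lact M z x = ract M x z"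
    and zN: "\<And>x. x \<in> carrier N \<Longrightarrow> lact N z x = ract N x z"
    and S: "S \<in> carrier E"
  shows "lact E z S = ract E S z"
proof -
  obtain f where f: "cocycle f" "S = cl f" using S by (rule E_cases)
  have hom: "right_hom K A (P n) (P n) (\<lambda>x. ract (P n) x z)" for n
    using P.linear_map_ract_left[OF z(1)] by (simp add: right_hom_def P.ract_mult[symmetric] z)
  have lifts: "lifts (lact M z) (\<lambda>n x. ract (P n) x z)"
    using hom z(1) by (simp add: lifts_def right_homD(3)[OF \<epsilon>_hom] right_homD(3)[OF d_hom] zM)
  have "ract E S z = cl (\<lambda>x. f (ract (P (Suc m)) x z))"
    using ract_cl[OF z(1) f(1) lifts] f(2) by simp
  also have "\<dots> = cl (\<lambda>x. lact N z (f x))"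
    using z(1) cocycleD(2)[OF f(1)] by (intro cl_cong) (simp add: right_homD(3)[OF cocycleD(1)[OF f(1)]] zN)
  finally show ?thesis using lact_cl[OF z(1) f(1)] f(2) by simp
qed

text \<open>
  Infinitesimally, \<open>1 + t \<delta>\<close> is an automorphism of \<open>A\<close> over the dual numbers that is compatible with \<open>M\<close> and
  \<open>N\<close>, so it acts on Ext by transport of structure. Explicitly, \<open>DM\<close> lifts to maps \<open>L\<close> on the resolution with
  \<open>L(xa) = L(x)a + x\<delta>(a)\<close>, and \<open>D f = DN \<circ> f - f \<circ> L\<close> is linear over \<open>A\<close> since the two defects are equal. The
  Leibniz rule for the left action is immediate. For the right action it involves the commutator
  \<open>\<kappa> = L l - l L\<close> with a lift \<open>l\<close> of the action of \<open>a\<close>: this is a lift of the action of \<open>\<delta> a\<close>.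
\<close>

theorem derivation_along_E:
  assumes \<delta>: "derivation K A (regular_bimodule A) \<delta>"
    and DM: "derivation_along K A M \<delta> DM" and DN: "derivation_along K A N \<delta> DN"
  obtains DE where "derivation_along K A E \<delta> DE"
proof -
  note M = derivation_alongD[OF DM] and N = derivation_alongD[OF DN]
  have res: "resolution K A M P d \<epsilon>" by unfold_locales
  have \<delta>_mem: "a \<in> carrier A \<Longrightarrow> \<delta> a \<in> carrier A" for a
    using linear_mapD(1)[OF derivationD(1)[OF \<delta>]] by simp
  have "\<exists>\<mu>. linear_map K (P n) (P n) \<mu> \<and> (\<forall>x\<in>carrier (P n). \<forall>a\<in>carrier A.
      \<mu> (ract (P n) x a) = ract (P n) (\<mu> x) a \<oplus>\<^bsub>P n\<^esub> ract (P n) x (\<delta> a))" for n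
  proof -
    obtain \<mu> where "linear_map K (P n) (P n) \<mu>"
      "\<And>x a. \<lbrakk>x \<in> carrier (P n); a \<in> carrier A\<rbrakk> \<Longrightarrow>
        \<mu> (ract (P n) x a) = ract (P n) (\<mu> x) a \<oplus>\<^bsub>P n\<^esub> ract (P n) x (\<delta> a)"
      proof (rule P.derivation_lifts_to_projective[OF P_projective[of n] \<delta>])
    qed (rule that)
    then show ?thesis by (intro exI[of _ \<mu>]) simp
  qed
  then obtain \<mu> where \<mu>_lin: "\<And>n. linear_map K (P n) (P n) (\<mu> n)"
    and \<mu>: "\<And>n x a. \<lbrakk>x \<in> carrier (P n); a \<in> carrier A\<rbrakk> \<Longrightarrow>
        \<mu> n (ract (P n) x a) = ract (P n) (\<mu> n x) a \<oplus>\<^bsub>P n\<^esub> ract (P n) x (\<delta> a)"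
    by metis
  have \<mu>_mem: "x \<in> carrier (P n) \<Longrightarrow> \<mu> n x \<in> carrier (P n)" for n x by (rule linear_mapD(1)[OF \<mu>_lin])
  have defect_0: "right_hom K A (P 0) M (\<lambda>x. DM (\<epsilon> x) \<ominus>\<^bsub>M\<^esub> \<epsilon> (\<mu> 0 x))"
  proof (rule right_hom_diff_of_twisted[OF M.k_rmodule_axioms, where c = "\<lambda>x a. ract M (\<epsilon> x) (\<delta> a)"])
    show "linear_map K (P 0) M (\<lambda>x. DM (\<epsilon> x))" by (rule linear_map_comp[OF right_homD(1)[OF \<epsilon>_hom] M(1)])
    show "linear_map K (P 0) M (\<lambda>x. \<epsilon> (\<mu> 0 x))" by (rule linear_map_comp[OF \<mu>_lin right_homD(1)[OF \<epsilon>_hom]])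
  qed (simp_all add: right_homD(3)[OF \<epsilon>_hom] M(3) \<mu> \<epsilon>_add \<mu>_mem \<delta>_mem)
  have defect_Suc: "right_hom K A (P (Suc n)) (P n) (\<lambda>x. \<mu> n (d n x) \<ominus>\<^bsub>P n\<^esub> d n (\<mu> (Suc n) x))" for n
  proof (rule right_hom_diff_of_twisted[OF P_rmodule, where c = "\<lambda>x a. ract (P n) (d n x) (\<delta> a)"])
    show "linear_map K (P (Suc n)) (P n) (\<lambda>x. \<mu> n (d n x))" by (rule linear_map_comp[OF right_homD(1)[OF d_hom] \<mu>_lin])
    show "linear_map K (P (Suc n)) (P n) (\<lambda>x. d n (\<mu> (Suc n) x))" by (rule linear_map_comp[OF \<mu>_lin right_homD(1)[OF d_hom]])
  qed (simp_all add: right_homD(3)[OF d_hom] \<mu> d_add \<mu>_mem \<delta>_mem)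
  obtain \<nu> where \<nu>: "\<And>n. right_hom K A (P n) (P n) (\<nu> n)"
    and \<nu>_0: "\<And>x. x \<in> carrier (P 0) \<Longrightarrow> \<epsilon> (\<mu> 0 x \<oplus>\<^bsub>P 0\<^esub> \<nu> 0 x) = DM (\<epsilon> x)"
    and \<nu>_Suc: "\<And>n x. x \<in> carrier (P (Suc n)) \<Longrightarrow>
       d n (\<mu> (Suc n) x \<oplus>\<^bsub>P (Suc n)\<^esub> \<nu> (Suc n) x) = \<mu> n (d n x) \<oplus>\<^bsub>P n\<^esub> \<nu> n (d n x)"
  proof (rule comparison[OF res res M(1) \<mu>_lin defect_0 defect_Suc])
  qed (rule that)
  define L where "L n x = \<mu> n x \<oplus>\<^bsub>P n\<^esub> \<nu> n x" for n x
  have \<nu>_mem: "x \<in> carrier (P n) \<Longrightarrow> \<nu> n x \<in> carrier (P n)" for n x by (rule right_homD(2)[OF \<nu>])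
  have L_lin: "linear_map K (P n) (P n) (L n)" for n
    unfolding L_def[abs_def] by (rule linear_map_add[OF P.M.module_axioms \<mu>_lin right_homD(1)[OF \<nu>]])
  have L_mem: "x \<in> carrier (P n) \<Longrightarrow> L n x \<in> carrier (P n)" for n x by (rule linear_mapD(1)[OF L_lin])
  have L_ract: "L n (ract (P n) x a) = ract (P n) (L n x) a \<oplus>\<^bsub>P n\<^esub> ract (P n) x (\<delta> a)"
    if "x \<in> carrier (P n)" "a \<in> carrier A" for n x a
    using that by (simp add: L_def \<mu> right_homD(3)[OF \<nu>] P.ract_add_left \<mu>_mem \<nu>_mem \<delta>_mem P.M.a_ac)
  have L_0: "\<epsilon> (L 0 x) = DM (\<epsilon> x)" if "x \<in> carrier (P 0)" for x using \<nu>_0[OF that] by (simp add: L_def)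
  have L_Suc: "d n (L (Suc n) x) = L n (d n x)" if "x \<in> carrier (P (Suc n))" for n x
    using \<nu>_Suc[OF that] by (simp add: L_def)
  define D where "D f x = DN (f x) \<ominus>\<^bsub>N\<^esub> f (L (Suc m) x)" for f x
  have commutator: "right_hom K A (P n) N (\<lambda>x. DN (f x) \<ominus>\<^bsub>N\<^esub> f (L n x))" if f: "right_hom K A (P n) N f" for n f
  proof (rule right_hom_diff_of_twisted[OF N.k_rmodule_axioms, where c = "\<lambda>x a. ract N (f x) (\<delta> a)"])
    note f_mem = right_homD(2)[OF f]
    show "linear_map K (P n) N (\<lambda>x. DN (f x))" by (rule linear_map_comp[OF right_homD(1)[OF f] N(1)])
    show "linear_map K (P n) N (\<lambda>x. f (L n x))" by (rule linear_map_comp[OF L_lin right_homD(1)[OF f]])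
    fix x a assume xa: "x \<in> carrier (P n)" "a \<in> carrier A"
    show "DN (f (ract (P n) x a)) = ract N (DN (f x)) a \<oplus>\<^bsub>N\<^esub> ract N (f x) (\<delta> a)"
      using xa f_mem by (simp add: right_homD(3)[OF f] N(3))
    show "f (L n (ract (P n) x a)) = ract N (f (L n x)) a \<oplus>\<^bsub>N\<^esub> ract N (f x) (\<delta> a)"
      using xa by (simp add: L_ract linear_mapD(2)[OF right_homD(1)[OF f]] right_homD(3)[OF f] L_mem \<delta>_mem)
    show "ract N (f x) (\<delta> a) \<in> carrier N" using xa f_mem \<delta>_mem by simp
  qed
  have DN_zero: "DN \<zero>\<^bsub>N\<^esub> = \<zero>\<^bsub>N\<^esub>"
    by (rule linear_map_zero[OF N.M.abelian_group_axioms N.M.abelian_group_axioms N(1)])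
  have D_cocycle: "cocycle (D f)" if f: "cocycle f" for f
  proof -
    have "D f (d (Suc m) x) = \<zero>\<^bsub>N\<^esub>" if x: "x \<in> carrier (P (Suc (Suc m)))" for x
    proof -
      have "f (L (Suc m) (d (Suc m) x)) = f (d (Suc m) (L (Suc (Suc m)) x))"
        using L_Suc[OF x] by simp
      also have "\<dots> = \<zero>\<^bsub>N\<^esub>" by (rule cocycleD(3)[OF f L_mem[OF x]])
      finally show ?thesis
        by (simp add: D_def cocycleD(3)[OF f x] DN_zero diff_zero[OF N.M.abelian_group_axioms])
    qed
    then show ?thesis using commutator[OF cocycleD(1)[OF f]] by (simp add: cocycle_def D_def[abs_def])
  qed
  have D_well_defined: "cl (D f) = cl (D g)" if f: "cocycle f" and g: "cocycle g" and eq: "cl f = cl g" for f g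
  proof -
    obtain h where h: "right_hom K A (P m) N h"
      and fgh: "\<And>x. x \<in> carrier (P (Suc m)) \<Longrightarrow> f x \<ominus>\<^bsub>N\<^esub> g x = h (d m x)"
      using eq cl_eq_iff[OF f g] by blast
    have "D f x \<ominus>\<^bsub>N\<^esub> D g x = DN (h (d m x)) \<ominus>\<^bsub>N\<^esub> h (L m (d m x))" if x: "x \<in> carrier (P (Suc m))" for x
    proof -
      note mem = cocycleD(2)[OF f] cocycleD(2)[OF g] L_mem[OF x]
      have "D f x \<ominus>\<^bsub>N\<^esub> D g x
          = (DN (f x) \<ominus>\<^bsub>N\<^esub> DN (g x)) \<ominus>\<^bsub>N\<^esub> (f (L (Suc m) x) \<ominus>\<^bsub>N\<^esub> g (L (Suc m) x))"
        unfolding D_def using x mem N(2) by (intro diff_diff_diff[OF N.M.abelian_group_axioms]) simp_all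
      also have "\<dots> = DN (f x \<ominus>\<^bsub>N\<^esub> g x) \<ominus>\<^bsub>N\<^esub> h (d m (L (Suc m) x))"
        using x mem by (simp add: fgh[symmetric] linear_map_minus[OF N.M.abelian_group_axioms N.M.abelian_group_axioms N(1)])
      finally show ?thesis using x by (simp add: fgh L_Suc)
    qed
    then show ?thesis
      unfolding cl_eq_iff[OF D_cocycle[OF f] D_cocycle[OF g]] using commutator[OF h] by blast
  qed
  define DE where "DE S = cl (D (SOME f. cocycle f \<and> S = cl f))" for S
  have DE: "DE (cl f) = cl (D f)" if f: "cocycle f" for f
  proof -
    let ?g = "SOME g. cocycle g \<and> cl f = cl g"
    have "cocycle ?g \<and> cl f = cl ?g" by (rule someI[of "\<lambda>g. cocycle g \<and> cl f = cl g" f]) (simp add: f)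
    then show ?thesis unfolding DE_def using D_well_defined[OF f, of ?g] by simp
  qed
  interpret E: k_bimodule K A E by (rule k_bimodule_E)
  have "derivation_along K A E \<delta> DE"
    unfolding derivation_along_def
  proof (intro conjI ballI linear_mapI)
    fix S assume "S \<in> carrier E"
    then obtain f where f: "cocycle f" "S = cl f" by (elim E_cases)
    then show "DE S \<in> carrier E" by (simp add: DE D_cocycle)
  next
    fix S T assume "S \<in> carrier E" "T \<in> carrier E"
    then obtain f g where f: "cocycle f" "S = cl f" and g: "cocycle g" "T = cl g" by (elim E_cases)
    have "D (\<lambda>x. f x \<oplus>\<^bsub>N\<^esub> g x) x = D f x \<oplus>\<^bsub>N\<^esub> D g x" if "x \<in> carrier (P (Suc m))" for x
      using cocycleD(2)[OF f(1) that] cocycleD(2)[OF g(1) that]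
        cocycleD(2)[OF f(1) L_mem[OF that]] cocycleD(2)[OF g(1) L_mem[OF that]] N(2)
      by (simp add: D_def linear_mapD(2)[OF N(1)] diff_add_diff[OF N.M.abelian_group_axioms])
    then have "cl (D (\<lambda>x. f x \<oplus>\<^bsub>N\<^esub> g x)) = cl (\<lambda>x. D f x \<oplus>\<^bsub>N\<^esub> D g x)" by (rule cl_cong)
    then show "DE (S \<oplus>\<^bsub>E\<^esub> T) = DE S \<oplus>\<^bsub>E\<^esub> DE T"
      using f g by (simp add: cl_add DE D_cocycle cocycle_add)
  next
    fix k S assume k: "k \<in> carrier K" and "S \<in> carrier E"
    then obtain f where f: "cocycle f" "S = cl f" by (elim E_cases)
    have "D (\<lambda>x. k \<odot>\<^bsub>N\<^esub> f x) x = k \<odot>\<^bsub>N\<^esub> D f x" if "x \<in> carrier (P (Suc m))" for x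
      using cocycleD(2)[OF f(1) that] cocycleD(2)[OF f(1) L_mem[OF that]] N(2) k
      by (simp add: D_def linear_mapD(3)[OF N(1)] a_minus_def N.M.smult_r_distr N.M.smult_r_minus)
    then have "cl (D (\<lambda>x. k \<odot>\<^bsub>N\<^esub> f x)) = cl (\<lambda>x. k \<odot>\<^bsub>N\<^esub> D f x)" by (rule cl_cong)
    then show "DE (k \<odot>\<^bsub>E\<^esub> S) = k \<odot>\<^bsub>E\<^esub> DE S"
      using f k by (simp add: cl_smult DE D_cocycle cocycle_smult)
  next
    fix S a assume "S \<in> carrier E" and a: "a \<in> carrier A"
    then obtain f where f: "cocycle f" "S = cl f" by (elim E_cases)
    note f_mem = cocycleD(2)[OF f(1)]
    have "D (\<lambda>x. lact N a (f x)) x = lact N (\<delta> a) (f x) \<oplus>\<^bsub>N\<^esub> lact N a (D f x)"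
      if x: "x \<in> carrier (P (Suc m))" for x
    proof -
      have "D (\<lambda>x. lact N a (f x)) x
          = (lact N (\<delta> a) (f x) \<oplus>\<^bsub>N\<^esub> lact N a (DN (f x))) \<ominus>\<^bsub>N\<^esub> lact N a (f (L (Suc m) x))"
        using f_mem[OF x] a by (simp add: D_def N(4))
      also have "\<dots> = lact N (\<delta> a) (f x) \<oplus>\<^bsub>N\<^esub> (lact N a (DN (f x)) \<ominus>\<^bsub>N\<^esub> lact N a (f (L (Suc m) x)))"
        using f_mem[OF x] f_mem[OF L_mem[OF x]] a N(2) \<delta>_mem by (simp add: a_minus_def N.M.a_assoc)
      also have "\<dots> = lact N (\<delta> a) (f x) \<oplus>\<^bsub>N\<^esub> lact N a (D f x)"
        using f_mem[OF x] f_mem[OF L_mem[OF x]] a N(2) by (simp add: D_def N.lact_minus_right)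
      finally show ?thesis .
    qed
    then have "cl (D (\<lambda>x. lact N a (f x))) = cl (\<lambda>x. lact N (\<delta> a) (f x) \<oplus>\<^bsub>N\<^esub> lact N a (D f x))"
      by (rule cl_cong)
    then show "DE (lact E a S) = lact E (\<delta> a) S \<oplus>\<^bsub>E\<^esub> lact E a (DE S)"
      using f a \<delta>_mem by (simp add: lact_cl DE D_cocycle cocycle_lact cl_add)
    \<comment> \<open>The commutator of \<open>L\<close> with the lift of \<open>a\<close> represents the action of \<open>\<delta> a\<close>.\<close>
    define \<kappa> where "\<kappa> n x = L n (lift a n x) \<ominus>\<^bsub>P n\<^esub> lift a n (L n x)" for n x
    note l = liftsD[OF lift[OF a]]
    have \<kappa>: "lifts (lact M (\<delta> a)) \<kappa>"
      unfolding lifts_def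
    proof (intro conjI allI ballI)
      show "right_hom K A (P n) (P n) (\<kappa> n)" for n
        unfolding \<kappa>_def[abs_def]
      proof (rule right_hom_diff_of_twisted[OF P_rmodule, where c = "\<lambda>x b. ract (P n) (lift a n x) (\<delta> b)"])
        show "linear_map K (P n) (P n) (\<lambda>x. L n (lift a n x))" by (rule linear_map_comp[OF right_homD(1)[OF l(1)] L_lin])
        show "linear_map K (P n) (P n) (\<lambda>x. lift a n (L n x))" by (rule linear_map_comp[OF L_lin right_homD(1)[OF l(1)]])
      qed (simp_all add: l(2) right_homD(3)[OF l(1)] L_ract linear_mapD(2)[OF right_homD(1)[OF l(1)]] L_mem \<delta>_mem)
      show "\<epsilon> (\<kappa> 0 x) = lact M (\<delta> a) (\<epsilon> x)" if x: "x \<in> carrier (P 0)" for x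
      proof -
        have "\<epsilon> (\<kappa> 0 x) = (lact M (\<delta> a) (\<epsilon> x) \<oplus>\<^bsub>M\<^esub> lact M a (DM (\<epsilon> x))) \<ominus>\<^bsub>M\<^esub> lact M a (DM (\<epsilon> x))"
          using x a by (simp add: \<kappa>_def \<epsilon>_minus L_mem l(2) L_0 l(3) M(4))
        also have "\<dots> = lact M (\<delta> a) (\<epsilon> x)"
          using x a \<delta>_mem M(2) by (simp add: a_minus_def M.M.a_assoc M.M.r_neg)
        finally show ?thesis .
      qed
      show "d n (\<kappa> (Suc n) x) = \<kappa> n (d n x)" if "x \<in> carrier (P (Suc n))" for n x
        using that by (simp add: \<kappa>_def d_minus L_mem l(2) L_Suc l(4))
    qed
    note f_lin = linear_map_minus[OF P.M.abelian_group_axioms N.M.abelian_group_axioms right_homD(1)[OF cocycleD(1)[OF f(1)]]]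
    have "D (\<lambda>x. f (lift a (Suc m) x)) x = D f (lift a (Suc m) x) \<oplus>\<^bsub>N\<^esub> f (\<kappa> (Suc m) x)"
      if x: "x \<in> carrier (P (Suc m))" for x
      unfolding D_def \<kappa>_def using x
      by (simp add: f_lin l(2) L_mem f_mem N(2) diff_add_diff_telescope[OF N.M.abelian_group_axioms])
    then have "cl (D (\<lambda>x. f (lift a (Suc m) x))) = cl (\<lambda>x. D f (lift a (Suc m) x) \<oplus>\<^bsub>N\<^esub> f (\<kappa> (Suc m) x))"
      by (rule cl_cong)
    then show "DE (ract E S a) = ract E (DE S) a \<oplus>\<^bsub>E\<^esub> ract E S (\<delta> a)"
      using f a by (simp add: ract_cl_lift DE D_cocycle ract_cl[OF \<delta>_mem[OF a] f(1) \<kappa>]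
          cocycle_lift[OF lift[OF a]] cocycle_lift[OF \<kappa>] cl_add)
  qed
  then show thesis by (rule that)
qed

lemma cocycle_finsum:
  assumes "finite I" "\<And>i. i \<in> I \<Longrightarrow> cocycle (g i)"
  shows "cocycle (\<lambda>x. \<Oplus>\<^bsub>N\<^esub>i\<in>I. g i x)" "cl (\<lambda>x. \<Oplus>\<^bsub>N\<^esub>i\<in>I. g i x) = (\<Oplus>\<^bsub>E\<^esub>i\<in>I. cl (g i))"
proof -
  interpret E: module K E by (rule module_E)
  have "cocycle (\<lambda>x. \<Oplus>\<^bsub>N\<^esub>i\<in>I. g i x) \<and> cl (\<lambda>x. \<Oplus>\<^bsub>N\<^esub>i\<in>I. g i x) = (\<Oplus>\<^bsub>E\<^esub>i\<in>I. cl (g i))"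
    using assms
  proof (induction I rule: finite_induct)
    case empty
    then show ?case by (simp add: cocycle_zero cl_zero)
  next
    case (insert j I)
    then have IH: "cocycle (\<lambda>x. \<Oplus>\<^bsub>N\<^esub>i\<in>I. g i x)" "cl (\<lambda>x. \<Oplus>\<^bsub>N\<^esub>i\<in>I. g i x) = (\<Oplus>\<^bsub>E\<^esub>i\<in>I. cl (g i))"
      and j: "cocycle (g j)" and I: "\<And>i. i \<in> I \<Longrightarrow> cocycle (g i)" by simp_all
    have eq: "(\<Oplus>\<^bsub>N\<^esub>i\<in>insert j I. g i x) = g j x \<oplus>\<^bsub>N\<^esub> (\<Oplus>\<^bsub>N\<^esub>i\<in>I. g i x)" if "x \<in> carrier (P (Suc m))" for x
      using insert.hyps cocycleD(2)[OF j that] cocycleD(2)[OF I that] by (intro N.M.finsum_insert) auto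
    have "cl (\<lambda>x. \<Oplus>\<^bsub>N\<^esub>i\<in>insert j I. g i x) = cl (g j) \<oplus>\<^bsub>E\<^esub> cl (\<lambda>x. \<Oplus>\<^bsub>N\<^esub>i\<in>I. g i x)"
      unfolding cl_add[OF j IH(1)] by (rule cl_cong) (rule eq)
    also have "\<dots> = (\<Oplus>\<^bsub>E\<^esub>i\<in>insert j I. cl (g i))"
      unfolding IH(2) using insert.hyps j I by (intro E.finsum_insert[symmetric]) (auto intro: cl_closed)
    finally show ?case
      using cocycle_add[OF j IH(1)] cocycle_cong[OF eq] by simp
  qed
  then show "cocycle (\<lambda>x. \<Oplus>\<^bsub>N\<^esub>i\<in>I. g i x)" "cl (\<lambda>x. \<Oplus>\<^bsub>N\<^esub>i\<in>I. g i x) = (\<Oplus>\<^bsub>E\<^esub>i\<in>I. cl (g i))"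
    by simp_all
qed

lemma cl_coboundary:
  assumes "right_hom K A (P m) N h"
  shows "cl (\<lambda>x. h (d m x)) = \<zero>\<^bsub>E\<^esub>"
proof -
  have "h (d m x) \<ominus>\<^bsub>N\<^esub> \<zero>\<^bsub>N\<^esub> = h (d m x)" if "x \<in> carrier (P (Suc m))" for x
    using that right_homD(2)[OF assms] by (intro diff_zero[OF N.M.abelian_group_axioms]) simp
  then show ?thesis
    unfolding cl_zero cl_eq_iff[OF cocycle_coboundary[OF assms] cocycle_zero] using assms by blast
qed

end

text \<open>
  The maps \<open>\<rho>\<close> express that the cycles in degree \<open>m + 1\<close> split off, as they do if the projective dimension
  of \<open>M\<close> is at most \<open>m + 1\<close>. Then \<open>Ext\<close> is a quotient of the dual of a projective module, so a left linear
  form \<open>\<phi>\<close> on it is the evaluation of cocycles at some element \<open>q\<close> of \<open>P (Suc m)\<close>. It vanishes on coboundaries, that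
  is, every linear form on \<open>P m\<close> vanishes at \<open>d m q\<close>; hence \<open>d m q = 0\<close> by the dual basis of \<open>P m\<close>. So \<open>q\<close> is a
  boundary and every cocycle vanishes at it.
\<close>

theorem left_hom_Ext_regular_eq_zero:
  assumes "bimodule_resolution K A M P d \<epsilon> (regular_bimodule A)"
    and \<rho>: "right_hom K A (P (Suc m)) (P (Suc m)) \<rho>"
      "\<And>x. x \<in> carrier (P (Suc m)) \<Longrightarrow> d m (\<rho> x) = \<zero>\<^bsub>P m\<^esub>"
      "\<And>x. \<lbrakk>x \<in> carrier (P (Suc m)); d m x = \<zero>\<^bsub>P m\<^esub>\<rbrakk> \<Longrightarrow> \<rho> x = x"
    and \<phi>: "linear_map K (ext_bimodule K A P d \<epsilon> M (regular_bimodule A) (Suc m)) A \<phi>"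
      "\<And>S a. \<lbrakk>S \<in> carrier (ext_bimodule K A P d \<epsilon> M (regular_bimodule A) (Suc m)); a \<in> carrier A\<rbrakk> \<Longrightarrow>
        \<phi> (lact (ext_bimodule K A P d \<epsilon> M (regular_bimodule A) (Suc m)) a S) = a \<otimes>\<^bsub>A\<^esub> \<phi> S"
    and S: "S \<in> carrier (ext_bimodule K A P d \<epsilon> M (regular_bimodule A) (Suc m))"
  shows "\<phi> S = \<zero>\<^bsub>A\<^esub>"
proof -
  interpret X: bimodule_resolution K A M P d \<epsilon> "regular_bimodule A" m by fact
  interpret E: k_bimodule K A X.E by (rule X.k_bimodule_E)
  let ?P = "P (Suc m)"
  have \<phi>_mem: "T \<in> carrier X.E \<Longrightarrow> \<phi> T \<in> carrier A" for T by (rule linear_mapD(1)[OF \<phi>(1)])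
  have \<rho>_mem: "x \<in> carrier ?P \<Longrightarrow> \<rho> x \<in> carrier ?P" for x by (rule right_homD(2)[OF \<rho>(1)])
  have kernel: "f y = \<zero>\<^bsub>A\<^esub>" if "X.cocycle f" "y \<in> carrier ?P" "d m y = \<zero>\<^bsub>P m\<^esub>" for f y
  proof -
    have "X.cycle (Suc m) y" using that by (simp add: X.cycle_def)
    then obtain x where "x \<in> carrier (P (Suc (Suc m)))" "y = d (Suc m) x" unfolding X.cycle_iff by blast
    then show ?thesis using X.cocycleD(3)[OF that(1)] by simp
  qed
  obtain n :: nat and b u where b: "\<And>i. i < n \<Longrightarrow> b i \<in> carrier ?P"
    and u: "\<And>i. i < n \<Longrightarrow> linear_map K ?P A (u i)"
      "\<And>i x a. \<lbrakk>i < n; x \<in> carrier ?P; a \<in> carrier A\<rbrakk> \<Longrightarrow> u i (ract ?P x a) = u i x \<otimes>\<^bsub>A\<^esub> a"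
    and expand: "\<And>x. x \<in> carrier ?P \<Longrightarrow> x = (\<Oplus>\<^bsub>?P\<^esub>i\<in>{..<n}. ract ?P (b i) (u i x))"
    using X.P.projective_dual_basis[OF X.P_projective] by blast
  have u_hom: "right_hom K A ?P (regular_bimodule A) (u i)" if "i < n" for i
    using u(1)[OF that] u(2)[OF that] by (simp add: right_hom_def linear_map_def)
  have u_mem: "u i x \<in> carrier A" if "i < n" "x \<in> carrier ?P" for i x
    using linear_mapD(1)[OF u(1)[OF that(1)] that(2)] .
  \<comment> \<open>The coordinate forms, made into cocycles by means of the complement of the cycles.\<close>
  define v where "v i x = u i (x \<ominus>\<^bsub>?P\<^esub> \<rho> x)" for i x
  have v: "X.cocycle (v i)" if i: "i < n" for i
    unfolding X.cocycle_def
  proof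
    show "right_hom K A ?P (regular_bimodule A) (v i)"
      unfolding v_def[abs_def]
      by (rule right_hom_comp[OF right_hom_diff[OF X.P_rmodule right_hom_id \<rho>(1)] u_hom[OF i]])
    show "\<forall>x\<in>carrier (P (Suc (Suc m))). v i (d (Suc m) x) = \<zero>\<^bsub>regular_bimodule A\<^esub>"
      using linear_map_zero[OF X.P.M.abelian_group_axioms X.A.A.abelian_group_axioms u(1)[OF i]]
      by (simp add: v_def \<rho>(3) X.d_d diff_eq_zero_iff[OF X.P.M.abelian_group_axioms, THEN iffD2])
  qed
  have v_mem: "v i x \<in> carrier A" if "i < n" "x \<in> carrier ?P" for i x
    using X.cocycleD(2)[OF v[OF that(1)] that(2)] by simp
  define q where "q = (\<Oplus>\<^bsub>?P\<^esub>i\<in>{..<n}. ract ?P (b i) (\<phi> (X.cl (v i))))"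
  have q_term: "(\<lambda>i. ract ?P (b i) (\<phi> (X.cl (v i)))) \<in> {..<n} \<rightarrow> carrier ?P"
    using b v \<phi>_mem by simp
  have q: "q \<in> carrier ?P" unfolding q_def by (rule X.P.M.finsum_closed[OF q_term])
  have finsum_regular: "finsum (regular_bimodule A) g I = finsum A g I" for g :: "nat \<Rightarrow> _" and I
    by (simp add: finsum_def finprod_def)
  have evaluation: "\<phi> (X.cl f) = f q" if f: "X.cocycle f" for f
  proof -
    have f_hom: "right_hom K A ?P (regular_bimodule A) f" by (rule X.cocycleD(1)[OF f])
    then have f_lin: "linear_map K ?P A f" by (simp add: right_hom_def linear_map_def)
    have f_mem: "x \<in> carrier ?P \<Longrightarrow> f x \<in> carrier A" for x by (rule linear_mapD(1)[OF f_lin])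
    have f_ract: "f (ract ?P x a) = f x \<otimes>\<^bsub>A\<^esub> a" if "x \<in> carrier ?P" "a \<in> carrier A" for x a
      using right_homD(3)[OF f_hom that] by simp
    have f_sum: "f (\<Oplus>\<^bsub>?P\<^esub>i\<in>{..<n}. ract ?P (b i) (c i)) = (\<Oplus>\<^bsub>A\<^esub>i\<in>{..<n}. f (b i) \<otimes>\<^bsub>A\<^esub> c i)"
      if c: "\<And>i. i < n \<Longrightarrow> c i \<in> carrier A" for c
    proof -
      have "f (\<Oplus>\<^bsub>?P\<^esub>i\<in>{..<n}. ract ?P (b i) (c i)) = (\<Oplus>\<^bsub>A\<^esub>i\<in>{..<n}. f (ract ?P (b i) (c i)))"
        using b c by (intro linear_map_finsum[OF X.P.M.abelian_group_axioms X.A.A.abelian_group_axioms f_lin]) auto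
      also have "\<dots> = (\<Oplus>\<^bsub>A\<^esub>i\<in>{..<n}. f (b i) \<otimes>\<^bsub>A\<^esub> c i)"
        using b c f_mem by (intro X.A.A.finsum_cong') (auto simp: f_ract)
      finally show ?thesis .
    qed
    have "f x = (\<Oplus>\<^bsub>A\<^esub>i\<in>{..<n}. f (b i) \<otimes>\<^bsub>A\<^esub> v i x)" if x: "x \<in> carrier ?P" for x
    proof -
      have "f (\<rho> x) = \<zero>\<^bsub>A\<^esub>" using kernel[OF f \<rho>_mem[OF x] \<rho>(2)[OF x]] .
      then have "f x = f (x \<ominus>\<^bsub>?P\<^esub> \<rho> x)"
        using x \<rho>_mem f_mem by (simp add: linear_map_minus[OF X.P.M.abelian_group_axioms X.A.A.abelian_group_axioms f_lin]
            diff_zero[OF X.A.A.abelian_group_axioms])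
      also have "\<dots> = f (\<Oplus>\<^bsub>?P\<^esub>i\<in>{..<n}. ract ?P (b i) (v i x))"
        unfolding v_def using arg_cong[OF expand, of "x \<ominus>\<^bsub>?P\<^esub> \<rho> x" f] x \<rho>_mem by blast
      also have "\<dots> = (\<Oplus>\<^bsub>A\<^esub>i\<in>{..<n}. f (b i) \<otimes>\<^bsub>A\<^esub> v i x)"
        using v_mem x by (intro f_sum)
      finally show ?thesis .
    qed
    then have "X.cl f = X.cl (\<lambda>x. \<Oplus>\<^bsub>regular_bimodule A\<^esub>i\<in>{..<n}. lact (regular_bimodule A) (f (b i)) (v i x))"
      by (intro X.cl_cong) (simp add: finsum_regular)
    also have "\<dots> = (\<Oplus>\<^bsub>X.E\<^esub>i\<in>{..<n}. X.cl (\<lambda>x. lact (regular_bimodule A) (f (b i)) (v i x)))"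
      by (rule X.cocycle_finsum(2)) (use v b f_mem in \<open>auto intro!: X.cocycle_lact simp del: ideal_bimodule_simps\<close>)
    also have "\<dots> = (\<Oplus>\<^bsub>X.E\<^esub>i\<in>{..<n}. lact X.E (f (b i)) (X.cl (v i)))"
    proof (rule E.M.finsum_cong'[OF refl])
      show "(\<lambda>i. lact X.E (f (b i)) (X.cl (v i))) \<in> {..<n} \<rightarrow> carrier X.E"
        using v b f_mem E.lact_closed X.cl_closed by blast
      show "X.cl (\<lambda>x. lact (regular_bimodule A) (f (b i)) (v i x)) = lact X.E (f (b i)) (X.cl (v i))"
        if "i \<in> {..<n}" for i
        using that by (intro X.lact_cl[symmetric] f_mem b v) simp_all
    qed
    finally have "\<phi> (X.cl f) = (\<Oplus>\<^bsub>A\<^esub>i\<in>{..<n}. \<phi> (lact X.E (f (b i)) (X.cl (v i))))"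
      using v b f_mem E.lact_closed[OF X.cl_closed[OF v]]
      by (simp add: linear_map_finsum[OF E.M.abelian_group_axioms X.A.A.abelian_group_axioms \<phi>(1)])
    also have "\<dots> = (\<Oplus>\<^bsub>A\<^esub>i\<in>{..<n}. f (b i) \<otimes>\<^bsub>A\<^esub> \<phi> (X.cl (v i)))"
      using v b f_mem \<phi>(2)[OF X.cl_closed[OF v]] \<phi>_mem[OF X.cl_closed[OF v]] by (intro X.A.A.finsum_cong') auto
    also have "\<dots> = f q"
      unfolding q_def using v \<phi>_mem by (intro f_sum[symmetric]) simp
    finally show ?thesis .
  qed
  have "d m q = \<zero>\<^bsub>P m\<^esub>"
  proof -
    obtain n' :: nat and b' u' where b': "\<And>i. i < n' \<Longrightarrow> b' i \<in> carrier (P m)"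
      and u': "\<And>i. i < n' \<Longrightarrow> linear_map K (P m) A (u' i)"
        "\<And>i x a. \<lbrakk>i < n'; x \<in> carrier (P m); a \<in> carrier A\<rbrakk> \<Longrightarrow> u' i (ract (P m) x a) = u' i x \<otimes>\<^bsub>A\<^esub> a"
      and expand': "\<And>x. x \<in> carrier (P m) \<Longrightarrow> x = (\<Oplus>\<^bsub>P m\<^esub>i\<in>{..<n'}. ract (P m) (b' i) (u' i x))"
      using X.P.projective_dual_basis[OF X.P_projective] by blast
    have u'_hom: "right_hom K A (P m) (regular_bimodule A) (u' i)" if "i < n'" for i
      using u'(1)[OF that] u'(2)[OF that] by (simp add: right_hom_def linear_map_def)
    have zero: "u' i (d m q) = \<zero>\<^bsub>A\<^esub>" if i: "i < n'" for i
      using evaluation[OF X.cocycle_coboundary[OF u'_hom[OF i]]] X.cl_coboundary[OF u'_hom[OF i]]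
        linear_map_zero[OF E.M.abelian_group_axioms X.A.A.abelian_group_axioms \<phi>(1)] by simp
    have "d m q = (\<Oplus>\<^bsub>P m\<^esub>i\<in>{..<n'}. ract (P m) (b' i) (u' i (d m q)))"
      by (rule expand'[OF X.d_closed[OF q]])
    also have "\<dots> = (\<Oplus>\<^bsub>P m\<^esub>i\<in>{..<n'}. \<zero>\<^bsub>P m\<^esub>)"
      using b' by (intro X.P.M.finsum_cong') (auto simp: zero X.P.ract_zero_right)
    finally show ?thesis by (simp add: X.P.M.finsum_zero)
  qed
  moreover obtain f where f: "X.cocycle f" "S = X.cl f" using S by (rule X.E_cases)
  ultimately show ?thesis using kernel[OF f(1) q] evaluation[OF f(1)] by simp
qed


section \<open>The dual bimodule and the global dimension\<close>

lemma module_self_space: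
  assumes "cring K"
  shows "module K (self_space K)"
proof -
  interpret cring K by fact
  have "abelian_group (self_space K)"
    using l_neg by (intro abelian_groupI) (auto simp: self_space_def a_ac)
  then show ?thesis
    by (intro moduleI is_cring) (auto simp: self_space_def l_distr r_distr m_assoc)
qed

lemma dual_bimodule_simps [simp]:
  "carrier (dual_bimodule K A) = lin K A (self_space K)"
  "\<zero>\<^bsub>dual_bimodule K A\<^esub> = (\<lambda>x\<in>carrier A. \<zero>\<^bsub>K\<^esub>)"
  "\<phi> \<oplus>\<^bsub>dual_bimodule K A\<^esub> \<psi> = (\<lambda>x\<in>carrier A. \<phi> x \<oplus>\<^bsub>K\<^esub> \<psi> x)"
  "k \<odot>\<^bsub>dual_bimodule K A\<^esub> \<phi> = (\<lambda>x\<in>carrier A. k \<otimes>\<^bsub>K\<^esub> \<phi> x)"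
  "ract (dual_bimodule K A) \<phi> a = (\<lambda>x\<in>carrier A. \<phi> (a \<otimes>\<^bsub>A\<^esub> x))"
  "lact (dual_bimodule K A) a \<phi> = (\<lambda>x\<in>carrier A. \<phi> (x \<otimes>\<^bsub>A\<^esub> a))"
  by (simp_all add: dual_bimodule_def Let_def self_space_def)

context k_algebra
begin

lemma linear_form_iff:
  "\<phi> \<in> lin K A (self_space K) \<longleftrightarrow> \<phi> \<in> extensional (carrier A) \<and> (\<forall>x\<in>carrier A. \<phi> x \<in> carrier K) \<and>
     (\<forall>x\<in>carrier A. \<forall>y\<in>carrier A. \<phi> (x \<oplus>\<^bsub>A\<^esub> y) = \<phi> x \<oplus>\<^bsub>K\<^esub> \<phi> y) \<and>
     (\<forall>k\<in>carrier K. \<forall>x\<in>carrier A. \<phi> (k \<odot>\<^bsub>A\<^esub> x) = k \<otimes>\<^bsub>K\<^esub> \<phi> x)"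
  by (auto simp: lin_iff linear_map_def self_space_def)

lemma linear_formD:
  assumes "\<phi> \<in> lin K A (self_space K)"
  shows "\<phi> \<in> extensional (carrier A)" "x \<in> carrier A \<Longrightarrow> \<phi> x \<in> carrier K"
    "\<lbrakk>x \<in> carrier A; y \<in> carrier A\<rbrakk> \<Longrightarrow> \<phi> (x \<oplus>\<^bsub>A\<^esub> y) = \<phi> x \<oplus>\<^bsub>K\<^esub> \<phi> y"
    "\<lbrakk>k \<in> carrier K; x \<in> carrier A\<rbrakk> \<Longrightarrow> \<phi> (k \<odot>\<^bsub>A\<^esub> x) = k \<otimes>\<^bsub>K\<^esub> \<phi> x"
  using assms by (simp_all add: linear_form_iff)

lemma linear_form_comp:
  assumes "\<phi> \<in> lin K A (self_space K)" "linear_map K A A f"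
  shows "(\<lambda>x\<in>carrier A. \<phi> (f x)) \<in> lin K A (self_space K)"
  by (rule restrict_in_lin[OF A.module_axioms linear_map_comp[OF assms(2) linear_map_in_lin[OF assms(1)]]])

lemma linear_map_mult_left: "a \<in> carrier A \<Longrightarrow> linear_map K A A (\<lambda>x. a \<otimes>\<^bsub>A\<^esub> x)"
  by (intro linear_mapI) (simp_all add: A.r_distr smult_mult_right)

lemma linear_map_mult_right: "a \<in> carrier A \<Longrightarrow> linear_map K A A (\<lambda>x. x \<otimes>\<^bsub>A\<^esub> a)"
  by (intro linear_mapI) (simp_all add: A.l_distr smult_mult_left)

lemma module_dual: "module K (dual_bimodule K A)"
proof -
  note D = linear_formD
  have "module K (fun_space (carrier A) (self_space K) (lin K A (self_space K)))"
  proof (rule module_fun_space[OF module_self_space[OF A.R.is_cring]])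
    show "lin K A (self_space K) \<subseteq> carrier A \<rightarrow>\<^sub>E carrier (self_space K)"
      by (auto simp: lin_def)
    show "(\<lambda>x\<in>carrier A. \<zero>\<^bsub>self_space K\<^esub>) \<in> lin K A (self_space K)"
      by (rule restrict_in_lin[OF A.module_axioms linear_map_zero_fun[OF module_self_space[OF A.R.is_cring]]])
    show "(\<lambda>x\<in>carrier A. \<phi> x \<oplus>\<^bsub>self_space K\<^esub> \<psi> x) \<in> lin K A (self_space K)"
      if "\<phi> \<in> lin K A (self_space K)" "\<psi> \<in> lin K A (self_space K)" for \<phi> \<psi>
      by (rule restrict_in_lin[OF A.module_axioms linear_map_add[OF module_self_space[OF A.R.is_cring]
            linear_map_in_lin[OF that(1)] linear_map_in_lin[OF that(2)]]])
    show "(\<lambda>x\<in>carrier A. k \<odot>\<^bsub>self_space K\<^esub> \<phi> x) \<in> lin K A (self_space K)"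
      if "k \<in> carrier K" "\<phi> \<in> lin K A (self_space K)" for k \<phi>
      by (rule restrict_in_lin[OF A.module_axioms linear_map_smult[OF module_self_space[OF A.R.is_cring]
            linear_map_in_lin[OF that(2)] that(1)]])
  qed
  then show ?thesis by (rule module_same_ops) (simp_all add: dual_bimodule_def Let_def)
qed

lemma k_bimodule_dual: "k_bimodule K A (dual_bimodule K A)"
proof -
  interpret D: module K "dual_bimodule K A" by (rule module_dual)
  note D = linear_formD
  have ext: "restrict \<phi> (carrier A) = \<phi>" if "\<phi> \<in> lin K A (self_space K)" for \<phi>
    using D(1)[OF that] by (simp add: extensional_restrict)
  show ?thesis
  proof (unfold_locales, goal_cases)
    case (1 \<phi> a) then show ?case by (simp add: linear_form_comp linear_map_mult_left)
  next
    case (2 \<phi> \<psi> a) then show ?case by (simp cong: restrict_cong)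
  next
    case (3 \<phi> a b) then show ?case by (simp add: A.l_distr D(3) cong: restrict_cong)
  next
    case (4 \<phi> a b) then show ?case by (simp add: A.m_assoc cong: restrict_cong)
  next
    case (5 \<phi>) then show ?case by (simp add: ext cong: restrict_cong)
  next
    case (6 k \<phi> a) then show ?case by (simp cong: restrict_cong)
  next
    case (7 k \<phi> a) then show ?case by (simp add: smult_mult_left D(4) cong: restrict_cong)
  next
    case (8 \<phi> a) then show ?case using linear_form_comp[OF _ linear_map_mult_right[of a], of \<phi>] by simp
  next
    case (9 \<phi> \<psi> a) then show ?case by (simp cong: restrict_cong)
  next
    case (10 \<phi> a b) then show ?case by (simp add: A.r_distr D(3) cong: restrict_cong)
  next
    case (11 \<phi> a b) then show ?case by (simp add: A.m_assoc cong: restrict_cong)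
  next
    case (12 \<phi>) then show ?case by (simp add: ext cong: restrict_cong)
  next
    case (13 k \<phi> a) then show ?case by (simp cong: restrict_cong)
  next
    case (14 k \<phi> a) then show ?case by (simp add: smult_mult_right D(4) cong: restrict_cong)
  next
    case (15 \<phi> a b) then show ?case by (simp add: A.m_assoc cong: restrict_cong)
  qed
qed

lemma dual_central:
  assumes "z \<in> carrier A" "\<And>a. a \<in> carrier A \<Longrightarrow> a \<otimes>\<^bsub>A\<^esub> z = z \<otimes>\<^bsub>A\<^esub> a"
  shows "lact (dual_bimodule K A) z \<phi> = ract (dual_bimodule K A) \<phi> z"
  using assms by (simp cong: restrict_cong)

text \<open>
  The action of \<open>\<delta>\<close> contragredient to the one on \<open>A\<close>.
\<close>

lemma derivation_along_dual:
  assumes \<delta>: "derivation K A (regular_bimodule A) \<delta>"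
  shows "derivation_along K A (dual_bimodule K A) \<delta> (\<lambda>\<phi>. \<lambda>x\<in>carrier A. \<ominus>\<^bsub>K\<^esub> \<phi> (\<delta> x))"
proof -
  note D = linear_formD
  have lin: "linear_map K A A \<delta>" using \<delta> by (simp add: derivation_def linear_map_def)
  have mem: "a \<in> carrier A \<Longrightarrow> \<delta> a \<in> carrier A" for a by (rule linear_mapD(1)[OF lin])
  have mult: "\<delta> (a \<otimes>\<^bsub>A\<^esub> b) = a \<otimes>\<^bsub>A\<^esub> \<delta> b \<oplus>\<^bsub>A\<^esub> \<delta> a \<otimes>\<^bsub>A\<^esub> b" if "a \<in> carrier A" "b \<in> carrier A" for a b
    using derivationD(2)[OF \<delta> that] by simp
  have neg: "(\<lambda>x\<in>carrier A. \<ominus>\<^bsub>K\<^esub> \<phi> (\<delta> x)) \<in> lin K A (self_space K)" if \<phi>: "\<phi> \<in> lin K A (self_space K)" for \<phi>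
    using mem D[OF \<phi>] linear_mapD[OF lin]
    by (simp add: linear_form_iff A.R.minus_add A.R.r_minus A.R.a_comm)
  show ?thesis
    unfolding derivation_along_def
  proof (intro conjI ballI linear_mapI)
    fix \<phi> assume "\<phi> \<in> carrier (dual_bimodule K A)"
    then show "(\<lambda>x\<in>carrier A. \<ominus>\<^bsub>K\<^esub> \<phi> (\<delta> x)) \<in> carrier (dual_bimodule K A)" by (simp add: neg)
  next
    fix \<phi> \<psi> assume "\<phi> \<in> carrier (dual_bimodule K A)" "\<psi> \<in> carrier (dual_bimodule K A)"
    then show "(\<lambda>x\<in>carrier A. \<ominus>\<^bsub>K\<^esub> (\<phi> \<oplus>\<^bsub>dual_bimodule K A\<^esub> \<psi>) (\<delta> x))
      = (\<lambda>x\<in>carrier A. \<ominus>\<^bsub>K\<^esub> \<phi> (\<delta> x)) \<oplus>\<^bsub>dual_bimodule K A\<^esub> (\<lambda>x\<in>carrier A. \<ominus>\<^bsub>K\<^esub> \<psi> (\<delta> x))"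
      by (simp add: mem D(2) A.R.minus_add A.R.a_comm cong: restrict_cong)
  next
    fix k \<phi> assume "k \<in> carrier K" "\<phi> \<in> carrier (dual_bimodule K A)"
    then show "(\<lambda>x\<in>carrier A. \<ominus>\<^bsub>K\<^esub> (k \<odot>\<^bsub>dual_bimodule K A\<^esub> \<phi>) (\<delta> x))
      = k \<odot>\<^bsub>dual_bimodule K A\<^esub> (\<lambda>x\<in>carrier A. \<ominus>\<^bsub>K\<^esub> \<phi> (\<delta> x))"
      by (simp add: mem D(2) A.R.r_minus cong: restrict_cong)
  next
    fix \<phi> a assume "\<phi> \<in> carrier (dual_bimodule K A)" and a: "a \<in> carrier A"
    then have \<phi>: "\<phi> \<in> lin K A (self_space K)" by simp
    show "(\<lambda>x\<in>carrier A. \<ominus>\<^bsub>K\<^esub> ract (dual_bimodule K A) \<phi> a (\<delta> x))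
      = ract (dual_bimodule K A) (\<lambda>x\<in>carrier A. \<ominus>\<^bsub>K\<^esub> \<phi> (\<delta> x)) a
        \<oplus>\<^bsub>dual_bimodule K A\<^esub> ract (dual_bimodule K A) \<phi> (\<delta> a)"
      using a by (simp add: mem mult D(2,3)[OF \<phi>] A.R.minus_add A.R.a_assoc A.R.l_neg cong: restrict_cong)
    show "(\<lambda>x\<in>carrier A. \<ominus>\<^bsub>K\<^esub> lact (dual_bimodule K A) a \<phi> (\<delta> x))
      = lact (dual_bimodule K A) (\<delta> a) \<phi>
        \<oplus>\<^bsub>dual_bimodule K A\<^esub> lact (dual_bimodule K A) a (\<lambda>x\<in>carrier A. \<ominus>\<^bsub>K\<^esub> \<phi> (\<delta> x))"
      using a by (simp add: mem mult D(2,3)[OF \<phi>] A.R.minus_add A.R.a_assoc[symmetric] A.R.r_neg cong: restrict_cong)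
  qed
qed

end

text \<open>
  The images of a spanning set span. A sum over \<open>S\<close> is not literally a sum over \<open>f ` S\<close>, as \<open>f\<close> may identify
  elements; so the combinations of \<open>f ` S\<close> are shown to be closed under sums and to contain all \<open>k f(s)\<close>.
\<close>

lemma fin_dim_image:
  assumes V: "module K V" and W: "module K W" and f: "linear_map K V W f" "f ` carrier V = carrier W"
    and fin: "fin_dim K V"
  shows "fin_dim K W"
proof -
  interpret V: module K V by fact
  interpret W: module K W by fact
  from fin obtain S where S: "finite S" "S \<subseteq> carrier V"
    and span: "\<And>v. v \<in> carrier V \<Longrightarrow> \<exists>a \<in> S \<rightarrow> carrier K. v = (\<Oplus>\<^bsub>V\<^esub>s\<in>S. a s \<odot>\<^bsub>V\<^esub> s)"
    by (auto simp: fin_dim_def)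
  define comb where "comb = {w. \<exists>a \<in> f ` S \<rightarrow> carrier K. w = (\<Oplus>\<^bsub>W\<^esub>t\<in>f ` S. a t \<odot>\<^bsub>W\<^esub> t)}"
  have T: "f ` S \<subseteq> carrier W" using S(2) f(2) by blast
  have zero: "\<zero>\<^bsub>W\<^esub> \<in> comb"
  proof -
    have "(\<Oplus>\<^bsub>W\<^esub>t\<in>f ` S. \<zero>\<^bsub>K\<^esub> \<odot>\<^bsub>W\<^esub> t) = (\<Oplus>\<^bsub>W\<^esub>t\<in>f ` S. \<zero>\<^bsub>W\<^esub>)"
      using T by (intro W.finsum_cong') auto
    then show ?thesis
      unfolding comb_def by (intro CollectI bexI[of _ "\<lambda>_. \<zero>\<^bsub>K\<^esub>"]) (simp_all add: W.finsum_zero)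
  qed
  have add: "w \<oplus>\<^bsub>W\<^esub> w' \<in> comb" if "w \<in> comb" "w' \<in> comb" for w w'
  proof -
    from that obtain a a' where a: "a \<in> f ` S \<rightarrow> carrier K" "a' \<in> f ` S \<rightarrow> carrier K"
      and w: "w = (\<Oplus>\<^bsub>W\<^esub>t\<in>f ` S. a t \<odot>\<^bsub>W\<^esub> t)" "w' = (\<Oplus>\<^bsub>W\<^esub>t\<in>f ` S. a' t \<odot>\<^bsub>W\<^esub> t)"
      unfolding comb_def by blast
    have "w \<oplus>\<^bsub>W\<^esub> w' = (\<Oplus>\<^bsub>W\<^esub>t\<in>f ` S. a t \<odot>\<^bsub>W\<^esub> t \<oplus>\<^bsub>W\<^esub> a' t \<odot>\<^bsub>W\<^esub> t)"
      unfolding w using a T by (intro W.finsum_addf[symmetric]) blast+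
    also have "\<dots> = (\<Oplus>\<^bsub>W\<^esub>t\<in>f ` S. (a t \<oplus>\<^bsub>K\<^esub> a' t) \<odot>\<^bsub>W\<^esub> t)"
      using a T by (intro W.finsum_cong') (auto simp: W.smult_l_distr Pi_iff subset_iff)
    finally show ?thesis
      unfolding comb_def using a by (intro CollectI bexI[of _ "\<lambda>t. a t \<oplus>\<^bsub>K\<^esub> a' t"]) auto
  qed
  have single: "k \<odot>\<^bsub>W\<^esub> f s \<in> comb" if "s \<in> S" "k \<in> carrier K" for k s
  proof -
    have fs: "f s \<in> f ` S" "f s \<in> carrier W" using that T by auto
    have "(\<Oplus>\<^bsub>W\<^esub>t\<in>f ` S. (if f s = t then k else \<zero>\<^bsub>K\<^esub>) \<odot>\<^bsub>W\<^esub> t)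
        = (\<Oplus>\<^bsub>W\<^esub>t\<in>f ` S. if f s = t then k \<odot>\<^bsub>W\<^esub> t else \<zero>\<^bsub>W\<^esub>)"
      using T that by (intro W.finsum_cong') (auto simp: subset_iff)
    also have "\<dots> = k \<odot>\<^bsub>W\<^esub> f s"
      using fs T that S(1) by (intro W.finsum_singleton) auto
    finally show ?thesis
      unfolding comb_def using that
      by (intro CollectI bexI[of _ "\<lambda>t. if f s = t then k else \<zero>\<^bsub>K\<^esub>"]) auto
  qed
  have "w \<in> comb" if "w \<in> carrier W" for w
  proof -
    have "w \<in> f ` carrier V" using that f(2) by simp
    then obtain v where v: "w = f v" "v \<in> carrier V" by (elim imageE)
    obtain a where a: "a \<in> S \<rightarrow> carrier K" "v = (\<Oplus>\<^bsub>V\<^esub>s\<in>S. a s \<odot>\<^bsub>V\<^esub> s)" using span[OF v(2)] by blast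
    have mem: "a s \<in> carrier K" "s \<in> carrier V" "f s \<in> carrier W" if "s \<in> S" for s
      using that a(1) S(2) T by auto
    then have aS: "(\<lambda>s. a s \<odot>\<^bsub>V\<^esub> s) \<in> S \<rightarrow> carrier V" by simp
    have "w = (\<Oplus>\<^bsub>W\<^esub>s\<in>S. f (a s \<odot>\<^bsub>V\<^esub> s))"
      unfolding v(1) a(2) by (rule linear_map_finsum[OF V.abelian_group_axioms W.abelian_group_axioms f(1) aS S(1)])
    also have "\<dots> = (\<Oplus>\<^bsub>W\<^esub>s\<in>S. a s \<odot>\<^bsub>W\<^esub> f s)"
      by (intro W.finsum_cong') (simp_all add: linear_mapD(3)[OF f(1)] mem)
    also have "\<dots> \<in> comb"
    proof -
      have "I \<subseteq> S \<Longrightarrow> (\<Oplus>\<^bsub>W\<^esub>s\<in>I. a s \<odot>\<^bsub>W\<^esub> f s) \<in> comb" if "finite I" for I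
        using that
      proof (induction I rule: finite_induct)
        case empty
        then show ?case by (simp add: zero)
      next
        case (insert s I)
        have "(\<Oplus>\<^bsub>W\<^esub>s\<in>insert s I. a s \<odot>\<^bsub>W\<^esub> f s) = a s \<odot>\<^bsub>W\<^esub> f s \<oplus>\<^bsub>W\<^esub> (\<Oplus>\<^bsub>W\<^esub>s\<in>I. a s \<odot>\<^bsub>W\<^esub> f s)"
          using insert.hyps insert.prems mem by (intro W.finsum_insert) auto
        also have "\<dots> \<in> comb"
          using insert.IH insert.prems mem by (intro add single) simp_all
        finally show ?case .
      qed
      then show ?thesis using S(1) by blast
    qed
    finally show ?thesis .
  qed
  then show ?thesis
    unfolding fin_dim_def comb_def using S(1) T by (intro exI[of _ "f ` S"]) auto
qed

text \<open>
  \<open>global_dim_le\<close> speaks of modules whose elements are functions \<open>nat \<Rightarrow> 'k\<close>. To apply it to a dual space, the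
  structure is transported along an injection \<open>\<psi>\<close>.
\<close>

definition copy_rmodule :: "('m \<Rightarrow> 'n) \<Rightarrow> ('k, 'a, 'm, 'x) rmodule_scheme \<Rightarrow> ('k, 'a, 'n) rmodule" where
  "copy_rmodule \<psi> M = (let g = inv_into (carrier M) \<psi> in
     \<lparr>carrier = \<psi> ` carrier M, monoid.mult = undefined, one = undefined, zero = \<psi> \<zero>\<^bsub>M\<^esub>,
      add = (\<lambda>x y. \<psi> (g x \<oplus>\<^bsub>M\<^esub> g y)), smult = (\<lambda>k x. \<psi> (k \<odot>\<^bsub>M\<^esub> g x)),
      ract = (\<lambda>x a. \<psi> (ract M (g x) a))\<rparr>)"

lemma (in k_rmodule) copy_rmodule:
  assumes inj: "inj_on \<psi> (carrier M)" and fin: "fin_dim K M"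
  shows "fin_dim_rmodule K A (copy_rmodule \<psi> M)"
    and "right_hom K A M (copy_rmodule \<psi> M) \<psi>"
    and "right_hom K A (copy_rmodule \<psi> M) M (inv_into (carrier M) \<psi>)"
proof -
  let ?g = "inv_into (carrier M) \<psi>" and ?C = "copy_rmodule \<psi> M"
  have g [simp]: "?g (\<psi> x) = x" if "x \<in> carrier M" for x using inj that by simp
  have simps [simp]: "carrier ?C = \<psi> ` carrier M" "\<zero>\<^bsub>?C\<^esub> = \<psi> \<zero>\<^bsub>M\<^esub>"
    "add ?C = (\<lambda>x y. \<psi> (?g x \<oplus>\<^bsub>M\<^esub> ?g y))" "smult ?C = (\<lambda>k x. \<psi> (k \<odot>\<^bsub>M\<^esub> ?g x))"
    "ract ?C = (\<lambda>x a. \<psi> (ract M (?g x) a))"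
    by (simp_all add: copy_rmodule_def Let_def)
  have ag: "abelian_group ?C"
  proof (rule abelian_groupI)
    fix x assume "x \<in> carrier ?C"
    then obtain y where "y \<in> carrier M" "x = \<psi> y" by auto
    then show "\<exists>z\<in>carrier ?C. z \<oplus>\<^bsub>?C\<^esub> x = \<zero>\<^bsub>?C\<^esub>"
      by (intro bexI[of _ "\<psi> (\<ominus>\<^bsub>M\<^esub> y)"]) (simp_all add: M.l_neg)
  qed (auto simp: M.a_ac)
  have mod: "module K ?C"
    by (rule moduleI[OF module.axioms(1)[OF M.module_axioms] ag]) (auto simp: M.smult_l_distr M.smult_r_distr M.smult_assoc1)
  interpret C: module K ?C by (rule mod)
  show hom: "right_hom K A M ?C \<psi>" by (auto simp: right_hom_def linear_map_def)
  show "right_hom K A ?C M ?g" by (auto simp: right_hom_def linear_map_def)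
  have "fin_dim K ?C"
    by (rule fin_dim_image[OF M.module_axioms mod right_homD(1)[OF hom] _ fin]) simp
  then show "fin_dim_rmodule K A ?C"
    by unfold_locales (auto simp: ract_add_left ract_add_right ract_mult ract_one ract_smult_left ract_smult_right)
qed

text \<open>
  A linear form is determined by its values on a finite spanning set.
\<close>

lemma (in k_algebra) dual_embeds_in_sequences:
  assumes "fin_dim K A"
  obtains \<psi> :: "('a \<Rightarrow> 'k) \<Rightarrow> nat \<Rightarrow> 'k" where "inj_on \<psi> (carrier (dual_bimodule K A))"
proof -
  from assms obtain S where S: "finite S" "S \<subseteq> carrier A"
    and span: "\<And>v. v \<in> carrier A \<Longrightarrow> \<exists>a \<in> S \<rightarrow> carrier K. v = (\<Oplus>\<^bsub>A\<^esub>s\<in>S. a s \<odot>\<^bsub>A\<^esub> s)"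
    by (auto simp: fin_dim_def)
  obtain xs where xs: "set xs = S" using finite_list[OF S(1)] by blast
  interpret K: module K "self_space K" by (rule module_self_space[OF A.R.is_cring])
  have inj: "\<phi> = \<chi>" if \<phi>: "\<phi> \<in> lin K A (self_space K)" and \<chi>: "\<chi> \<in> lin K A (self_space K)"
    and eq: "\<And>i. i < length xs \<Longrightarrow> \<phi> (xs ! i) = \<chi> (xs ! i)" for \<phi> \<chi>
  proof (rule extensionalityI[OF linear_formD(1)[OF \<phi>] linear_formD(1)[OF \<chi>]])
    fix v assume "v \<in> carrier A"
    then obtain a where a: "a \<in> S \<rightarrow> carrier K" "v = (\<Oplus>\<^bsub>A\<^esub>s\<in>S. a s \<odot>\<^bsub>A\<^esub> s)" using span by blast
    have aS: "(\<lambda>s. a s \<odot>\<^bsub>A\<^esub> s) \<in> S \<rightarrow> carrier A" using a(1) S(2) by blast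
    have S_eq: "\<phi> s = \<chi> s" if "s \<in> S" for s using that eq unfolding xs[symmetric] by (metis in_set_conv_nth)
    note sum = linear_map_finsum[OF A.abelian_group_axioms K.abelian_group_axioms _ aS S(1)]
    have "\<phi> v = (\<Oplus>\<^bsub>self_space K\<^esub>s\<in>S. \<phi> (a s \<odot>\<^bsub>A\<^esub> s))"
      unfolding a(2) by (rule sum[OF linear_map_in_lin[OF \<phi>]])
    also have "\<dots> = (\<Oplus>\<^bsub>self_space K\<^esub>s\<in>S. \<chi> (a s \<odot>\<^bsub>A\<^esub> s))"
    proof (rule K.finsum_cong'[OF refl])
      show "(\<lambda>s. \<chi> (a s \<odot>\<^bsub>A\<^esub> s)) \<in> S \<rightarrow> carrier (self_space K)"
        using aS linear_formD(2)[OF \<chi>] by (auto simp: self_space_def)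
      show "\<phi> (a s \<odot>\<^bsub>A\<^esub> s) = \<chi> (a s \<odot>\<^bsub>A\<^esub> s)" if "s \<in> S" for s
      proof -
        have "a s \<in> carrier K" "s \<in> carrier A" using that a(1) S(2) by auto
        then show ?thesis using S_eq[OF that] by (simp add: linear_formD(4)[OF \<phi>] linear_formD(4)[OF \<chi>])
      qed
    qed
    also have "\<dots> = \<chi> v"
      unfolding a(2) by (rule sum[OF linear_map_in_lin[OF \<chi>], symmetric])
    finally show "\<phi> v = \<chi> v" .
  qed
  show thesis
  proof (rule that[of "\<lambda>\<phi> i. if i < length xs then \<phi> (xs ! i) else \<zero>\<^bsub>K\<^esub>"], rule inj_onI)
    fix \<phi> \<chi> assume "\<phi> \<in> carrier (dual_bimodule K A)" "\<chi> \<in> carrier (dual_bimodule K A)"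
      and eq: "(\<lambda>i. if i < length xs then \<phi> (xs ! i) else \<zero>\<^bsub>K\<^esub>)
        = (\<lambda>i. if i < length xs then \<chi> (xs ! i) else \<zero>\<^bsub>K\<^esub>)"
    then show "\<phi> = \<chi>"
    proof (intro inj)
      show "\<phi> (xs ! i) = \<chi> (xs ! i)" if "i < length xs" for i
        using fun_cong[OF eq, of i] that by simp
    qed simp_all
  qed
qed

text \<open>
  The dual bimodule is finite-dimensional as the image of \<open>P 0\<close>, so a copy of it is subject to the bound on the
  global dimension and has a resolution of length \<open>m + 1\<close>.
\<close>

lemma cycles_retract_of_global_dim_le:
  fixes K :: "('k, 'r) ring_scheme" and A :: "('k, 'a, 's) module_scheme" and P :: "nat \<Rightarrow> ('k, 'a, 'p) rmodule"
  assumes A: "fin_dim_algebra K A" and gd: "global_dim_le K A (Suc m)"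
    and res: "resolution K A (dual_bimodule K A) P d \<epsilon>"
  obtains \<rho> where "right_hom K A (P (Suc m)) (P (Suc m)) \<rho>"
    "\<And>x. x \<in> carrier (P (Suc m)) \<Longrightarrow> d m (\<rho> x) = \<zero>\<^bsub>P m\<^esub>"
    "\<And>x. \<lbrakk>x \<in> carrier (P (Suc m)); d m x = \<zero>\<^bsub>P m\<^esub>\<rbrakk> \<Longrightarrow> \<rho> x = x"
proof -
  interpret fin_dim_algebra K A by fact
  interpret A: k_algebra K A by (rule k_algebra)
  interpret R: resolution K A "dual_bimodule K A" P d \<epsilon> by fact
  obtain \<psi> :: "('a \<Rightarrow> 'k) \<Rightarrow> nat \<Rightarrow> 'k" where \<psi>: "inj_on \<psi> (carrier (dual_bimodule K A))"
    using A.dual_embeds_in_sequences[OF fin_dim] by blast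
  have "fin_dim_rmodule K A (P 0)" using R.resolution by (simp add: projective_resolution_def)
  then have "fin_dim K (P 0)" by (rule fin_dim_rmodule.fin_dim)
  then have "fin_dim K (dual_bimodule K A)"
    by (rule fin_dim_image[OF R.P.M.module_axioms R.M.M.module_axioms right_homD(1)[OF R.\<epsilon>_hom] R.\<epsilon>_surj])
  note copy = R.M.copy_rmodule[OF \<psi> this]
  let ?C = "copy_rmodule \<psi> (dual_bimodule K A)"
  obtain P' :: "nat \<Rightarrow> ('k, 'a, nat \<Rightarrow> 'k) rmodule" and d' \<epsilon>'
    where P': "projective_resolution K A ?C P' d' \<epsilon>'" "\<And>i. i > Suc m \<Longrightarrow> carrier (P' i) = {\<zero>\<^bsub>P' i\<^esub>}"
    using gd copy(1) unfolding global_dim_le_def proj_dim_le_def by metis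
  have res': "resolution K A ?C P' d' \<epsilon>'"
    by (intro resolution.intro resolution_axioms.intro A.k_algebra_axioms P'(1)
        fin_dim_rmodule.k_rmodule[OF copy(1)])
  show thesis
    by (rule cycles_retract[OF res res' copy(2,3) _ P'(2), of m]) (use \<psi> in \<open>simp_all add: that\<close>)
qed


section \<open>Trivial extensions and partial relation extensions\<close>

lemma trivial_ext_simps [simp]:
  "carrier (trivial_ext A M) = carrier A \<times> carrier M"
  "(a, x) \<otimes>\<^bsub>trivial_ext A M\<^esub> (b, y) = (a \<otimes>\<^bsub>A\<^esub> b, lact M a y \<oplus>\<^bsub>M\<^esub> ract M x b)"
  "\<one>\<^bsub>trivial_ext A M\<^esub> = (\<one>\<^bsub>A\<^esub>, \<zero>\<^bsub>M\<^esub>)" "\<zero>\<^bsub>trivial_ext A M\<^esub> = (\<zero>\<^bsub>A\<^esub>, \<zero>\<^bsub>M\<^esub>)"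
  "(a, x) \<oplus>\<^bsub>trivial_ext A M\<^esub> (b, y) = (a \<oplus>\<^bsub>A\<^esub> b, x \<oplus>\<^bsub>M\<^esub> y)"
  "k \<odot>\<^bsub>trivial_ext A M\<^esub> (a, x) = (k \<odot>\<^bsub>A\<^esub> a, k \<odot>\<^bsub>M\<^esub> x)"
  by (simp_all add: trivial_ext_def)

context k_bimodule
begin

lemma k_algebra_trivial_ext: "k_algebra K (trivial_ext A M)"
proof -
  let ?T = "trivial_ext A M"
  have ag: "abelian_group ?T"
  proof (rule abelian_groupI)
    show "\<exists>y\<in>carrier ?T. y \<oplus>\<^bsub>?T\<^esub> x = \<zero>\<^bsub>?T\<^esub>" if "x \<in> carrier ?T" for x
      using that by (intro bexI[of _ "(\<ominus>\<^bsub>A\<^esub> fst x, \<ominus>\<^bsub>M\<^esub> snd x)"]) (auto simp: A.A.l_neg M.l_neg)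
  qed (auto simp: A.A.a_ac M.a_ac)
  interpret T: module K ?T
    by (rule moduleI[OF module.axioms(1)[OF M.module_axioms] ag])
      (auto simp: A.A.smult_l_distr A.A.smult_r_distr A.A.smult_assoc1 M.smult_l_distr M.smult_r_distr M.smult_assoc1)
  have "monoid ?T"
    by (rule monoidI) (auto simp: A.A.m_assoc lact_add_right ract_add_left lact_mult ract_mult lact_ract
        lact_one ract_one lact_zero_right ract_zero_left M.a_ac)
  then interpret T: ring ?T
    by (rule ringI[OF ag]) (auto simp: A.A.l_distr A.A.r_distr lact_add_right ract_add_left lact_add_left
        ract_add_right M.a_ac)
  show ?thesis
    by unfold_locales (auto simp: A.smult_mult_left A.smult_mult_right lact_smult_left lact_smult_right
        ract_smult_left ract_smult_right M.smult_r_distr)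
qed

lemma derivation_trivial_ext:
  assumes \<delta>: "derivation K A (regular_bimodule A) \<delta>" and \<psi>: "derivation K A M \<psi>"
    and \<kappa>: "derivation_along K A M \<delta> \<kappa>"
  shows "derivation K (trivial_ext A M) (regular_bimodule (trivial_ext A M)) (\<lambda>(a, x). (\<delta> a, \<psi> a \<oplus>\<^bsub>M\<^esub> \<kappa> x))"
proof -
  have \<delta>_lin: "linear_map K A A \<delta>" using \<delta> by (simp add: derivation_def linear_map_def)
  note lin = linear_mapD[OF \<delta>_lin] linear_mapD[OF derivationD(1)[OF \<psi>]] linear_mapD[OF derivation_alongD(1)[OF \<kappa>]]
  have \<delta>_mult: "\<delta> (a \<otimes>\<^bsub>A\<^esub> b) = a \<otimes>\<^bsub>A\<^esub> \<delta> b \<oplus>\<^bsub>A\<^esub> \<delta> a \<otimes>\<^bsub>A\<^esub> b" if "a \<in> carrier A" "b \<in> carrier A" for a b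
    using derivationD(2)[OF \<delta> that] by simp
  show ?thesis
    unfolding derivation_def linear_map_def
    by (auto simp: lin \<delta>_mult derivationD(2)[OF \<psi>] derivation_alongD(3,4)[OF \<kappa>] M.smult_r_distr
        lact_add_right ract_add_left M.a_ac)
qed

text \<open>
  A derivation of \<open>A \<ltimes> M\<close> has four components. The one from \<open>M\<close> to \<open>A\<close> is left linear over \<open>A\<close>, by the Leibniz
  rule for \<open>(a, 0)(0, x)\<close>, and \<open>zero\<close> excludes it.
\<close>

lemma derivation_trivial_ext_components:
  assumes D: "derivation K (trivial_ext A M) (regular_bimodule (trivial_ext A M)) D"
    and zero: "\<And>\<phi> x. \<lbrakk>linear_map K M A \<phi>;
        \<And>a x. \<lbrakk>a \<in> carrier A; x \<in> carrier M\<rbrakk> \<Longrightarrow> \<phi> (lact M a x) = a \<otimes>\<^bsub>A\<^esub> \<phi> x; x \<in> carrier M\<rbrakk> \<Longrightarrow> \<phi> x = \<zero>\<^bsub>A\<^esub>"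
  obtains \<delta> \<psi> \<kappa> where "derivation K A (regular_bimodule A) \<delta>" "derivation K A M \<psi>" "derivation_along K A M \<delta> \<kappa>"
    "\<And>a x. \<lbrakk>a \<in> carrier A; x \<in> carrier M\<rbrakk> \<Longrightarrow> D (a, x) = (\<delta> a, \<psi> a \<oplus>\<^bsub>M\<^esub> \<kappa> x)"
proof -
  let ?T = "trivial_ext A M"
  define \<delta> where "\<delta> a = fst (D (a, \<zero>\<^bsub>M\<^esub>))" for a
  define \<psi> where "\<psi> a = snd (D (a, \<zero>\<^bsub>M\<^esub>))" for a
  define \<gamma> where "\<gamma> x = fst (D (\<zero>\<^bsub>A\<^esub>, x))" for x
  define \<kappa> where "\<kappa> x = snd (D (\<zero>\<^bsub>A\<^esub>, x))" for x
  have Da: "D (a, \<zero>\<^bsub>M\<^esub>) = (\<delta> a, \<psi> a)" for a by (simp add: \<delta>_def \<psi>_def)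
  have Dx: "D (\<zero>\<^bsub>A\<^esub>, x) = (\<gamma> x, \<kappa> x)" for x by (simp add: \<gamma>_def \<kappa>_def)
  have D_mem: "D (a, x) \<in> carrier A \<times> carrier M" if "a \<in> carrier A" "x \<in> carrier M" for a x
    using linear_mapD(1)[OF derivationD(1)[OF D], of "(a, x)"] that by simp
  have D_add: "D (a \<oplus>\<^bsub>A\<^esub> b, x \<oplus>\<^bsub>M\<^esub> y) = D (a, x) \<oplus>\<^bsub>?T\<^esub> D (b, y)"
    if "a \<in> carrier A" "x \<in> carrier M" "b \<in> carrier A" "y \<in> carrier M" for a x b y
    using linear_mapD(2)[OF derivationD(1)[OF D], of "(a, x)" "(b, y)"] that by simp
  have D_smult: "D (k \<odot>\<^bsub>A\<^esub> a, k \<odot>\<^bsub>M\<^esub> x) = k \<odot>\<^bsub>?T\<^esub> D (a, x)"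
    if "k \<in> carrier K" "a \<in> carrier A" "x \<in> carrier M" for k a x
    using linear_mapD(3)[OF derivationD(1)[OF D], of k "(a, x)"] that by simp
  have D_mult: "D (a \<otimes>\<^bsub>A\<^esub> b, lact M a y \<oplus>\<^bsub>M\<^esub> ract M x b) = (a, x) \<otimes>\<^bsub>?T\<^esub> D (b, y) \<oplus>\<^bsub>?T\<^esub> D (a, x) \<otimes>\<^bsub>?T\<^esub> (b, y)"
    if "a \<in> carrier A" "x \<in> carrier M" "b \<in> carrier A" "y \<in> carrier M" for a x b y
    using derivationD(2)[OF D, of "(a, x)" "(b, y)"] that by simp
  have mem [simp]: "a \<in> carrier A \<Longrightarrow> \<delta> a \<in> carrier A" "a \<in> carrier A \<Longrightarrow> \<psi> a \<in> carrier M"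
    "x \<in> carrier M \<Longrightarrow> \<gamma> x \<in> carrier A" "x \<in> carrier M \<Longrightarrow> \<kappa> x \<in> carrier M" for a x
    using D_mem[of a "\<zero>\<^bsub>M\<^esub>"] D_mem[of "\<zero>\<^bsub>A\<^esub>" x] by (auto simp: Da Dx)
  have \<gamma>\<kappa>_lin: "linear_map K M A \<gamma>" "linear_map K M M \<kappa>"
    using D_add[of "\<zero>\<^bsub>A\<^esub>" _ "\<zero>\<^bsub>A\<^esub>"] D_smult[of _ "\<zero>\<^bsub>A\<^esub>"] by (auto simp: linear_map_def Dx)
  have \<delta>\<psi>_lin: "linear_map K A A \<delta>" "linear_map K A M \<psi>"
    using D_add[of _ "\<zero>\<^bsub>M\<^esub>" _ "\<zero>\<^bsub>M\<^esub>"] D_smult[of _ _ "\<zero>\<^bsub>M\<^esub>"] by (auto simp: linear_map_def Da)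
  have left: "(\<gamma> (lact M a x), \<kappa> (lact M a x)) = (a \<otimes>\<^bsub>A\<^esub> \<gamma> x, lact M a (\<kappa> x) \<oplus>\<^bsub>M\<^esub> lact M (\<delta> a) x)"
    if "a \<in> carrier A" "x \<in> carrier M" for a x
    using D_mult[of a "\<zero>\<^bsub>M\<^esub>" "\<zero>\<^bsub>A\<^esub>" x] that
    by (simp add: ract_zero_left ract_zero_right lact_zero_left lact_zero_right Da Dx)
  have \<gamma>_zero: "\<gamma> x = \<zero>\<^bsub>A\<^esub>" if "x \<in> carrier M" for x
    by (rule zero[OF \<gamma>\<kappa>_lin(1) _ that]) (use left in simp)
  have right: "\<kappa> (ract M x a) = ract M x (\<delta> a) \<oplus>\<^bsub>M\<^esub> ract M (\<kappa> x) a"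
    if "a \<in> carrier A" "x \<in> carrier M" for a x
    using D_mult[of "\<zero>\<^bsub>A\<^esub>" x a "\<zero>\<^bsub>M\<^esub>"] that
    by (simp add: ract_zero_left ract_zero_right lact_zero_left lact_zero_right Da Dx)
  have mult: "(\<delta> (a \<otimes>\<^bsub>A\<^esub> b), \<psi> (a \<otimes>\<^bsub>A\<^esub> b))
      = (a \<otimes>\<^bsub>A\<^esub> \<delta> b \<oplus>\<^bsub>A\<^esub> \<delta> a \<otimes>\<^bsub>A\<^esub> b, lact M a (\<psi> b) \<oplus>\<^bsub>M\<^esub> ract M (\<psi> a) b)"
    if "a \<in> carrier A" "b \<in> carrier A" for a b
    using D_mult[of a "\<zero>\<^bsub>M\<^esub>" b "\<zero>\<^bsub>M\<^esub>"] that
    by (simp add: ract_zero_left lact_zero_right Da)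
  show thesis
  proof (rule that)
    show "derivation K A (regular_bimodule A) \<delta>" "derivation K A M \<psi>"
      using \<delta>\<psi>_lin mult by (simp_all add: derivation_def linear_map_def)
    show "derivation_along K A M \<delta> \<kappa>"
      using \<gamma>\<kappa>_lin(2) left right by (simp add: derivation_along_def M.a_comm)
    show "D (a, x) = (\<delta> a, \<psi> a \<oplus>\<^bsub>M\<^esub> \<kappa> x)" if "a \<in> carrier A" "x \<in> carrier M" for a x
      using D_add[of a "\<zero>\<^bsub>M\<^esub>" "\<zero>\<^bsub>A\<^esub>" x] that by (simp add: Da Dx \<gamma>_zero)
  qed
qed

lemma k_bimodule_sub_bimodule:
  assumes "sub_bimodule K A M U"
  shows "k_bimodule K A (M\<lparr>carrier := U\<rparr>)"
proof -
  have sub: "submodule U K M" and closed: "\<And>x a. \<lbrakk>x \<in> U; a \<in> carrier A\<rbrakk> \<Longrightarrow> ract M x a \<in> U"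
    "\<And>x a. \<lbrakk>x \<in> U; a \<in> carrier A\<rbrakk> \<Longrightarrow> lact M a x \<in> U"
    using assms by (auto simp: sub_bimodule_def)
  have U: "x \<in> U \<Longrightarrow> x \<in> carrier M" for x using M.submoduleE(1)[OF sub] by blast
  interpret U: module K "M\<lparr>carrier := U\<rparr>" by (rule submodule.submodule_is_module[OF sub M.module_axioms])
  show ?thesis
    by unfold_locales (simp_all add: closed U ract_add_left ract_add_right ract_mult ract_one ract_smult_left
        ract_smult_right lact_add_left lact_add_right lact_mult lact_one lact_smult_left lact_smult_right lact_ract)
qed

end

text \<open>
  For \<open>B = C \<ltimes> E'\<close> over \<open>C\<close> the summand \<open>\<E>(E', C)\<close> vanishes, and the left term becomes \<open>H\<^sup>1(B, E')\<close> itself.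
\<close>

lemma short_exact_drop_trivial_summand:
  assumes "module K U" "module K Y" "carrier Y = {\<zero>\<^bsub>Y\<^esub>}"
    and "short_exact K (direct_sum U Y) V W f g"
  shows "\<exists>\<iota>. short_exact K U V W \<iota> g"
proof -
  interpret U: module K U by fact
  interpret Y: module K Y by fact
  have f: "linear_map K (direct_sum U Y) V f" "inj_on f (carrier (direct_sum U Y))"
    using assms(4) by (auto simp: short_exact_def lin_iff)
  let ?\<iota> = "\<lambda>u\<in>carrier U. f (u, \<zero>\<^bsub>Y\<^esub>)"
  have "linear_map K U (direct_sum U Y) (\<lambda>u. (u, \<zero>\<^bsub>Y\<^esub>))"
    by (intro linear_mapI) simp_all
  from restrict_in_lin[OF assms(1) linear_map_comp[OF this f(1)]] have "?\<iota> \<in> lin K U V" .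
  moreover have "inj_on ?\<iota> (carrier U)"
  proof (rule inj_onI)
    fix u v assume "u \<in> carrier U" "v \<in> carrier U" "?\<iota> u = ?\<iota> v"
    then show "u = v" using inj_onD[OF f(2), of "(u, \<zero>\<^bsub>Y\<^esub>)" "(v, \<zero>\<^bsub>Y\<^esub>)"] by simp
  qed
  moreover have "?\<iota> ` carrier U = f ` carrier (direct_sum U Y)"
    using assms(3) by (auto simp: image_iff)
  ultimately have "short_exact K U V W ?\<iota> g" using assms(4) by (simp add: short_exact_def)
  then show ?thesis by blast
qed

locale bimodule_splitting = E: k_bimodule K A E
  for K and A :: "('k, 'a, 's) module_scheme" and E :: "('k, 'a, 'm) bimodule" +
  fixes U W :: "'m set"
  assumes splits: "splits K A E U W"
begin

abbreviation \<pi> where "\<pi> \<equiv> component E U W"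

lemma sub: "sub_bimodule K A E U" "sub_bimodule K A E W"
  using splits by (simp_all add: splits_def)

lemma subset: "x \<in> U \<Longrightarrow> x \<in> carrier E" "x \<in> W \<Longrightarrow> x \<in> carrier E"
  using E.M.submoduleE(1) sub by (auto simp: sub_bimodule_def)

lemma zero_mem: "\<zero>\<^bsub>E\<^esub> \<in> U" "\<zero>\<^bsub>E\<^esub> \<in> W"
  using submodule_zero_in sub by (auto simp: sub_bimodule_def)

lemma minus_mem: "\<lbrakk>x \<in> U; y \<in> U\<rbrakk> \<Longrightarrow> x \<ominus>\<^bsub>E\<^esub> y \<in> U" "\<lbrakk>x \<in> W; y \<in> W\<rbrakk> \<Longrightarrow> x \<ominus>\<^bsub>E\<^esub> y \<in> W"
  using E.M.submoduleE(3,5) sub by (auto simp: sub_bimodule_def a_minus_def)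

lemma component_eqI:
  assumes "u \<in> U" "w \<in> W"
  shows "\<pi> (u \<oplus>\<^bsub>E\<^esub> w) = u"
  unfolding component_def
proof (rule the_equality)
  show "u \<in> U \<and> (\<exists>w'\<in>W. u \<oplus>\<^bsub>E\<^esub> w = u \<oplus>\<^bsub>E\<^esub> w')" using assms by blast
  fix v assume "v \<in> U \<and> (\<exists>w'\<in>W. u \<oplus>\<^bsub>E\<^esub> w = v \<oplus>\<^bsub>E\<^esub> w')"
  then obtain w' where v: "v \<in> U" "w' \<in> W" and eq: "u \<oplus>\<^bsub>E\<^esub> w = v \<oplus>\<^bsub>E\<^esub> w'" by blast
  note mem = subset(1)[OF assms(1)] subset(2)[OF assms(2)] subset(1)[OF v(1)] subset(2)[OF v(2)]
  have "(v \<ominus>\<^bsub>E\<^esub> u) \<ominus>\<^bsub>E\<^esub> (w \<ominus>\<^bsub>E\<^esub> w') = (v \<oplus>\<^bsub>E\<^esub> w') \<ominus>\<^bsub>E\<^esub> (u \<oplus>\<^bsub>E\<^esub> w)"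
    using mem by (simp add: a_minus_def E.M.minus_add E.M.a_ac)
  also have "\<dots> = \<zero>\<^bsub>E\<^esub>"
    using mem eq by (simp add: diff_eq_zero_iff[OF E.M.abelian_group_axioms])
  finally have "v \<ominus>\<^bsub>E\<^esub> u = w \<ominus>\<^bsub>E\<^esub> w'"
    using mem by (simp add: diff_eq_zero_iff[OF E.M.abelian_group_axioms])
  then have "v \<ominus>\<^bsub>E\<^esub> u \<in> U \<inter> W" using minus_mem(1)[OF v(1) assms(1)] minus_mem(2)[OF assms(2) v(2)] by simp
  moreover have "U \<inter> W = {\<zero>\<^bsub>E\<^esub>}" using splits by (simp add: splits_def)
  ultimately have "v \<ominus>\<^bsub>E\<^esub> u = \<zero>\<^bsub>E\<^esub>" by (metis singletonD)
  then show "v = u" using mem by (simp add: diff_eq_zero_iff[OF E.M.abelian_group_axioms])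
qed

lemma splitE:
  assumes "x \<in> carrier E"
  obtains u w where "u \<in> U" "w \<in> W" "x = u \<oplus>\<^bsub>E\<^esub> w"
proof -
  have "x \<in> U <+>\<^bsub>E\<^esub> W" using assms splits by (simp add: splits_def)
  then show thesis using that by (auto simp: set_add_def')
qed

lemma component_closed [simp]: "x \<in> carrier E \<Longrightarrow> \<pi> x \<in> U"
  by (metis splitE component_eqI)

lemma component_on_U: "x \<in> U \<Longrightarrow> \<pi> x = x"
  using component_eqI[OF _ zero_mem(2), of x] subset by simp

lemma component_eq_zero_iff: "x \<in> carrier E \<Longrightarrow> \<pi> x = \<zero>\<^bsub>E\<^esub> \<longleftrightarrow> x \<in> W"
proof
  assume x: "x \<in> carrier E" and "\<pi> x = \<zero>\<^bsub>E\<^esub>"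
  from x obtain u w where uw: "u \<in> U" "w \<in> W" "x = u \<oplus>\<^bsub>E\<^esub> w" by (rule splitE)
  then have "u = \<zero>\<^bsub>E\<^esub>" using \<open>\<pi> x = \<zero>\<^bsub>E\<^esub>\<close> component_eqI by simp
  then show "x \<in> W" using uw subset by simp
next
  assume "x \<in> W"
  then show "\<pi> x = \<zero>\<^bsub>E\<^esub>" using component_eqI[OF zero_mem(1), of x] subset by simp
qed

lemma component_add: "\<lbrakk>x \<in> carrier E; y \<in> carrier E\<rbrakk> \<Longrightarrow> \<pi> (x \<oplus>\<^bsub>E\<^esub> y) = \<pi> x \<oplus>\<^bsub>E\<^esub> \<pi> y"
proof -
  assume "x \<in> carrier E" "y \<in> carrier E"
  then obtain u w u' w' where *: "u \<in> U" "w \<in> W" "x = u \<oplus>\<^bsub>E\<^esub> w" "u' \<in> U" "w' \<in> W" "y = u' \<oplus>\<^bsub>E\<^esub> w'"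
    by (elim splitE)
  have "x \<oplus>\<^bsub>E\<^esub> y = (u \<oplus>\<^bsub>E\<^esub> u') \<oplus>\<^bsub>E\<^esub> (w \<oplus>\<^bsub>E\<^esub> w')"
    using * subset by (simp add: E.M.a_ac)
  moreover have "u \<oplus>\<^bsub>E\<^esub> u' \<in> U" "w \<oplus>\<^bsub>E\<^esub> w' \<in> W"
    using * sub E.M.submoduleE(5) by (auto simp: sub_bimodule_def)
  ultimately show ?thesis using * by (simp add: component_eqI)
qed

lemma component_smult: "\<lbrakk>k \<in> carrier K; x \<in> carrier E\<rbrakk> \<Longrightarrow> \<pi> (k \<odot>\<^bsub>E\<^esub> x) = k \<odot>\<^bsub>E\<^esub> \<pi> x"
proof -
  assume k: "k \<in> carrier K" and "x \<in> carrier E"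
  then obtain u w where *: "u \<in> U" "w \<in> W" "x = u \<oplus>\<^bsub>E\<^esub> w" by (elim splitE)
  have "k \<odot>\<^bsub>E\<^esub> u \<in> U" "k \<odot>\<^bsub>E\<^esub> w \<in> W"
    using * k sub E.M.submoduleE(4) by (auto simp: sub_bimodule_def)
  then show ?thesis using * k subset by (simp add: component_eqI E.M.smult_r_distr)
qed

lemma component_ract: "\<lbrakk>x \<in> carrier E; a \<in> carrier A\<rbrakk> \<Longrightarrow> \<pi> (ract E x a) = ract E (\<pi> x) a"
proof -
  assume a: "a \<in> carrier A" and "x \<in> carrier E"
  then obtain u w where *: "u \<in> U" "w \<in> W" "x = u \<oplus>\<^bsub>E\<^esub> w" by (elim splitE)
  have "ract E u a \<in> U" "ract E w a \<in> W"
    using * a sub by (auto simp: sub_bimodule_def)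
  then show ?thesis using * a subset by (simp add: component_eqI E.ract_add_left)
qed

lemma component_lact: "\<lbrakk>x \<in> carrier E; a \<in> carrier A\<rbrakk> \<Longrightarrow> \<pi> (lact E a x) = lact E a (\<pi> x)"
proof -
  assume a: "a \<in> carrier A" and "x \<in> carrier E"
  then obtain u w where *: "u \<in> U" "w \<in> W" "x = u \<oplus>\<^bsub>E\<^esub> w" by (elim splitE)
  have "lact E a u \<in> U" "lact E a w \<in> W"
    using * a sub by (auto simp: sub_bimodule_def)
  then show ?thesis using * a subset by (simp add: component_eqI E.lact_add_right)
qed

end

lemma bimodule_splitting_sym:
  assumes "bimodule_splitting K A E U W"
  shows "bimodule_splitting K A E W U"
proof -
  interpret bimodule_splitting K A E U W by fact
  have "W <+>\<^bsub>E\<^esub> U = carrier E"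
  proof -
    have "W <+>\<^bsub>E\<^esub> U = U <+>\<^bsub>E\<^esub> W"
    proof (rule Set.set_eqI)
      have "u \<oplus>\<^bsub>E\<^esub> w = w \<oplus>\<^bsub>E\<^esub> u" if "u \<in> U" "w \<in> W" for u w
        using that subset by (simp add: E.M.a_comm)
      then show "x \<in> W <+>\<^bsub>E\<^esub> U \<longleftrightarrow> x \<in> U <+>\<^bsub>E\<^esub> W" for x
        unfolding set_add_def' by fastforce
    qed
    then show ?thesis using splits by (simp add: splits_def)
  qed
  then show ?thesis
    using splits by unfold_locales (auto simp: splits_def)
qed

text \<open>
  The three properties of the relation bimodule \<open>E = Ext\<^sup>2(DA, A)\<close> on which the four sequences rest, together
  with a decomposition \<open>E = U \<oplus> W\<close>. In this locale \<open>B = A \<ltimes> U\<close> is the partial relation extension and \<open>R = A \<ltimes> E\<close>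
  the relation extension.
\<close>

locale relation_bimodule = bimodule_splitting K A E U W
  for K and A :: "('k, 'a, 's) module_scheme" and E :: "('k, 'a, 'm) bimodule" and U W +
  assumes central: "\<And>z x. \<lbrakk>z \<in> carrier A; \<And>a. a \<in> carrier A \<Longrightarrow> a \<otimes>\<^bsub>A\<^esub> z = z \<otimes>\<^bsub>A\<^esub> a; x \<in> carrier E\<rbrakk>
      \<Longrightarrow> lact E z x = ract E x z"
    and derivation: "\<And>\<delta>. derivation K A (regular_bimodule A) \<delta> \<Longrightarrow> \<exists>D. derivation_along K A E \<delta> D"
    and no_left_hom: "\<And>\<phi> x. \<lbrakk>linear_map K E A \<phi>;
      \<And>a x. \<lbrakk>a \<in> carrier A; x \<in> carrier E\<rbrakk> \<Longrightarrow> \<phi> (lact E a x) = a \<otimes>\<^bsub>A\<^esub> \<phi> x; x \<in> carrier E\<rbrakk> \<Longrightarrow> \<phi> x = \<zero>\<^bsub>A\<^esub>"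
begin

abbreviation E' where "E' \<equiv> E\<lparr>carrier := U\<rparr>"
abbreviation E'' where "E'' \<equiv> E\<lparr>carrier := W\<rparr>"
abbreviation B where "B \<equiv> trivial_ext A E'"
abbreviation R where "R \<equiv> trivial_ext A E"
abbreviation E''\<^sub>B where "E''\<^sub>B \<equiv> restrict_scalars fst E'' :: ('k, 'a \<times> 'm, 'm) bimodule"

sublocale E': k_bimodule K A E' by (rule E.k_bimodule_sub_bimodule[OF sub(1)])
sublocale E'': k_bimodule K A E'' by (rule E.k_bimodule_sub_bimodule[OF sub(2)])
sublocale B: k_algebra K B by (rule E'.k_algebra_trivial_ext)
sublocale R: k_algebra K R by (rule E.k_algebra_trivial_ext)
sublocale W: bimodule_splitting K A E W U by (rule bimodule_splitting_sym) unfold_locales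

abbreviation \<pi>'' where "\<pi>'' \<equiv> component E W U"

lemma component_sum: "x \<in> carrier E \<Longrightarrow> \<pi> x \<oplus>\<^bsub>E\<^esub> \<pi>'' x = x"
  using component_eqI W.component_eqI subset by (metis splitE E.M.a_comm)

text \<open>
  A left linear form on the summand \<open>U\<close> extends to \<open>E\<close> through the projection.
\<close>

lemma no_left_hom_E':
  assumes "linear_map K E' A \<phi>" "\<And>a x. \<lbrakk>a \<in> carrier A; x \<in> U\<rbrakk> \<Longrightarrow> \<phi> (lact E a x) = a \<otimes>\<^bsub>A\<^esub> \<phi> x" "x \<in> U"
  shows "\<phi> x = \<zero>\<^bsub>A\<^esub>"
proof -
  have "\<phi> (\<pi> x) = \<zero>\<^bsub>A\<^esub>"
  proof (rule no_left_hom[where \<phi> = "\<lambda>x. \<phi> (\<pi> x)" and x = x])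
    show "linear_map K E A (\<lambda>x. \<phi> (\<pi> x))"
      using assms(1) by (simp add: linear_map_def component_add component_smult)
    show "\<phi> (\<pi> (lact E a x)) = a \<otimes>\<^bsub>A\<^esub> \<phi> (\<pi> x)" if "a \<in> carrier A" "x \<in> carrier E" for a x
      using that by (simp add: component_lact assms(2))
    show "x \<in> carrier E" using assms(3) subset by blast
  qed
  then show ?thesis using assms(3) by (simp add: component_on_U)
qed

sublocale BA: split_square_zero K A B E' fst "\<lambda>a. (a, \<zero>\<^bsub>E\<^esub>)" "\<lambda>x. (\<zero>\<^bsub>A\<^esub>, x)"
proof (intro split_square_zero.intro split_square_zero_axioms.intro E.A.k_algebra_axioms B.k_algebra_axioms
    E'.M.module_axioms)
  note E'.lact_zero_right [simp] E'.ract_zero_left [simp] E'.lact_zero_left [simp] E'.ract_zero_right [simp]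
    zero_mem(1) [simp]
  show "linear_map K B A fst" by (auto simp: linear_map_def)
  show "linear_map K A B (\<lambda>a. (a, \<zero>\<^bsub>E\<^esub>))"
    using E'.M.smult_r_null by (auto simp: linear_map_def)
  show "linear_map K E' B (\<lambda>x. (\<zero>\<^bsub>A\<^esub>, x))" by (auto simp: linear_map_def)
  show "inj_on (\<lambda>x. (\<zero>\<^bsub>A\<^esub>, x)) (carrier E')" by (simp add: inj_on_def)
  show "(\<lambda>x. (\<zero>\<^bsub>A\<^esub>, x)) ` carrier E' = {r \<in> carrier B. fst r = \<zero>\<^bsub>A\<^esub>}" by auto
qed (use subset(1) zero_mem(1) E'.lact_closed E'.ract_closed E'.lact_zero_right E'.ract_zero_left
  E'.lact_zero_left E'.ract_zero_right in \<open>auto simp: subset\<close>)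

lemma module_E''\<^sub>B: "module K E''\<^sub>B"
  by (rule module_same_ops[OF E''.M.module_axioms]) (simp_all add: restrict_scalars_def)

lemma E''\<^sub>B_simps [simp]:
  "carrier E''\<^sub>B = W" "add E''\<^sub>B = add E" "zero E''\<^sub>B = zero E" "smult E''\<^sub>B = smult E"
  "ract E''\<^sub>B x b = ract E x (fst b)" "lact E''\<^sub>B b x = lact E (fst b) x"
  by (simp_all add: restrict_scalars_def)

lemmas component_in_E [simp] = subset(1)[OF component_closed]

sublocale RB: split_square_zero K B R E''\<^sub>B "\<lambda>(a, x). (a, \<pi> x)" "\<lambda>b. b" "\<lambda>x. (\<zero>\<^bsub>A\<^esub>, x)"
proof (intro split_square_zero.intro split_square_zero_axioms.intro B.k_algebra_axioms R.k_algebra_axioms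
    module_E''\<^sub>B)
  show "linear_map K R B (\<lambda>(a, x). (a, \<pi> x))"
    by (auto simp: linear_map_def component_add component_smult)
  show "linear_map K B R (\<lambda>b. b)" by (auto simp: linear_map_def subset)
  show "linear_map K E''\<^sub>B R (\<lambda>x. (\<zero>\<^bsub>A\<^esub>, x))" by (auto simp: linear_map_def subset)
  show "inj_on (\<lambda>x. (\<zero>\<^bsub>A\<^esub>, x)) (carrier E''\<^sub>B)" by (simp add: inj_on_def)
  show "(\<lambda>x. (\<zero>\<^bsub>A\<^esub>, x)) ` carrier E''\<^sub>B = {r \<in> carrier R. (case r of (a, x) \<Rightarrow> (a, \<pi> x)) = \<zero>\<^bsub>B\<^esub>}"
    by (auto simp: component_eq_zero_iff subset)
  fix r s assume "r \<in> carrier R" "s \<in> carrier R"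
  then show "(case r \<otimes>\<^bsub>R\<^esub> s of (a, x) \<Rightarrow> (a, \<pi> x))
      = (case r of (a, x) \<Rightarrow> (a, \<pi> x)) \<otimes>\<^bsub>B\<^esub> (case s of (a, x) \<Rightarrow> (a, \<pi> x))"
    by (auto simp: component_add component_lact component_ract)
next
  fix a b assume "a \<in> carrier B" "b \<in> carrier B"
  then show "a \<otimes>\<^bsub>B\<^esub> b = a \<otimes>\<^bsub>R\<^esub> b" by auto
next
  fix b assume "b \<in> carrier B"
  then show "(case b of (a, x) \<Rightarrow> (a, \<pi> x)) = b" by (auto simp: component_on_U)
next
  fix b x assume bx: "b \<in> carrier B" "x \<in> carrier E''\<^sub>B"
  show "lact E''\<^sub>B b x \<in> carrier E''\<^sub>B" "ract E''\<^sub>B x b \<in> carrier E''\<^sub>B"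
    using bx sub(2) by (auto simp: sub_bimodule_def)
  show "(\<zero>\<^bsub>A\<^esub>, lact E''\<^sub>B b x) = b \<otimes>\<^bsub>R\<^esub> (\<zero>\<^bsub>A\<^esub>, x)" "(\<zero>\<^bsub>A\<^esub>, ract E''\<^sub>B x b) = (\<zero>\<^bsub>A\<^esub>, x) \<otimes>\<^bsub>R\<^esub> b"
    using bx by (auto simp: subset E.ract_zero_right E.lact_zero_left)
next
  fix x y assume "x \<in> carrier E''\<^sub>B" "y \<in> carrier E''\<^sub>B"
  then show "(\<zero>\<^bsub>A\<^esub>, x) \<otimes>\<^bsub>R\<^esub> (\<zero>\<^bsub>A\<^esub>, y) = \<zero>\<^bsub>R\<^esub>"
    by (simp add: subset E.ract_zero_right E.lact_zero_left)
qed

lemma ideal_eq: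
  "(\<lambda>x. (\<zero>\<^bsub>A\<^esub>, x)) ` carrier E' = {\<zero>\<^bsub>A\<^esub>} \<times> U" "(\<lambda>x. (\<zero>\<^bsub>A\<^esub>, x)) ` carrier E''\<^sub>B = {\<zero>\<^bsub>A\<^esub>} \<times> W"
  by auto

lemma central_B:
  assumes "z \<in> carrier A" "\<And>a. a \<in> carrier A \<Longrightarrow> a \<otimes>\<^bsub>A\<^esub> z = z \<otimes>\<^bsub>A\<^esub> a" "r \<in> carrier B"
  shows "r \<otimes>\<^bsub>B\<^esub> (z, \<zero>\<^bsub>E\<^esub>) = (z, \<zero>\<^bsub>E\<^esub>) \<otimes>\<^bsub>B\<^esub> r"
proof -
  obtain a x where r: "r = (a, x)" "a \<in> carrier A" "x \<in> U" using assms(3) by auto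
  then show ?thesis
    using assms(1,2) subset(1)[OF r(3)] central[OF assms(1,2), of x]
    by (simp add: E.lact_zero_right E.ract_zero_left)
qed

text \<open>
  If \<open>(c, e)\<close> is central in \<open>B\<close>, then \<open>c\<close> is central in \<open>A\<close> and so acts symmetrically on \<open>E\<close>, while \<open>e\<close> commutes
  with \<open>A\<close> and annihilates \<open>E\<close>.
\<close>

lemma central_R:
  assumes z: "z \<in> carrier B" "\<And>b. b \<in> carrier B \<Longrightarrow> b \<otimes>\<^bsub>B\<^esub> z = z \<otimes>\<^bsub>B\<^esub> b" and r: "r \<in> carrier R"
  shows "r \<otimes>\<^bsub>R\<^esub> z = z \<otimes>\<^bsub>R\<^esub> r"
proof -
  obtain c e where ce: "z = (c, e)" "c \<in> carrier A" "e \<in> U" "e \<in> carrier E" using z(1) subset by auto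
  obtain a x where ax: "r = (a, x)" "a \<in> carrier A" "x \<in> carrier E" using r by auto
  have *: "b \<otimes>\<^bsub>A\<^esub> c = c \<otimes>\<^bsub>A\<^esub> b \<and> lact E b e = ract E e b" if "b \<in> carrier A" for b
    using z(2)[of "(b, \<zero>\<^bsub>E\<^esub>)"] that ce zero_mem by (simp add: E.lact_zero_right E.ract_zero_left)
  have "lact E c x = ract E x c" by (rule central[OF ce(2) conjunct1[OF *] ax(3)])
  then show ?thesis using ce ax *[OF ax(2)] by (simp add: E.M.a_comm)
qed

text \<open>
  The extension of \<open>\<delta>\<close> to \<open>E\<close>, followed by the projection onto \<open>U\<close>.
\<close>

lemma derivation_lifts_B:
  assumes \<delta>: "derivation K A (regular_bimodule A) \<delta>"
  shows "\<exists>D. derivation K B (regular_bimodule B) D \<and> (\<forall>a\<in>carrier A. fst (D (a, \<zero>\<^bsub>E\<^esub>)) = \<delta> a)"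
proof -
  obtain D where D: "derivation_along K A E \<delta> D" using derivation[OF \<delta>] by blast
  note D_rules = derivation_alongD[OF D]
  have \<delta>_mem: "a \<in> carrier A \<Longrightarrow> \<delta> a \<in> carrier A" for a
    using linear_mapD(1)[OF derivationD(1)[OF \<delta>]] by simp
  have "derivation_along K A E' \<delta> (\<lambda>x. \<pi> (D x))"
    by (auto simp: derivation_along_def linear_map_def subset D_rules linear_mapD[OF D_rules(1)]
        component_add component_smult component_lact component_ract component_on_U E'.lact_closed E'.ract_closed \<delta>_mem)
  from E'.derivation_trivial_ext[OF \<delta> E'.derivation_zero this] show ?thesis by auto
qed

text \<open>
  A derivation of \<open>B\<close> is given by \<open>\<delta>\<close>, \<open>\<psi>\<close> and \<open>\<kappa>\<close> as in \<open>derivation_trivial_ext_components\<close>, where \<open>\<kappa>\<close> is a map on \<open>U\<close>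
  along \<open>\<delta>\<close>. On \<open>W\<close> it is continued by an extension \<open>D\<close> of the same \<open>\<delta>\<close> to \<open>E\<close>; both parts satisfy the Leibniz
  rule along \<open>\<delta>\<close>, hence so does their sum.
\<close>

lemma derivation_lifts_R:
  assumes "derivation K B (regular_bimodule B) \<Delta>"
  shows "\<exists>D. derivation K R (regular_bimodule R) D \<and>
    (\<forall>b\<in>carrier B. (case D b of (a, x) \<Rightarrow> (a, \<pi> x)) = \<Delta> b)"
proof -
  obtain \<delta> \<psi> \<kappa> where \<delta>: "derivation K A (regular_bimodule A) \<delta>" and \<psi>: "derivation K A E' \<psi>"
    and \<kappa>: "derivation_along K A E' \<delta> \<kappa>"
    and \<Delta>: "\<And>a x. \<lbrakk>a \<in> carrier A; x \<in> carrier E'\<rbrakk> \<Longrightarrow> \<Delta> (a, x) = (\<delta> a, \<psi> a \<oplus>\<^bsub>E'\<^esub> \<kappa> x)"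
  proof (rule E'.derivation_trivial_ext_components[OF assms])
    show "\<phi> x = \<zero>\<^bsub>A\<^esub>" if "linear_map K E' A \<phi>"
      "\<And>a x. \<lbrakk>a \<in> carrier A; x \<in> carrier E'\<rbrakk> \<Longrightarrow> \<phi> (lact E' a x) = a \<otimes>\<^bsub>A\<^esub> \<phi> x" "x \<in> carrier E'" for \<phi> x
      by (rule no_left_hom_E'[OF that(1)]) (use that(2,3) in simp_all)
  qed (rule that)
  obtain D where D: "derivation_along K A E \<delta> D" using derivation[OF \<delta>] by blast
  note D_rules = derivation_alongD[OF D] and \<kappa>_rules = derivation_alongD[OF \<kappa>, simplified]
  have \<delta>_mem: "a \<in> carrier A \<Longrightarrow> \<delta> a \<in> carrier A" for a
    using linear_mapD(1)[OF derivationD(1)[OF \<delta>]] by simp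
  have \<psi>_mem: "a \<in> carrier A \<Longrightarrow> \<psi> a \<in> U" for a
    using linear_mapD(1)[OF derivationD(1)[OF \<psi>]] by simp
  have \<psi>_E: "derivation K A E \<psi>"
    using \<psi> subset by (auto simp: derivation_def linear_map_def)
  define \<kappa>' where "\<kappa>' x = \<kappa> (\<pi> x) \<oplus>\<^bsub>E\<^esub> D (\<pi>'' x)" for x
  have mem: "\<pi> x \<in> carrier E" "\<pi>'' x \<in> carrier E" "\<pi> x \<in> U" "\<pi>'' x \<in> W"
    "\<kappa> (\<pi> x) \<in> carrier E" "\<kappa> (\<pi> x) \<in> U" "D (\<pi>'' x) \<in> carrier E" if "x \<in> carrier E" for x
    using that subset by (auto simp: W.component_closed D_rules \<kappa>_rules)
  have "derivation_along K A E \<delta> \<kappa>'"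
    unfolding derivation_along_def
  proof (intro conjI ballI linear_mapI)
    fix x assume x: "x \<in> carrier E"
    then show "\<kappa>' x \<in> carrier E" by (simp add: \<kappa>'_def mem)
    show "\<kappa>' (x \<oplus>\<^bsub>E\<^esub> y) = \<kappa>' x \<oplus>\<^bsub>E\<^esub> \<kappa>' y" if y: "y \<in> carrier E" for y
      using linear_mapD(2)[OF \<kappa>_rules(1), of "\<pi> x" "\<pi> y"] linear_mapD(2)[OF D_rules(1), of "\<pi>'' x" "\<pi>'' y"] x y
      by (simp add: \<kappa>'_def component_add W.component_add mem E.M.a_ac)
    show "\<kappa>' (k \<odot>\<^bsub>E\<^esub> x) = k \<odot>\<^bsub>E\<^esub> \<kappa>' x" if k: "k \<in> carrier K" for k
      using linear_mapD(3)[OF \<kappa>_rules(1), of k "\<pi> x"] linear_mapD(3)[OF D_rules(1), of k "\<pi>'' x"] x k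
      by (simp add: \<kappa>'_def component_smult W.component_smult mem E.M.smult_r_distr)
    fix a assume a: "a \<in> carrier A"
    have "\<kappa>' (ract E x a) = (ract E (\<kappa> (\<pi> x)) a \<oplus>\<^bsub>E\<^esub> ract E (\<pi> x) (\<delta> a))
        \<oplus>\<^bsub>E\<^esub> (ract E (D (\<pi>'' x)) a \<oplus>\<^bsub>E\<^esub> ract E (\<pi>'' x) (\<delta> a))"
      using x a by (simp add: \<kappa>'_def component_ract W.component_ract mem \<kappa>_rules(3) D_rules(3))
    also have "\<dots> = ract E (\<kappa>' x) a \<oplus>\<^bsub>E\<^esub> ract E (\<pi> x \<oplus>\<^bsub>E\<^esub> \<pi>'' x) (\<delta> a)"
      using x a by (simp add: \<kappa>'_def mem E.ract_add_left \<delta>_mem E.M.a_ac)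
    finally show "\<kappa>' (ract E x a) = ract E (\<kappa>' x) a \<oplus>\<^bsub>E\<^esub> ract E x (\<delta> a)"
      using x by (simp add: component_sum)
    have "\<kappa>' (lact E a x) = (lact E (\<delta> a) (\<pi> x) \<oplus>\<^bsub>E\<^esub> lact E a (\<kappa> (\<pi> x)))
        \<oplus>\<^bsub>E\<^esub> (lact E (\<delta> a) (\<pi>'' x) \<oplus>\<^bsub>E\<^esub> lact E a (D (\<pi>'' x)))"
      using x a by (simp add: \<kappa>'_def component_lact W.component_lact mem \<kappa>_rules(4) D_rules(4))
    also have "\<dots> = lact E (\<delta> a) (\<pi> x \<oplus>\<^bsub>E\<^esub> \<pi>'' x) \<oplus>\<^bsub>E\<^esub> lact E a (\<kappa>' x)"
      using x a by (simp add: \<kappa>'_def mem E.lact_add_right \<delta>_mem E.M.a_ac)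
    finally show "\<kappa>' (lact E a x) = lact E (\<delta> a) x \<oplus>\<^bsub>E\<^esub> lact E a (\<kappa>' x)"
      using x by (simp add: component_sum)
  qed
  from E.derivation_trivial_ext[OF \<delta> \<psi>_E this]
  have "derivation K R (regular_bimodule R) (\<lambda>(a, x). (\<delta> a, \<psi> a \<oplus>\<^bsub>E\<^esub> \<kappa>' x))" .
  moreover have "(\<delta> a, \<pi> (\<psi> a \<oplus>\<^bsub>E\<^esub> \<kappa>' x)) = \<Delta> (a, x)" if a: "a \<in> carrier A" and x: "x \<in> U" for a x
  proof -
    have "\<pi>'' x = \<zero>\<^bsub>E\<^esub>" using x subset W.component_eq_zero_iff by simp
    then have "\<kappa>' x = \<kappa> x"
      using x subset linear_map_zero[OF E.M.abelian_group_axioms E.M.abelian_group_axioms D_rules(1)] \<kappa>_rules(2)[OF x]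
      by (simp add: \<kappa>'_def component_on_U)
    moreover have "\<psi> a \<oplus>\<^bsub>E\<^esub> \<kappa> x \<in> U"
      using \<psi>_mem[OF a] \<kappa>_rules(2)[OF x] E'.M.a_closed[of "\<psi> a" "\<kappa> x"] by simp
    ultimately show ?thesis using \<Delta>[OF a] x by (simp add: component_on_U)
  qed
  ultimately show ?thesis
    by (intro exI[of _ "\<lambda>(a, x). (\<delta> a, \<psi> a \<oplus>\<^bsub>E\<^esub> \<kappa>' x)"]) auto
qed

theorem short_exact_B_degree_0:
  "\<exists>\<iota>. short_exact K (hoch_cohomology K B (ideal_bimodule B ({\<zero>\<^bsub>A\<^esub>} \<times> U)) 0) (HH K B 0) (HH K A 0)
     \<iota> (hoch_projection K B A fst (\<lambda>a. (a, \<zero>\<^bsub>E\<^esub>)) 0)"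
  using BA.short_exact_degree_0[OF central_B] unfolding ideal_eq .

theorem short_exact_B_degree_1:
  "\<exists>\<iota>. short_exact K (hoch_cohomology K B (ideal_bimodule B ({\<zero>\<^bsub>A\<^esub>} \<times> U)) 1) (HH K B 1) (HH K A 1)
     \<iota> (hoch_projection K B A fst (\<lambda>a. (a, \<zero>\<^bsub>E\<^esub>)) 1)"
proof -
  have "\<exists>\<iota>. short_exact K (direct_sum (hoch_cohomology K B BA.coefficients 1) (\<E>_space K E' A))
      (HH K B 1) (HH K A 1) \<iota> (hoch_projection K B A fst (\<lambda>a. (a, \<zero>\<^bsub>E\<^esub>)) 1)"
    by (rule BA.short_exact_degree_1[OF central_B derivation_lifts_B])
  then obtain \<iota> where exact: "short_exact K (direct_sum (hoch_cohomology K B BA.coefficients 1) (\<E>_space K E' A))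
      (HH K B 1) (HH K A 1) \<iota> (hoch_projection K B A fst (\<lambda>a. (a, \<zero>\<^bsub>E\<^esub>)) 1)"
    by (elim exE)
  have zero: "\<zero>\<^bsub>\<E>_space K E' A\<^esub> = (\<lambda>x\<in>U. \<zero>\<^bsub>A\<^esub>)" by (simp add: \<E>_space_def)
  have "\<theta> = (\<lambda>x\<in>U. \<zero>\<^bsub>A\<^esub>)" if "\<theta> \<in> carrier (\<E>_space K E' A)" for \<theta>
  proof (rule extensionalityI[of _ U])
    show "\<theta> \<in> extensional U" using that by (simp add: E_space_iff)
    show "\<theta> x = (\<lambda>x\<in>U. \<zero>\<^bsub>A\<^esub>) x" if "x \<in> U" for x
      using no_left_hom_E'[of \<theta> x] that \<open>\<theta> \<in> carrier (\<E>_space K E' A)\<close> by (simp add: E_space_iff)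
  qed simp
  moreover have "\<zero>\<^bsub>\<E>_space K E' A\<^esub> \<in> carrier (\<E>_space K E' A)"
  proof -
    interpret module K "\<E>_space K E' A" by (rule BA.module_E_space)
    show ?thesis by (rule M.zero_closed)
  qed
  ultimately have "carrier (\<E>_space K E' A) = {\<zero>\<^bsub>\<E>_space K E' A\<^esub>}" unfolding zero by blast
  moreover have "module K (hoch_cohomology K B BA.coefficients 1)"
    unfolding hoch_cohomology_def by (rule quotient_space.module_Q[OF BA.I.quotient_space_hoch_1])
  ultimately show ?thesis
    using short_exact_drop_trivial_summand[OF _ BA.module_E_space _ exact] unfolding ideal_eq by simp
qed

theorem short_exact_R_degree_0:
  "\<exists>\<iota>. short_exact K (hoch_cohomology K R (ideal_bimodule R ({\<zero>\<^bsub>A\<^esub>} \<times> W)) 0) (HH K R 0) (HH K B 0)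
     \<iota> (hoch_projection K R B (\<lambda>(a, x). (a, \<pi> x)) (\<lambda>b. b) 0)"
  using RB.short_exact_degree_0[OF central_R] unfolding ideal_eq .

theorem short_exact_R_degree_1:
  "\<exists>\<iota>. short_exact K (direct_sum (hoch_cohomology K R (ideal_bimodule R ({\<zero>\<^bsub>A\<^esub>} \<times> W)) 1) (\<E>_space K E''\<^sub>B B))
     (HH K R 1) (HH K B 1) \<iota> (hoch_projection K R B (\<lambda>(a, x). (a, \<pi> x)) (\<lambda>b. b) 1)"
  using RB.short_exact_degree_1[OF central_R derivation_lifts_R] unfolding ideal_eq .

end

theorem theorem1:
  fixes K :: "'k ring" and C :: "('k, 'c) module"
    and P :: "nat \<Rightarrow> ('k, 'c, 'p) rmodule" and d :: "nat \<Rightarrow> 'p \<Rightarrow> 'p"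
    and \<epsilon> :: "'p \<Rightarrow> 'c \<Rightarrow> 'k"
    and E :: "('k, 'c, ('p \<Rightarrow> 'c) set) bimodule" and E' E'' :: "('p \<Rightarrow> 'c) set set"
    and B Ct :: "('k, 'c \<times> ('p \<Rightarrow> 'c) set) module"
  assumes "algebraically_closed K"
    and "fin_dim_algebra K C" and "triangular C" and "global_dim_le K C 2"
    and "projective_resolution K C (dual_bimodule K C) P d \<epsilon>"
    and E: "E = ext_bimodule K C P d \<epsilon> (dual_bimodule K C) (regular_bimodule C) 2"
    and "splits K C E E' E''"
    and B: "B = trivial_ext C (E\<lparr>carrier := E'\<rparr>)"
    and Ct: "Ct = trivial_ext C E"
  shows "(\<exists>\<iota>. short_exact K
            (hoch_cohomology K B (ideal_bimodule B ({\<zero>\<^bsub>C\<^esub>} \<times> E')) 0) (HH K B 0) (HH K C 0)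
            \<iota> (hoch_projection K B C fst (\<lambda>c. (c, \<zero>\<^bsub>E\<^esub>)) 0))
    \<and> (\<exists>\<iota>. short_exact K
            (hoch_cohomology K B (ideal_bimodule B ({\<zero>\<^bsub>C\<^esub>} \<times> E')) 1) (HH K B 1) (HH K C 1)
            \<iota> (hoch_projection K B C fst (\<lambda>c. (c, \<zero>\<^bsub>E\<^esub>)) 1))
    \<and> (\<exists>\<iota>. short_exact K
            (hoch_cohomology K Ct (ideal_bimodule Ct ({\<zero>\<^bsub>C\<^esub>} \<times> E'')) 0) (HH K Ct 0) (HH K B 0)
            \<iota> (hoch_projection K Ct B (\<lambda>(c, e). (c, component E E' E'' e)) (\<lambda>b. b) 0))
    \<and> (\<exists>\<iota>. short_exact K
            (direct_sum (hoch_cohomology K Ct (ideal_bimodule Ct ({\<zero>\<^bsub>C\<^esub>} \<times> E'')) 1)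
              (\<E>_space K (restrict_scalars fst (E\<lparr>carrier := E''\<rparr>)) B))
            (HH K Ct 1) (HH K B 1)
            \<iota> (hoch_projection K Ct B (\<lambda>(c, e). (c, component E E' E'' e)) (\<lambda>b. b) 1))"
proof -
  interpret C: k_algebra K C by (rule fin_dim_algebra.k_algebra[OF assms(2)])
  interpret D: k_bimodule K C "dual_bimodule K C" by (rule C.k_bimodule_dual)
  interpret N: k_bimodule K C "regular_bimodule C" by (rule C.k_bimodule_regular)
  interpret X: bimodule_resolution K C "dual_bimodule K C" P d \<epsilon> "regular_bimodule C" 1
    by unfold_locales (rule assms(5))
  \<comment> \<open>\<open>X\<close> has \<open>m = 1\<close>, so \<open>X.E\<close> is the Ext group of degree \<open>Suc 1 = 2\<close>.\<close>
  have E_eq: "E = X.E" by (simp add: E numeral_2_eq_2 One_nat_def)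
  have res: "resolution K C (dual_bimodule K C) P d \<epsilon>" by unfold_locales
  have gd: "global_dim_le K C (Suc 1)" using assms(4) by (simp add: numeral_2_eq_2 One_nat_def)
  obtain \<rho> where \<rho>: "right_hom K C (P (Suc 1)) (P (Suc 1)) \<rho>"
    "\<And>x. x \<in> carrier (P (Suc 1)) \<Longrightarrow> d 1 (\<rho> x) = \<zero>\<^bsub>P 1\<^esub>"
    "\<And>x. \<lbrakk>x \<in> carrier (P (Suc 1)); d 1 x = \<zero>\<^bsub>P 1\<^esub>\<rbrakk> \<Longrightarrow> \<rho> x = x"
  proof (rule cycles_retract_of_global_dim_le[OF assms(2) gd res])
  qed (rule that)
  interpret Y: relation_bimodule K C E E' E''
  proof (intro relation_bimodule.intro bimodule_splitting.intro bimodule_splitting_axioms.intro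
      relation_bimodule_axioms.intro)
    show "k_bimodule K C E" unfolding E_eq by (rule X.k_bimodule_E)
    show "splits K C E E' E''" by (rule assms(7))
    show "lact E z x = ract E x z"
      if "z \<in> carrier C" "\<And>a. a \<in> carrier C \<Longrightarrow> a \<otimes>\<^bsub>C\<^esub> z = z \<otimes>\<^bsub>C\<^esub> a" "x \<in> carrier E" for z x
      unfolding E_eq
    proof (rule X.central_acts_symmetrically[OF that(1,2)])
      show "lact (dual_bimodule K C) z \<phi> = ract (dual_bimodule K C) \<phi> z" for \<phi>
        by (rule C.dual_central[OF that(1,2)])
      show "lact (regular_bimodule C) z y = ract (regular_bimodule C) y z" if "y \<in> carrier (regular_bimodule C)" for y
        using that \<open>\<And>a. a \<in> carrier C \<Longrightarrow> a \<otimes>\<^bsub>C\<^esub> z = z \<otimes>\<^bsub>C\<^esub> a\<close> by simp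
      show "x \<in> carrier X.E" using that(3) by (simp add: E_eq)
    qed
    show "\<exists>D. derivation_along K C E \<delta> D" if \<delta>: "derivation K C (regular_bimodule C) \<delta>" for \<delta>
    proof -
      obtain DE where "derivation_along K C X.E \<delta> DE"
      proof (rule X.derivation_along_E[OF \<delta> C.derivation_along_dual[OF \<delta>]
            derivation_along_regular[OF C.k_algebra_axioms \<delta>]])
      qed (rule that)
      then show ?thesis unfolding E_eq by (intro exI)
    qed
    show "\<phi> x = \<zero>\<^bsub>C\<^esub>" if "linear_map K E C \<phi>"
      "\<And>a x. \<lbrakk>a \<in> carrier C; x \<in> carrier E\<rbrakk> \<Longrightarrow> \<phi> (lact E a x) = a \<otimes>\<^bsub>C\<^esub> \<phi> x" "x \<in> carrier E" for \<phi> x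
    proof (rule left_hom_Ext_regular_eq_zero[OF X.bimodule_resolution_axioms \<rho> that(1)[unfolded E_eq] _
          that(3)[unfolded E_eq]])
      show "\<phi> (lact X.E a S) = a \<otimes>\<^bsub>C\<^esub> \<phi> S" if "S \<in> carrier X.E" "a \<in> carrier C" for S a
        using \<open>\<And>a x. \<lbrakk>a \<in> carrier C; x \<in> carrier E\<rbrakk> \<Longrightarrow> \<phi> (lact E a x) = a \<otimes>\<^bsub>C\<^esub> \<phi> x\<close>[unfolded E_eq] that
        by simp
    qed
  qed
  show ?thesis
    unfolding B Ct
    using Y.short_exact_B_degree_0 Y.short_exact_B_degree_1 Y.short_exact_R_degree_0 Y.short_exact_R_degree_1
    by (intro conjI)
qed

end
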